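(* Let $\Gamma$ be a finite connected digraph of out-valency at most three and let $G\leqslant\mathrm{Aut}(\Gamma)$ be transitive on the vertices of $\Gamma$. Then $G$ does not contain a nontrivial semiregular element if and only if $\Gamma\cong\overrightarrow{\mathrm{PX}}(3,2^a,1)$ (for some integer $a\geqslant 2$) and, identifying $\Gamma$ with $\overrightarrow{\mathrm{PX}}(3,2^a,1)$ and putting $r=2^a$, up to conjugacy in $W$, $G=N\rtimes\Lambda_i\langle\rho\rangle$ for some $i\in\{1,\ldots,2^{a-2}\}$.
   Context: A digraph consists of a finite non-empty set of vertices together with an irreflexive, not necessarily symmetric, binary relation (the set of arcs) on it. It is connected if its underlying undirected graph is connected. The out-valency of a vertex $v$ is the number of vertices $w$ with $(v,w)$ an arc; a digraph has out-valency $d$ if every vertex has out-valency $d$. Automorphisms are vertex permutations preserving arcs, and $\mathrm{Aut}(\Gamma)$ is the group of all of them. A permutation is semiregular if all its cycles (including those of length one) have the same length. Permutations act on the right. For $r\geqslant 3$, $\overrightarrow{\mathrm{PX}}(3,r,1)$ is the digraph with vertex set $\mathbb{Z}_3\times\mathbb{Z}_r$ and an arc from $(u,x)$ to $(v,y)$ if and only if $y-x=1$. Notation, for $r=2^a$ with $a\geqslant 2$: $\mathrm{Dih}(r)$ is the dihedral group of order $2r$ acting naturally on $\mathbb{Z}_r$ (the maps $y\mapsto \pm y+c$). $W=\mathrm{Sym}(\mathbb{Z}_3)\wr\mathrm{Dih}(r)=\mathrm{Sym}(\mathbb{Z}_3)^r\rtimes\mathrm{Dih}(r)$ acts on $\mathbb{Z}_3\times\mathbb{Z}_r$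 by $(x,y)^{(g_0,\ldots,g_{r-1},h)}=(x^{g_y},y^h)$. $B=\mathrm{Sym}(\mathbb{Z}_3)^r\leqslant W$, whose elements are written as $r$-tuples indexed by $0,\ldots,r-1$. $\mathbf{1}$ is the identity of $\mathrm{Sym}(\mathbb{Z}_3)$ and $\mathbf{-1}$ is the involution of $\mathrm{Sym}(\mathbb{Z}_3)$ fixing $0$. $\mathbb{Z}_3$ is viewed as a subgroup of $\mathrm{Sym}(\mathbb{Z}_3)$ via its regular action on itself by translation, so $\mathrm{Sym}(\mathbb{Z}_3)=\mathbb{Z}_3\rtimes\langle\mathbf{-1}\rangle$ and $\mathbb{Z}_3^r\leqslant B$. $\sigma\in W$ is given by $(x,y)^\sigma=(x,y+1)$; $\alpha=(\mathbf 1,\ldots,\mathbf 1,\mathbf{-1})\in B$; $\rho=\alpha\sigma$. Concatenating four $(r/4)$-tuples to get an $r$-tuple, put $$N=\{(x+y,x,y,x-y)\mid x,y\in\mathbb{Z}_3^{r/4}\},\qquad \Lambda=\{(z,z,z,z)\mid z\in\langle\mathbf{-1}\rangle^{r/4}\},$$ subgroups of $B$. $\Lambda$ is an elementary abelian $2$-group normalised by $\langle\sigma\rangle$; viewed as a $\mathbb{Z}_2\langle\sigma\rangle$-module it has a unique submodule of each dimension $i\in\{0,1,\ldots,r/4\}$, denoted $\Lambda_i$.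
   Formalization: The digraph Γ is additionally assumed to have at least two vertices, since for the one-vertex digraph (out-valency 0, G trivial) G has no nontrivial semiregular element although Γ is not isomorphic to any PX(3,2^a,1). *)

theory Defs
  imports
    Graph_Theory.Digraph_Component
    "HOL-Combinatorics.Orbits"
    "HOL-Algebra.Bij"
    "HOL-Algebra.Coset"
    "HOL-Algebra.Generated_Groups"
    "HOL-Number_Theory.Cong"
begin

text \<open>
  Permutations of a set \<open>V\<close> are the elements of the group \<open>BijGroup V\<close>. Its
  multiplication is composition of functions, so the product \<open>g h\<close> of permutations acting
  on the right (first \<open>g\<close>, then \<open>h\<close>) is \<open>h \<otimes>\<^bsub>BijGroup V\<^esub> g\<close>.
\<close>

section \<open>Digraphs, automorphisms, semiregular permutations\<close>

definition has_out_valency :: "'a pair_pre_digraph \<Rightarrow> nat \<Rightarrow> bool" where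
  "has_out_valency \<Gamma> d \<longleftrightarrow> (\<forall>v\<in>pverts \<Gamma>. out_degree (with_proj \<Gamma>) v = d)"

definition dg_iso :: "'a pair_pre_digraph \<Rightarrow> 'b pair_pre_digraph \<Rightarrow> ('a \<Rightarrow> 'b) \<Rightarrow> bool" where
  "dg_iso \<Gamma> \<Delta> f \<longleftrightarrow> bij_betw f (pverts \<Gamma>) (pverts \<Delta>) \<and>
     (\<forall>u\<in>pverts \<Gamma>. \<forall>v\<in>pverts \<Gamma>. (u, v) \<in> parcs \<Gamma> \<longleftrightarrow> (f u, f v) \<in> parcs \<Delta>)"

definition aut_group :: "'a pair_pre_digraph \<Rightarrow> ('a \<Rightarrow> 'a) monoid" where
  "aut_group \<Gamma> = BijGroup (pverts \<Gamma>) \<lparr>carrier := {g \<in> Bij (pverts \<Gamma>). dg_iso \<Gamma> \<Gamma> g}\<rparr>"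

definition transitive_on :: "'a set \<Rightarrow> ('a \<Rightarrow> 'a) set \<Rightarrow> bool" where
  "transitive_on V G \<longleftrightarrow> (\<forall>u\<in>V. \<forall>v\<in>V. \<exists>g\<in>G. g u = v)"

text \<open>The cycle of \<open>g\<close> through \<open>u\<close> is \<open>orbit g u\<close>.\<close>

definition semiregular :: "'a set \<Rightarrow> ('a \<Rightarrow> 'a) \<Rightarrow> bool" where
  "semiregular V g \<longleftrightarrow> g \<in> Bij V \<and> (\<forall>u\<in>V. \<forall>v\<in>V. card (orbit g u) = card (orbit g v))"

text \<open>The permutation of \<open>V'\<close> corresponding to \<open>g\<close> when \<open>V\<close> is identified with \<open>V'\<close> via \<open>f\<close>.\<close>

definition transport :: "'a set \<Rightarrow> 'b set \<Rightarrow> ('a \<Rightarrow> 'b) \<Rightarrow> ('a \<Rightarrow> 'a) \<Rightarrow> 'b \<Rightarrow> 'b" where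
  "transport V V' f g = (\<lambda>p\<in>V'. f (g (inv_into V f p)))"


section \<open>Group-theoretic notions\<close>

definition conj_by :: "('g, 'b) monoid_scheme \<Rightarrow> 'g \<Rightarrow> 'g set \<Rightarrow> 'g set" where
  "conj_by S w K = (\<lambda>g. w \<otimes>\<^bsub>S\<^esub> g \<otimes>\<^bsub>S\<^esub> inv\<^bsub>S\<^esub> w) ` K"

text \<open>\<open>K\<close> is a subgroup of \<open>S\<close> and the internal semidirect product of \<open>N\<close> (normal) by \<open>H\<close>.\<close>

definition internal_semidirect ::
  "('g, 'b) monoid_scheme \<Rightarrow> 'g set \<Rightarrow> 'g set \<Rightarrow> 'g set \<Rightarrow> bool" where
  "internal_semidirect S K N H \<longleftrightarrow>
     subgroup K S \<and> N \<lhd> S\<lparr>carrier := K\<rparr> \<and> subgroup H (S\<lparr>carrier := K\<rparr>) \<and>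
     N \<inter> H = {\<one>\<^bsub>S\<^esub>} \<and> K = N <#>\<^bsub>S\<^esub> H"

text \<open>
  A subgroup of an elementary abelian 2-group is the same thing as a \<open>\<int>\<^sub>2\<close>-subspace, and the
  \<open>\<int>\<^sub>2\<close>-span of a set is the subgroup it generates. Hence a basis of \<open>L\<close> over \<open>\<int>\<^sub>2\<close> is an
  independent set, in the sense that no element lies in the span of the others, which
  generates \<open>L\<close>.
\<close>

definition Z2_basis :: "('g, 'b) monoid_scheme \<Rightarrow> 'g set \<Rightarrow> 'g set \<Rightarrow> bool" where
  "Z2_basis S L X \<longleftrightarrow> X \<subseteq> L \<and> generate S X = L \<and> (\<forall>b\<in>X. b \<notin> generate S (X - {b}))"

definition has_Z2_dim :: "('g, 'b) monoid_scheme \<Rightarrow> 'g set \<Rightarrow> nat \<Rightarrow> bool" where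
  "has_Z2_dim S L i \<longleftrightarrow> (\<exists>X. finite X \<and> card X = i \<and> Z2_basis S L X)"


section \<open>The digraphs and the group $W$\<close>

text \<open>\<open>\<int>\<^sub>n\<close> is represented by the residues \<open>0, \<dots>, n - 1\<close>.\<close>

definition Zmod :: "nat \<Rightarrow> int set" where
  "Zmod n = {0..<int n}"

definition PXV :: "nat \<Rightarrow> (int \<times> int) set" where
  "PXV r = Zmod 3 \<times> Zmod r"

definition PX3 :: "nat \<Rightarrow> (int \<times> int) pair_pre_digraph" where
  "PX3 r = \<lparr>pverts = PXV r,
     parcs = {((u, x), (v, y)) | u x v y.
       (u, x) \<in> PXV r \<and> (v, y) \<in> PXV r \<and> [y - x = 1] (mod int r)}\<rparr>"

abbreviation SymV :: "nat \<Rightarrow> (int \<times> int \<Rightarrow> int \<times> int) monoid" where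
  "SymV r \<equiv> BijGroup (PXV r)"

definition Dih :: "nat \<Rightarrow> (int \<Rightarrow> int) set" where
  "Dih r = {(\<lambda>y\<in>Zmod r. (s * y + c) mod int r) | s c. s \<in> {1, -1} \<and> c \<in> Zmod r}"

text \<open>The permutation \<open>(g\<^sub>0, \<dots>, g\<^sub>r\<^sub>-\<^sub>1, h)\<close>, with the \<open>r\<close>-tuple given as a list of length \<open>r\<close>.\<close>

definition wreath_elt :: "nat \<Rightarrow> (int \<Rightarrow> int) list \<Rightarrow> (int \<Rightarrow> int) \<Rightarrow> int \<times> int \<Rightarrow> int \<times> int" where
  "wreath_elt r gs h = restrict (\<lambda>(x, y). ((gs ! nat y) x, h y)) (PXV r)"

definition W :: "nat \<Rightarrow> (int \<times> int \<Rightarrow> int \<times> int) set" where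
  "W r = {wreath_elt r gs h | gs h. length gs = r \<and> set gs \<subseteq> Bij (Zmod 3) \<and> h \<in> Dih r}"

definition tuple :: "nat \<Rightarrow> (int \<Rightarrow> int) list \<Rightarrow> int \<times> int \<Rightarrow> int \<times> int" where
  "tuple r gs = wreath_elt r gs (\<lambda>y\<in>Zmod r. y)"

definition neg3 :: "int \<Rightarrow> int" where
  "neg3 = (\<lambda>u\<in>Zmod 3. (- u) mod 3)"

text \<open>The element \<open>c\<close> of \<open>\<int>\<^sub>3\<close> as a permutation; \<open>c\<close> need not be reduced modulo 3.\<close>

definition transl3 :: "int \<Rightarrow> int \<Rightarrow> int" where
  "transl3 c = (\<lambda>u\<in>Zmod 3. (u + c) mod 3)"

definition sigma :: "nat \<Rightarrow> int \<times> int \<Rightarrow> int \<times> int" where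
  "sigma r = restrict (\<lambda>(x, y). (x, (y + 1) mod int r)) (PXV r)"

definition alpha :: "nat \<Rightarrow> int \<times> int \<Rightarrow> int \<times> int" where
  "alpha r = tuple r (replicate (r - 1) \<one>\<^bsub>BijGroup (Zmod 3)\<^esub> @ [neg3])"

text \<open>First \<open>alpha\<close>, then \<open>sigma\<close>.\<close>

definition rho :: "nat \<Rightarrow> int \<times> int \<Rightarrow> int \<times> int" where
  "rho r = sigma r \<otimes>\<^bsub>SymV r\<^esub> alpha r"

definition NN :: "nat \<Rightarrow> (int \<times> int \<Rightarrow> int \<times> int) set" where
  "NN r = {tuple r (map transl3 (map2 (+) xs ys @ xs @ ys @ map2 (-) xs ys)) | xs ys.
     length xs = r div 4 \<and> length ys = r div 4 \<and> set xs \<subseteq> Zmod 3 \<and> set ys \<subseteq> Zmod 3}"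

definition Lambda :: "nat \<Rightarrow> (int \<times> int \<Rightarrow> int \<times> int) set" where
  "Lambda r = {tuple r (zs @ zs @ zs @ zs) | zs.
     length zs = r div 4 \<and> set zs \<subseteq> generate (BijGroup (Zmod 3)) {neg3}}"

definition Lambda_submodule :: "nat \<Rightarrow> (int \<times> int \<Rightarrow> int \<times> int) set \<Rightarrow> bool" where
  "Lambda_submodule r L \<longleftrightarrow> subgroup L (SymV r) \<and> L \<subseteq> Lambda r \<and>
     (\<forall>s\<in>generate (SymV r) {sigma r}. conj_by (SymV r) s L \<subseteq> L)"

definition Lambda_i :: "nat \<Rightarrow> nat \<Rightarrow> (int \<times> int \<Rightarrow> int \<times> int) set" where
  "Lambda_i r i = (THE L. Lambda_submodule r L \<and> has_Z2_dim (SymV r) L i)"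

text \<open>The set of products of an element of \<open>Lambda_i\<close> followed by a power of \<open>rho\<close>.\<close>

definition Lambda_i_rho :: "nat \<Rightarrow> nat \<Rightarrow> (int \<times> int \<Rightarrow> int \<times> int) set" where
  "Lambda_i_rho r i = generate (SymV r) {rho r} <#>\<^bsub>SymV r\<^esub> Lambda_i r i"

end

theory Submission
 imports Defs
  "HOL-Computational_Algebra.Fundamental_Theorem_Algebra"
  "Jordan_Normal_Form.Char_Poly"
  "HOL-Algebra.Group_Action"
  "HOL-Algebra.Multiplicative_Group"
  "HOL-Algebra.Sylow"
begin

text \<open>
 Why a group \<open>G\<close> without nontrivial semiregular elements has the stated form. An element of \<open>G\<close> of prime order is not
 semiregular, so it fixes a vertex. By connectedness it then fixes a vertex one of whose at most three out-neighbours
 it moves, so its order is two or three (\<open>prime_le_three\<close>). Therefore \<open>G\<close> has order \<open>2\<^sup>a 3\<^sup>b\<close>, and by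
 Burnside's theorem it has a nontrivial elementary abelian normal subgroup \<open>A\<close>. The case of Burnside's theorem used here,
 \<open>two_p_group_abelian_normal_subgroup\<close>, is proved without characters: an involution \<open>t\<close> whose class generates the group
 and has prime power size is studied through the sum of the left translations by its class, a selfadjoint operator on
 the functions on the group (\<open>prime_power_involution_class_not_perfect\<close>). The subgroup \<open>A\<close> cannot be a 2-group, since an
 element of order three would permute three out-neighbours of a vertex cyclically and two different transpositions of three
 points do not commute (\<open>elementary_abelian_three\<close>). So \<open>A\<close> is a 3-group, and the stabiliser in \<open>A\<close> of a vertex
 permutes its three out-neighbours cyclically.

 Let \<open>M\<close> be generated by the stabilisers in \<open>A\<close> of all vertices. The orbits of \<open>M\<close> form a directed cycle of some length
 \<open>r\<close>. Let \<open>T v j\<close> be generated by the stabilisers of the vertices within \<open>j\<close> steps of \<open>v\<close>, and choose \<open>j\<close> maximal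
 with \<open>T v j \<noteq> M\<close>. The orbit of \<open>v\<close> under this group is its cell. Each orbit of \<open>M\<close> consists of three cells
 (\<open>card_block\<close>), and \<open>G\<close> acts faithfully on the cells (\<open>act_faithful\<close>), so elements of prime order fix cells. As
 some element of order three preserves all orbits of \<open>M\<close>, it follows that \<open>r\<close> is a power of two and that the cells can be labelled by \<open>\<int>\<^sub>3 \<times> \<int>\<^sub>r\<close> in such a way that \<open>rho\<close>
 becomes an element of the group (\<open>coordinates\<close>).

 The translations in such a group form a code over \<open>\<int>\<^sub>3\<close>, invariant under conjugation by \<open>rho\<close>, that is, an ideal
 modulo \<open>x\<^sup>r + 1\<close>. All its words have a zero, as a translation without zeros would be semiregular. With \<open>r = 4 k\<close>,
 \<^item> \<open>x\<^sup>4\<^sup>k + 1 = (x\<^sup>2\<^sup>k + x\<^sup>k - 1) (x\<^sup>2\<^sup>k - x\<^sup>k - 1)\<close>,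

 where both factors are irreducible, because the shift moves all nonzero words in cycles of length \<open>2 r\<close> and \<open>2 r\<close> divides
 \<open>3\<^sup>d - 1\<close> only if \<open>r / 2\<close> divides \<open>d\<close> (\<open>code_card_lower_bound\<close>). So the code is one of two
 (\<open>zero_meeting_code_is_tetra\<close>): the one that gives \<open>NN\<close>, or its reversal. It contains a word without two adjacent zeros,
 which implies that the cells are single vertices (\<open>jj_zero\<close>). Hence the digraph is \<open>PX3 r\<close>, and \<open>G\<close> is a
 group of permutations of \<open>\<int>\<^sub>3 \<times> \<int>\<^sub>r\<close> containing \<open>rho\<close>, as described by the locale \<open>rho_group\<close>.

 In such a group, an element that preserves the blocks is a product of a translation and of a sign change which
 both belong to the group (\<open>block_preserving_decomposition\<close>). If the code gives \<open>NN\<close>, then the sign changes have period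
 \<open>k\<close>, because they normalise \<open>NN\<close> (\<open>signs_periodic\<close>); so they form a submodule of \<open>Lambda\<close>. Such a submodule is determined
 by its dimension because one plus the shift is nilpotent on it (\<open>sign_module_unique\<close>). Together with \<open>rho\<close> they generate the
 stabiliser of the set of points with first coordinate \<open>0\<close>, a complement to the translations
 (\<open>semidirect_decomposition\<close>). The other code is reduced to this one by reversing the cycle of blocks
 (\<open>conjugate_semidirect_decomposition\<close>).

 Conversely, consider a semiregular element of a group of the stated form. A power that preserves the blocks fixes a
 point, as every word of the code has a zero within each set of four positions that are \<open>k\<close> apart (\<open>tetra_zero\<close>)
 and the signs agree there; so this power is trivial. If the element itself does not preserve the blocks, then one of its powers
 rotates by half a turn. The square of that power preserves the blocks but is nontrivial, because \<open>rho\<close> changes all signs in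
 one turn (\<open>half_turn_square\<close>), a contradiction (\<open>no_semiregular\<close>).
\<close>

hide_const (open) Polynomial.order up_ring.coeff up_ring.monom

section \<open>Joint eigenvectors of commuting self-adjoint operators\<close>

lemma homogeneous_system_nontrivial_solution:
 fixes v :: "'i \<Rightarrow> 'a \<Rightarrow> complex"
 assumes "finite X" "finite I" "card X < card I"
 shows "\<exists>c. (\<exists>i\<in>I. c i \<noteq> 0) \<and> (\<forall>x\<in>X. (\<Sum>i\<in>I. c i * v i x) = 0)"
 using assms
proof (induction X arbitrary: I v rule: finite_induct)
 case empty
 then obtain i where "i \<in> I" by fastforce
 then show ?case by (intro exI[of _ "\<lambda>_. 1"]) auto
next
 case (insert x X)
 show ?case
 proof (cases "\<forall>i\<in>I. v i x = 0")
  case True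
  have "card X < card I" using insert by simp
  with insert.IH[of I v] insert.prems True show ?thesis by auto
 next
  case False
  then obtain j where j: "j \<in> I" "v j x \<noteq> 0" by auto
  have I: "finite (I - {j})" "card X < card (I - {j})"
   using insert j by (auto simp: card_Diff_singleton)
  define w where "w i y = v i y - v i x / v j x * v j y" for i y
  obtain c where c: "\<exists>i\<in>I-{j}. c i \<noteq> 0" "\<And>y. y \<in> X \<Longrightarrow> (\<Sum>i\<in>I-{j}. c i * w i y) = 0"
   using insert.IH[OF I, of w] by blast
  define s where "s = (\<Sum>i\<in>I-{j}. c i * (v i x / v j x))"
  define c' where "c' i = (if i = j then - s else c i)" for i
  have eq: "(\<Sum>i\<in>I. c' i * v i y) = (\<Sum>i\<in>I-{j}. c i * w i y)" for y
  proof -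
   have "(\<Sum>i\<in>I. c' i * v i y) = - s * v j y + (\<Sum>i\<in>I-{j}. c i * v i y)"
    using j \<open>finite I\<close> by (simp add: sum.remove[of I j] c'_def)
   also have "\<dots> = (\<Sum>i\<in>I-{j}. c i * v i y - c i * (v i x / v j x) * v j y)"
    by (simp add: sum_subtractf s_def sum_distrib_right)
   also have "\<dots> = (\<Sum>i\<in>I-{j}. c i * w i y)"
    by (intro sum.cong) (auto simp: w_def algebra_simps)
   finally show ?thesis .
  qed
  have "w i x = 0" for i using j by (simp add: w_def)
  then have "(\<Sum>i\<in>I. c' i * v i x) = 0" by (simp add: eq)
  moreover have "\<exists>i\<in>I. c' i \<noteq> 0" using c(1) by (auto simp: c'_def)
  ultimately show ?thesis using eq c(2) by (intro exI[of _ c']) auto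
 qed
qed

lemma eigenvector_exists:
 fixes W :: "('a \<Rightarrow> complex) set"
 assumes fin: "finite X" and supp: "\<And>f x. f \<in> W \<Longrightarrow> x \<notin> X \<Longrightarrow> f x = 0"
  and add: "\<And>f g. f \<in> W \<Longrightarrow> g \<in> W \<Longrightarrow> (\<lambda>x. f x + g x) \<in> W"
  and scale: "\<And>c f. f \<in> W \<Longrightarrow> (\<lambda>x. c * f x) \<in> W"
  and u_add: "\<And>f g. u (\<lambda>x. f x + g x) = (\<lambda>x. u f x + u g x)"
  and u_scale: "\<And>c f. u (\<lambda>x. c * f x) = (\<lambda>x. c * u f x)"
  and inv: "\<And>f. f \<in> W \<Longrightarrow> u f \<in> W" and f0: "f0 \<in> W" "f0 \<noteq> (\<lambda>_. 0)"
 obtains g z where "g \<in> W" "g \<noteq> (\<lambda>_. 0)" "u g = (\<lambda>x. z * g x)"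
proof -
 define v where "v i = (u ^^ i) f0" for i
 have vW: "v i \<in> W" for i by (induction i) (auto simp: v_def f0 inv)
 define A where "A p = (\<lambda>x. \<Sum>i\<le>degree p. coeff p i * v i x)" for p
 have A: "A p x = (\<Sum>i\<le>n. coeff p i * v i x)" if "degree p \<le> n" for p n x
  unfolding A_def using that
  by (intro sum.mono_neutral_left) (auto simp: coeff_eq_0)
 have zeroW: "(\<lambda>x. 0) \<in> W" using scale[OF f0(1), of 0] by simp
 have sumW: "(\<lambda>x. \<Sum>i\<le>n. c i * v i x) \<in> W" for n :: nat and c
  by (induction n) (auto intro!: add scale vW)
 have usum: "u (\<lambda>x. \<Sum>i\<le>n. c i * v i x) = (\<lambda>x. \<Sum>i\<le>n. c i * v (Suc i) x)" for n :: nat and c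
  by (induction n) (auto simp: u_add u_scale v_def)
 \<comment> \<open>The iterates of the starting vector are linearly dependent, so some nonzero polynomial
  in the operator annihilates it; the one of least degree has a root, which is an eigenvalue.\<close>
 have "\<exists>p. p \<noteq> 0 \<and> A p = (\<lambda>_. 0)"
 proof -
  obtain c where c: "\<exists>i\<in>{..card X}. c i \<noteq> 0" "\<And>x. x \<in> X \<Longrightarrow> (\<Sum>i\<le>card X. c i * v i x) = 0"
   using homogeneous_system_nontrivial_solution[OF fin, of "{..card X}" v] by auto
  define p where "p = (\<Sum>i\<le>card X. monom (c i) i)"
  have cp: "coeff p i = (if i \<le> card X then c i else 0)" for i
   by (simp add: p_def coeff_sum)
  have deg: "degree p \<le> card X" by (rule degree_le) (simp add: cp)
  have "p \<noteq> 0" using c(1) cp by (metis atMost_iff coeff_0)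
  moreover have "A p x = 0" for x
  proof (cases "x \<in> X")
   case True
   then show ?thesis using c(2) by (simp add: A[OF deg] cp)
  next
   case False
   then show ?thesis using supp[OF vW] by (simp add: A_def)
  qed
  ultimately show ?thesis by blast
 qed
 then obtain p where p: "p \<noteq> 0" "A p = (\<lambda>_. 0)"
  and min: "\<And>q. q \<noteq> 0 \<and> A q = (\<lambda>_. 0) \<Longrightarrow> degree p \<le> degree q"
  using ex_has_least_nat[of "\<lambda>p. p \<noteq> 0 \<and> A p = (\<lambda>_. 0)" _ degree] by metis
 have "degree p \<noteq> 0"
 proof
  assume "degree p = 0"
  then have "A p = (\<lambda>x. coeff p 0 * f0 x)" "coeff p 0 \<noteq> 0"
   using p(1) by (auto simp: A_def v_def) (metis leading_coeff_0_iff)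
  then show False using p(2) f0(2) by (metis mult_eq_0_iff)
 qed
 then obtain z where "poly p z = 0"
  using fundamental_theorem_of_algebra[of p] by (metis constant_degree)
 then obtain q where q: "p = [:- z, 1:] * q" by (meson dvdE poly_eq_0_iff_dvd)
 have "q \<noteq> 0" using p(1) q by auto
 have degp: "degree p = Suc (degree q)"
  unfolding q by (subst degree_mult_eq) (use \<open>q \<noteq> 0\<close> in auto)
 define g where "g = A q"
 have "g \<noteq> (\<lambda>_. 0)" using min[of q] \<open>q \<noteq> 0\<close> degp by (auto simp: g_def)
 moreover have "g \<in> W" unfolding g_def A_def by (rule sumW)
 moreover have "u g = (\<lambda>x. z * g x)"
 proof
  fix x
  have cf: "coeff p i = (if i = 0 then 0 else coeff q (i - 1)) - z * coeff q i" for i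
   by (cases i) (auto simp: q)
  have "0 = A p x" by (simp add: p)
  also have "\<dots> = (\<Sum>i\<le>Suc (degree q). coeff p i * v i x)" by (simp add: A_def degp)
  also have "\<dots> = (\<Sum>i\<le>Suc (degree q). (if i = 0 then 0 else coeff q (i - 1)) * v i x)
    - (\<Sum>i\<le>Suc (degree q). z * coeff q i * v i x)"
   by (simp add: cf sum_subtractf[symmetric] algebra_simps del: sum.atMost_Suc)
  also have "(\<Sum>i\<le>Suc (degree q). (if i = 0 then 0 else coeff q (i - 1)) * v i x)
    = (\<Sum>i\<le>degree q. coeff q i * v (Suc i) x)"
   by (simp add: sum.atMost_Suc_shift del: sum.atMost_Suc)
  also have "\<dots> = u g x" by (simp add: g_def A_def usum)
  also have "(\<Sum>i\<le>Suc (degree q). z * coeff q i * v i x) = z * g x"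
   by (simp add: g_def A[of q "Suc (degree q)"] sum_distrib_left mult.assoc del: sum.atMost_Suc)
  finally show "u g x = z * g x" by simp
 qed
 ultimately show ?thesis using that by blast
qed

text \<open>Functions on \<open>X\<close> are extended by \<open>0\<close>, so that operators act on total functions.\<close>

definition supported_on :: "'a set \<Rightarrow> ('a \<Rightarrow> complex) set" where
 "supported_on X = {f. \<forall>x. x \<notin> X \<longrightarrow> f x = 0}"

definition herm :: "'a set \<Rightarrow> ('a \<Rightarrow> complex) \<Rightarrow> ('a \<Rightarrow> complex) \<Rightarrow> complex" where
 "herm X f g = (\<Sum>x\<in>X. f x * cnj (g x))"

definition selfadjoint :: "'a set \<Rightarrow> (('a \<Rightarrow> complex) \<Rightarrow> ('a \<Rightarrow> complex)) \<Rightarrow> bool" where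
 "selfadjoint X T \<longleftrightarrow>
   (\<forall>f g. T (\<lambda>x. f x + g x) = (\<lambda>x. T f x + T g x)) \<and>
   (\<forall>c f. T (\<lambda>x. c * f x) = (\<lambda>x. c * T f x)) \<and>
   (\<forall>f\<in>supported_on X. T f \<in> supported_on X) \<and>
   (\<forall>f\<in>supported_on X. \<forall>g\<in>supported_on X. herm X (T f) g = herm X f (T g))"

lemma selfadjointD:
 assumes "selfadjoint X T"
 shows "T (\<lambda>x. f x + g x) = (\<lambda>x. T f x + T g x)"
  and "T (\<lambda>x. c * f x) = (\<lambda>x. c * T f x)"
  and "f \<in> supported_on X \<Longrightarrow> T f \<in> supported_on X"
  and "f \<in> supported_on X \<Longrightarrow> g \<in> supported_on X \<Longrightarrow> herm X (T f) g = herm X f (T g)"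
 using assms unfolding selfadjoint_def by blast+

lemma supported_on_add: "f \<in> supported_on X \<Longrightarrow> g \<in> supported_on X \<Longrightarrow> (\<lambda>x. f x + g x) \<in> supported_on X"
 and supported_on_scale: "f \<in> supported_on X \<Longrightarrow> (\<lambda>x. c * f x) \<in> supported_on X"
 by (auto simp: supported_on_def)

lemma herm_add: "herm X (\<lambda>x. f x + g x) h = herm X f h + herm X g h"
 and herm_scale: "herm X (\<lambda>x. c * f x) h = c * herm X f h"
 and herm_scale_right: "herm X h (\<lambda>x. c * f x) = cnj c * herm X h f"
 by (auto simp: herm_def sum.distrib sum_distrib_left algebra_simps)

lemma herm_self: "herm X f f = complex_of_real (\<Sum>x\<in>X. (cmod (f x))\<^sup>2)"
 by (simp add: herm_def complex_norm_square[symmetric])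

lemma herm_self_eq_0:
 assumes "finite X" "f \<in> supported_on X" "herm X f f = 0"
 shows "f = (\<lambda>_. 0)"
proof
 fix x
 have "(\<Sum>x\<in>X. (cmod (f x))\<^sup>2) = 0" using assms(3) unfolding herm_self by (simp only: of_real_eq_0_iff)
 then have "x \<in> X \<Longrightarrow> f x = 0" using assms(1) by (auto simp: sum_nonneg_eq_0_iff)
 then show "f x = 0" using assms(2) by (auto simp: supported_on_def)
qed

text \<open>One step of the diagonalisation: a nonzero vector of a subspace that is stable under an
 involution yields a nonzero eigenvector of the involution inside the subspace.\<close>

lemma involution_eigenvector:
 assumes "selfadjoint X L" "g \<in> supported_on X" "L (L g) = g" "g \<noteq> (\<lambda>_. 0)"
 obtains g' c where "g' = g \<or> g' = (\<lambda>x. g x + L g x)" "g' \<noteq> (\<lambda>_. 0)" "c = 1 \<or> c = -1" "L g' = (\<lambda>x. c * g' x)"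
proof (cases "L g = (\<lambda>x. - g x)")
 case True
 show ?thesis by (rule that[of g "-1"]) (use True assms in auto)
next
 case False
 have "L (\<lambda>x. g x + L g x) = (\<lambda>x. 1 * (g x + L g x))"
  by (simp add: selfadjointD(1)[OF assms(1)] assms(3) add.commute)
 moreover have "(\<lambda>x. g x + L g x) \<noteq> (\<lambda>_. 0)"
 proof
  assume "(\<lambda>x. g x + L g x) = (\<lambda>_. 0)"
  then have "L g x = - g x" for x by (metis add_eq_0_iff fun_cong)
  then show False using False by auto
 qed
 ultimately show ?thesis by (intro that[of "\<lambda>x. g x + L g x" 1]) auto
qed

text \<open>A maximal orthonormal family of joint eigenvectors spans: its orthogonal complement is stable under the
 three operators, so if it were nonzero it would contain an eigenvector of \<open>u\<close>, which the two involutions turn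
 into a joint eigenvector. Completeness is expressed by the reproducing identity at the end.\<close>

theorem joint_eigenbasis:
 fixes X :: "'a set"
 assumes fin: "finite X" and u: "selfadjoint X u" and L: "selfadjoint X L" and R: "selfadjoint X R"
  and uL: "\<And>f. f \<in> supported_on X \<Longrightarrow> u (L f) = L (u f)"
  and uR: "\<And>f. f \<in> supported_on X \<Longrightarrow> u (R f) = R (u f)"
  and LR: "\<And>f. f \<in> supported_on X \<Longrightarrow> L (R f) = R (L f)"
  and LL: "\<And>f. f \<in> supported_on X \<Longrightarrow> L (L f) = f"
  and RR: "\<And>f. f \<in> supported_on X \<Longrightarrow> R (R f) = f"
 obtains B lam and \<epsilon> \<eta> :: "_ \<Rightarrow> int" where "finite B" "B \<subseteq> supported_on X"
  "\<And>b. b \<in> B \<Longrightarrow> u b = (\<lambda>x. lam b * b x)"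
  "\<And>b. b \<in> B \<Longrightarrow> L b = (\<lambda>x. of_int (\<epsilon> b) * b x)" "\<And>b. b \<in> B \<Longrightarrow> \<epsilon> b = 1 \<or> \<epsilon> b = -1"
  "\<And>b. b \<in> B \<Longrightarrow> R b = (\<lambda>x. of_int (\<eta> b) * b x)" "\<And>b. b \<in> B \<Longrightarrow> \<eta> b = 1 \<or> \<eta> b = -1"
  "\<And>b b'. b \<in> B \<Longrightarrow> b' \<in> B \<Longrightarrow> herm X b b' = (if b = b' then 1 else 0)"
  "\<And>x y. x \<in> X \<Longrightarrow> y \<in> X \<Longrightarrow> (\<Sum>b\<in>B. b x * cnj (b y)) = (if x = y then 1 else 0)"
proof -
 let ?V = "supported_on X"
 define joint where "joint b \<longleftrightarrow> b \<in> ?V \<and> (\<exists>c. u b = (\<lambda>x. c * b x)) \<and>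
   (\<exists>c. (c = 1 \<or> c = -1) \<and> L b = (\<lambda>x. c * b x)) \<and> (\<exists>c. (c = 1 \<or> c = -1) \<and> R b = (\<lambda>x. c * b x))" for b
 define ok where "ok B \<longleftrightarrow> finite B \<and> (\<forall>b\<in>B. joint b) \<and>
   (\<forall>b\<in>B. \<forall>b'\<in>B. herm X b b' = (if b = b' then 1 else 0))" for B
 \<comment> \<open>The component orthogonal to \<open>B\<close> of the point mass at \<open>y\<close>.\<close>
 define res where "res B y = (\<lambda>x. if x \<in> X then (if x = y then 1 else 0) - (\<Sum>b\<in>B. b x * cnj (b y)) else 0)"
  for B y
 have resV: "res B y \<in> ?V" for B y by (auto simp: res_def supported_on_def)
 have res_orth: "herm X (res B y) b = 0" if "ok B" "b \<in> B" "y \<in> X" for B y b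
 proof -
  have "herm X (res B y) b = (\<Sum>x\<in>X. (if x = y then 1 else 0) * cnj (b x))
    - (\<Sum>x\<in>X. \<Sum>b'\<in>B. b' x * cnj (b' y) * cnj (b x))"
   by (simp add: herm_def res_def left_diff_distrib sum_subtractf sum_distrib_right cong: sum.cong)
  also have "(\<Sum>x\<in>X. (if x = y then 1 else 0) * cnj (b x)) = cnj (b y)"
   using that fin by (simp add: if_distrib[where f = "\<lambda>a. a * _"] cong: if_cong)
  also have "(\<Sum>x\<in>X. \<Sum>b'\<in>B. b' x * cnj (b' y) * cnj (b x)) = (\<Sum>b'\<in>B. cnj (b' y) * herm X b' b)"
   by (subst sum.swap) (simp add: herm_def sum_distrib_left algebra_simps)
  also have "\<dots> = (\<Sum>b'\<in>B. if b' = b then cnj (b' y) else 0)"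
   using that by (intro sum.cong) (auto simp: ok_def)
  also have "\<dots> = cnj (b y)" using that by (simp add: ok_def)
  finally show ?thesis by simp
 qed
 have bessel: "(\<Sum>b\<in>B. (cmod (b y))\<^sup>2) \<le> 1" if "ok B" "y \<in> X" for B y
 proof -
  have "herm X (res B y) (res B y) =
    herm X (res B y) (\<lambda>x. (if x = y then 1 else 0)) - herm X (res B y) (\<lambda>x. \<Sum>b\<in>B. b x * cnj (b y))"
   unfolding herm_def by (simp add: res_def right_diff_distrib sum_subtractf cong: sum.cong)
  also have "herm X (res B y) (\<lambda>x. \<Sum>b\<in>B. b x * cnj (b y)) = (\<Sum>b\<in>B. b y * herm X (res B y) b)"
   unfolding herm_def by (simp add: sum_distrib_left) (subst sum.swap, simp add: algebra_simps)
  also have "\<dots> = 0" using res_orth that by simp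
  also have "herm X (res B y) (\<lambda>x. (if x = y then 1 else 0)) = res B y y"
   using that fin by (simp add: herm_def if_distrib[where f = cnj] if_distrib[where f = "\<lambda>a. _ * a"] cong: if_cong)
  also have "\<dots> = complex_of_real (1 - (\<Sum>b\<in>B. (cmod (b y))\<^sup>2))"
   using that by (simp add: res_def complex_norm_square[symmetric])
  finally have "(\<Sum>x\<in>X. (cmod (res B y x))\<^sup>2) = 1 - (\<Sum>b\<in>B. (cmod (b y))\<^sup>2)"
   unfolding herm_self by (simp only: of_real_eq_iff diff_zero)
  moreover have "(\<Sum>x\<in>X. (cmod (res B y x))\<^sup>2) \<ge> 0" by (simp add: sum_nonneg)
  ultimately show ?thesis by linarith
 qed
 \<comment> \<open>By Bessel's inequality, so that there is an orthonormal family of maximal size.\<close>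
 have bound: "card B \<le> card X" if "ok B" for B
 proof -
  have "real (card B) = (\<Sum>b\<in>B. \<Sum>y\<in>X. (cmod (b y))\<^sup>2)"
  proof -
   have "(\<Sum>y\<in>X. (cmod (b y))\<^sup>2) = 1" if "b \<in> B" for b
   proof -
    have "herm X b b = 1" using that \<open>ok B\<close> by (simp add: ok_def)
    then show ?thesis unfolding herm_self by (simp only: of_real_eq_1_iff)
   qed
   then show ?thesis by simp
  qed
  also have "\<dots> = (\<Sum>y\<in>X. \<Sum>b\<in>B. (cmod (b y))\<^sup>2)" by (rule sum.swap)
  also have "\<dots> \<le> (\<Sum>y\<in>X. 1)" using bessel that by (intro sum_mono) auto
  finally show ?thesis by simp
 qed
 have "ok {}" by (simp add: ok_def)
 moreover have "\<forall>B. ok B \<longrightarrow> card B < Suc (card X)" using bound by (simp add: less_Suc_eq_le)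
 ultimately have "\<exists>B. ok B \<and> (\<forall>B'. ok B' \<longrightarrow> card B' \<le> card B)"
  by (rule ex_has_greatest_nat)
 then obtain B where B: "ok B" and max: "\<And>B'. ok B' \<Longrightarrow> card B' \<le> card B" by blast
 define W where "W = {f \<in> ?V. \<forall>b\<in>B. herm X f b = 0}"
 have W_inv: "T f \<in> W" if T: "selfadjoint X T" "\<And>b. b \<in> B \<Longrightarrow> \<exists>c. T b = (\<lambda>x. c * b x)" and f: "f \<in> W" for T f
 proof -
  have "herm X (T f) b = 0" if b: "b \<in> B" for b
  proof -
   obtain c where "T b = (\<lambda>x. c * b x)" using T(2)[OF b] by blast
   moreover have "b \<in> ?V" using B b by (auto simp: ok_def joint_def)
   ultimately show ?thesis
    using f b selfadjointD(4)[OF T(1)] by (auto simp: W_def herm_scale_right)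
  qed
  then show ?thesis using f selfadjointD(3)[OF T(1)] by (auto simp: W_def)
 qed
 have Bu: "\<exists>c. u b = (\<lambda>x. c * b x)" and BL: "\<exists>c. (c = 1 \<or> c = -1) \<and> L b = (\<lambda>x. c * b x)"
  and BR: "\<exists>c. (c = 1 \<or> c = -1) \<and> R b = (\<lambda>x. c * b x)" if "b \<in> B" for b
  using B that unfolding ok_def joint_def by blast+
 have Wu: "u f \<in> W" if "f \<in> W" for f by (rule W_inv[OF u _ that]) (rule Bu)
 have WL: "L f \<in> W" if "f \<in> W" for f by (rule W_inv[OF L _ that]) (use BL in blast)
 have WR: "R f \<in> W" if "f \<in> W" for f by (rule W_inv[OF R _ that]) (use BR in blast)
 have W_add: "(\<lambda>x. f x + g x) \<in> W" if "f \<in> W" "g \<in> W" for f g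
  using that by (auto simp: W_def herm_add supported_on_add)
 have W_scale: "(\<lambda>x. c * f x) \<in> W" if "f \<in> W" for f c
  using that by (auto simp: W_def herm_scale supported_on_scale)
 have res0: "res B y = (\<lambda>_. 0)" if y: "y \<in> X" for y
 proof (rule ccontr)
  assume nz: "res B y \<noteq> (\<lambda>_. 0)"
  have resW: "res B y \<in> W" using resV res_orth[OF B _ y] by (auto simp: W_def)
  have W_supp: "f x = 0" if "f \<in> W" "x \<notin> X" for f x
   using that by (auto simp: W_def supported_on_def)
  obtain g z where g: "g \<in> W" "g \<noteq> (\<lambda>_. 0)" "u g = (\<lambda>x. z * g x)"
  proof (rule eigenvector_exists[of X W u "res B y"])
   show "u (\<lambda>x. f x + g x) = (\<lambda>x. u f x + u g x)" for f g by (rule selfadjointD(1)[OF u])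
   show "u (\<lambda>x. c * f x) = (\<lambda>x. c * u f x)" for c f by (rule selfadjointD(2)[OF u])
   show "finite X" "res B y \<in> W" "res B y \<noteq> (\<lambda>_. 0)" by fact+
   show "f x = 0" if "f \<in> W" "x \<notin> X" for f x using that by (rule W_supp)
   show "(\<lambda>x. f x + g x) \<in> W" if "f \<in> W" "g \<in> W" for f g using that by (rule W_add)
   show "(\<lambda>x. c * f x) \<in> W" if "f \<in> W" for c f using that by (rule W_scale)
   show "u f \<in> W" if "f \<in> W" for f using that by (rule Wu)
  qed (rule that)
  have gV: "g \<in> ?V" using g by (simp add: W_def)
  obtain g1 c1 where g1: "g1 = g \<or> g1 = (\<lambda>x. g x + L g x)" "g1 \<noteq> (\<lambda>_. 0)" "c1 = 1 \<or> c1 = -1"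
   "L g1 = (\<lambda>x. c1 * g1 x)"
   using involution_eigenvector[OF L gV LL[OF gV] g(2)] .
  have g1W: "g1 \<in> W" using g1(1) g(1) W_add WL by auto
  then have g1V: "g1 \<in> ?V" by (simp add: W_def)
  have "u (L g) = (\<lambda>x. z * L g x)" using uL[OF gV] g(3) selfadjointD(2)[OF L] by simp
  then have ug1: "u g1 = (\<lambda>x. z * g1 x)"
   using g1(1) g(3) selfadjointD(1)[OF u] by (auto simp: algebra_simps)
  obtain g2 c2 where g2: "g2 = g1 \<or> g2 = (\<lambda>x. g1 x + R g1 x)" "g2 \<noteq> (\<lambda>_. 0)" "c2 = 1 \<or> c2 = -1"
   "R g2 = (\<lambda>x. c2 * g2 x)"
   using involution_eigenvector[OF R g1V RR[OF g1V] g1(2)] .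
  have g2W: "g2 \<in> W" using g2(1) g1W W_add WR by auto
  then have g2V: "g2 \<in> ?V" by (simp add: W_def)
  have "u (R g1) = (\<lambda>x. z * R g1 x)" using uR[OF g1V] ug1 selfadjointD(2)[OF R] by simp
  then have ug2: "u g2 = (\<lambda>x. z * g2 x)"
   using g2(1) ug1 selfadjointD(1)[OF u] by (auto simp: algebra_simps)
  have "L (R g1) = (\<lambda>x. c1 * R g1 x)" using LR[OF g1V] g1(4) selfadjointD(2)[OF R] by simp
  then have Lg2: "L g2 = (\<lambda>x. c1 * g2 x)"
   using g2(1) g1(4) selfadjointD(1)[OF L] by (auto simp: algebra_simps)
  define n where "n = (\<Sum>x\<in>X. (cmod (g2 x))\<^sup>2)"
  have gg: "herm X g2 g2 = complex_of_real n" unfolding herm_self n_def ..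
  have "n \<noteq> 0" using herm_self_eq_0[OF fin g2V] g2(2) gg by auto
  moreover have "n \<ge> 0" by (simp add: n_def sum_nonneg)
  ultimately have n: "n > 0" by simp
  define b where "b = (\<lambda>x. complex_of_real (1 / sqrt n) * g2 x)"
  have bW: "b \<in> W" unfolding b_def by (rule W_scale[OF g2W])
  have bb: "herm X b b = 1"
   unfolding b_def herm_scale herm_scale_right gg
   using n by (simp flip: of_real_mult)
  have "joint b"
   unfolding joint_def
  proof (intro conjI)
   show "b \<in> ?V" using bW by (simp add: W_def)
   show "\<exists>c. u b = (\<lambda>x. c * b x)"
    unfolding b_def selfadjointD(2)[OF u] ug2 by (intro exI[of _ z]) (simp add: algebra_simps)
   show "\<exists>c. (c = 1 \<or> c = -1) \<and> L b = (\<lambda>x. c * b x)"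
    unfolding b_def selfadjointD(2)[OF L] Lg2 using g1(3) by (intro exI[of _ c1]) (simp add: algebra_simps)
   show "\<exists>c. (c = 1 \<or> c = -1) \<and> R b = (\<lambda>x. c * b x)"
    unfolding b_def selfadjointD(2)[OF R] g2(4) using g2(3) by (intro exI[of _ c2]) (simp add: algebra_simps)
  qed
  moreover have "herm X b b' = 0" "herm X b' b = 0" if "b' \<in> B" for b'
  proof -
   show 0: "herm X b b' = 0" using that bW by (simp add: W_def)
   have "herm X b' b = cnj (herm X b b')" by (simp add: herm_def mult.commute)
   then show "herm X b' b = 0" using 0 by simp
  qed
  moreover have "b \<notin> B" using calculation(2) bb by auto
  ultimately have "ok (insert b B)" using B bb by (auto simp: ok_def)
  then show False using max[of "insert b B"] \<open>b \<notin> B\<close> B by (simp add: ok_def)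
 qed
 have "\<forall>b\<in>B. \<exists>c. u b = (\<lambda>x. c * b x)" using Bu by blast
 from bchoice[OF this] obtain lam where lam: "\<forall>b\<in>B. u b = (\<lambda>x. lam b * b x)" ..
 have int_sign: "\<exists>e::int. (e = 1 \<or> e = -1) \<and> f = (\<lambda>x. of_int e * b x)"
  if "\<exists>c. (c = 1 \<or> c = -1) \<and> f = (\<lambda>x. c * b x)" for f b :: "'a \<Rightarrow> complex"
  using that by (metis of_int_1 of_int_minus)
 have "\<forall>b\<in>B. \<exists>e::int. (e = 1 \<or> e = -1) \<and> L b = (\<lambda>x. of_int e * b x)" using int_sign[OF BL] by blast
 from bchoice[OF this] obtain eps where eps: "\<forall>b\<in>B. (eps b = 1 \<or> eps b = -1) \<and> L b = (\<lambda>x. of_int (eps b) * b x)" ..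
 have "\<forall>b\<in>B. \<exists>e::int. (e = 1 \<or> e = -1) \<and> R b = (\<lambda>x. of_int e * b x)" using int_sign[OF BR] by blast
 from bchoice[OF this] obtain eta where eta: "\<forall>b\<in>B. (eta b = 1 \<or> eta b = -1) \<and> R b = (\<lambda>x. of_int (eta b) * b x)" ..
 from lam eps eta show ?thesis
 proof (intro that[of B lam eps eta])
  fix x y assume "x \<in> X" "y \<in> X"
  then show "(\<Sum>b\<in>B. b x * cnj (b y)) = (if x = y then 1 else 0)"
   using fun_cong[OF res0[of y], of x] by (simp add: res_def)
 qed (use B in \<open>auto simp: ok_def joint_def\<close>)
qed

section \<open>Rational eigenvalues of integer matrices\<close>

text \<open>A rational eigenvalue of an integer matrix is an algebraic integer, hence an integer.\<close>

lemma rational_eigenvalue_in_Ints: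
 fixes a :: "'a \<Rightarrow> 'a \<Rightarrow> int" and \<mu> :: complex
 assumes fin: "finite X" and x: "x0 \<in> X" "f x0 \<noteq> 0"
  and eig: "\<And>x. x \<in> X \<Longrightarrow> (\<Sum>y\<in>X. of_int (a x y) * f y) = \<mu> * f x" and rat: "\<mu> \<in> \<rat>"
 shows "\<mu> \<in> \<int>"
proof -
 define n where "n = card X"
 obtain e where e: "bij_betw e {0..<n} X" using ex_bij_betw_nat_finite[OF fin] n_def by blast
 define A where "A = mat n n (\<lambda>(i, j). a (e i) (e j))"
 define v where "v = vec n (\<lambda>i. f (e i))"
 have A: "A \<in> carrier_mat n n" by (simp add: A_def)
 define A' :: "complex mat" where "A' = map_mat of_int A"
 have A': "A' \<in> carrier_mat n n" by (simp add: A'_def A_def)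
 have "A' *\<^sub>v v = \<mu> \<cdot>\<^sub>v v"
 proof (rule eq_vecI)
  fix i assume "i < dim_vec (\<mu> \<cdot>\<^sub>v v)"
  then have i: "i < n" by (simp add: v_def)
  then have "(A' *\<^sub>v v) $ i = (\<Sum>j\<in>{0..<n}. of_int (a (e i) (e j)) * f (e j))"
   by (simp add: A'_def A_def v_def scalar_prod_def)
  also have "\<dots> = (\<Sum>y\<in>X. of_int (a (e i) y) * f y)"
   by (rule sum.reindex_bij_betw[OF e])
  also have "\<dots> = \<mu> * f (e i)" using eig bij_betwE[OF e] i by simp
  finally show "(A' *\<^sub>v v) $ i = (\<mu> \<cdot>\<^sub>v v) $ i" using i by (simp add: v_def)
 qed (simp add: A'_def A_def v_def)
 moreover have "v \<noteq> 0\<^sub>v n"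
 proof
  assume v0: "v = 0\<^sub>v n"
  obtain i where i: "i < n" "x0 = e i" using e x(1) unfolding bij_betw_def by auto
  then have "v $ i = f x0" by (simp add: v_def)
  then show False using v0 i x(2) by simp
 qed
 ultimately have "eigenvector A' v \<mu>" using A' by (auto simp: eigenvector_def v_def)
 then have "eigenvalue A' \<mu>" by (auto simp: eigenvalue_def)
 then have "poly (char_poly A') \<mu> = 0" using eigenvalue_root_char_poly[OF A'] by simp
 moreover have "char_poly A' = map_poly of_int (char_poly A)"
  unfolding A'_def using of_int_hom.char_poly_hom[OF A] .
 ultimately have "algebraic_int \<mu>"
  unfolding algebraic_int_altdef_ipoly using degree_monic_char_poly[OF A] by metis
 then show ?thesis using rat by (rule rational_algebraic_int_is_int)
qed

section \<open>Translation operators on a finite group\<close>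

definition left_op :: "('a, 'b) monoid_scheme \<Rightarrow> 'a set \<Rightarrow> ('a \<Rightarrow> complex) \<Rightarrow> 'a \<Rightarrow> complex" where
 "left_op G D f x = (if x \<in> carrier G then \<Sum>d\<in>D. f (d \<otimes>\<^bsub>G\<^esub> x) else 0)"

definition right_op :: "('a, 'b) monoid_scheme \<Rightarrow> 'a set \<Rightarrow> ('a \<Rightarrow> complex) \<Rightarrow> 'a \<Rightarrow> complex" where
 "right_op G D f x = (if x \<in> carrier G then \<Sum>d\<in>D. f (x \<otimes>\<^bsub>G\<^esub> d) else 0)"

definition conj_class :: "('a, 'b) monoid_scheme \<Rightarrow> 'a \<Rightarrow> 'a set" where
 "conj_class G t = {x \<otimes>\<^bsub>G\<^esub> t \<otimes>\<^bsub>G\<^esub> inv\<^bsub>G\<^esub> x | x. x \<in> carrier G}"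

text \<open>Composition with an involution of \<open>X\<close> is selfadjoint, as substituting the involution shows.\<close>

lemma selfadjoint_sum_of_involutions:
 assumes inv: "\<And>d x. d \<in> D \<Longrightarrow> x \<in> X \<Longrightarrow> \<pi> d x \<in> X \<and> \<pi> d (\<pi> d x) = x"
 shows "selfadjoint X (\<lambda>f x. if x \<in> X then \<Sum>d\<in>D. f (\<pi> d x) else 0)" (is "selfadjoint X ?U")
 unfolding selfadjoint_def
proof (intro conjI allI ballI)
 fix f g
 have "herm X (?U f) g = (\<Sum>d\<in>D. \<Sum>x\<in>X. f (\<pi> d x) * cnj (g x))"
  by (subst sum.swap) (simp add: herm_def sum_distrib_right)
 also have "\<dots> = (\<Sum>d\<in>D. \<Sum>x\<in>X. f x * cnj (g (\<pi> d x)))"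
 proof (rule sum.cong[OF refl])
  fix d assume d: "d \<in> D"
  have "bij_betw (\<pi> d) X X" by (rule bij_betw_byWitness[of _ "\<pi> d"]) (use inv[OF d] in auto)
  then have "(\<Sum>x\<in>X. f x * cnj (g (\<pi> d x))) = (\<Sum>x\<in>X. f (\<pi> d x) * cnj (g (\<pi> d (\<pi> d x))))"
   by (rule sum.reindex_bij_betw[symmetric])
  also have "\<dots> = (\<Sum>x\<in>X. f (\<pi> d x) * cnj (g x))" using inv[OF d] by (intro sum.cong) auto
  finally show "(\<Sum>x\<in>X. f (\<pi> d x) * cnj (g x)) = (\<Sum>x\<in>X. f x * cnj (g (\<pi> d x)))" ..
 qed
 also have "\<dots> = herm X f (?U g)"
  by (subst sum.swap) (simp add: herm_def sum_distrib_left)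
 finally show "herm X (?U f) g = herm X f (?U g)" .
qed (auto simp: supported_on_def sum.distrib sum_distrib_left fun_eq_iff)

context group
begin

lemma bij_left_mult: "g \<in> carrier G \<Longrightarrow> bij_betw (\<lambda>x. g \<otimes> x) (carrier G) (carrier G)"
 by (rule bij_betw_byWitness[of _ "\<lambda>x. inv g \<otimes> x"]) (auto simp: m_assoc[symmetric])

lemma bij_right_mult: "g \<in> carrier G \<Longrightarrow> bij_betw (\<lambda>x. x \<otimes> g) (carrier G) (carrier G)"
 by (rule bij_betw_byWitness[of _ "\<lambda>x. x \<otimes> inv g"]) (auto simp: m_assoc)

lemma involution_inv: "d \<in> carrier G \<Longrightarrow> d \<otimes> d = \<one> \<Longrightarrow> inv d = d"
 by (simp add: inv_equality)

lemma selfadjoint_left_op: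
 assumes D: "\<And>d. d \<in> D \<Longrightarrow> d \<in> carrier G \<and> d \<otimes> d = \<one>"
 shows "selfadjoint (carrier G) (left_op G D)"
 unfolding left_op_def by (rule selfadjoint_sum_of_involutions) (use D in \<open>auto simp: m_assoc[symmetric]\<close>)

lemma selfadjoint_right_op:
 assumes D: "\<And>d. d \<in> D \<Longrightarrow> d \<in> carrier G \<and> d \<otimes> d = \<one>"
 shows "selfadjoint (carrier G) (right_op G D)"
 unfolding right_op_def by (rule selfadjoint_sum_of_involutions) (use D in \<open>auto simp: m_assoc\<close>)

lemma conj_class_closed:
 assumes "t \<in> carrier G" "d \<in> conj_class G t" "g \<in> carrier G"
 shows "g \<otimes> d \<otimes> inv g \<in> conj_class G t"
proof -
 obtain x where x: "x \<in> carrier G" "d = x \<otimes> t \<otimes> inv x" using assms(2) by (auto simp: conj_class_def)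
 have "g \<otimes> d \<otimes> inv g = (g \<otimes> x) \<otimes> t \<otimes> inv (g \<otimes> x)"
  using x assms by (simp add: m_assoc inv_mult_group)
 then show ?thesis using x assms unfolding conj_class_def by blast
qed

lemma conj_class_carrier: "t \<in> carrier G \<Longrightarrow> conj_class G t \<subseteq> carrier G"
 by (auto simp: conj_class_def)

lemma conj_bij_class:
 assumes t: "t \<in> carrier G" and g: "g \<in> carrier G"
 shows "bij_betw (\<lambda>d. g \<otimes> d \<otimes> inv g) (conj_class G t) (conj_class G t)"
proof (rule bij_betw_byWitness[of _ "\<lambda>d. inv g \<otimes> d \<otimes> g"])
 have c: "d \<in> conj_class G t \<Longrightarrow> d \<in> carrier G" for d using conj_class_carrier[OF t] by auto
 show "\<forall>d\<in>conj_class G t. inv g \<otimes> (g \<otimes> d \<otimes> inv g) \<otimes> g = d"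
  using c g by (simp add: m_assoc) (simp add: m_assoc[symmetric])
 show "\<forall>d\<in>conj_class G t. g \<otimes> (inv g \<otimes> d \<otimes> g) \<otimes> inv g = d"
  using c g by (simp add: m_assoc) (simp add: m_assoc[symmetric])
 show "(\<lambda>d. g \<otimes> d \<otimes> inv g) ` conj_class G t \<subseteq> conj_class G t"
  using conj_class_closed[OF t] g by auto
 show "(\<lambda>d. inv g \<otimes> d \<otimes> g) ` conj_class G t \<subseteq> conj_class G t"
  using conj_class_closed[OF t _ inv_closed[OF g]] g by auto
qed

lemma inv_mult_cancel [simp]:
 assumes "x \<in> carrier G" "y \<in> carrier G"
 shows "inv x \<otimes> (x \<otimes> y) = y" "x \<otimes> (inv x \<otimes> y) = y"
 using assms by (simp_all add: m_assoc[symmetric])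

lemma involution_class_square:
 assumes "t \<in> carrier G" "t \<otimes> t = \<one>" "d \<in> conj_class G t"
 shows "d \<otimes> d = \<one>"
proof -
 obtain x where x: "x \<in> carrier G" "d = x \<otimes> t \<otimes> inv x" using assms(3) by (auto simp: conj_class_def)
 have "t \<otimes> (t \<otimes> inv x) = inv x" using x assms by (simp add: m_assoc[symmetric])
 then show ?thesis using x assms by (simp add: m_assoc)
qed

end

section \<open>Conjugacy classes of involutions of prime power size\<close>

text \<open>Let \<open>p\<^sup>j\<close> be the exact power of \<open>p\<close> in \<open>M\<close>. The second equation makes \<open>m\<close> divisible by
 the square of \<open>p ^ (k - j)\<close>; the first then leaves a factor \<open>p ^ (k - j)\<close> in \<open>T1\<close>.\<close>

lemma prime_dvd_trace:
 fixes p T1 T2 M m :: int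
 assumes p: "prime p" and 1: "p ^ k * T1 = M * m" and 2: "(p ^ k)\<^sup>2 * T2 = M\<^sup>2 * m"
  and nd: "\<not> p ^ k dvd M"
 shows "p dvd T1"
proof -
 define j where "j = multiplicity p M"
 have M0: "M \<noteq> 0" using nd by auto
 obtain M' where M': "M = p ^ j * M'" "\<not> p dvd M'"
  using multiplicity_decompose'[of M p] M0 p unfolding j_def
  by (metis not_prime_unit)
 have jk: "j < k"
  using nd M'(1) by (metis dvd_triv_left le_imp_power_dvd dvd_trans not_le_imp_less)
 define i where "i = k - j"
 have i: "k = j + i" "i > 0" using jk by (auto simp: i_def)
 have p0: "p ^ j \<noteq> 0" using p by auto
 have "p ^ j * (p ^ i * T1) = p ^ j * (M' * m)" using 1 M'(1) by (simp add: i(1) power_add algebra_simps)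
 then have a: "p ^ i * T1 = M' * m" using p0 by (metis mult_left_cancel)
 have "(p ^ j)\<^sup>2 * ((p ^ i)\<^sup>2 * T2) = (p ^ j)\<^sup>2 * (M'\<^sup>2 * m)"
  using 2 M'(1) by (simp add: i(1) power_add power_mult_distrib algebra_simps)
 then have b: "(p ^ i)\<^sup>2 * T2 = M'\<^sup>2 * m" using p0 by (metis mult_left_cancel power_not_zero)
 have "coprime (p ^ (i + i)) (M'\<^sup>2)"
  using p M'(2) by (intro coprime_power_left_iff[THEN iffD2] disjI1 coprime_power_right_iff[THEN iffD2])
   (auto intro: prime_imp_coprime)
 moreover have "p ^ (i + i) dvd M'\<^sup>2 * m"
  using b by (metis dvd_triv_left power2_eq_square power_add)
 ultimately have "p ^ (i + i) dvd m" by (simp add: coprime_dvd_mult_right_iff)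
 then obtain m' where m': "m = p ^ (i + i) * m'" by (auto simp: dvd_def)
 have "p ^ i * T1 = p ^ i * (M' * p ^ i * m')" using a m' by (simp add: power_add algebra_simps)
 moreover have "p ^ i \<noteq> 0" using p by auto
 ultimately have "T1 = M' * p ^ i * m'" by (metis mult_left_cancel)
 then show ?thesis using i(2) by (simp add: dvd_mult dvd_mult2 dvd_power)
qed

text \<open>Let \<open>U\<close> be the sum of the left translations by the class \<open>D\<close> of \<open>t\<close>, acting on functions on the group, with
 \<open>q = p\<^sup>k\<close> the size of \<open>D\<close>. An eigenspace of \<open>U\<close> with eigenvalue \<open>\<mu>\<close> and dimension \<open>m\<close> is stable under all
 translations. If \<open>T1\<close> and \<open>T2\<close> are the traces on it of the left translation by \<open>t\<close> and of its product with the right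
 translation by \<open>t\<close>, then averaging over \<open>D\<close> gives \<open>q T1 = \<mu> m\<close> and \<open>q\<^sup>2 T2 = \<mu>\<^sup>2 m\<close>. So \<open>\<mu>\<close> is rational, hence an
 integer, and \<open>p\<close> divides \<open>T1\<close> unless \<open>q\<close> divides \<open>\<mu>\<close>, that is, unless \<open>\<mu>\<close> is \<open>q\<close>, \<open>-q\<close> or \<open>0\<close> (and \<open>T1 = 0\<close>
 for \<open>\<mu> = 0\<close>). For \<open>\<mu> = q\<close> the eigenspace consists of the constants, because \<open>D\<close> generates the group, and
 \<open>T1 = 1\<close>. As left translation by \<open>t\<close> has trace \<open>0\<close> on all functions, \<open>-q\<close> must be an eigenvalue as well. Every
 element of \<open>D\<close> negates its eigenfunctions, which therefore change by a sign under every translation and are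
 invariant under translation by commutators, although \<open>t\<close> does not leave them invariant.\<close>

theorem (in group) prime_power_involution_class_not_perfect:
 fixes t and p :: nat
 defines "D \<equiv> conj_class G t"
 assumes fin: "finite (carrier G)" and t: "t \<in> carrier G" "t \<otimes> t = \<one>" "t \<noteq> \<one>"
  and p: "prime p" and cardD: "card D = p ^ k" and gen: "generate G D = carrier G"
 shows "derived G (carrier G) \<noteq> carrier G"
proof -
 define X where "X = carrier G"
 define q where "q = p ^ k"
 define n where "n = card X"
 let ?V = "supported_on X"
 let ?U = "left_op G D" and ?L = "left_op G {t}" and ?R = "right_op G {t}"
 have finX: "finite X" using fin by (simp add: X_def)
 have tX: "t \<in> X" using t by (simp add: X_def)
 have DX: "d \<in> X" if "d \<in> D" for d using conj_class_carrier[OF t(1)] that by (auto simp: D_def X_def)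
 have DD: "d \<otimes> d = \<one>" if "d \<in> D" for d using involution_class_square[OF t(1,2)] that by (simp add: D_def)
 have finD: "finite D" using DX finX by (meson finite_subset subsetI)
 have Dconj: "bij_betw (\<lambda>d. g \<otimes> d \<otimes> inv g) D D" if "g \<in> X" for g
  using conj_bij_class[OF t(1)] that by (simp add: D_def X_def)
 have tD: "t \<in> D" unfolding D_def conj_class_def using t by (auto intro!: exI[of _ \<one>])
 have Dform: "\<exists>g\<in>X. d = g \<otimes> t \<otimes> inv g" if "d \<in> D" for d
  using that by (auto simp: D_def X_def conj_class_def)
 have X1: "\<one> \<in> X" by (simp add: X_def)
 have saU: "selfadjoint X ?U" unfolding X_def
  by (rule selfadjoint_left_op) (use DX DD in \<open>auto simp: X_def\<close>)
 have saL: "selfadjoint X ?L" unfolding X_def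
  by (rule selfadjoint_left_op) (use t in auto)
 have saR: "selfadjoint X ?R" unfolding X_def
  by (rule selfadjoint_right_op) (use t in auto)
 have UL: "?U (?L f) = ?L (?U f)" for f
 proof
  fix x show "?U (?L f) x = ?L (?U f) x"
  proof (cases "x \<in> X")
   case x: True
   have "?U (?L f) x = (\<Sum>d\<in>D. f (t \<otimes> (d \<otimes> x)))"
    using x DX tX by (auto simp: left_op_def X_def intro!: sum.cong)
   also have "\<dots> = (\<Sum>d\<in>D. f ((t \<otimes> d \<otimes> inv t) \<otimes> (t \<otimes> x)))"
    using x DX tX by (intro sum.cong) (auto simp: X_def m_assoc)
   also have "\<dots> = (\<Sum>d\<in>D. f (d \<otimes> (t \<otimes> x)))"
    by (rule sum.reindex_bij_betw[OF Dconj[OF tX]])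
   finally show ?thesis using x DX tX by (auto simp: left_op_def X_def)
  qed (auto simp: left_op_def X_def)
 qed
 have UR: "?U (?R f) = ?R (?U f)" for f
  using DX tX by (auto simp: left_op_def right_op_def X_def fun_eq_iff m_assoc intro!: sum.cong)
 have LR: "?L (?R f) = ?R (?L f)" for f
  using tX by (auto simp: left_op_def right_op_def X_def fun_eq_iff m_assoc)
 have LL: "?L (?L f) = f" if "f \<in> ?V" for f
  using tX t that by (auto simp: left_op_def X_def fun_eq_iff m_assoc[symmetric] supported_on_def)
 have RR: "?R (?R f) = f" if "f \<in> ?V" for f
  using tX t that by (auto simp: right_op_def X_def fun_eq_iff m_assoc supported_on_def)
 obtain B lam and \<epsilon> \<eta> :: "_ \<Rightarrow> int" where finB: "finite B" and BV: "B \<subseteq> ?V"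
  and UB: "\<And>b. b \<in> B \<Longrightarrow> ?U b = (\<lambda>x. lam b * b x)"
  and LB: "\<And>b. b \<in> B \<Longrightarrow> ?L b = (\<lambda>x. of_int (\<epsilon> b) * b x)" and eps: "\<And>b. b \<in> B \<Longrightarrow> \<epsilon> b = 1 \<or> \<epsilon> b = -1"
  and RB: "\<And>b. b \<in> B \<Longrightarrow> ?R b = (\<lambda>x. of_int (\<eta> b) * b x)" and eta: "\<And>b. b \<in> B \<Longrightarrow> \<eta> b = 1 \<or> \<eta> b = -1"
  and orth: "\<And>b b'. b \<in> B \<Longrightarrow> b' \<in> B \<Longrightarrow> herm X b b' = (if b = b' then 1 else 0)"
  and complete: "\<And>x y. x \<in> X \<Longrightarrow> y \<in> X \<Longrightarrow> (\<Sum>b\<in>B. b x * cnj (b y)) = (if x = y then 1 else 0)"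
  using joint_eigenbasis[OF finX saU saL saR UL UR LR LL RR] by blast
 define E where "E \<mu> = {f \<in> ?V. ?U f = (\<lambda>x. \<mu> * f x)}" for \<mu>
 define Bm where "Bm \<mu> = {b \<in> B. lam b = \<mu>}" for \<mu>
 \<comment> \<open>The kernel of the orthogonal projection onto the eigenspace \<open>E \<mu>\<close>.\<close>
 define ker where "ker \<mu> x y = (\<Sum>b\<in>Bm \<mu>. b x * cnj (b y))" for \<mu> x y
 have BmE: "Bm \<mu> \<subseteq> E \<mu>" for \<mu> using BV UB by (auto simp: Bm_def E_def)
 have finBm: "finite (Bm \<mu>)" for \<mu> using finB by (simp add: Bm_def)
 have real: "cnj (lam b) = lam b" if b: "b \<in> B" for b
 proof -
  have "b \<in> ?V" using b BV by auto
  then have "herm X (?U b) b = herm X b (?U b)" by (intro selfadjointD(4)[OF saU])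
  then show ?thesis using b by (simp add: UB herm_scale herm_scale_right orth)
 qed
 have orthE: "herm X f b = 0" if f: "f \<in> E \<mu>" and b: "b \<in> B" "lam b \<noteq> \<mu>" for f b \<mu>
 proof -
  have "herm X (?U f) b = herm X f (?U b)" using f b BV by (intro selfadjointD(4)[OF saU]) (auto simp: E_def)
  then have "\<mu> * herm X f b = lam b * herm X f b" using f b by (simp add: E_def UB real herm_scale herm_scale_right)
  then show ?thesis using b by simp
 qed
 have expand: "f x = (\<Sum>y\<in>X. f y * ker \<mu> x y)" if f: "f \<in> E \<mu>" and x: "x \<in> X" for f x \<mu>
 proof -
  have "f x = (\<Sum>y\<in>X. f y * (if x = y then 1 else 0))"
   using x finX by (simp add: if_distrib[where f = "\<lambda>a. _ * a"] cong: if_cong)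
  also have "\<dots> = (\<Sum>y\<in>X. \<Sum>b\<in>B. f y * (b x * cnj (b y)))"
   using complete x by (simp add: sum_distrib_left[symmetric])
  also have "\<dots> = (\<Sum>b\<in>B. b x * herm X f b)"
   by (subst sum.swap) (simp add: herm_def sum_distrib_left algebra_simps)
  also have "\<dots> = (\<Sum>b\<in>Bm \<mu>. b x * herm X f b)"
   using orthE[OF f] finB by (intro sum.mono_neutral_right) (auto simp: Bm_def)
  also have "\<dots> = (\<Sum>y\<in>X. f y * ker \<mu> x y)"
   unfolding herm_def ker_def by (simp add: sum_distrib_left) (subst sum.swap, simp add: algebra_simps)
  finally show ?thesis .
 qed
 have E_sum: "(\<lambda>x. \<Sum>b\<in>S. b x * c b) \<in> E \<mu>" if S: "S \<subseteq> Bm \<mu>" for S \<mu> c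
 proof -
  have "finite S" using S finBm finite_subset by blast
  then show ?thesis using S
  proof (induction S rule: finite_induct)
   case empty
   then show ?case by (auto simp: E_def supported_on_def left_op_def)
  next
   case (insert b S)
   have "b \<in> E \<mu>" using insert BmE by auto
   then show ?case using insert
    by (auto simp: E_def supported_on_def selfadjointD(1)[OF saU] selfadjointD(2)[OF saU, of "c b" b]
     mult.commute[of _ "c b"] distrib_left fun_eq_iff)
  qed
 qed
 have kerE: "(\<lambda>x. ker \<mu> x y) \<in> E \<mu>" for \<mu> y unfolding ker_def by (rule E_sum) simp
 have ker_cnj: "cnj (ker \<mu> x y) = ker \<mu> y x" for \<mu> x y by (simp add: ker_def mult.commute)
 \<comment> \<open>The projection commutes with every bijection of \<open>X\<close> that preserves the eigenspace.\<close>
 have ker_inv: "ker \<mu> (\<tau> x) (\<tau> y) = ker \<mu> x y"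
  if tau: "bij_betw \<tau> X X" "\<And>x. x \<in> X \<Longrightarrow> \<tau>' (\<tau> x) = x"
   "\<And>f. f \<in> E \<mu> \<Longrightarrow> (\<lambda>x. if x \<in> X then f (\<tau> x) else 0) \<in> E \<mu>"
   "\<And>f. f \<in> E \<mu> \<Longrightarrow> (\<lambda>x. if x \<in> X then f (\<tau>' x) else 0) \<in> E \<mu>"
   and xy: "x \<in> X" "y \<in> X" for \<mu> \<tau> \<tau>' x y
 proof -
  define k' where "k' x y = ker \<mu> (\<tau> x) (\<tau> y)" for x y
  have tX: "\<tau> x \<in> X" if "x \<in> X" for x using bij_betwE[OF tau(1)] that by auto
  have e1: "f x = (\<Sum>y\<in>X. f y * k' x y)" if f: "f \<in> E \<mu>" and x: "x \<in> X" for f x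
  proof -
   have "f x = (\<Sum>y\<in>X. (if y \<in> X then f (\<tau>' y) else 0) * ker \<mu> (\<tau> x) y)"
    using expand[OF tau(4)[OF f] tX[OF x]] tau(2)[OF x] tX[OF x] by simp
   also have "\<dots> = (\<Sum>y\<in>X. (if \<tau> y \<in> X then f (\<tau>' (\<tau> y)) else 0) * ker \<mu> (\<tau> x) (\<tau> y))"
    by (rule sum.reindex_bij_betw[OF tau(1), symmetric])
   also have "\<dots> = (\<Sum>y\<in>X. f y * k' x y)"
    using tX tau(2) by (intro sum.cong) (auto simp: k'_def)
   finally show ?thesis .
  qed
  have "ker \<mu> x y = cnj (ker \<mu> y x)" by (simp add: ker_cnj)
  also have "\<dots> = cnj (\<Sum>z\<in>X. ker \<mu> z x * k' y z)" using e1[OF kerE xy(2)] by simp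
  also have "\<dots> = (\<Sum>z\<in>X. (if z \<in> X then ker \<mu> (\<tau> z) (\<tau> y) else 0) * ker \<mu> x z)"
   by (simp add: ker_cnj k'_def mult.commute)
  also have "\<dots> = k' x y" using expand[OF tau(3)[OF kerE[of \<mu> "\<tau> y"]] xy(1)] xy by (simp add: k'_def)
  finally show ?thesis by (simp add: k'_def)
 qed
 have E_left: "(\<lambda>x. if x \<in> X then f (g \<otimes> x) else 0) \<in> E \<mu>" if f: "f \<in> E \<mu>" and g: "g \<in> X" for f g \<mu>
 proof -
  have "(\<Sum>d\<in>D. f (g \<otimes> (d \<otimes> x))) = \<mu> * f (g \<otimes> x)" if x: "x \<in> X" for x
  proof -
   have "(\<Sum>d\<in>D. f (g \<otimes> (d \<otimes> x))) = (\<Sum>d\<in>D. f ((g \<otimes> d \<otimes> inv g) \<otimes> (g \<otimes> x)))"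
    using x g DX by (intro sum.cong) (auto simp: X_def m_assoc)
   also have "\<dots> = (\<Sum>d\<in>D. f (d \<otimes> (g \<otimes> x)))" by (rule sum.reindex_bij_betw[OF Dconj[OF g]])
   also have "\<dots> = ?U f (g \<otimes> x)" using x g by (simp add: left_op_def X_def)
   finally show ?thesis using f by (simp add: E_def)
  qed
  then show ?thesis using DX by (auto simp: E_def supported_on_def left_op_def X_def fun_eq_iff)
 qed
 have E_right: "(\<lambda>x. if x \<in> X then f (x \<otimes> g) else 0) \<in> E \<mu>" if f: "f \<in> E \<mu>" and g: "g \<in> X" for f g \<mu>
 proof -
  have "(\<Sum>d\<in>D. f (d \<otimes> x \<otimes> g)) = \<mu> * f (x \<otimes> g)" if x: "x \<in> X" for x
  proof -
   have "(\<Sum>d\<in>D. f (d \<otimes> x \<otimes> g)) = ?U f (x \<otimes> g)"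
    using x g DX by (simp add: left_op_def X_def) (auto simp: m_assoc intro!: sum.cong)
   then show ?thesis using f by (simp add: E_def)
  qed
  then show ?thesis using DX by (auto simp: E_def supported_on_def left_op_def X_def fun_eq_iff)
 qed
 have ker_left: "ker \<mu> (g \<otimes> x) (g \<otimes> y) = ker \<mu> x y" if "g \<in> X" "x \<in> X" "y \<in> X" for \<mu> g x y
  using that by (intro ker_inv[where \<tau>' = "\<lambda>x. inv g \<otimes> x"] E_left) (auto simp: X_def bij_left_mult)
 have ker_right: "ker \<mu> (x \<otimes> g) (y \<otimes> g) = ker \<mu> x y" if "g \<in> X" "x \<in> X" "y \<in> X" for \<mu> g x y
  using that by (intro ker_inv[where \<tau>' = "\<lambda>x. x \<otimes> inv g"] E_right) (auto simp: X_def bij_right_mult m_assoc)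
 have ker_diag: "ker \<mu> x x = ker \<mu> \<one> \<one>" if "x \<in> X" for \<mu> x
  using ker_left[of x \<one> \<one> \<mu>] that by (simp add: X_def)
 have ker_conj: "ker \<mu> (d \<otimes> x) x = ker \<mu> t \<one>" if d: "d \<in> D" and x: "x \<in> X" for \<mu> d x
 proof -
  obtain g where g: "g \<in> X" "d = g \<otimes> t \<otimes> inv g" using Dform[OF d] by blast
  have "ker \<mu> (d \<otimes> x) x = ker \<mu> d \<one>" using ker_right[of x d \<one> \<mu>] d x DX by (simp add: X_def)
  also have "\<dots> = ker \<mu> (g \<otimes> t \<otimes> inv g) (g \<otimes> inv g)" using g by (simp add: X_def)
  also have "\<dots> = ker \<mu> (g \<otimes> t) (g \<otimes> \<one>)"
   using g t ker_right[of "inv g" "g \<otimes> t" g \<mu>] by (simp add: X_def)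
  also have "\<dots> = ker \<mu> t \<one>" using g t by (intro ker_left) (auto simp: X_def)
  finally show ?thesis .
 qed
 \<comment> \<open>Dimension and traces of the eigenspace, read off from the joint eigenbasis.\<close>
 define m where "m \<mu> = card (Bm \<mu>)" for \<mu>
 define T1 where "T1 \<mu> = (\<Sum>b\<in>Bm \<mu>. \<epsilon> b)" for \<mu>
 define T2 where "T2 \<mu> = (\<Sum>b\<in>Bm \<mu>. \<epsilon> b * \<eta> b)" for \<mu>
 have norm_b: "(\<Sum>x\<in>X. b x * cnj (b x)) = 1" if "b \<in> B" for b
  using orth[OF that that] by (simp add: herm_def)
 have tr0: "of_nat (m \<mu>) = of_nat n * ker \<mu> \<one> \<one>" for \<mu>
 proof -
  have "of_nat n * ker \<mu> \<one> \<one> = (\<Sum>x\<in>X. ker \<mu> x x)" using ker_diag by (simp add: n_def)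
  also have "\<dots> = (\<Sum>b\<in>Bm \<mu>. \<Sum>x\<in>X. b x * cnj (b x))" unfolding ker_def by (rule sum.swap)
  also have "\<dots> = (\<Sum>b\<in>Bm \<mu>. 1)" using norm_b by (intro sum.cong) (auto simp: Bm_def)
  finally show ?thesis by (simp add: m_def)
 qed
 have Lb: "b (t \<otimes> x) = of_int (\<epsilon> b) * b x" if "b \<in> B" "x \<in> X" for b x
  using fun_cong[OF LB[OF that(1)], of x] that by (simp add: left_op_def X_def)
 have Rb: "b (x \<otimes> t) = of_int (\<eta> b) * b x" if "b \<in> B" "x \<in> X" for b x
  using fun_cong[OF RB[OF that(1)], of x] that by (simp add: right_op_def X_def)
 have tr1: "of_int (T1 \<mu>) = of_nat n * ker \<mu> t \<one>" for \<mu>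
 proof -
  have "of_nat n * ker \<mu> t \<one> = (\<Sum>x\<in>X. ker \<mu> (t \<otimes> x) x)" using ker_conj[OF tD] by (simp add: n_def)
  also have "\<dots> = (\<Sum>b\<in>Bm \<mu>. \<Sum>x\<in>X. b (t \<otimes> x) * cnj (b x))" unfolding ker_def by (rule sum.swap)
  also have "\<dots> = (\<Sum>b\<in>Bm \<mu>. \<Sum>x\<in>X. of_int (\<epsilon> b) * (b x * cnj (b x)))"
   by (intro sum.cong refl) (simp add: Bm_def Lb)
  also have "\<dots> = of_int (T1 \<mu>)" unfolding T1_def of_int_sum sum_distrib_left[symmetric]
   using norm_b by (intro sum.cong) (auto simp: Bm_def)
  finally show ?thesis by simp
 qed
 have eigE: "(\<Sum>d\<in>D. f (d \<otimes> x)) = \<mu> * f x" if "f \<in> E \<mu>" "x \<in> X" for f x \<mu>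
 proof -
  have "?U f x = \<mu> * f x" using that by (simp add: E_def)
  then show ?thesis using that by (simp add: left_op_def X_def)
 qed
 have rel1: "of_nat q * of_int (T1 \<mu>) = \<mu> * of_nat (m \<mu>)" for \<mu>
 proof -
  have "\<mu> * ker \<mu> \<one> \<one> = (\<Sum>d\<in>D. ker \<mu> (d \<otimes> \<one>) \<one>)" using eigE[OF kerE, of \<one>] by (simp add: X_def)
  also have "\<dots> = of_nat q * ker \<mu> t \<one>" using ker_conj[of _ \<one>] by (simp add: X_def cardD q_def)
  finally show ?thesis using tr0[of \<mu>] tr1[of \<mu>] by (simp add: algebra_simps)
 qed
 have rel2: "(of_nat q)\<^sup>2 * of_int (T2 \<mu>) = \<mu>\<^sup>2 * of_nat (m \<mu>)" for \<mu>
 proof -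
  have T2: "(\<Sum>x\<in>X. ker \<mu> (d \<otimes> (x \<otimes> d')) x) = of_int (T2 \<mu>)" if d: "d \<in> D" "d' \<in> D" for d d'
  proof -
   obtain g where g: "g \<in> X" "d = g \<otimes> t \<otimes> inv g" using d by (auto simp: D_def X_def conj_class_def)
   obtain h where h: "h \<in> X" "d' = h \<otimes> t \<otimes> inv h" using d by (auto simp: D_def X_def conj_class_def)
   have "bij_betw ((\<lambda>x. g \<otimes> x) \<circ> (\<lambda>x. x \<otimes> inv h)) X X"
    using g h by (intro bij_betw_trans[of _ X X]) (auto simp: X_def bij_left_mult bij_right_mult)
   then have bij: "bij_betw (\<lambda>x. g \<otimes> (x \<otimes> inv h)) X X" by (simp add: comp_def)
   have "(\<Sum>x\<in>X. ker \<mu> (d \<otimes> (x \<otimes> d')) x)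
     = (\<Sum>x\<in>X. ker \<mu> (d \<otimes> ((g \<otimes> (x \<otimes> inv h)) \<otimes> d')) (g \<otimes> (x \<otimes> inv h)))"
    by (rule sum.reindex_bij_betw[OF bij, symmetric])
   also have "\<dots> = (\<Sum>x\<in>X. ker \<mu> (g \<otimes> (t \<otimes> (x \<otimes> t) \<otimes> inv h)) (g \<otimes> (x \<otimes> inv h)))"
    using g h t by (intro sum.cong) (auto simp: X_def m_assoc)
   also have "\<dots> = (\<Sum>x\<in>X. ker \<mu> (t \<otimes> (x \<otimes> t)) x)"
    using g h t ker_left ker_right by (intro sum.cong) (auto simp: X_def)
   also have "\<dots> = (\<Sum>b\<in>Bm \<mu>. \<Sum>x\<in>X. b (t \<otimes> (x \<otimes> t)) * cnj (b x))" unfolding ker_def by (rule sum.swap)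
   also have "\<dots> = (\<Sum>b\<in>Bm \<mu>. \<Sum>x\<in>X. of_int (\<epsilon> b * \<eta> b) * (b x * cnj (b x)))"
    using tX by (intro sum.cong refl) (simp add: Bm_def Lb Rb X_def)
   also have "\<dots> = of_int (T2 \<mu>)" unfolding T2_def of_int_sum sum_distrib_left[symmetric]
    using norm_b by (intro sum.cong) (auto simp: Bm_def)
   finally show ?thesis .
  qed
  have right: "(\<Sum>d\<in>D. f (x \<otimes> d)) = \<mu> * f x" if f: "f \<in> E \<mu>" and x: "x \<in> X" for f x
  proof -
   have "(\<Sum>d\<in>D. f (x \<otimes> d)) = (\<Sum>d\<in>D. f ((x \<otimes> d \<otimes> inv x) \<otimes> x))"
    using x DX by (intro sum.cong) (auto simp: X_def m_assoc)
   also have "\<dots> = (\<Sum>d\<in>D. f (d \<otimes> x))" by (rule sum.reindex_bij_betw[OF Dconj[OF x]])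
   finally show ?thesis using eigE[OF f x] by simp
  qed
  have "(of_nat q)\<^sup>2 * of_int (T2 \<mu>) = (\<Sum>d'\<in>D. \<Sum>d\<in>D. of_int (T2 \<mu>) :: complex)" by (simp add: cardD q_def power2_eq_square)
  also have "\<dots> = (\<Sum>d'\<in>D. \<Sum>d\<in>D. \<Sum>x\<in>X. ker \<mu> (d \<otimes> (x \<otimes> d')) x)" using T2 by (intro sum.cong) auto
  also have "\<dots> = (\<Sum>x\<in>X. \<Sum>d'\<in>D. \<Sum>d\<in>D. ker \<mu> (d \<otimes> (x \<otimes> d')) x)"
   by (simp only: sum.swap[of _ D X])
  also have "\<dots> = (\<Sum>x\<in>X. \<mu>\<^sup>2 * ker \<mu> x x)"
  proof (rule sum.cong[OF refl])
   fix x assume x: "x \<in> X"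
   have "(\<Sum>d'\<in>D. \<Sum>d\<in>D. ker \<mu> (d \<otimes> (x \<otimes> d')) x) = (\<Sum>d'\<in>D. \<mu> * ker \<mu> (x \<otimes> d') x)"
    using eigE[OF kerE] x DX by (intro sum.cong) (auto simp: X_def)
   then show "(\<Sum>d'\<in>D. \<Sum>d\<in>D. ker \<mu> (d \<otimes> (x \<otimes> d')) x) = \<mu>\<^sup>2 * ker \<mu> x x"
    using right[OF kerE x] by (simp add: sum_distrib_left[symmetric] power2_eq_square)
  qed
  also have "\<dots> = \<mu>\<^sup>2 * of_nat (m \<mu>)"
   using tr0 ker_diag by (simp add: sum_distrib_left[symmetric] n_def)
  finally show ?thesis .
 qed
 have T1_le: "\<bar>T1 \<mu>\<bar> \<le> int (m \<mu>)" for \<mu>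
 proof -
  have "\<bar>T1 \<mu>\<bar> \<le> (\<Sum>b\<in>Bm \<mu>. \<bar>\<epsilon> b\<bar>)" unfolding T1_def by (rule sum_abs)
  also have "\<dots> = (\<Sum>b\<in>Bm \<mu>. 1)" using eps by (intro sum.cong) (fastforce simp: Bm_def)+
  finally show ?thesis by (simp add: m_def)
 qed
 have nonzero: "\<exists>x\<in>X. b x \<noteq> 0" if "b \<in> B" for b
 proof (rule ccontr)
  assume "\<not> (\<exists>x\<in>X. b x \<noteq> 0)"
  then have "(\<Sum>x\<in>X. b x * cnj (b x)) = 0" by simp
  then show False using norm_b[OF that] by simp
 qed
 have integral: "\<exists>M. \<mu> = of_int M" if mu: "\<mu> \<in> lam ` B" for \<mu>
 proof -
  obtain b where b: "b \<in> B" "\<mu> = lam b" using mu by auto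
  then have "b \<in> Bm \<mu>" by (simp add: Bm_def)
  then have m0: "m \<mu> \<noteq> 0" using finBm by (auto simp: m_def)
  obtain x0 where x0: "x0 \<in> X" "b x0 \<noteq> 0" using nonzero[OF b(1)] by auto
  have "\<mu> = of_nat q * of_int (T1 \<mu>) / of_nat (m \<mu>)" using rel1[of \<mu>] m0 by (simp add: field_simps)
  then have rat: "\<mu> \<in> \<rat>" by (metis Rats_divide Rats_mult Rats_of_int Rats_of_nat)
  have eig: "(\<Sum>y\<in>X. of_int (if y \<otimes> inv x \<in> D then 1 else 0) * b y) = \<mu> * b x" if x: "x \<in> X" for x
  proof -
   have "(\<Sum>y\<in>X. of_int (if y \<otimes> inv x \<in> D then 1 else 0) * b y)
     = (\<Sum>y\<in>X. of_int (if (y \<otimes> x) \<otimes> inv x \<in> D then 1 else 0) * b (y \<otimes> x))"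
    using x by (intro sum.reindex_bij_betw[symmetric]) (auto simp: X_def bij_right_mult)
   also have "\<dots> = (\<Sum>y\<in>X. if y \<in> D then b (y \<otimes> x) else 0)"
    using x by (intro sum.cong) (auto simp: X_def m_assoc)
   also have "\<dots> = (\<Sum>y\<in>D. b (y \<otimes> x))"
    using DX by (simp add: sum.inter_restrict[OF finX, symmetric] Int_absorb1 subset_eq)
   also have "\<dots> = \<mu> * b x" using b x BmE by (intro eigE) (auto simp: Bm_def)
   finally show ?thesis .
  qed
  have "\<mu> \<in> \<int>"
   by (rule rational_eigenvalue_in_Ints[where X = X and f = b and a = "\<lambda>x y. if y \<otimes> inv x \<in> D then 1 else 0",
      OF finX x0 eig rat])
  then show ?thesis by (auto elim: Ints_cases)
 qed
 \<comment> \<open>On an eigenspace where the trace of \<open>t\<close> is extremal, every element of the class acts as a sign.\<close>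
 have sign: "f (d \<otimes> x) = of_int c * f x"
  if c: "\<And>b. b \<in> Bm \<mu> \<Longrightarrow> \<epsilon> b = c" and f: "f \<in> E \<mu>" and d: "d \<in> D" and x: "x \<in> X" for c f d x \<mu>
 proof -
  have T: "f (t \<otimes> x) = of_int c * f x" if f: "f \<in> E \<mu>" and x: "x \<in> X" for f x
  proof -
   have k: "ker \<mu> (t \<otimes> x) y = of_int c * ker \<mu> x y" for y
    unfolding ker_def sum_distrib_left
    using c x by (intro sum.cong) (auto simp: Bm_def Lb)
   show ?thesis using expand[OF f, of "t \<otimes> x"] expand[OF f x] x tX
    by (simp add: X_def k sum_distrib_left algebra_simps)
  qed
  obtain g where g: "g \<in> X" "d = g \<otimes> t \<otimes> inv g" using Dform[OF d] by blast
  have "f (d \<otimes> x) = f (g \<otimes> (t \<otimes> (inv g \<otimes> x)))" using g x t by (simp add: X_def m_assoc)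
  also have "\<dots> = of_int c * f (g \<otimes> (inv g \<otimes> x))"
   using T[OF E_left[OF f g(1)], of "inv g \<otimes> x"] g x tX by (simp add: X_def)
  also have "\<dots> = of_int c * f x" using g x by (simp add: X_def)
  finally show ?thesis .
 qed
 have extremal: "\<epsilon> b = c" if c: "c = 1 \<or> c = -1" "T1 \<mu> = c * int (m \<mu>)" and b: "b \<in> Bm \<mu>" for b c \<mu>
 proof (rule ccontr)
  assume ne: "\<epsilon> b \<noteq> c"
  have e: "\<epsilon> b = 1 \<or> \<epsilon> b = -1" if "b \<in> Bm \<mu>" for b using eps that by (simp add: Bm_def)
  have "(\<Sum>b\<in>Bm \<mu>. 1 - c * \<epsilon> b) > 0"
  proof (rule sum_pos2[OF finBm b])
   show "1 - c * \<epsilon> b > 0" using c(1) e[OF b] ne by auto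
   show "1 - c * \<epsilon> b' \<ge> 0" if "b' \<in> Bm \<mu>" for b' using c(1) e[OF that] by auto
  qed
  then have "int (m \<mu>) - c * T1 \<mu> > 0" by (simp add: sum_subtractf sum_distrib_left[symmetric] m_def T1_def)
  then show False using c by auto
 qed
 have gen_induct: "P x" if x: "x \<in> X" and "P \<one>" and step: "\<And>d y. d \<in> D \<Longrightarrow> y \<in> X \<Longrightarrow> P y \<Longrightarrow> P (d \<otimes> y)" for P x
 proof -
  have G: "\<forall>y\<in>X. P y \<longrightarrow> P (x \<otimes> y)" if "x \<in> generate G D" for x
   using that
  proof (induction rule: generate.induct)
   case one
   then show ?case by (simp add: X_def)
  next
   case (incl h)
   then show ?case using step by blast
  next
   case (inv h)
   then have "inv h = h" using involution_inv DX DD by (simp add: X_def)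
   then show ?case using step inv by auto
  next
   case (eng h1 h2)
   have "h1 \<in> X" "h2 \<in> X" using eng(1,2) gen by (auto simp: X_def)
   then show ?case using eng.IH by (auto simp: X_def m_assoc)
  qed
  have "P (x \<otimes> \<one>)" using G[of x] x \<open>P \<one>\<close> gen X1 unfolding X_def by blast
  then show ?thesis using x by (simp add: X_def)
 qed
 have oneE: "(\<lambda>x. if x \<in> X then 1 else 0) \<in> E (of_nat q)"
  using DX by (auto simp: E_def supported_on_def left_op_def X_def fun_eq_iff cardD q_def)
 have q0: "q \<noteq> 0" using p by (auto simp: q_def)
 have m_q: "m (of_nat q) = 1" "T1 (of_nat q) = 1"
 proof -
  have "of_nat q * of_int (T1 (of_nat q)) = (of_nat q * of_nat (m (of_nat q)) :: complex)" by (rule rel1)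
  then have "of_int (T1 (of_nat q)) = (of_int (1 * int (m (of_nat q))) :: complex)" using q0 by simp
  then have S: "T1 (of_nat q) = 1 * int (m (of_nat q))" by (simp only: of_int_eq_iff)
  have const: "f x = f \<one>" if f: "f \<in> E (of_nat q)" and x: "x \<in> X" for f x
  proof (rule gen_induct[OF x])
   fix d y assume "d \<in> D" "y \<in> X" "f y = f \<one>"
   then show "f (d \<otimes> y) = f \<one>" using sign[OF extremal[OF _ S] f, of d y] by simp
  qed simp
  have "ker (of_nat q) \<one> y = ker (of_nat q) \<one> \<one>" if y: "y \<in> X" for y
   using const[OF kerE[of _ y] y] ker_diag[OF y, of "of_nat q"] by simp
  then have "(\<Sum>y\<in>X. (if y \<in> X then 1 else 0) * ker (of_nat q) \<one> y) = of_nat n * ker (of_nat q) \<one> \<one>"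
   by (simp add: n_def)
  then have "1 = of_nat n * ker (of_nat q) \<one> \<one>"
   using expand[OF oneE X1] X1 by simp
  then show "m (of_nat q) = 1" using tr0[of "of_nat q"] by (metis of_nat_eq_1_iff)
  then show "T1 (of_nat q) = 1" using S by simp
 qed
 have q_in: "of_nat q \<in> lam ` B"
 proof -
  have "Bm (of_nat q) \<noteq> {}" using m_q(1) by (auto simp: m_def)
  then show ?thesis by (force simp: Bm_def)
 qed
 \<comment> \<open>Left translation by \<open>t\<close> moves every element, so it has trace \<open>0\<close>.\<close>
 have total: "(\<Sum>\<mu>\<in>lam ` B. T1 \<mu>) = 0"
 proof -
  have "of_int (\<Sum>b\<in>B. \<epsilon> b) = (\<Sum>b\<in>B. \<Sum>x\<in>X. of_int (\<epsilon> b) * (b x * cnj (b x)))"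
   using norm_b by (simp add: sum_distrib_left[symmetric])
  also have "\<dots> = (\<Sum>b\<in>B. \<Sum>x\<in>X. b (t \<otimes> x) * cnj (b x))" by (intro sum.cong refl) (simp add: Lb)
  also have "\<dots> = (\<Sum>x\<in>X. \<Sum>b\<in>B. b (t \<otimes> x) * cnj (b x))" by (rule sum.swap)
  also have "\<dots> = (\<Sum>x\<in>X. 0)"
  proof (rule sum.cong[OF refl])
   fix x assume x: "x \<in> X"
   have "t \<otimes> x \<noteq> x" using x t by (simp add: X_def)
   then show "(\<Sum>b\<in>B. b (t \<otimes> x) * cnj (b x)) = 0" using complete[of "t \<otimes> x" x] x tX by (simp add: X_def)
  qed
  finally have "(of_int (\<Sum>b\<in>B. \<epsilon> b) :: complex) = 0" by simp
  then have "(\<Sum>b\<in>B. \<epsilon> b) = 0" by (simp only: of_int_eq_0_iff)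
  then show ?thesis
   unfolding T1_def Bm_def using sum.image_gen[OF finB, of \<epsilon> lam] by simp
 qed
 have "\<exists>\<mu>\<in>lam ` B. \<mu> = - of_nat q"
 proof (rule ccontr)
  assume neg: "\<not> (\<exists>\<mu>\<in>lam ` B. \<mu> = - of_nat q)"
  have "int p dvd T1 \<mu>" if mu: "\<mu> \<in> lam ` B - {of_nat q}" for \<mu>
  proof -
   obtain M where M: "\<mu> = of_int M" using integral mu by auto
   have r1: "int p ^ k * T1 \<mu> = M * int (m \<mu>)"
   proof -
    have "of_int (int p ^ k * T1 \<mu>) = (of_int (M * int (m \<mu>)) :: complex)"
     using rel1[of \<mu>] by (simp add: M q_def)
    then show ?thesis by (simp only: of_int_eq_iff)
   qed
   have r2: "(int p ^ k)\<^sup>2 * T2 \<mu> = M\<^sup>2 * int (m \<mu>)"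
   proof -
    have "of_int ((int p ^ k)\<^sup>2 * T2 \<mu>) = (of_int (M\<^sup>2 * int (m \<mu>)) :: complex)"
     using rel2[of \<mu>] by (simp add: M q_def)
    then show ?thesis by (simp only: of_int_eq_iff)
   qed
   show ?thesis
   proof (cases "int p ^ k dvd M")
    case False
    then show ?thesis using prime_dvd_trace[OF _ r1 r2] p by simp
   next
    case True
    then obtain c where c: "M = int p ^ k * c" by (auto simp: dvd_def)
    have "int p ^ k * T1 \<mu> = int p ^ k * (c * int (m \<mu>))" using r1 c by (simp add: algebra_simps)
    then have S1c: "T1 \<mu> = c * int (m \<mu>)" using q0 by (metis mult_left_cancel of_nat_eq_0_iff of_nat_power q_def)
    have m0: "m \<mu> > 0" using mu finBm by (auto simp: m_def card_gt_0_iff Bm_def)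
    have "\<bar>c\<bar> * int (m \<mu>) \<le> 1 * int (m \<mu>)" using T1_le[of \<mu>] S1c by (simp add: abs_mult)
    then have "\<bar>c\<bar> \<le> 1" using m0 by simp
    moreover have "c \<noteq> 1" using mu M c by (auto simp: q_def)
    moreover have "c \<noteq> -1" using neg mu M c by (auto simp: q_def)
    ultimately have "c = 0" by linarith
    then show ?thesis using S1c by simp
   qed
  qed
  then have "int p dvd (\<Sum>\<mu>\<in>lam ` B - {of_nat q}. T1 \<mu>)" by (rule dvd_sum)
  moreover have "(\<Sum>\<mu>\<in>lam ` B. T1 \<mu>) = 1 + (\<Sum>\<mu>\<in>lam ` B - {of_nat q}. T1 \<mu>)"
   using sum.remove[OF _ q_in, of T1] finB m_q(2) by simp
  ultimately have "int p dvd 1" using total by (metis add_eq_0_iff dvd_minus_iff)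
  then show False using p by (simp add: prime_nat_iff)
 qed
 then obtain f where f: "f \<in> B" "lam f = - of_nat q" by auto
 then have fE: "f \<in> E (- of_nat q)" using BmE by (auto simp: Bm_def)
 have "of_nat q * of_int (T1 (- of_nat q)) = (- of_nat q * of_nat (m (- of_nat q)) :: complex)" by (rule rel1)
 then have "of_nat q * of_int (T1 (- of_nat q)) = (of_nat q * of_int (-1 * int (m (- of_nat q))) :: complex)" by simp
 then have "of_int (T1 (- of_nat q)) = (of_int (-1 * int (m (- of_nat q))) :: complex)" using q0 by (metis mult_left_cancel of_nat_eq_0_iff)
 then have Sneg: "T1 (- of_nat q) = -1 * int (m (- of_nat q))" by (simp only: of_int_eq_iff)
 have fd: "f (d \<otimes> x) = - f x" if "d \<in> D" "x \<in> X" for d x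
  using sign[OF extremal[OF _ Sneg] fE that] by simp
 have sg: "\<exists>s. s * s = 1 \<and> (\<forall>y\<in>X. f (x \<otimes> y) = s * f y)" if "x \<in> X" for x
 proof (rule gen_induct[OF that])
  show "\<exists>s. s * s = 1 \<and> (\<forall>y\<in>X. f (\<one> \<otimes> y) = s * f y)" by (intro exI[of _ 1]) (simp add: X_def)
 next
  fix d x assume d: "d \<in> D" and x: "x \<in> X" and "\<exists>s. s * s = 1 \<and> (\<forall>y\<in>X. f (x \<otimes> y) = s * f y)"
  then obtain s where s: "s * s = 1" "\<forall>y\<in>X. f (x \<otimes> y) = s * f y" by blast
  then show "\<exists>s. s * s = 1 \<and> (\<forall>y\<in>X. f ((d \<otimes> x) \<otimes> y) = s * f y)"
   using d x DX fd by (intro exI[of _ "- s"]) (auto simp: X_def m_assoc)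
 qed
 have inverse: "f (inv x \<otimes> y) = s * f y" if "x \<in> X" "s * s = 1" "\<forall>y\<in>X. f (x \<otimes> y) = s * f y" "y \<in> X" for x y s
 proof -
  have "x \<otimes> (inv x \<otimes> y) = y" using that by (simp add: X_def m_assoc[symmetric])
  then have "f y = s * f (inv x \<otimes> y)" using that(3)[rule_format, of "inv x \<otimes> y"] that by (simp add: X_def)
  then show ?thesis using that(2) by (simp add: mult.assoc[symmetric])
 qed
 have commutator: "f (x \<otimes> y \<otimes> inv x \<otimes> inv y \<otimes> z) = f z" if xyz: "x \<in> X" "y \<in> X" "z \<in> X" for x y z
 proof -
  obtain s where s: "s * s = 1" "\<forall>y\<in>X. f (x \<otimes> y) = s * f y" using sg xyz by blast
  obtain u where u: "u * u = 1" "\<forall>z\<in>X. f (y \<otimes> z) = u * f z" using sg xyz by blast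
  have "f (x \<otimes> y \<otimes> inv x \<otimes> inv y \<otimes> z) = f (x \<otimes> (y \<otimes> (inv x \<otimes> (inv y \<otimes> z))))" using xyz by (simp add: X_def m_assoc)
  also have "\<dots> = s * (u * (s * (u * f z)))"
   using s(2) u(2) inverse[OF xyz(1) s] inverse[OF xyz(2) u] xyz by (simp add: X_def)
  also have "\<dots> = (s * s) * (u * u) * f z" by (simp add: algebra_simps)
  finally show ?thesis using s u by simp
 qed
 have "\<forall>z\<in>X. f (h \<otimes> z) = f z" if "h \<in> derived G (carrier G)" for h
  using that unfolding derived_def
 proof (induction rule: generate.induct)
  case (incl h)
  then show ?case using commutator by (auto simp: X_def)
 next
  case (inv h)
  then have h: "h \<in> X" "\<forall>z\<in>X. f (h \<otimes> z) = 1 * f z" using commutator by (auto simp: X_def)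
  show ?case using inverse[OF h(1) _ h(2)] by simp
 next
  case (eng h1 h2)
  then have "h1 \<in> X" "h2 \<in> X" using derived_in_carrier[of "carrier G"] by (auto simp: X_def derived_def)
  then show ?case using eng.IH by (simp add: X_def m_assoc)
 qed (simp add: X_def)
 moreover obtain x0 where x0: "x0 \<in> X" "f x0 \<noteq> 0" using nonzero[OF f(1)] by auto
 moreover have "f (t \<otimes> x0) \<noteq> f x0"
 proof
  assume "f (t \<otimes> x0) = f x0"
  then have "f x0 + f x0 = 0" using fd[OF tD x0(1)] by (metis add.right_inverse)
  then show False using x0 by simp
 qed
 ultimately show ?thesis using t(1) by blast
qed

section \<open>Groups of order $2^a p^b$\<close>

lemma (in group) power_of_prime_order:
 assumes "finite (carrier G)" "x \<in> carrier G" "prime p" "p dvd ord x"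
 obtains n :: nat where "x [^] n \<noteq> \<one>" "(x [^] n) [^] p = \<one>"
proof -
 have pos: "ord x \<ge> 1" using ord_ge_1[OF assms(1,2)] .
 obtain n where n: "ord x = p * n" using assms(4) by (auto simp: dvd_def)
 have "x [^] n \<noteq> \<one>"
 proof
  assume "x [^] n = \<one>"
  then have "ord x dvd n" using assms(2) pow_eq_id by blast
  moreover have "p > 1" "n > 0" using prime_gt_1_nat[OF assms(3)] n pos by (auto intro: gr0I)
  ultimately have "p * n \<le> n" "p > 1" "n > 0" using n by (auto dest: dvd_imp_le)
  then show False by simp
 qed
 moreover have "(x [^] n) [^] p = \<one>"
  using assms(2) n by (metis mult.commute nat_pow_pow pow_ord_eq_1)
 ultimately show ?thesis using that by blast
qed

lemma (in group) nontrivial_power_of_prime_order: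
 assumes "finite (carrier G)" "x \<in> carrier G" "x \<noteq> \<one>"
 obtains n p :: nat where "prime p" "x [^] n \<noteq> \<one>" "(x [^] n) [^] p = \<one>"
proof -
 have "ord x \<noteq> 1" using assms ord_eq_1 by auto
 then obtain p where "prime p" "p dvd ord x" using prime_factor_nat by blast
 then show ?thesis using power_of_prime_order[OF assms(1,2)] that by metis
qed

lemma (in group) cauchy_prime_order:
 assumes fin: "finite (carrier G)" and p: "prime p" "p dvd order G"
 obtains x where "x \<in> carrier G" "x \<noteq> \<one>" "x [^] p = \<one>"
proof -
 obtain m where "order G = p ^ 1 * m" using p by (auto simp: dvd_def)
 from sylow_thm[OF p(1) is_group this fin] obtain H where H: "subgroup H G" "card H = p" by auto
 have "card H > 1" using H p prime_gt_1_nat by simp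
 then obtain x where x: "x \<in> H" "x \<noteq> \<one>"
  by (metis card_le_Suc0_iff_eq card.infinite less_nat_zero_code not_less One_nat_def subgroup.one_closed[OF H(1)])
 interpret H: group "G\<lparr>carrier := H\<rparr>" using subgroup_imp_group[OF H(1)] .
 have "x [^]\<^bsub>G\<lparr>carrier := H\<rparr>\<^esub> order (G\<lparr>carrier := H\<rparr>) = \<one>\<^bsub>G\<lparr>carrier := H\<rparr>\<^esub>"
  by (rule H.pow_order_eq_1) (simp add: x)
 then have "x [^] p = \<one>" by (simp add: Coset.order_def H(2) nat_pow_consistent[symmetric])
 then show ?thesis using that x subgroup.subset[OF H(1)] by blast
qed

text \<open>The orbits of a \<open>p\<close>-group have \<open>p\<close>-power length, so modulo \<open>p\<close> only the fixed points count.\<close>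

lemma (in group_action) card_fixed_points_cong:
 assumes fin: "finite E" and p: "prime p" and ord: "order G = p ^ k"
 shows "[card E = card {x\<in>E. \<forall>g\<in>carrier G. \<phi> g x = x}] (mod p)"
proof -
 interpret group G using group_hom group_hom.axioms(1) by auto
 define F where "F = {x\<in>E. \<forall>g\<in>carrier G. \<phi> g x = x}"
 have sub: "orbit G \<phi> x \<subseteq> E" if "x \<in> E" for x using that element_image by (auto simp: orbit_def)
 have finO: "finite (orbits G E \<phi>)" using fin by (auto simp: orbits_def)
 have single: "orbit G \<phi> x = {x}" if "x \<in> F" for x
  using that orbit_refl[of x] by (auto simp: orbit_def F_def)
 define O1 where "O1 = {orb \<in> orbits G E \<phi>. card orb = 1}"
 have O1: "O1 = (\<lambda>x. {x}) ` F"
 proof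
  show "O1 \<subseteq> (\<lambda>x. {x}) ` F"
  proof
   fix orb assume "orb \<in> O1"
   then obtain x where x: "x \<in> E" "orb = orbit G \<phi> x" "card orb = 1" by (auto simp: O1_def orbits_def)
   then have "orb = {x}" using orbit_refl[of x] by (auto simp: card_1_singleton_iff)
   then have "x \<in> F" using x by (auto simp: F_def orbit_def)
   then show "orb \<in> (\<lambda>x. {x}) ` F" using \<open>orb = {x}\<close> by auto
  qed
  show "(\<lambda>x. {x}) ` F \<subseteq> O1" using single by (auto simp: O1_def orbits_def F_def)
 qed
 have dvd: "p dvd card orb" if orb: "orb \<in> orbits G E \<phi> - O1" for orb
 proof -
  obtain x where x: "x \<in> E" "orb = orbit G \<phi> x" using orb by (auto simp: orbits_def)
  then have "card orb dvd p ^ k" using orbit_stabilizer_theorem[of x] ord by (metis dvd_triv_left)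
  then obtain j where "card orb = p ^ j" using p by (auto simp: divides_primepow_nat)
  moreover have "card orb \<noteq> 1" using orb by (auto simp: O1_def)
  ultimately show ?thesis by (cases j) auto
 qed
 have "card E = (\<Sum>orb\<in>orbits G E \<phi>. card orb)" using disjoint_sum[OF fin, of "\<lambda>_. 1::nat"] by simp
 also have "\<dots> = (\<Sum>orb\<in>O1. card orb) + (\<Sum>orb\<in>orbits G E \<phi> - O1. card orb)"
  using finO by (subst sum.subset_diff[of O1]) (auto simp: O1_def)
 also have "(\<Sum>orb\<in>O1. card orb) = card O1" by (simp add: O1_def)
 also have "card O1 = card F" unfolding O1 by (rule card_image) simp
 finally have "card E = card F + (\<Sum>orb\<in>orbits G E \<phi> - O1. card orb)" .
 moreover have "p dvd (\<Sum>orb\<in>orbits G E \<phi> - O1. card orb)" using dvd by (rule dvd_sum)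
 ultimately show ?thesis unfolding F_def[symmetric] by (simp add: cong_def mod_add_eq[symmetric] flip: mod_add_right_eq)
qed

lemma (in group) p_group_center_nontrivial:
 assumes p: "prime p" and ord: "order G = p ^ k" and nt: "carrier G \<noteq> {\<one>}"
 obtains z where "z \<in> carrier G" "z \<noteq> \<one>" "\<And>g. g \<in> carrier G \<Longrightarrow> g \<otimes> z = z \<otimes> g"
proof -
 have fin: "finite (carrier G)" using p ord by (simp add: order_gt_0_iff_finite[symmetric] prime_gt_0_nat)
 interpret A: group_action G "carrier G" "\<lambda>g. (\<lambda>h \<in> carrier G. g \<otimes> h \<otimes> (inv g))"
  by (rule action_by_conjugation)
 define F where "F = {x\<in>carrier G. \<forall>g\<in>carrier G. g \<otimes> x \<otimes> inv g = x}"
 have "{x \<in> carrier G. \<forall>g\<in>carrier G. (\<lambda>h\<in>carrier G. g \<otimes> h \<otimes> inv g) x = x} = F"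
  by (auto simp: F_def)
 then have c: "[card (carrier G) = card F] (mod p)"
  using A.card_fixed_points_cong[OF fin p ord] by simp
 have "k \<noteq> 0"
 proof
  assume "k = 0"
  then have "order G = 1" using ord by simp
  then show False using nt order_one_triv_iff by blast
 qed
 then have "p dvd card (carrier G)" using ord by (simp add: Coset.order_def)
 then have "p dvd card F" using c by (simp add: cong_dvd_iff)
 moreover have "\<one> \<in> F" by (simp add: F_def)
 moreover have "finite F" using fin by (simp add: F_def)
 ultimately have "card F > 1" using p by (metis card_gt_0_iff dvd_imp_le empty_iff less_le_trans prime_gt_1_nat)
 then obtain z where z: "z \<in> F" "z \<noteq> \<one>"
  by (metis \<open>\<one> \<in> F\<close> \<open>finite F\<close> card_le_Suc0_iff_eq not_less One_nat_def)
 have "g \<otimes> z = z \<otimes> g" if g: "g \<in> carrier G" for g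
 proof -
  have "z \<in> carrier G" "g \<otimes> z \<otimes> inv g = z" using z(1) g by (auto simp: F_def)
  then show ?thesis using g by (metis inv_solve_right m_closed)
 qed
 then show ?thesis using that z by (auto simp: F_def)
qed

lemma dvd_two_power_times_prime_power:
 fixes p n :: nat
 assumes "prime p" "n dvd 2 ^ a * p ^ b"
 shows "\<exists>a' b'. n = 2 ^ a' * p ^ b'"
proof -
 obtain x y where xy: "n = x * y" "x dvd 2 ^ a" "y dvd p ^ b" using division_decomp[OF assms(2)] by blast
 then show ?thesis using assms(1) by (metis divides_primepow_nat two_is_prime_nat)
qed

lemma (in group) commute_if_derived_trivial:
 assumes "derived G A = {\<one>}" "A \<subseteq> carrier G" "x \<in> A" "y \<in> A"
 shows "x \<otimes> y = y \<otimes> x"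
proof -
 have xy: "x \<in> carrier G" "y \<in> carrier G" using assms by auto
 have "x \<otimes> y \<otimes> inv x \<otimes> inv y \<in> derived G A"
  unfolding derived_def using assms by (intro generate.incl) blast
 then have "x \<otimes> y \<otimes> inv (y \<otimes> x) = \<one>" using assms(1) xy by (simp add: inv_mult_group m_assoc)
 then show ?thesis using xy by (metis inv_inv inv_closed inv_equality m_closed)
qed

text \<open>A nontrivial centre is the whole of a simple group. If \<open>a > 0\<close>, an involution in the centre of a Sylow
 2-subgroup commutes with that subgroup, so that its class has \<open>p\<close>-power size; by simplicity the class generates,
 and the derived subgroup, being proper, is trivial.\<close>

lemma (in group) two_p_simple_group_abelian:
 fixes p :: nat
 assumes simple: "\<And>H. H \<lhd> G \<Longrightarrow> H = carrier G \<or> H = {\<one>}"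
  and p: "prime p" "p \<noteq> 2" and ord: "order G = 2 ^ a * p ^ b"
 shows "comm_group G"
proof -
 have fin: "finite (carrier G)" using p ord by (simp add: order_gt_0_iff_finite[symmetric] prime_gt_0_nat)
 have comm_if_center: "comm_group G"
  if z: "z \<in> carrier G" "z \<noteq> \<one>" "\<And>g. g \<in> carrier G \<Longrightarrow> g \<otimes> z = z \<otimes> g" for z
 proof -
  have "generate G {z} \<lhd> G"
   by (rule normal_generateI) (use z in \<open>auto simp: m_assoc\<close>)
  moreover have "z \<in> generate G {z}" by (rule generate.incl) simp
  ultimately have gen: "carrier G = {z [^] n | n. n \<in> (UNIV :: nat set)}"
   using simple z(2) generate_pow_on_finite_carrier[OF fin z(1)] by blast
  have "x \<otimes> y = y \<otimes> x" if "x \<in> carrier G" "y \<in> carrier G" for x y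
  proof -
   obtain i j :: nat where "x = z [^] i" "y = z [^] j" using \<open>x \<in> carrier G\<close> \<open>y \<in> carrier G\<close> unfolding gen by blast
   then show ?thesis using nat_pow_comm[OF z(1)] by simp
  qed
  then show ?thesis by (rule group_comm_groupI)
 qed
 show ?thesis
 proof (cases "a = 0")
  case True
  show ?thesis
  proof (cases "carrier G = {\<one>}")
   case True
   then show ?thesis by (intro group_comm_groupI) auto
  next
   case False
   from p_group_center_nontrivial[OF p(1), of b] this ord \<open>a = 0\<close> show ?thesis
    using comm_if_center by (metis mult_1 power_0)
  qed
 next
  case a: False
  from sylow_thm[OF two_is_prime_nat is_group ord fin]
  obtain H where H: "subgroup H G" "card H = 2 ^ a" by auto
  interpret H: group "G\<lparr>carrier := H\<rparr>" using subgroup_imp_group[OF H(1)] .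
  have ordH: "order (G\<lparr>carrier := H\<rparr>) = 2 ^ a" by (simp add: Coset.order_def H)
  have HG: "H \<subseteq> carrier G" using subgroup.subset[OF H(1)] .
  have "H \<noteq> {\<one>}" using H(2) a by (metis card.empty card_insert_disjoint empty_iff finite.emptyI One_nat_def nat_power_eq_Suc_0_iff numeral_eq_one_iff semiring_norm(85))
  then obtain z where z: "z \<in> H" "z \<noteq> \<one>" "\<And>g. g \<in> H \<Longrightarrow> g \<otimes> z = z \<otimes> g"
   using H.p_group_center_nontrivial[OF two_is_prime_nat ordH] by auto
  obtain n q where q: "prime q" "z [^] (n::nat) \<noteq> \<one>" "(z [^] n) [^] (q::nat) = \<one>"
   using nontrivial_power_of_prime_order[OF fin, of z] z(1,2) HG by (metis subset_iff)
  define t where "t = z [^] n"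
  have tH: "t \<in> H" unfolding t_def
   using H.nat_pow_closed[of z n] z(1) by (simp add: nat_pow_consistent[symmetric])
  then have tG: "t \<in> carrier G" using HG by auto
  have "t [^] (2 ^ a :: nat) = \<one>"
   using H.pow_order_eq_1[of t] tH ordH by (simp add: nat_pow_consistent[symmetric])
  then have "ord t dvd 2 ^ a" using tG pow_eq_id by blast
  moreover have "ord t dvd q" using tG q(3) pow_eq_id by (simp add: t_def)
  moreover have "ord t \<noteq> 1" using q(2) tG ord_eq_1 by (simp add: t_def)
  ultimately have "ord t = q" "q dvd 2 ^ a" using q(1) by (auto simp: prime_nat_iff)
  then have "q = 2" using q(1) by (metis prime_dvd_power primes_dvd_imp_eq two_is_prime_nat)
  then have tt: "t \<otimes> t = \<one>" using q(3) tG by (simp add: t_def[symmetric] numeral_2_eq_2)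
  have t1: "t \<noteq> \<one>" using q by (simp add: t_def)
  have t_comm: "g \<otimes> t = t \<otimes> g" if "g \<in> H" for g
  proof -
   have "z [^] n \<otimes> g = g \<otimes> z [^] n"
    using z HG that by (intro group_commutes_pow) auto
   then show ?thesis by (simp add: t_def)
  qed
  interpret A: group_action G "carrier G" "\<lambda>g. (\<lambda>h \<in> carrier G. g \<otimes> h \<otimes> (inv g))"
   by (rule action_by_conjugation)
  let ?S = "stabilizer G (\<lambda>g. (\<lambda>h \<in> carrier G. g \<otimes> h \<otimes> (inv g))) t"
  have orb: "orbit G (\<lambda>g. (\<lambda>h \<in> carrier G. g \<otimes> h \<otimes> (inv g))) t = conj_class G t"
   using tG by (auto simp: orbit_def conj_class_def)
  have cS: "card (conj_class G t) * card ?S = 2 ^ a * p ^ b"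
   using A.orbit_stabilizer_theorem[OF tG] by (simp add: orb ord)
  have subS: "subgroup ?S G" by (rule A.stabilizer_subgroup[OF tG])
  have "H \<subseteq> ?S"
  proof
   fix g assume g: "g \<in> H"
   then have gG: "g \<in> carrier G" using HG by auto
   have "g \<otimes> t \<otimes> inv g = t" using t_comm[OF g] gG tG by (simp add: m_assoc)
   then show "g \<in> ?S" using gG tG by (simp add: stabilizer_def)
  qed
  then have "subgroup H (G\<lparr>carrier := ?S\<rparr>)" using H(1) subS subgroup_incl by blast
  then have "card H dvd order (G\<lparr>carrier := ?S\<rparr>)"
   by (subst group.lagrange[OF subgroup_imp_group[OF subS], symmetric]) (assumption, rule dvd_triv_right)
  then obtain s where s: "card ?S = 2 ^ a * s" using H(2) by (auto simp: Coset.order_def dvd_def)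
  then have "card (conj_class G t) * s = p ^ b" using cS by simp
  then have "card (conj_class G t) dvd p ^ b" by (metis dvd_triv_left)
  then obtain k where k: "card (conj_class G t) = p ^ k" using p(1) by (auto simp: divides_primepow_nat)
  have gen: "generate G (conj_class G t) = carrier G"
  proof -
   have "generate G (conj_class G t) \<lhd> G"
    using conj_class_carrier[OF tG] conj_class_closed[OF tG] by (intro normal_generateI) auto
   moreover have "t \<in> generate G (conj_class G t)"
    using tG by (intro generate.incl) (auto simp: conj_class_def intro!: exI[of _ \<one>])
   ultimately show ?thesis using simple t1 by blast
  qed
  from prime_power_involution_class_not_perfect[OF fin tG tt t1 p(1) k gen]
  have "derived G (carrier G) \<noteq> carrier G" .
  then have "derived G (carrier G) = {\<one>}" using simple[OF derived_is_normal[OF normal_self]] by blast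
  then show ?thesis using commute_if_derived_trivial[of "carrier G"] by (intro group_comm_groupI) blast
 qed
qed

text \<open>A maximal proper normal subgroup has a simple quotient, which is abelian; hence the derived
 subgroup is proper.\<close>

lemma (in group) two_p_group_not_perfect:
 fixes p :: nat
 assumes p: "prime p" "p \<noteq> 2" and ord: "order G = 2 ^ a * p ^ b" and nt: "carrier G \<noteq> {\<one>}"
 shows "derived G (carrier G) \<noteq> carrier G"
proof -
 have fin: "finite (carrier G)" using p ord by (simp add: order_gt_0_iff_finite[symmetric] prime_gt_0_nat)
 define \<N> where "\<N> = {N. N \<lhd> G \<and> N \<noteq> carrier G}"
 have "\<N> \<subseteq> Pow (carrier G)" by (auto simp: \<N>_def dest: normal_imp_subgroup subgroup.subset)
 then have "finite \<N>" using fin by (metis finite_Pow_iff finite_subset)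
 moreover have "{\<one>} \<in> \<N>" using nt one_is_normal by (auto simp: \<N>_def)
 ultimately obtain N where N: "N \<in> \<N>" and max: "\<And>M. M \<in> \<N> \<Longrightarrow> N \<subseteq> M \<Longrightarrow> M = N"
  using finite_has_maximal[of \<N>] by (metis empty_iff)
 interpret N: normal N G using N by (simp add: \<N>_def)
 interpret Q: group "G Mod N" by (rule N.factorgroup_is_group)
 have cardQ: "order (G Mod N) * card N = order G"
  using lagrange[OF N.subgroup_axioms] by (simp add: Coset.order_def FactGroup_def)
 then have "order (G Mod N) dvd 2 ^ a * p ^ b" using ord by (metis dvd_triv_left)
 then obtain a' b' where ordQ: "order (G Mod N) = 2 ^ a' * p ^ b'"
  using dvd_two_power_times_prime_power[OF p(1)] by blast
 have simple: "H = carrier (G Mod N) \<or> H = {\<one>\<^bsub>G Mod N\<^esub>}" if H: "H \<lhd> G Mod N" for H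
 proof -
  have HQ: "subgroup H (G Mod N)" using H by (rule normal_imp_subgroup)
  have U: "\<Union>H = {x \<in> carrier G. N #> x \<in> H}" by (rule N.factgroup_subgroup_union_char[OF HQ])
  have Hsub: "H \<subseteq> carrier (G Mod N)" using subgroup.subset[OF HQ] .
  have in_U: "N #> x \<in> H \<Longrightarrow> x \<in> carrier G \<Longrightarrow> x \<in> \<Union>H" for x using U by auto
  have "N \<in> H" using subgroup.one_closed[OF HQ] by simp
  then have NU: "N \<subseteq> \<Union>H" by auto
  have "\<Union>H \<lhd> G" by (rule N.factgroup_subgroup_union_normal[OF H])
  then have "\<Union>H \<in> \<N>" if "\<Union>H \<noteq> carrier G" using that unfolding \<N>_def by blast
  then consider "\<Union>H = carrier G" | "\<Union>H = N" using max[OF _ NU] by blast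
  then show ?thesis
  proof cases
   case 1
   have "carrier (G Mod N) \<subseteq> H"
   proof
    fix c assume "c \<in> carrier (G Mod N)"
    then obtain x where "x \<in> carrier G" "c = N #> x" by (auto simp: carrier_FactGroup)
    then show "c \<in> H" using 1 U by auto
   qed
   then show ?thesis using Hsub by blast
  next
   case 2
   have "c = N" if c: "c \<in> H" for c
   proof -
    obtain x where x: "x \<in> carrier G" "c = N #> x" using c Hsub unfolding carrier_FactGroup by blast
    then have "x \<in> N" using in_U c 2 by blast
    then show ?thesis using x N.subgroup_axioms coset_join2 by blast
   qed
   then have "H = {N}" using \<open>N \<in> H\<close> by blast
   then show ?thesis by simp
  qed
 qed
 have "comm_group (G Mod N)" by (rule Q.two_p_simple_group_abelian[OF simple p ordQ])
 then have "derived G (carrier G) \<subseteq> N" using derived_minimal[OF N.normal_axioms] by blast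
 moreover have "N \<noteq> carrier G" using N by (simp add: \<N>_def)
 ultimately show ?thesis using N.subset by blast
qed

text \<open>The form in which the solvability of groups of order \<open>2\<^sup>a p\<^sup>b\<close> is used: a minimal normal
 subgroup is abelian.\<close>

theorem (in group) two_p_group_abelian_normal_subgroup:
 fixes p :: nat
 assumes p: "prime p" "p \<noteq> 2" and ord: "order G = 2 ^ a * p ^ b" and nt: "carrier G \<noteq> {\<one>}"
 obtains A where "A \<lhd> G" "A \<noteq> {\<one>}" "\<And>x y. x \<in> A \<Longrightarrow> y \<in> A \<Longrightarrow> x \<otimes> y = y \<otimes> x"
proof -
 have fin: "finite (carrier G)" using p ord by (simp add: order_gt_0_iff_finite[symmetric] prime_gt_0_nat)
 define \<N> where "\<N> = {N. N \<lhd> G \<and> N \<noteq> {\<one>}}"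
 have "\<N> \<subseteq> Pow (carrier G)" by (auto simp: \<N>_def dest: normal_imp_subgroup subgroup.subset)
 then have "finite \<N>" using fin by (metis finite_Pow_iff finite_subset)
 moreover have "carrier G \<in> \<N>" using nt normal_self by (auto simp: \<N>_def)
 ultimately obtain A where A: "A \<in> \<N>" and min: "\<And>M. M \<in> \<N> \<Longrightarrow> M \<subseteq> A \<Longrightarrow> M = A"
  using finite_has_minimal[of \<N>] by (metis empty_iff)
 have An: "A \<lhd> G" and A1: "A \<noteq> {\<one>}" using A by (auto simp: \<N>_def)
 have As: "subgroup A G" using An by (rule normal_imp_subgroup)
 interpret A: group "G\<lparr>carrier := A\<rparr>" using subgroup_imp_group[OF As] .
 have "card A dvd 2 ^ a * p ^ b" using lagrange[OF As] ord by (metis dvd_triv_right)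
 then obtain a' b' where "card A = 2 ^ a' * p ^ b'"
  using dvd_two_power_times_prime_power[OF p(1)] by blast
 then have "order (G\<lparr>carrier := A\<rparr>) = 2 ^ a' * p ^ b'" by (simp add: Coset.order_def)
 from A.two_p_group_not_perfect[OF p this]
 have "derived (G\<lparr>carrier := A\<rparr>) A \<noteq> A" using A1 by simp
 then have ne: "derived G A \<noteq> A" using derived_consistent[OF _ As, of A] by simp
 have sub: "derived G A \<subseteq> A" using derived_incl[OF _ As, of A] by simp
 have "derived G A \<notin> \<N>" using min[OF _ sub] ne by blast
 then have D1: "derived G A = {\<one>}" using derived_is_normal[OF An] by (simp add: \<N>_def)
 then have "x \<otimes> y = y \<otimes> x" if "x \<in> A" "y \<in> A" for x y
  using commute_if_derived_trivial[of A] subgroup.subset[OF As] that by blast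
 then show ?thesis using that An A1 by blast
qed

section \<open>Negacyclic ternary codes\<close>

hide_const (open) Group_Action.orbit

lemma only_prime_factor_imp_power:
 fixes n q :: nat
 assumes "n > 0" "\<And>p. prime p \<Longrightarrow> p dvd n \<Longrightarrow> p = q"
 shows "\<exists>k. n = q ^ k"
 using assms
proof (induction n rule: less_induct)
 case (less n)
 show ?case
 proof (cases "n = 1")
  case True
  then show ?thesis by (intro exI[of _ 0]) simp
 next
  case False
  then obtain p where p: "prime p" "p dvd n" using prime_factor_nat by blast
  then have "p = q" using less by blast
  then obtain m where m: "n = q * m" using p by (auto simp: dvd_def)
  have "m < n" "m > 0" using m less.prems(1) prime_gt_1_nat[OF p(1)] \<open>p = q\<close> by auto
  moreover have "p' = q" if "prime p'" "p' dvd m" for p' using less.prems(2) that m by simp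
  ultimately obtain k where "m = q ^ k" using less.IH by blast
  then show ?thesis using m by (intro exI[of _ "Suc k"]) simp
 qed
qed

lemma funpow_fixes_iff_card_orbit_dvd:
 assumes "(f ^^ N) x = x" "0 < N"
 shows "(f ^^ n) x = x \<longleftrightarrow> card (orbit f x) dvd n" "card (orbit f x) > 0"
proof -
 have o: "x \<in> orbit f x" using assms by (auto simp: orbit_altdef intro!: exI[of _ N])
 define m where "m = funpow_dist1 f x x"
 have m: "(f ^^ m) x = x" "m > 0" unfolding m_def by (rule funpow_dist1_prop[OF o]) simp
 have card: "card (orbit f x) = m"
  unfolding orbit_conv_funpow_dist1[OF o] using inj_on_funpow_dist1[OF o] by (simp add: card_image m_def)
 have "(f ^^ n) x = x \<longleftrightarrow> m dvd n"
 proof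
  assume n: "(f ^^ n) x = x"
  then have "(f ^^ (n mod m)) x = x" using funpow_mod_eq[OF m(1), of n] by simp
  then have "n mod m = 0" using funpow_dist1_least[of "n mod m" f x x] m(2) m_def by (metis gr0I mod_less_divisor)
  then show "m dvd n" by auto
 next
  assume "m dvd n"
  then show "(f ^^ n) x = x" using funpow_mod_eq[OF m(1), of n] by simp
 qed
 then show "(f ^^ n) x = x \<longleftrightarrow> card (orbit f x) dvd n" "card (orbit f x) > 0" using card m(2) by simp_all
qed

lemma card_orbit_dvd_card:
 assumes fin: "finite X" and cl: "\<And>x. x \<in> X \<Longrightarrow> f x \<in> X" and N: "0 < N" "\<And>x. x \<in> X \<Longrightarrow> (f ^^ N) x = x"
  and m: "\<And>x. x \<in> X \<Longrightarrow> card (orbit f x) = m"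
 shows "m dvd card X"
proof -
 let ?O = "orbit f"
 have self: "x \<in> ?O x" if "x \<in> X" for x using N that by (auto simp: orbit_altdef intro!: exI[of _ N])
 have sub: "?O x \<subseteq> X" if x: "x \<in> X" for x
 proof
  fix y assume "y \<in> ?O x"
  then show "y \<in> X" by induction (use cl x in auto)
 qed
 have eq: "?O y = ?O x" if "x \<in> X" "y \<in> ?O x" for x y
  by (rule orbit_cyclic_eq3[OF _ that(2)]) (use self that in \<open>auto simp: cyclic_on_def\<close>)
 have U: "\<Union>(?O ` X) = X" using self sub by blast
 have "m * card (?O ` X) = card (\<Union>(?O ` X))"
 proof (rule card_partition)
  show "finite (?O ` X)" "finite (\<Union>(?O ` X))" using fin U by simp_all
  show "card c = m" if "c \<in> ?O ` X" for c using that m by auto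
  show "c \<inter> d = {}" if "c \<in> ?O ` X" "d \<in> ?O ` X" "c \<noteq> d" for c d using that eq by blast
 qed
 then show ?thesis unfolding U by (metis dvd_triv_left)
qed

lemma power_eq_1_mod: "\<exists>u::int. (m * v + 1) ^ n = m * u + 1"
proof (induction n)
 case 0
 show ?case by (intro exI[of _ 0]) simp
next
 case (Suc n)
 then obtain u where "(m * v + 1) ^ n = m * u + 1" by blast
 then show ?case by (intro exI[of _ "v * (m * u + 1) + u"]) (simp add: algebra_simps)
qed

text \<open>The order of \<open>3\<close> modulo \<open>2\<^sup>a\<^sup>+\<^sup>3\<close> is \<open>2\<^sup>a\<^sup>+\<^sup>1\<close>. In the step \<open>d = 2 e\<close> with \<open>e\<close> even, and of the factors
 \<open>3\<^sup>e - 1\<close> and \<open>3\<^sup>e + 1\<close> the second is twice an odd number.\<close>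

lemma two_power_dvd_three_power_minus_1:
 fixes a d :: nat
 assumes "2 ^ (a + 3) dvd (3::int) ^ d - 1"
 shows "2 ^ (a + 1) dvd d"
 using assms
proof (induction a arbitrary: d)
 case 0
 have "even d"
 proof (rule ccontr)
  assume "odd d"
  then obtain e where e: "d = 2 * e + 1" by (rule oddE)
  obtain u where "(9::int) ^ e = 8 * u + 1" using power_eq_1_mod[of 8 1 e] by auto
  then have "(3::int) ^ d - 1 = 24 * u + 2" by (simp add: e power_mult)
  moreover have "\<not> (8::int) dvd 2 + 24 * u" by presburger
  ultimately show False using 0 by simp
 qed
 then show ?case by simp
next
 case (Suc a)
 have "(2::int) ^ (a + 3) dvd 2 ^ (Suc a + 3)" by (simp add: le_imp_power_dvd)
 then have "2 ^ (a + 1) dvd d" using Suc dvd_trans by blast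
 moreover have "(2::nat) dvd 2 ^ (a + 1)" by simp
 ultimately have "even d" using dvd_trans by blast
 then obtain e where e: "d = 2 * e" by blast
 have fac: "(3::int) ^ d - 1 = (3 ^ e - 1) * (3 ^ e + 1)"
  unfolding e by (simp add: mult.commute[of 2] power_mult power2_eq_square algebra_simps)
 have "even e"
 proof (rule ccontr)
  assume "odd e"
  then obtain f where f: "e = 2 * f + 1" by (rule oddE)
  have "(16::int) dvd 2 ^ (Suc a + 3)" using le_imp_power_dvd[of 4 "Suc a + 3" "2::int"] by simp
  then have dvd: "(16::int) dvd 3 ^ d - 1" using Suc.prems dvd_trans by blast
  obtain u where u: "(81::int) ^ f = 16 * u + 1" using power_eq_1_mod[of 16 5 f] by auto
  have "d = 4 * f + 2" by (simp add: e f)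
  then have "(3::int) ^ d - 1 = 144 * u + 8" using u by (simp add: power_add power_mult)
  moreover have "\<not> (16::int) dvd 8 + 144 * u" by presburger
  ultimately show False using dvd by simp
 qed
 then obtain f where f: "e = 2 * f" by blast
 obtain u where u: "(9::int) ^ f = 8 * u + 1" using power_eq_1_mod[of 8 1 f] by auto
 define h where "h = 2 * u"
 have h: "(3::int) ^ e + 1 = 2 * (2 * h + 1)" using u by (simp add: f power_mult h_def)
 have "(2::int) * 2 ^ (a + 3) = 2 ^ (Suc a + 3)" by (simp only: power_Suc add_Suc)
 also have "\<dots> dvd 2 * ((3 ^ e - 1) * (2 * h + 1))"
  using Suc.prems unfolding fac h by (simp only: mult.left_commute)
 finally have "(2::int) ^ (a + 3) dvd (3 ^ e - 1) * (2 * h + 1)"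
  by (simp only: dvd_mult_cancel_left) simp
 moreover have "coprime ((2::int) ^ (a + 3)) (2 * h + 1)" by (simp add: coprime_left_2_iff_odd)
 ultimately have "(2::int) ^ (a + 3) dvd 3 ^ e - 1" by (simp add: coprime_dvd_mult_left_iff)
 then have "2 ^ (a + 1) dvd e" by (rule Suc.IH)
 then show ?case using e by (simp add: mult_dvd_mono)
qed

lemma int_period:
 fixes f :: "int \<Rightarrow> 'a"
 assumes "\<And>y. f (y + p) = f y"
 shows "f (y + p * n) = f y"
proof (induction n rule: int_induct[where k = 0])
 case (step1 n)
 then show ?case using assms[of "y + p * n"] by (simp add: algebra_simps)
next
 case (step2 n)
 then show ?case using assms[of "y + p * (n - 1)"] by (simp add: algebra_simps)
qed simp

text \<open>A tuple over \<open>\<int>\<^sub>3\<close> indexed by \<open>0, \<dots>, r - 1\<close> is continued to all integers so that it changes sign after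
 \<open>r\<close> steps. Conjugation by \<open>rho\<close> then becomes the shift.\<close>

definition nwords :: "nat \<Rightarrow> (int \<Rightarrow> int) set" where
 "nwords r = {c. \<forall>y. 0 \<le> c y \<and> c y < 3 \<and> c (y + int r) = (- c y) mod 3}"

definition wadd :: "(int \<Rightarrow> int) \<Rightarrow> (int \<Rightarrow> int) \<Rightarrow> int \<Rightarrow> int" where
 "wadd c d = (\<lambda>y. (c y + d y) mod 3)"

definition negacyclic_code :: "nat \<Rightarrow> (int \<Rightarrow> int) set \<Rightarrow> bool" where
 "negacyclic_code r C \<longleftrightarrow> C \<subseteq> nwords r \<and> (\<lambda>_. 0) \<in> C \<and> (\<forall>c\<in>C. \<forall>d\<in>C. wadd c d \<in> C) \<and>
   (\<forall>c\<in>C. (\<lambda>y. c (y + 1)) \<in> C)"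

lemma nwordsD:
 assumes "c \<in> nwords r"
 shows "0 \<le> c y" "c y < 3" "c (y + int r) = (- c y) mod 3" "c y mod 3 = c y"
 using assms by (auto simp: nwords_def)

lemma nwords_cases: "c \<in> nwords r \<Longrightarrow> c y = 0 \<or> c y = 1 \<or> c y = 2"
 using nwordsD(1,2)[of c r y] by linarith

lemma nwords_shift_mult:
 assumes "c \<in> nwords r"
 shows "c (y + int r * q) = (if even q then c y else (- c y) mod 3)"
proof (induction q arbitrary: y rule: int_induct[where k = 0])
 case base
 then show ?case by simp
next
 case (step1 i)
 have "c (y + int r * (i + 1)) = (- c (y + int r * i)) mod 3"
  using nwordsD(3)[OF assms, of "y + int r * i"] by (simp add: algebra_simps)
 then show ?case using step1 nwords_cases[OF assms, of y] by (auto simp: mod_minus_eq)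
next
 case (step2 i)
 have "c (y + int r * i) = (- c (y + int r * (i - 1))) mod 3"
  using nwordsD(3)[OF assms, of "y + int r * (i - 1)"] by (simp add: algebra_simps)
 then show ?case using step2(2)[of y] nwords_cases[OF assms, of y] nwords_cases[OF assms, of "y + int r * (i - 1)"]
  by (auto split: if_splits)
qed

lemma nwords_mod:
 assumes "c \<in> nwords r"
 shows "c y = (if even (y div int r) then c (y mod int r) else (- c (y mod int r)) mod 3)"
 using nwords_shift_mult[OF assms, of "y mod int r" "y div int r"] by simp

lemma nwords_eqI:
 assumes "c \<in> nwords r" "d \<in> nwords r" "r > 0" "\<And>y. 0 \<le> y \<Longrightarrow> y < int r \<Longrightarrow> c y = d y"
 shows "c = d"
proof
 fix y
 have "c (y mod int r) = d (y mod int r)" using assms(3,4) by simp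
 then show "c y = d y" by (simp add: nwords_mod[OF assms(1), of y] nwords_mod[OF assms(2), of y])
qed

lemma finite_nwords: "r > 0 \<Longrightarrow> finite (nwords r)"
proof -
 assume r: "r > 0"
 let ?f = "\<lambda>c. restrict c {0..<int r}"
 have "inj_on ?f (nwords r)"
 proof (rule inj_onI)
  fix c d assume "c \<in> nwords r" "d \<in> nwords r" "?f c = ?f d"
  then show "c = d" by (intro nwords_eqI[OF _ _ r]) (auto dest!: fun_cong simp: restrict_def split: if_splits)
 qed
 moreover have "?f ` nwords r \<subseteq> {0..<int r} \<rightarrow>\<^sub>E {0..<3}" by (auto simp: nwords_def)
 ultimately show "finite (nwords r)" by (meson finite_PiE finite_atLeastLessThan_int finite_imageD finite_subset)
qed

lemma negacyclic_codeD:
 assumes "negacyclic_code r C"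
 shows "C \<subseteq> nwords r" "(\<lambda>_. 0) \<in> C" "c \<in> C \<Longrightarrow> d \<in> C \<Longrightarrow> wadd c d \<in> C"
  "c \<in> C \<Longrightarrow> (\<lambda>y. c (y + 1)) \<in> C"
 using assms by (auto simp: negacyclic_code_def)

lemma code_shift_nat: "negacyclic_code r C \<Longrightarrow> c \<in> C \<Longrightarrow> (\<lambda>y. c (y + int j)) \<in> C"
proof (induction j)
 case (Suc j)
 then show ?case using negacyclic_codeD(4)[of r C "\<lambda>y. c (y + int j)"] by (simp add: algebra_simps)
qed simp

lemma code_card_power_of_3:
 assumes C: "negacyclic_code r C" and r: "r > 0"
 shows "\<exists>d. card C = 3 ^ d"
proof -
 note D = negacyclic_codeD[OF C]
 define A where "A = \<lparr>carrier = C, mult = wadd, one = (\<lambda>_. 0)\<rparr>"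
 have cw: "c \<in> C \<Longrightarrow> c \<in> nwords r" for c using D(1) by auto
 interpret A: group A
 proof (rule groupI)
  show "x \<otimes>\<^bsub>A\<^esub> y \<in> carrier A" if "x \<in> carrier A" "y \<in> carrier A" for x y using that D(3) by (simp add: A_def)
  show "\<one>\<^bsub>A\<^esub> \<in> carrier A" using D(2) by (simp add: A_def)
  show "x \<otimes>\<^bsub>A\<^esub> y \<otimes>\<^bsub>A\<^esub> z = x \<otimes>\<^bsub>A\<^esub> (y \<otimes>\<^bsub>A\<^esub> z)" for x y z
   by (simp add: A_def wadd_def mod_add_left_eq mod_add_right_eq add.assoc)
  show "\<one>\<^bsub>A\<^esub> \<otimes>\<^bsub>A\<^esub> x = x" if "x \<in> carrier A" for x
   using that nwordsD(4)[OF cw] by (simp add: A_def wadd_def)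
  show "\<exists>y\<in>carrier A. y \<otimes>\<^bsub>A\<^esub> x = \<one>\<^bsub>A\<^esub>" if "x \<in> carrier A" for x
   using that D(3)[of x x] by (intro bexI[of _ "wadd x x"]) (auto simp: A_def wadd_def mod_add_left_eq fun_eq_iff)
 qed
 have fin: "finite (carrier A)" using D(1) finite_nwords[OF r] finite_subset by (auto simp: A_def)
 have three: "x [^]\<^bsub>A\<^esub> (3::nat) = \<one>\<^bsub>A\<^esub>" if "x \<in> carrier A" for x
  using that by (simp add: numeral_3_eq_3 A_def wadd_def fun_eq_iff mod_add_left_eq)
 have "order A > 0" using A.order_gt_0_iff_finite fin by blast
 moreover have "p = 3" if p: "prime p" "p dvd order A" for p
 proof -
  obtain x where x: "x \<in> carrier A" "x \<noteq> \<one>\<^bsub>A\<^esub>" "x [^]\<^bsub>A\<^esub> p = \<one>\<^bsub>A\<^esub>" using A.cauchy_prime_order[OF fin p] .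
  then have "A.ord x dvd p" "A.ord x dvd 3" "A.ord x \<noteq> 1" using three A.pow_eq_id A.ord_eq_1 by auto
  moreover have "prime (3::nat)" by simp
  ultimately show "p = 3" using p(1) by (metis prime_nat_iff)
 qed
 ultimately show ?thesis using only_prime_factor_imp_power[of "order A" 3] by (simp add: Coset.order_def A_def)
qed

text \<open>The shift has order \<open>2 r\<close> and its \<open>r\<close>-th power is negation. For \<open>r\<close> a power of two every
 nontrivial power of the shift has negation among its powers, so it fixes no nonzero word:
 the nonzero words of a code fall into orbits of length exactly \<open>2 r\<close>.\<close>

lemma nwords_no_short_period:
 assumes r: "r = 2 ^ a" and c: "c \<in> nwords r" "c \<noteq> (\<lambda>_. 0)"
  and j: "0 < j" "j < 2 * int r"
 shows "(\<lambda>y. c (y + j)) \<noteq> c"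
proof
 assume per: "(\<lambda>y. c (y + j)) = c"
 define P where "P = {i. \<forall>y. c (y + i) = c y}"
 have P_mult: "i * n \<in> P" if "i \<in> P" for i n using that int_period[of c i] by (simp add: P_def)
 have P_add: "i + i' \<in> P" if "i \<in> P" "i' \<in> P" for i i'
  using that by (simp add: P_def add.assoc[symmetric])
 have jP: "j \<in> P" using per by (auto simp: P_def fun_eq_iff)
 have rP: "2 * int r \<in> P" using nwords_shift_mult[OF c(1), of _ 2] by (auto simp: P_def algebra_simps)
 define g where "g = gcd j (2 * int r)"
 obtain u v where "u * j + v * (2 * int r) = g" unfolding g_def using bezout_int by blast
 then have "g \<in> P" using P_add[OF P_mult[OF jP, of u] P_mult[OF rP, of v]] by (simp add: mult.commute)
 have "g dvd 2 * int r" "g > 0" using j by (auto simp: g_def)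
 moreover have two: "2 * int r = int (2 ^ Suc a)" using r by simp
 ultimately have "nat g dvd 2 ^ Suc a" by (metis int_dvd_int_iff int_nat_eq less_imp_le of_nat_eq_iff)
 then obtain e where e: "e \<le> Suc a" "nat g = 2 ^ e" using divides_primepow_nat[OF two_is_prime_nat] by blast
 have "g \<le> j" using j by (auto simp: g_def intro: zdvd_imp_le)
 then have "e \<noteq> Suc a" using e(2) j(2) two \<open>g > 0\<close> by auto
 then have "2 ^ e dvd (2::nat) ^ a" using e by (simp add: le_imp_power_dvd)
 then have "g dvd int r" using e(2) \<open>g > 0\<close> r by (metis int_dvd_int_iff int_nat_eq less_imp_le)
 then have "int r \<in> P" using P_mult[OF \<open>g \<in> P\<close>] by (auto simp: dvd_def)
 then have "c y = 0" for y
  using nwordsD(3)[OF c(1), of y] nwords_cases[OF c(1), of y] by (auto simp: P_def)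
 then show False using c(2) by auto
qed

lemma code_orbit_length_dvd:
 assumes r: "r = 2 ^ a" and C: "negacyclic_code r C"
 shows "2 * r dvd card (C - {\<lambda>_. 0})"
proof (rule card_orbit_dvd_card)
 note D = negacyclic_codeD[OF C]
 let ?s = "\<lambda>(c :: int \<Rightarrow> int) y. c (y + 1)"
 have r0: "r > 0" by (simp add: r)
 show "0 < 2 * r" using r0 by simp
 show "finite (C - {\<lambda>_. 0})" using D(1) finite_nwords[OF r0] finite_subset by auto
 have pow: "(?s ^^ n) c = (\<lambda>y. c (y + int n))" for n c by (induction n) (simp_all add: algebra_simps)
 fix c assume c: "c \<in> C - {\<lambda>_. 0}"
 then have cw: "c \<in> nwords r" "c \<noteq> (\<lambda>_. 0)" using D(1) by auto
 have "?s c \<noteq> (\<lambda>_. 0)"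
 proof
  assume "?s c = (\<lambda>_. 0)"
  then have "c (y - 1 + 1) = 0" for y by (rule fun_cong)
  then show False using cw(2) by auto
 qed
 then show "?s c \<in> C - {\<lambda>_. 0}" using c D(4) by blast
 show full: "(?s ^^ (2 * r)) c = c"
  unfolding pow using nwords_shift_mult[OF cw(1), of _ 2] by (simp add: mult.commute)
 let ?m = "card (orbit ?s c)"
 note period = funpow_fixes_iff_card_orbit_dvd[OF full \<open>0 < 2 * r\<close>]
 have m: "?m dvd 2 * r" "(?s ^^ ?m) c = c" using period(1)[of "2 * r"] period(1)[of ?m] full by auto
 moreover have "\<not> ?m < 2 * r"
  using nwords_no_short_period[OF r cw, of "int ?m"] m(2) period(2) unfolding pow by auto
 ultimately show "?m = 2 * r" using r0 by (auto dest: dvd_imp_le)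
qed

text \<open>If the code has \<open>3\<^sup>d\<close> words, then \<open>2 r\<close> divides \<open>3\<^sup>d - 1\<close>, which forces \<open>r / 2\<close> to divide \<open>d\<close>.\<close>

theorem code_card_lower_bound:
 assumes r: "r = 2 ^ a" "a \<ge> 2" and C: "negacyclic_code r C" "C \<noteq> {\<lambda>_. 0}"
 shows "3 ^ (r div 2) \<le> card C"
proof -
 note D = negacyclic_codeD[OF C(1)]
 obtain d where d: "card C = 3 ^ d" using code_card_power_of_3[OF C(1)] r by auto
 have finC: "finite C" using D(1) finite_nwords[of r] r finite_subset by auto
 have "card C \<noteq> 1" using C(2) D(2) by (auto simp: card_1_singleton_iff)
 then have "d \<noteq> 0" using d by auto
 have "2 ^ (a + 1) dvd card (C - {\<lambda>_. 0})" using code_orbit_length_dvd[OF r(1) C(1)] r by simp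
 then have "2 ^ (a + 1) dvd (3 ^ d - 1 :: nat)" using D(2) finC d by (simp add: card_Diff_singleton)
 then have "int (2 ^ (a + 1)) dvd int (3 ^ d - 1)" by (simp only: int_dvd_int_iff)
 then have "(2::int) ^ (a + 1) dvd 3 ^ d - 1" by (simp add: of_nat_diff)
 moreover obtain a' where a': "a = a' + 2" using r(2) by (metis add.commute le_Suc_ex)
 ultimately have "2 ^ (a' + 1) dvd d" using two_power_dvd_three_power_minus_1[of a' d] by (simp add: numeral_3_eq_3)
 then have "2 ^ (a' + 1) \<le> d" using \<open>d \<noteq> 0\<close> by (simp add: dvd_imp_le)
 moreover have "r div 2 = 2 ^ (a' + 1)" using r a' by simp
 ultimately show ?thesis unfolding d by (simp add: power_increasing)
qed

section \<open>The two codes cut out by a three-term relation\<close>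

text \<open>Under the shift by \<open>k\<close>, called \<open>x\<close>, the words of \<open>nwords (4 * k)\<close> satisfy \<open>x\<^sup>4 = -1\<close>. The code \<open>tetra s k\<close> is the
 kernel of \<open>1 - s x - x\<^sup>2\<close>. Its words are determined by two of their four blocks, and for \<open>s = 1\<close> they have the
 shape \<open>(X + Y, X, Y, X - Y)\<close>.\<close>

definition tetra :: "int \<Rightarrow> nat \<Rightarrow> (int \<Rightarrow> int) set" where
 "tetra s k = {c \<in> nwords (4 * k). \<forall>y. (c y - s * c (y + int k) - c (y + 2 * int k)) mod 3 = 0}"

definition tetra_op :: "int \<Rightarrow> nat \<Rightarrow> (int \<Rightarrow> int) \<Rightarrow> int \<Rightarrow> int" where
 "tetra_op s k c = (\<lambda>y. (c y - s * c (y + int k) - c (y + 2 * int k)) mod 3)"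

lemma tetra_iff: "c \<in> tetra s k \<longleftrightarrow> c \<in> nwords (4 * k) \<and> tetra_op s k c = (\<lambda>_. 0)"
 by (auto simp: tetra_def tetra_op_def fun_eq_iff)

lemma negacyclic_nwords: "negacyclic_code r (nwords r)"
 unfolding negacyclic_code_def
proof (intro conjI ballI)
 fix c d assume cd: "c \<in> nwords r" "d \<in> nwords r"
 have "wadd c d (y + int r) = (- wadd c d y) mod 3" for y
  using nwordsD(3)[OF cd(1), of y] nwordsD(3)[OF cd(2), of y]
  by (simp add: wadd_def mod_add_eq mod_minus_eq)
 then show "wadd c d \<in> nwords r" by (simp add: nwords_def wadd_def)
next
 fix c assume c: "c \<in> nwords r"
 have "c (y + int r + 1) = (- c (y + 1)) mod 3" for y
  using nwordsD(3)[OF c, of "y + 1"] by (simp add: algebra_simps)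
 then show "(\<lambda>y. c (y + 1)) \<in> nwords r" using nwordsD(1,2)[OF c] by (simp add: nwords_def)
qed (auto simp: nwords_def)

lemma mod3_combination: "(a mod 3 - s * (b mod 3) - e mod 3) mod 3 = (a - s * b - e) mod (3::int)"
 by (intro mod_diff_cong mod_mult_cong) simp_all

lemma tetra_op_wadd: "tetra_op s k (wadd c d) = wadd (tetra_op s k c) (tetra_op s k d)"
 unfolding tetra_op_def wadd_def mod3_combination mod_add_eq by (simp add: algebra_simps)

lemma negacyclic_tetra: "negacyclic_code (4 * k) (tetra s k)"
 unfolding negacyclic_code_def
proof (intro conjI ballI)
 note D = negacyclic_codeD[OF negacyclic_nwords[of "4 * k"]]
 show "tetra s k \<subseteq> nwords (4 * k)" by (auto simp: tetra_def)
 show "(\<lambda>_. 0) \<in> tetra s k" by (simp add: tetra_def nwords_def)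
 show "wadd c d \<in> tetra s k" if "c \<in> tetra s k" "d \<in> tetra s k" for c d
  using that D(3) by (simp add: tetra_iff tetra_op_wadd) (simp add: wadd_def)
 fix c assume c: "c \<in> tetra s k"
 then have "(\<lambda>y. c (y + 1)) \<in> nwords (4 * k)" using D(4)[of c] by (simp add: tetra_def)
 moreover have "tetra_op s k (\<lambda>y. c (y + 1)) = (\<lambda>y. tetra_op s k c (y + 1))"
  by (simp add: tetra_op_def algebra_simps)
 ultimately show "(\<lambda>y. c (y + 1)) \<in> tetra s k" using c by (simp add: tetra_iff)
qed

lemma code_tetra_op:
 assumes C: "negacyclic_code (4 * k) C" and c: "c \<in> C" and s: "s = 1 \<or> s = -1"
 shows "tetra_op s k c \<in> C"
proof -
 note D = negacyclic_codeD[OF C]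
 define u where "u = (\<lambda>y. c (y + int k))"
 define v where "v = (\<lambda>y. c (y + int (2 * k)))"
 have uv: "u \<in> C" "v \<in> C" unfolding u_def v_def using code_shift_nat[OF C c] by blast+
 define u' where "u' = (if s = 1 then wadd u u else u)"
 have "u' \<in> C" using uv D(3) by (simp add: u'_def)
 then have "wadd c (wadd u' (wadd v v)) \<in> C" using uv c D(3) by blast
 moreover have "wadd c (wadd u' (wadd v v)) = tetra_op s k c"
 proof
  fix y
  have "wadd c (wadd u' (wadd v v)) y = (c y + ((if s = 1 then u y + u y else u y) + (v y + v y))) mod 3"
   by (cases "s = 1") (simp_all only: wadd_def u'_def simp_thms if_True if_False mod_add_right_eq mod_add_left_eq)
  also have "\<dots> = (c y - s * u y - v y + 3 * ((if s = 1 then u y else 0) + v y)) mod 3"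
   using s by (intro arg_cong[where f = "\<lambda>a. a mod 3"]) (auto simp: algebra_simps)
  also have "\<dots> = tetra_op s k c y" by (simp only: mod_mult_self2) (simp add: tetra_op_def u_def v_def)
  finally show "wadd c (wadd u' (wadd v v)) y = tetra_op s k c y" .
 qed
 ultimately show ?thesis by simp
qed

text \<open>Over the field with three elements \<open>x\<^sup>4 + 1 = (x\<^sup>2 + x - 1) (x\<^sup>2 - x - 1)\<close>.\<close>

lemma tetra_op_in_tetra:
 assumes c: "c \<in> nwords (4 * k)" and s: "s = 1 \<or> s = -1"
 shows "tetra_op s k c \<in> tetra (- s) k"
proof -
 have "tetra_op (- s) k (tetra_op s k c) y = 0" for y
 proof -
  have c4: "c (y + 4 * int k) = (- c y) mod 3" using nwordsD(3)[OF c, of y] by simp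
  have p: "y + int k + int k = y + 2 * int k" "y + int k + 2 * int k = y + 3 * int k"
   "y + 2 * int k + int k = y + 3 * int k" "y + 2 * int k + 2 * int k = y + 4 * int k" by simp_all
  have "tetra_op (- s) k (tetra_op s k c) y = ((c y - s * c (y + int k) - c (y + 2 * int k))
    - (- s) * (c (y + int k) - s * c (y + 2 * int k) - c (y + 3 * int k))
    - (c (y + 2 * int k) - s * c (y + 3 * int k) - (- c y) mod 3)) mod 3"
   unfolding tetra_op_def p c4 mod3_combination ..
  also have "\<dots> = (c y + (- c y) mod 3 + 3 * (- c (y + 2 * int k))) mod 3"
   using s by (intro arg_cong[where f = "\<lambda>a. a mod 3"]) (auto simp: algebra_simps)
  also have "\<dots> = 0" by (simp only: mod_mult_self2 mod_add_right_eq) simp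
  finally show ?thesis .
 qed
 moreover have "tetra_op s k c \<in> nwords (4 * k)" by (rule code_tetra_op[OF negacyclic_nwords c s])
 ultimately show ?thesis by (auto simp: tetra_iff)
qed

lemma card_tetra_le:
 assumes k: "k > 0" and s: "s = 1 \<or> s = -1"
 shows "card (tetra s k) \<le> 3 ^ (2 * k)"
proof -
 let ?f = "\<lambda>c. restrict c {int k..<3 * int k}"
 have inj: "inj_on ?f (tetra s k)"
 proof (rule inj_onI)
  fix c d assume cd: "c \<in> tetra s k" "d \<in> tetra s k" and eq: "?f c = ?f d"
  have cdw: "c \<in> nwords (4 * k)" "d \<in> nwords (4 * k)" using cd by (auto simp: tetra_def)
  have mid: "c y = d y" if "int k \<le> y" "y < 3 * int k" for y
   using fun_cong[OF eq, of y] that by simp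
  have rel: "(c y - s * c (y + int k) - c (y + 2 * int k)) mod 3 = 0"
   "(d y - s * d (y + int k) - d (y + 2 * int k)) mod 3 = 0" for y using cd by (auto simp: tetra_def)
  show "c = d"
  proof (rule nwords_eqI[OF cdw])
   fix y assume y: "0 \<le> y" "y < int (4 * k)"
   consider "y < int k" | "int k \<le> y" "y < 3 * int k" | "3 * int k \<le> y" using k by linarith
   then show "c y = d y"
   proof cases
    case 1
    have "c (y + int k) = d (y + int k)" "c (y + 2 * int k) = d (y + 2 * int k)"
     using 1 y by (intro mid; simp)+
    then show ?thesis using rel[of y] nwords_cases[OF cdw(1), of y] nwords_cases[OF cdw(2), of y]
     by presburger
   next
    case 2
    then show ?thesis by (rule mid)
   next
    case 3
    define z where "z = y - 2 * int k"
    have "c z = d z" "c (z + int k) = d (z + int k)" using 3 y by (intro mid; simp add: z_def)+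
    moreover have "y = z + 2 * int k" by (simp add: z_def)
    ultimately show ?thesis using rel[of z] nwords_cases[OF cdw(1), of y] nwords_cases[OF cdw(2), of y]
     by presburger
   qed
  qed (use k in simp)
 qed
 have "?f ` tetra s k \<subseteq> {int k..<3 * int k} \<rightarrow>\<^sub>E {0..<3}" by (auto simp: tetra_def nwords_def)
 then have "card (tetra s k) \<le> card ({int k..<3 * int k} \<rightarrow>\<^sub>E {0..<3::int})"
  using inj by (intro card_inj_on_le) (auto intro: finite_PiE)
 also have "\<dots> = 3 ^ (2 * k)" by (simp add: card_PiE nat_diff_distrib' nat_mult_distrib)
 finally show ?thesis .
qed

text \<open>The lower bound for the size of a code agrees with the size of \<open>tetra s k\<close>: as polynomials in
 the shift by one, the two factors have degree \<open>r / 2\<close> and are irreducible.\<close>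

lemma code_in_tetra_eq:
 assumes a: "4 * k = 2 ^ a" and s: "s = 1 \<or> s = -1"
  and U: "negacyclic_code (4 * k) U" "U \<noteq> {\<lambda>_. 0}" "U \<subseteq> tetra s k"
 shows "U = tetra s k"
proof (rule card_seteq)
 have k: "k > 0" using a by (cases k) auto
 have "a \<ge> 2"
 proof (rule ccontr)
  assume "\<not> a \<ge> 2"
  then have "a = 0 \<or> a = 1" by auto
  then show False using a k by auto
 qed
 then have "3 ^ (4 * k div 2) \<le> card U" using code_card_lower_bound[OF a _ U(1,2)] by blast
 then have "3 ^ (2 * k) \<le> card U" by simp
 then show "card (tetra s k) \<le> card U" using card_tetra_le[OF k s] by simp
 show "finite (tetra s k)" using finite_nwords[of "4 * k"] k by (simp add: tetra_def)
qed (rule U(3))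

text \<open>The intersection of the code with each of \<open>tetra 1 k\<close> and \<open>tetra (-1) k\<close> is zero or everything. Not both can
 be contained in the code, since together they span all words, including words without zeros. If one is not contained
 in the code, then its operator, which maps into the other, vanishes on the code.\<close>

theorem zero_meeting_code_is_tetra:
 assumes a: "4 * k = 2 ^ a" and C: "negacyclic_code (4 * k) C" "C \<noteq> {\<lambda>_. 0}"
  and zero: "\<And>c. c \<in> C \<Longrightarrow> \<exists>y. c y = 0"
 shows "\<exists>s\<in>{1,-1}. C = tetra s k"
proof -
 note D = negacyclic_codeD[OF C(1)]
 have k: "k > 0" using a by (cases k) auto
 have inter: "negacyclic_code (4 * k) (C \<inter> tetra s k)" for s
  using C(1) negacyclic_tetra[of k s] by (auto simp: negacyclic_code_def)
 have full: "tetra s k \<subseteq> C" if "c \<in> C" "c \<in> tetra s k" "c \<noteq> (\<lambda>_. 0)" "s = 1 \<or> s = -1" for c s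
  using code_in_tetra_eq[OF a that(4) inter] that by blast
 have not_both: "\<not> (tetra 1 k \<subseteq> C \<and> tetra (- 1) k \<subseteq> C)"
 proof
  assume both: "tetra 1 k \<subseteq> C \<and> tetra (- 1) k \<subseteq> C"
  \<comment> \<open>The two halves span all words, in particular one without zeros.\<close>
  define d where "d y = (if even (y div (4 * int k)) then 1 else 2 :: int)" for y
  have d: "d \<in> nwords (4 * k)"
  proof -
   have "(y + 4 * int k) div (4 * int k) = y div (4 * int k) + 1" for y
    using k by (simp add: div_add_self2)
   then show ?thesis by (simp add: nwords_def d_def)
  qed
  have "tetra_op 1 k d \<in> C" "tetra_op (- 1) k d \<in> C"
   using tetra_op_in_tetra[OF d, of 1] tetra_op_in_tetra[OF d, of "-1"] both by auto
  then have "wadd (tetra_op 1 k d) (wadd (tetra_op (- 1) k d) (tetra_op (- 1) k d)) \<in> C" using D(3) by blast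
  then obtain y where "wadd (tetra_op 1 k d) (wadd (tetra_op (- 1) k d) (tetra_op (- 1) k d)) y = 0"
   using zero by blast
  then have "((d y - d (y + int k) - d (y + 2 * int k)) + 2 * (d y + d (y + int k) - d (y + 2 * int k))) mod 3 = 0"
   by (simp add: wadd_def tetra_op_def mod_simps)
  then have "(3 * (d y - d (y + 2 * int k)) + d (y + int k)) mod 3 = 0" by (simp add: algebra_simps)
  then have "d (y + int k) mod 3 = 0" by presburger
  then show False by (simp add: d_def split: if_splits)
 qed
 obtain c where c: "c \<in> C" "c \<noteq> (\<lambda>_. 0)" using C(2) D(2) by blast
 have cw: "c \<in> nwords (4 * k)" if "c \<in> C" for c using D(1) that by blast
 have dicho: "tetra (- s) k \<subseteq> C" if s: "s = 1 \<or> s = -1" and c: "c \<in> C" "c \<notin> tetra s k" for c s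
 proof -
  have "tetra_op s k c \<noteq> (\<lambda>_. 0)" using c cw by (simp add: tetra_iff)
  then show ?thesis
   using full[of "tetra_op s k c" "- s"] code_tetra_op[OF C(1) c(1) s] tetra_op_in_tetra[OF cw[OF c(1)] s] s by auto
 qed
 show ?thesis
 proof (cases "c \<in> tetra 1 k")
  case True
  then have "tetra 1 k \<subseteq> C" using full c by blast
  moreover have "C \<subseteq> tetra 1 k" using dicho[of 1] not_both calculation by auto
  ultimately show ?thesis by blast
 next
  case False
  then have "tetra (- 1) k \<subseteq> C" using dicho[of 1] c by auto
  moreover have "C \<subseteq> tetra (- 1) k" using dicho[of "-1"] not_both calculation by auto
  ultimately show ?thesis by blast
 qed
qed

text \<open>The first block is \<open>X + Y\<close>, followed by \<open>X\<close>, \<open>Y\<close> and \<open>X - Y\<close>, where \<open>X\<close> and \<open>Y\<close> matter only on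
 \<open>0, \<dots>, k - 1\<close>; \<open>m div 4\<close> counts the sign changes.\<close>

definition tetra_word :: "nat \<Rightarrow> (int \<Rightarrow> int) \<Rightarrow> (int \<Rightarrow> int) \<Rightarrow> int \<Rightarrow> int" where
 "tetra_word k X Y y = (let m = y div int k; i = y mod int k; b = m mod 4 in
   (if even (m div 4) then 1 else -1) *
   (if b = 0 then X i + Y i else if b = 1 then X i else if b = 2 then Y i else X i - Y i)) mod 3"

lemma mod4_cases: obtains q where "(m::int) = 4 * q" | q where "m = 4 * q + 1" | q where "m = 4 * q + 2" | q where "m = 4 * q + 3"
proof -
 have "m = 4 * (m div 4) + m mod 4" by simp
 moreover have "m mod 4 \<in> {0,1,2,3}" by auto
 ultimately show ?thesis using that by (metis add.right_neutral empty_iff insert_iff)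
qed

lemma tetra_word_in_tetra:
 assumes k: "k > 0"
 shows "tetra_word k X Y \<in> tetra 1 k"
proof -
 have sh: "(y + n * int k) div int k = y div int k + n" "(y + n * int k) mod int k = y mod int k" for y n
  using k by (auto simp: div_mult_self3)
 have sh1: "(y + int k) div int k = y div int k + 1" "(y + int k) mod int k = y mod int k" for y
  using sh[of y 1] by simp_all
 have neg: "tetra_word k X Y (y + int (4 * k)) = (- tetra_word k X Y y) mod 3" for y
 proof -
  have 4: "(m + 4) div 4 = m div 4 + 1" "(m + 4) mod 4 = m mod 4" for m :: int by simp_all
  show ?thesis unfolding tetra_word_def Let_def of_nat_mult of_nat_numeral sh 4
   by (cases "even (y div int k div 4)") (simp_all only: even_add odd_one if_True if_False simp_thms mult_1 mult_minus1 mod_minus_eq add.inverse_inverse)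
 qed
 have rec: "(tetra_word k X Y y - 1 * tetra_word k X Y (y + int k) - tetra_word k X Y (y + 2 * int k)) mod 3 = 0" for y
 proof -
  define m where "m = y div int k"
  define A where "A = X (y mod int k)"
  define B where "B = Y (y mod int k)"
  have d: "(4 * q) div 4 = q" "(4 * q + 1) div 4 = q" "(4 * q + 2) div 4 = q" "(4 * q + 3) div 4 = q"
   "(4 * q + 1 + 1) div 4 = q" "(4 * q + 1 + 2) div 4 = q" "(4 * q + 2 + 1) div 4 = q"
   "(4 * q + 2 + 2) div 4 = q + 1" "(4 * q + 3 + 1) div 4 = q + 1" "(4 * q + 3 + 2) div 4 = q + 1"
   "(4 * q) mod 4 = 0" "(4 * q + 1) mod 4 = 1" "(4 * q + 2) mod 4 = 2" "(4 * q + 3) mod 4 = 3"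
   "(4 * q + 1 + 1) mod 4 = 2" "(4 * q + 1 + 2) mod 4 = 3" "(4 * q + 2 + 1) mod 4 = 3"
   "(4 * q + 2 + 2) mod 4 = 0" "(4 * q + 3 + 1) mod 4 = 0" "(4 * q + 3 + 2) mod 4 = 1" for q :: int
   by simp_all
  note unf = tetra_word_def Let_def sh sh1 m_def[symmetric] A_def[symmetric] B_def[symmetric]
  show ?thesis
  proof (cases m rule: mod4_cases)
   case (1 q)
   show ?thesis unfolding unf 1 d mod3_combination by (cases "even q") (simp_all add: algebra_simps)
  next
   case (2 q)
   show ?thesis unfolding unf 2 d mod3_combination by (cases "even q") (simp_all add: algebra_simps)
  next
   case (3 q)
   show ?thesis unfolding unf 3 d mod3_combination by (cases "even q") (simp_all add: algebra_simps)
  next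
   case (4 q)
   show ?thesis unfolding unf 4 d mod3_combination by (cases "even q") (simp_all add: algebra_simps)
  qed
 qed
 have "0 \<le> tetra_word k X Y y" "tetra_word k X Y y < 3" for y by (simp_all add: tetra_word_def Let_def)
 then show ?thesis unfolding tetra_def nwords_def using neg rec by blast
qed

lemma tetra_word_eq:
 assumes c: "c \<in> tetra 1 k" and k: "k > 0"
 shows "c = tetra_word k (\<lambda>i. c (i + int k)) (\<lambda>i. c (i + 2 * int k))" (is "c = ?t")
proof (rule nwords_eqI)
 show cw: "c \<in> nwords (4 * k)" using c by (simp add: tetra_def)
 show "?t \<in> nwords (4 * k)" using tetra_word_in_tetra[OF k] by (simp add: tetra_def)
 fix y assume y: "0 \<le> y" "y < int (4 * k)"
 define m where "m = y div int k"
 define i where "i = y mod int k"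
 have yk: "y = m * int k + i" by (simp add: m_def i_def)
 have m0: "0 \<le> m" using y k by (simp add: m_def pos_imp_zdiv_nonneg_iff)
 have i0: "0 \<le> i" using k by (simp add: i_def)
 have "m * int k < 4 * int k" using y yk i0 by linarith
 then have "m < 4" using k by simp
 then have m: "0 \<le> m" "m < 4" using m0 by simp_all
 then have "m = 0 \<or> m = 1 \<or> m = 2 \<or> m = 3" by linarith
 have rel: "(c z - c (z + int k) - c (z + 2 * int k)) mod 3 = 0" for z using c by (simp add: tetra_def)
 have t: "?t y = (if m = 0 then c (i + int k) + c (i + 2 * int k) else if m = 1 then c (i + int k)
   else if m = 2 then c (i + 2 * int k) else c (i + int k) - c (i + 2 * int k)) mod 3"
  using m by (simp add: tetra_word_def m_def[symmetric] i_def[symmetric] Let_def)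
 have r0: "(c i - c (i + int k) - c (i + 2 * int k)) mod 3 = 0" by (rule rel)
 have r1: "(c (i + int k) - c (i + 2 * int k) - c (i + 3 * int k)) mod 3 = 0"
  using rel[of "i + int k"] by (simp add: algebra_simps)
 show "c y = ?t y"
  using \<open>m = 0 \<or> m = 1 \<or> m = 2 \<or> m = 3\<close>
 proof (elim disjE)
  assume "m = 0"
  then show ?thesis using r0 nwords_cases[OF cw, of i] unfolding t by (simp add: yk) presburger
 next
  assume "m = 1"
  then show ?thesis using nwordsD(4)[OF cw] unfolding t by (simp add: yk add.commute)
 next
  assume "m = 2"
  then show ?thesis using nwordsD(4)[OF cw] unfolding t by (simp add: yk add.commute)
 next
  assume "m = 3"
  then show ?thesis using r1 nwords_cases[OF cw, of "i + 3 * int k"] unfolding t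
   by (simp add: yk add.commute[of i]) presburger
 qed
qed (use k in simp)

lemma nwords_reverse:
 assumes "c \<in> nwords r"
 shows "(\<lambda>y. c (-1 - y)) \<in> nwords r"
proof -
 have "c (-1 - (y + int r)) = (- c (-1 - y)) mod 3" for y
  using nwords_shift_mult[OF assms, of "-1 - y" "-1"] by (simp add: algebra_simps)
 then show ?thesis using nwordsD(1,2)[OF assms] by (simp add: nwords_def)
qed

text \<open>Reversal replaces the polynomial \<open>1 - s x - x\<^sup>2\<close> by its reciprocal, which up to sign is \<open>1 + s x - x\<^sup>2\<close>.\<close>

lemma tetra_reverse:
 assumes c: "c \<in> tetra s k"
 shows "(\<lambda>y. c (-1 - y)) \<in> tetra (- s) k"
proof -
 have "(c (-1 - y) - (- s) * c (-1 - (y + int k)) - c (-1 - (y + 2 * int k))) mod 3 = 0" for y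
 proof -
  define u where "u = -1 - y - 2 * int k"
  have "(c u - s * c (u + int k) - c (u + 2 * int k)) mod 3 = 0" using c by (simp add: tetra_def)
  moreover have "-1 - y = u + 2 * int k" "-1 - (y + int k) = u + int k" "-1 - (y + 2 * int k) = u" by (auto simp: u_def)
  moreover have "(A - s * B - D) mod 3 = 0 \<Longrightarrow> (D - (- s) * B - A) mod 3 = 0" for A B D :: int
  proof -
   assume "(A - s * B - D) mod 3 = 0"
   then have "3 dvd - (A - s * B - D)" unfolding dvd_minus_iff by (rule mod_0_imp_dvd)
   moreover have "- (A - s * B - D) = D - (- s) * B - A" by simp
   ultimately show ?thesis by (metis dvd_imp_mod_0)
  qed
  ultimately show ?thesis by metis
 qed
 then show ?thesis using c nwords_reverse by (simp add: tetra_def)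
qed

text \<open>With \<open>X = 1, 0, 1, 0, \<dots>\<close> and \<open>Y = 2, 1, 2, 1, \<dots>\<close> the first block has its zeros at the even positions, the second
 at the odd ones, and the other two have none.\<close>

lemma tetra_word_without_adjacent_zeros:
 assumes k: "k > 0" and s: "s = 1 \<or> s = -1"
 shows "\<exists>c\<in>tetra s k. \<forall>y. \<not> (c y = 0 \<and> c (y + 1) = 0)"
proof -
 define c where "c = tetra_word k (\<lambda>i. if even i then 1 else 0) (\<lambda>i. if even i then 2 else 1)"
 have cz: "c y = 0 \<longleftrightarrow> (let b = y div int k mod 4; i = y mod int k in (b = 0 \<and> even i) \<or> (b = 1 \<and> odd i))" for y
 proof -
  define b where "b = y div int k mod 4"
  show ?thesis
   unfolding c_def tetra_word_def Let_def b_def[symmetric]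
   by (cases "even (y mod int k)"; cases "even (y div int k div 4)"; simp)
 qed
 have no: "\<not> (c y = 0 \<and> c (y + 1) = 0)" for y
 proof (cases "y mod int k = int k - 1")
  case True
  then have "y = int k * (y div int k) + (int k - 1)" using mult_div_mod_eq[of "int k" y] by metis
  then have "y + 1 = int k * (y div int k + 1)" by (simp only: distrib_left)
  then have "(y + 1) mod int k = 0" "(y + 1) div int k = y div int k + 1" using k by simp_all
  moreover have "(m mod 4 = 0 \<or> m mod 4 = 1) \<longrightarrow> (m + 1) mod 4 \<noteq> 0" for m :: int by presburger
  from this[of "y div int k"] calculation show ?thesis unfolding cz Let_def by auto
 next
  case False
  moreover have i: "0 \<le> y mod int k" "y mod int k < int k" using k by simp_all
  ultimately have lt: "y mod int k + 1 < int k" by linarith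
  have "y + 1 = int k * (y div int k) + (y mod int k + 1)" by simp
  then have "(y + 1) mod int k = y mod int k + 1" "(y + 1) div int k = y div int k"
   using lt i int_mod_pos_eq[of "y + 1" "int k" "y div int k" "y mod int k + 1"]
    int_div_pos_eq[of "y + 1" "int k" "y div int k" "y mod int k + 1"] by simp_all
  then show ?thesis unfolding cz Let_def by auto
 qed
 have c1: "c \<in> tetra 1 k" unfolding c_def by (rule tetra_word_in_tetra[OF k])
 show ?thesis
 proof (cases "s = 1")
  case True
  then show ?thesis using c1 no by blast
 next
  case False
  then have "(\<lambda>y. c (-1 - y)) \<in> tetra s k" using tetra_reverse[OF c1] s by simp
  moreover have "\<forall>y. \<not> (c (-1 - y) = 0 \<and> c (-1 - (y + 1)) = 0)"
  proof
   fix y show "\<not> (c (-1 - y) = 0 \<and> c (-1 - (y + 1)) = 0)"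
    using no[of "-1 - (y + 1)"] by auto
  qed
  ultimately show ?thesis
   by (intro bexI[where P = "\<lambda>c. \<forall>y. \<not> (c y = 0 \<and> c (y + 1) = 0)" and x = "\<lambda>y. c (-1 - y)"])
 qed
qed

section \<open>Permutations of $\mathbb{Z}_3 \times \mathbb{Z}_r$\<close>

text \<open>In a finite group the inverse of an element is one of its powers.\<close>

lemma (in group) finite_closed_subgroup:
 assumes "finite (carrier G)" "H \<subseteq> carrier G" "\<one> \<in> H" "\<And>x y. x \<in> H \<Longrightarrow> y \<in> H \<Longrightarrow> x \<otimes> y \<in> H"
 shows "subgroup H G"
proof (rule subgroupI)
 fix x assume x: "x \<in> H"
 then have xc: "x \<in> carrier G" using assms(2) by blast
 have pow: "x [^] n \<in> H" for n :: nat by (induction n) (use assms(3,4) x in simp_all)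
 obtain n where "ord x = Suc n" using ord_ge_1[OF assms(1) xc] by (cases "ord x") auto
 then have "x [^] n \<otimes> x = \<one>" using pow_ord_eq_1[OF xc] by simp
 then have "inv x = x [^] n" using inv_equality[of "x [^] n" x] xc by simp
 then show "inv x \<in> H" using pow by simp
qed (use assms in auto)

lemma hom_image_subgroup:
 assumes "group S" "group S'" and G: "subgroup G S" and F: "\<And>g. g \<in> G \<Longrightarrow> F g \<in> carrier S'"
  and mult: "\<And>g h. g \<in> G \<Longrightarrow> h \<in> G \<Longrightarrow> F (g \<otimes>\<^bsub>S\<^esub> h) = F g \<otimes>\<^bsub>S'\<^esub> F h"
 shows "subgroup (F ` G) S'" "F \<one>\<^bsub>S\<^esub> = \<one>\<^bsub>S'\<^esub>"
proof -
 interpret S: group S by (rule assms)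
 interpret S': group S' by (rule assms)
 interpret Gg: group "S\<lparr>carrier := G\<rparr>" by (rule S.subgroup_imp_group[OF G])
 interpret h: group_hom "S\<lparr>carrier := G\<rparr>" S' F
  by unfold_locales (use F mult in \<open>auto simp: hom_def\<close>)
 show "subgroup (F ` G) S'" using h.img_is_subgroup by simp
 show "F \<one>\<^bsub>S\<^esub> = \<one>\<^bsub>S'\<^esub>" using h.hom_one by simp
qed

lemma (in group) conj_group_hom: "g \<in> carrier G \<Longrightarrow> group_hom G G (\<lambda>x. g \<otimes> x \<otimes> inv g)"
 by unfold_locales (auto simp: hom_def m_assoc inv_solve_left)

lemma finite_Bij: "finite V \<Longrightarrow> finite (Bij V)"
proof -
 assume V: "finite V"
 have "Bij V \<subseteq> V \<rightarrow>\<^sub>E V" by (auto simp: Bij_def PiE_def dest: bij_betwE)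
 then show ?thesis using finite_PiE[of V "\<lambda>_. V"] V finite_subset by blast
qed

lemma carrier_BijGroup: "carrier (BijGroup V) = Bij V"
 by (simp add: BijGroup_def)

lemma BijGroup_mult_apply: "g \<in> Bij V \<Longrightarrow> h \<in> Bij V \<Longrightarrow> p \<in> V \<Longrightarrow> (g \<otimes>\<^bsub>BijGroup V\<^esub> h) p = g (h p)"
 by (simp add: BijGroup_def compose_eq)

lemma BijGroup_one_apply: "p \<in> V \<Longrightarrow> \<one>\<^bsub>BijGroup V\<^esub> p = p"
 by (simp add: BijGroup_def)

lemma Bij_apply_closed: "g \<in> Bij V \<Longrightarrow> p \<in> V \<Longrightarrow> g p \<in> V"
 by (auto simp: Bij_def dest: bij_betwE)

lemma Bij_eqI: "g \<in> Bij V \<Longrightarrow> h \<in> Bij V \<Longrightarrow> (\<And>p. p \<in> V \<Longrightarrow> g p = h p) \<Longrightarrow> g = h"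
 by (rule extensionalityI[of _ V]) (auto simp: Bij_def)

lemma Bij_inj: "g \<in> Bij V \<Longrightarrow> p \<in> V \<Longrightarrow> q \<in> V \<Longrightarrow> g p = g q \<Longrightarrow> p = q"
 by (auto simp: Bij_def bij_betw_def dest: inj_onD)

lemma BijGroup_inv_apply:
 assumes "g \<in> Bij V" "p \<in> V"
 shows "(inv\<^bsub>BijGroup V\<^esub> g) (g p) = p" "g ((inv\<^bsub>BijGroup V\<^esub> g) p) = p" "(inv\<^bsub>BijGroup V\<^esub> g) p \<in> V"
proof -
 interpret group "BijGroup V" by (rule group_BijGroup)
 have i: "inv\<^bsub>BijGroup V\<^esub> g \<in> Bij V" using inv_closed[of g] assms by (simp add: carrier_BijGroup)
 then show "(inv\<^bsub>BijGroup V\<^esub> g) p \<in> V" using assms Bij_apply_closed by metis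
 show "(inv\<^bsub>BijGroup V\<^esub> g) (g p) = p" "g ((inv\<^bsub>BijGroup V\<^esub> g) p) = p"
  using assms i l_inv[of g] r_inv[of g] BijGroup_mult_apply[OF i assms(1), of p]
   BijGroup_mult_apply[OF assms(1) i, of p] BijGroup_one_apply[of p V]
  by (simp_all add: carrier_BijGroup)
qed

lemma Bij_finiteI:
 assumes "finite V" "g \<in> extensional V" "\<And>p. p \<in> V \<Longrightarrow> g p \<in> V" "inj_on g V"
 shows "g \<in> Bij V"
proof -
 have "g ` V = V" using assms by (intro card_subset_eq) (auto simp: card_image)
 then show ?thesis using assms by (auto simp: Bij_def bij_betw_def)
qed

lemma mod3_add_cancel:
 assumes "0 \<le> x" "x < 3" "0 \<le> x'" "x' < 3" "(x + c) mod 3 = (x' + c) mod (3::int)"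
 shows "x = x'"
proof -
 have "(x + c - c) mod 3 = (x' + c - c) mod 3" using assms(5) by (rule mod_diff_cong) simp
 then show ?thesis using assms by simp
qed

lemma mod3_minus_cancel:
 assumes "0 \<le> x" "x < 3" "0 \<le> x'" "x' < 3" "(- x) mod 3 = (- x') mod (3::int)"
 shows "x = x'"
 using mod_minus_cong[OF assms(5)] assms by simp

lemma PXV_iff: "(x, y) \<in> PXV r \<longleftrightarrow> 0 \<le> x \<and> x < 3 \<and> 0 \<le> y \<and> y < int r"
 by (auto simp: PXV_def Zmod_def)

lemma finite_PXV: "finite (PXV r)"
 by (simp add: PXV_def Zmod_def)

lemma SymV_eqI:
 "g \<in> Bij (PXV r) \<Longrightarrow> h \<in> Bij (PXV r) \<Longrightarrow> (\<And>x y. (x, y) \<in> PXV r \<Longrightarrow> g (x, y) = h (x, y)) \<Longrightarrow> g = h"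
 by (rule Bij_eqI) auto

lemma finite_SymV: "finite (carrier (SymV r))"
 by (simp add: carrier_BijGroup finite_Bij[OF finite_PXV])

definition transl :: "nat \<Rightarrow> (int \<Rightarrow> int) \<Rightarrow> int \<times> int \<Rightarrow> int \<times> int" where
 "transl r c = restrict (\<lambda>(x, y). ((x + c y) mod 3, y)) (PXV r)"

definition sgnp :: "nat \<Rightarrow> (int \<Rightarrow> int) \<Rightarrow> int \<times> int \<Rightarrow> int \<times> int" where
 "sgnp r e = restrict (\<lambda>(x, y). ((e y * x) mod 3, y)) (PXV r)"

definition signs :: "nat \<Rightarrow> (int \<Rightarrow> int) set" where
 "signs r = {e. \<forall>y. 0 \<le> y \<and> y < int r \<longrightarrow> e y = 1 \<or> e y = -1}"

lemma transl_apply: "(x, y) \<in> PXV r \<Longrightarrow> transl r c (x, y) = ((x + c y) mod 3, y)"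
 by (simp add: transl_def)

lemma sgnp_apply: "(x, y) \<in> PXV r \<Longrightarrow> sgnp r e (x, y) = ((e y * x) mod 3, y)"
 by (simp add: sgnp_def)

lemma transl_cube: "(x, y) \<in> PXV r \<Longrightarrow> transl r c (transl r c (transl r c (x, y))) = (x, y)"
proof -
 assume p: "(x, y) \<in> PXV r"
 then have "((x + c y) mod 3, y) \<in> PXV r" "(((x + c y) mod 3 + c y) mod 3, y) \<in> PXV r" by (auto simp: PXV_iff)
 moreover have "(((x + c y) mod 3 + c y) mod 3 + c y) mod 3 = (x + 3 * c y) mod 3"
  by (simp only: mod_add_left_eq) (simp add: algebra_simps)
 moreover have "(x + 3 * c y) mod 3 = x" using p by (simp add: PXV_iff)
 ultimately show ?thesis using p by (simp only: transl_apply)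
qed

lemma transl_Bij: "transl r c \<in> Bij (PXV r)"
proof (rule Bij_finiteI[OF finite_PXV])
 show "inj_on (transl r c) (PXV r)"
 proof (rule inj_onI)
  fix p q assume pq: "p \<in> PXV r" "q \<in> PXV r" "transl r c p = transl r c q"
  obtain x y where p: "p = (x, y)" by (cases p)
  obtain x' y' where q: "q = (x', y')" by (cases q)
  have "y = y'" "(x + c y) mod 3 = (x' + c y) mod 3" using pq by (auto simp: p q transl_apply)
  moreover have "0 \<le> x" "x < 3" "0 \<le> x'" "x' < 3" using pq by (auto simp: p q PXV_iff)
  ultimately have "x = x'" using mod3_add_cancel by blast
  then show "p = q" using \<open>y = y'\<close> by (simp add: p q)
 qed
qed (auto simp: transl_def PXV_iff)

lemma sgnp_Bij: "e \<in> signs r \<Longrightarrow> sgnp r e \<in> Bij (PXV r)"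
proof (rule Bij_finiteI[OF finite_PXV])
 assume e: "e \<in> signs r"
 show "inj_on (sgnp r e) (PXV r)"
 proof (rule inj_onI)
  fix p q assume pq: "p \<in> PXV r" "q \<in> PXV r" "sgnp r e p = sgnp r e q"
  obtain x y where p: "p = (x, y)" by (cases p)
  obtain x' y' where q: "q = (x', y')" by (cases q)
  have "y = y'" "(e y * x) mod 3 = (e y * x') mod 3" using pq by (auto simp: p q sgnp_apply)
  moreover have "0 \<le> x" "x < 3" "0 \<le> x'" "x' < 3" "e y = 1 \<or> e y = -1" using pq e by (auto simp: p q PXV_iff signs_def)
  ultimately have "x = x'" using mod3_minus_cancel[of x x'] by auto
  then show "p = q" using \<open>y = y'\<close> by (simp add: p q)
 qed
qed (auto simp: sgnp_def PXV_iff)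

lemma sigma_apply: "(x, y) \<in> PXV r \<Longrightarrow> sigma r (x, y) = (x, (y + 1) mod int r)"
 by (simp add: sigma_def)

lemma sigma_Bij: "r > 0 \<Longrightarrow> sigma r \<in> Bij (PXV r)"
proof (rule Bij_finiteI[OF finite_PXV])
 assume r: "r > 0"
 show "inj_on (sigma r) (PXV r)"
 proof (rule inj_onI)
  fix p q assume pq: "p \<in> PXV r" "q \<in> PXV r" "sigma r p = sigma r q"
  obtain u v u' v' where [simp]: "p = (u, v)" "q = (u', v')" by (cases p, cases q)
  have "u = u'" "(v + 1) mod int r = (v' + 1) mod int r" using pq sigma_apply by auto
  moreover have "(v + 1 - 1) mod int r = (v' + 1 - 1) mod int r" using calculation(2) by (metis mod_diff_left_eq)
  ultimately show "p = q" using pq by (auto simp: PXV_iff)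
 qed
 show "sigma r p \<in> PXV r" if "p \<in> PXV r" for p
  using that r by (cases p) (auto simp: sigma_apply PXV_iff)
qed (simp add: sigma_def)

lemma alpha_eq: "alpha r = sgnp r (\<lambda>y. if y = int r - 1 then -1 else 1)"
 unfolding alpha_def tuple_def wreath_elt_def sgnp_def
proof (rule restrict_ext, clarify)
 fix x y assume p: "(x, y) \<in> PXV r"
 have "(replicate (r - 1) \<one>\<^bsub>BijGroup (Zmod 3)\<^esub> @ [neg3]) ! nat y = (if y = int r - 1 then neg3 else \<one>\<^bsub>BijGroup (Zmod 3)\<^esub>)"
  using p by (auto simp: PXV_iff nth_append)
 then show "((replicate (r - 1) \<one>\<^bsub>BijGroup (Zmod 3)\<^esub> @ [neg3]) ! nat y) x = ((if y = int r - 1 then -1 else 1) * x) mod 3 \<and>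
   (\<lambda>y\<in>Zmod r. y) y = y"
  using p by (auto simp: neg3_def BijGroup_def PXV_iff Zmod_def)
qed

lemma rho_apply:
 assumes p: "(x, y) \<in> PXV r"
 shows "rho r (x, y) = (if y = int r - 1 then (- x) mod 3 else x, (y + 1) mod int r)"
  and "rho r \<in> Bij (PXV r)"
proof -
 have r: "r > 0" using p by (auto simp: PXV_iff)
 have al: "alpha r (u, v) = (if v = int r - 1 then (- u) mod 3 else u, v)" if "(u, v) \<in> PXV r" for u v
  using that by (simp add: alpha_eq sgnp_apply) (simp add: PXV_iff)
 have alB: "alpha r \<in> Bij (PXV r)" unfolding alpha_eq by (rule sgnp_Bij) (simp add: signs_def)
 note siB = sigma_Bij[OF r]
 show "rho r (x, y) = (if y = int r - 1 then (- x) mod 3 else x, (y + 1) mod int r)"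
  using p al[OF p] unfolding rho_def by (simp add: BijGroup_mult_apply[OF siB alB p]) (auto simp: PXV_iff sigma_apply)
 show "rho r \<in> Bij (PXV r)" unfolding rho_def
  using monoid.m_closed[OF group.is_monoid[OF group_BijGroup]] alB siB by (metis carrier_BijGroup)
qed

lemma neg3_group: "generate (BijGroup (Zmod 3)) {neg3} = {\<one>\<^bsub>BijGroup (Zmod 3)\<^esub>, neg3}"
proof -
 let ?G = "BijGroup (Zmod 3)"
 interpret group ?G by (rule group_BijGroup)
 have nB: "neg3 \<in> Bij (Zmod 3)"
 proof (rule Bij_finiteI)
  show "inj_on neg3 (Zmod 3)"
  proof (rule inj_onI)
   fix x y assume "x \<in> Zmod 3" "y \<in> Zmod 3" "neg3 x = neg3 y"
   then show "x = y" using mod3_minus_cancel[of x y] by (auto simp: neg3_def Zmod_def)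
  qed
 qed (auto simp: neg3_def Zmod_def)
 have nn: "neg3 \<otimes>\<^bsub>?G\<^esub> neg3 = \<one>\<^bsub>?G\<^esub>"
 proof (rule Bij_eqI)
  show "neg3 \<otimes>\<^bsub>?G\<^esub> neg3 \<in> Bij (Zmod 3)" using m_closed[of neg3 neg3] nB by (simp add: carrier_BijGroup)
  show "\<one>\<^bsub>?G\<^esub> \<in> Bij (Zmod 3)" using one_closed by (simp add: carrier_BijGroup)
  show "(neg3 \<otimes>\<^bsub>?G\<^esub> neg3) p = \<one>\<^bsub>?G\<^esub> p" if "p \<in> Zmod 3" for p
   using that by (simp add: BijGroup_mult_apply[OF nB nB] BijGroup_one_apply) (auto simp: neg3_def Zmod_def mod_minus_eq)
 qed
 have nc: "neg3 \<in> carrier (?G)" using nB by (simp add: carrier_BijGroup)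
 have ni: "inv\<^bsub>?G\<^esub> neg3 = neg3" using inv_equality[OF nn nc nc] .
 show ?thesis
 proof
  show "generate (?G) {neg3} \<subseteq> {\<one>\<^bsub>?G\<^esub>, neg3}"
  proof
   fix x assume "x \<in> generate (?G) {neg3}"
   then show "x \<in> {\<one>\<^bsub>?G\<^esub>, neg3}"
    by induction (use nn nc ni in auto)
  qed
 qed (auto intro: generate.one generate.incl)
qed

section \<open>Groups containing $\rho$ and their translation codes\<close>

lemma three_cases: "0 \<le> x \<Longrightarrow> x < 3 \<Longrightarrow> x = 0 \<or> x = 1 \<or> x = (2::int)"
 by linarith

text \<open>The symmetric group of degree three is the affine group of the field with three elements.\<close>

lemma perm3_affine:
 fixes f :: "int \<Rightarrow> int"
 assumes "\<And>x. 0 \<le> x \<Longrightarrow> x < 3 \<Longrightarrow> 0 \<le> f x \<and> f x < 3" "inj_on f {0..<3}" "0 \<le> x" "x < 3"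
 shows "f x = ((if f 1 = (1 + f 0) mod 3 then 1 else -1) * x + f 0) mod 3"
proof -
 have r: "f 0 \<in> {0,1,2}" "f 1 \<in> {0,1,2}" "f 2 \<in> {0,1,2}"
  using assms(1)[of 0] assms(1)[of 1] assms(1)[of 2] three_cases by auto
 have d: "f 0 \<noteq> f 1" "f 0 \<noteq> f 2" "f 1 \<noteq> f 2"
  using inj_onD[OF assms(2), of 0 1] inj_onD[OF assms(2), of 0 2] inj_onD[OF assms(2), of 1 2] by auto
 show ?thesis using three_cases[OF assms(3,4)] r d by auto
qed

text \<open>On each block, a permutation that preserves the blocks is an affine map of \<open>\<int>\<^sub>3\<close>; this is its linear coefficient.\<close>

definition sign_part :: "(int \<times> int \<Rightarrow> int \<times> int) \<Rightarrow> int \<Rightarrow> int" where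
 "sign_part b y = (if fst (b (1, y)) = (1 + fst (b (0, y))) mod 3 then 1 else -1)"

lemma block_permutation:
 assumes b: "b \<in> Bij (PXV r)" and pres: "\<And>p. p \<in> PXV r \<Longrightarrow> snd (b p) = snd p" and xy: "(x, y) \<in> PXV r"
 shows "b (x, y) = ((sign_part b y * x + fst (b (0, y))) mod 3, y)"
proof -
 have in_P: "(x, y) \<in> PXV r" if "0 \<le> x" "x < 3" for x using that xy by (simp add: PXV_iff)
 have sndb: "b (x, y) = (fst (b (x, y)), y)" if "0 \<le> x" "x < 3" for x
  using pres[OF in_P[OF that]] by (simp add: prod_eq_iff)
 have "0 \<le> fst (b (x, y)) \<and> fst (b (x, y)) < 3" if "0 \<le> x" "x < 3" for x
  using Bij_apply_closed[OF b in_P[OF that]] by (cases "b (x, y)") (simp add: PXV_iff)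
 moreover have "inj_on (\<lambda>x. fst (b (x, y))) {0..<3}"
 proof (rule inj_onI)
  fix u v assume "u \<in> {0..<3}" "v \<in> {0..<3}" "fst (b (u, y)) = fst (b (v, y))"
  then show "u = v" using Bij_inj[OF b in_P[of u] in_P[of v]] sndb[of u] sndb[of v] by simp
 qed
 ultimately have "fst (b (x, y)) = (sign_part b y * x + fst (b (0, y))) mod 3"
  unfolding sign_part_def by (rule perm3_affine[where f = "\<lambda>x. fst (b (x, y))"]) (use xy in \<open>auto simp: PXV_iff\<close>)
 moreover have "snd (b (x, y)) = y" using pres[OF xy] by simp
 ultimately show ?thesis by (simp add: prod_eq_iff)
qed

text \<open>An affine map \<open>x \<mapsto> c - x\<close> of \<open>\<int>\<^sub>3\<close> is an involution with exactly one fixed point, so its cube is not the identity.\<close>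

lemma order_three_translation:
 assumes t: "t \<in> Bij (PXV r)" and t3: "\<And>q. q \<in> PXV r \<Longrightarrow> t (t (t q)) = q"
  and pres: "\<And>q. q \<in> PXV r \<Longrightarrow> snd (t q) = snd q"
 shows "t = transl r (\<lambda>y. fst (t (0, y)))"
proof (rule Bij_eqI[OF t transl_Bij])
 fix p assume p: "p \<in> PXV r"
 obtain x y where xy: "p = (x, y)" by (cases p)
 define c where "c = fst (t (0, y))"
 have t_eq: "t (x, y) = ((sign_part t y * x + c) mod 3, y)" if "0 \<le> x" "x < 3" for x
  unfolding c_def by (rule block_permutation[OF t pres]) (use p xy that in \<open>auto simp: PXV_iff\<close>)
 have "sign_part t y = 1"
 proof (rule ccontr)
  assume "sign_part t y \<noteq> 1"
  then have tx: "t (x, y) = ((c - x) mod 3, y)" if "0 \<le> x" "x < 3" for x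
   using t_eq[OF that] by (simp add: sign_part_def split: if_splits)
  have "t (t (x, y)) = (x, y)" if x: "0 \<le> x" "x < 3" for x
   using tx[OF x] tx[of "(c - x) mod 3"] x by (simp add: mod_diff_right_eq)
  then have "t (x, y) = (x, y)" if x: "0 \<le> x" "x < 3" for x
   using t3[of "(x, y)"] x p xy by (simp add: PXV_iff)
  then have "(c - 0) mod 3 = 0" "(c - 1) mod 3 = 1" using tx[of 0] tx[of 1] by simp_all
  then show False by presburger
 qed
 then have "t (x, y) = ((x + c) mod 3, y)" using t_eq[of x] p xy by (simp add: PXV_iff)
 then show "t p = transl r (\<lambda>y. fst (t (0, y))) p" using p unfolding xy c_def by (simp only: transl_apply)
qed

lemma transl_sgnp_apply:
 assumes e: "e \<in> signs r" and p: "(x, y) \<in> PXV r"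
 shows "(transl r c \<otimes>\<^bsub>SymV r\<^esub> sgnp r e) (x, y) = ((e y * x + c y) mod 3, y)"
proof -
 have "((e y * x) mod 3, y) \<in> PXV r" using p by (auto simp: PXV_iff)
 then show ?thesis using p
  by (simp add: BijGroup_mult_apply[OF transl_Bij sgnp_Bij[OF e]] sgnp_apply transl_apply mod_add_left_eq)
qed

text \<open>Going once around the blocks changes the sign of the first coordinate, hence the parity of the number of turns.\<close>

lemma rho_pow:
 assumes r: "r > 0"
 shows "rho r [^]\<^bsub>SymV r\<^esub> (n::nat) \<in> Bij (PXV r)"
  and "(x, y) \<in> PXV r \<Longrightarrow> (rho r [^]\<^bsub>SymV r\<^esub> n) (x, y) =
   (if even ((y + int n) div int r) then x else (- x) mod 3, (y + int n) mod int r)"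
proof -
 interpret group "SymV r" by (rule group_BijGroup)
 have rB: "rho r \<in> Bij (PXV r)" using rho_apply(2)[of 0 0 r] r by (simp add: PXV_iff)
 show B: "rho r [^]\<^bsub>SymV r\<^esub> (n::nat) \<in> Bij (PXV r)" for n
  using nat_pow_closed[of "rho r" n] rB by (simp add: carrier_BijGroup)
 show "(x, y) \<in> PXV r \<Longrightarrow> (rho r [^]\<^bsub>SymV r\<^esub> n) (x, y) =
   (if even ((y + int n) div int r) then x else (- x) mod 3, (y + int n) mod int r)" for n
 proof (induction n arbitrary: x y)
  case 0
  then show ?case by (simp add: BijGroup_one_apply) (auto simp: PXV_iff)
 next
  case (Suc n)
  have xy: "0 \<le> x" "x < 3" "0 \<le> y" "y < int r" using Suc.prems by (auto simp: PXV_iff)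
  have "(rho r [^]\<^bsub>SymV r\<^esub> Suc n) (x, y) = (rho r [^]\<^bsub>SymV r\<^esub> n) (rho r (x, y))"
   using BijGroup_mult_apply[OF B rB Suc.prems] by simp
  also have "\<dots> = (if even ((y + int (Suc n)) div int r) then x else (- x) mod 3, (y + int (Suc n)) mod int r)"
  proof (cases "y = int r - 1")
   case True
   have p: "((- x) mod 3, 0) \<in> PXV r" using r by (simp add: PXV_iff)
   have e: "y + int (Suc n) = int n + int r" using True by simp
   have d: "(int n + int r) div int r = int n div int r + 1" using r by (simp add: div_add_self2)
   have m: "(- ((- x) mod 3)) mod 3 = x" using xy by (simp add: mod_minus_eq)
   have "rho r (x, y) = ((- x) mod 3, 0)" using rho_apply(1)[OF Suc.prems] True by simp
   then show ?thesis unfolding e d using Suc.IH[OF p] m by simp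
  next
   case False
   then have "(y + 1) mod int r = y + 1" "(x, y + 1) \<in> PXV r" using xy by (auto simp: PXV_iff)
   then show ?thesis using False Suc.IH[of x "y + 1"] by (simp add: rho_apply[OF Suc.prems] algebra_simps)
  qed
  finally show ?case .
 qed
qed

text \<open>The continuation of an arbitrary integer tuple to a word; only the entries at \<open>0, \<dots>, r - 1\<close> and only their residues
 matter.\<close>

definition extend :: "nat \<Rightarrow> (int \<Rightarrow> int) \<Rightarrow> int \<Rightarrow> int" where
 "extend r c y = (if even (y div int r) then c (y mod int r) else - c (y mod int r)) mod 3"

lemma extend_nwords: "r > 0 \<Longrightarrow> extend r c \<in> nwords r"
 by (auto simp: nwords_def extend_def div_add_self2 mod_minus_eq)

lemma extend_eq: "0 \<le> y \<Longrightarrow> y < int r \<Longrightarrow> extend r c y = c y mod 3"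
 by (simp add: extend_def)

lemma transl_eqI: "(\<And>y. 0 \<le> y \<Longrightarrow> y < int r \<Longrightarrow> c y mod 3 = d y mod 3) \<Longrightarrow> transl r c = transl r d"
proof -
 assume h: "\<And>y. 0 \<le> y \<Longrightarrow> y < int r \<Longrightarrow> c y mod 3 = d y mod 3"
 have "transl r c p = transl r d p" for p
 proof (cases p)
  case (Pair x y)
  show ?thesis
  proof (cases "(x, y) \<in> PXV r")
   case True
   then have "c y mod 3 = d y mod 3" using h by (simp add: PXV_iff)
   then have "(x + c y) mod 3 = (x + d y) mod 3" by (intro mod_add_cong) simp_all
   then show ?thesis using True by (simp add: Pair transl_apply)
  qed (simp add: Pair transl_def)
 qed
 then show ?thesis by auto
qed

text \<open>The situation of a group without semiregular elements after coordinates have been chosen in which it contains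
 \<open>rho\<close>. A translation without zero coordinates would be semiregular, which explains the condition \<open>zero\<close>.\<close>

locale rho_group =
 fixes r a :: nat and K :: "(int \<times> int \<Rightarrow> int \<times> int) set"
 assumes r_def: "r = 2 ^ a"
  and K: "subgroup K (SymV r)"
  and rho_K: "rho r \<in> K"
  and rotates: "\<And>g. g \<in> K \<Longrightarrow> \<exists>j. \<forall>x y. (x, y) \<in> PXV r \<longrightarrow> snd (g (x, y)) = (y + j) mod int r"
  and zero: "\<And>c. transl r c \<in> K \<Longrightarrow> \<exists>y. 0 \<le> y \<and> y < int r \<and> c y mod 3 = 0"
  and nontrivial: "\<exists>c. transl r c \<in> K \<and> transl r c \<noteq> \<one>\<^bsub>SymV r\<^esub>"
begin

abbreviation "S \<equiv> SymV r"

abbreviation S_mult (infixl "\<cdot>" 70) where "g \<cdot> h \<equiv> g \<otimes>\<^bsub>S\<^esub> h"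
abbreviation S_pow (infixr "\<up>" 75) where "g \<up> (n::nat) \<equiv> g [^]\<^bsub>S\<^esub> n"
abbreviation iv where "iv g \<equiv> inv\<^bsub>S\<^esub> g"
abbreviation id\<^sub>S where "id\<^sub>S \<equiv> \<one>\<^bsub>S\<^esub>"

sublocale S: group S by (rule group_BijGroup)

lemma r_pos: "r > 0" by (simp add: r_def)

lemma KB: "g \<in> K \<Longrightarrow> g \<in> Bij (PXV r)" using subgroup.subset[OF K] by (auto simp: carrier_BijGroup)

lemma K_mult: "g \<in> K \<Longrightarrow> h \<in> K \<Longrightarrow> g \<cdot> h \<in> K" by (rule subgroup.m_closed[OF K])
lemma K_inv: "g \<in> K \<Longrightarrow> iv g \<in> K" by (rule subgroup.m_inv_closed[OF K])
lemma K_one: "id\<^sub>S \<in> K" by (rule subgroup.one_closed[OF K])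

lemma mult_apply: "g \<in> Bij (PXV r) \<Longrightarrow> h \<in> Bij (PXV r) \<Longrightarrow> p \<in> PXV r \<Longrightarrow> (g \<cdot> h) p = g (h p)"
 by (rule BijGroup_mult_apply)

lemma mult_Bij: "g \<in> Bij (PXV r) \<Longrightarrow> h \<in> Bij (PXV r) \<Longrightarrow> g \<cdot> h \<in> Bij (PXV r)"
 using S.m_closed by (simp add: carrier_BijGroup)

lemma inv_Bij: "g \<in> Bij (PXV r) \<Longrightarrow> iv g \<in> Bij (PXV r)"
 using S.inv_closed by (simp add: carrier_BijGroup)

lemma one_Bij: "id\<^sub>S \<in> Bij (PXV r)"
 using S.one_closed by (simp add: carrier_BijGroup)

lemma transl_mult: "transl r c \<cdot> transl r d = transl r (\<lambda>y. c y + d y)"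
proof (rule SymV_eqI)
 fix x y assume p: "(x, y) \<in> PXV r"
 have "((x + d y) mod 3 + c y) mod 3 = (x + (c y + d y)) mod 3"
  by (simp only: mod_add_left_eq) (simp add: algebra_simps)
 moreover have "((x + d y) mod 3, y) \<in> PXV r" using p by (auto simp: PXV_iff)
 ultimately show "(transl r c \<cdot> transl r d) (x, y) = transl r (\<lambda>y. c y + d y) (x, y)"
  using p by (simp add: mult_apply[OF transl_Bij transl_Bij] transl_apply)
qed (auto intro: mult_Bij transl_Bij)

lemma transl_wadd: "transl r c \<cdot> transl r d = transl r (wadd c d)"
 unfolding transl_mult by (rule transl_eqI) (simp add: wadd_def)

lemma transl_zero: "transl r c = id\<^sub>S \<longleftrightarrow> (\<forall>y. 0 \<le> y \<and> y < int r \<longrightarrow> c y mod 3 = 0)"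
proof
 assume e: "transl r c = id\<^sub>S"
 show "\<forall>y. 0 \<le> y \<and> y < int r \<longrightarrow> c y mod 3 = 0"
 proof (intro allI impI)
  fix y assume "0 \<le> y \<and> y < int r"
  then have "(0, y) \<in> PXV r" by (simp add: PXV_iff)
  then show "c y mod 3 = 0" using fun_cong[OF e, of "(0, y)"] by (simp add: transl_apply BijGroup_one_apply)
 qed
next
 assume h: "\<forall>y. 0 \<le> y \<and> y < int r \<longrightarrow> c y mod 3 = 0"
 show "transl r c = id\<^sub>S"
 proof (rule SymV_eqI[OF transl_Bij one_Bij])
  fix x y assume p: "(x, y) \<in> PXV r"
  have "(x + c y) mod 3 = (x + 0) mod 3" using h p by (intro mod_add_cong) (auto simp: PXV_iff)
  then show "transl r c (x, y) = id\<^sub>S (x, y)" using p by (simp add: transl_apply BijGroup_one_apply) (auto simp: PXV_iff)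
 qed
qed

lemma rhoB: "rho r \<in> Bij (PXV r)" using KB rho_K by blast

lemma rho_trans:
 assumes c: "c \<in> nwords r"
 shows "transl r c \<cdot> rho r = rho r \<cdot> transl r (\<lambda>y. c (y + 1))"
proof (rule SymV_eqI)
 fix x y assume p: "(x, y) \<in> PXV r"
 have xy: "0 \<le> x" "x < 3" "0 \<le> y" "y < int r" using p by (auto simp: PXV_iff)
 have q: "((x + c (y + 1)) mod 3, y) \<in> PXV r" using xy by (simp add: PXV_iff)
 have rp: "rho r (x, y) \<in> PXV r" using Bij_apply_closed[OF rhoB p] .
 show "(transl r c \<cdot> rho r) (x, y) = (rho r \<cdot> transl r (\<lambda>y. c (y + 1))) (x, y)"
 proof (cases "y = int r - 1")
  case True
  have "c (y + 1) = (- c 0) mod 3" using nwordsD(3)[OF c, of 0] True by simp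
  then have "(- ((x + c (y + 1)) mod 3)) mod 3 = ((- x) mod 3 + c 0) mod 3"
   by (simp add: mod_minus_eq mod_add_left_eq mod_add_right_eq mod_diff_right_eq)
  then show ?thesis using True p q rp xy
   by (simp add: mult_apply[OF transl_Bij rhoB] mult_apply[OF rhoB transl_Bij] transl_apply rho_apply)
 next
  case False
  then have "(y + 1) mod int r = y + 1" using xy by simp
  then show ?thesis using False p q rp xy
   by (simp add: mult_apply[OF transl_Bij rhoB] mult_apply[OF rhoB transl_Bij] transl_apply rho_apply)
 qed
qed (auto intro: mult_Bij transl_Bij rhoB)

lemma subgroup_words:
 assumes M: "subgroup M S" and inv: "\<And>m. m \<in> M \<Longrightarrow> iv (rho r) \<cdot> (m \<cdot> rho r) \<in> M"
 shows "negacyclic_code r {c \<in> nwords r. transl r c \<in> M}"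
 unfolding negacyclic_code_def
proof (intro conjI ballI)
 note D = negacyclic_codeD[OF negacyclic_nwords[of r]]
 let ?U = "{c \<in> nwords r. transl r c \<in> M}"
 show "?U \<subseteq> nwords r" by auto
 have "transl r (\<lambda>_. 0) = id\<^sub>S" by (simp add: transl_zero)
 then show "(\<lambda>_. 0) \<in> ?U" using subgroup.one_closed[OF M] by (simp add: nwords_def)
 show "wadd c d \<in> ?U" if "c \<in> ?U" "d \<in> ?U" for c d
  using that subgroup.m_closed[OF M, of "transl r c" "transl r d"] D(3) by (simp add: transl_wadd)
 fix c assume "c \<in> ?U"
 then have cw: "c \<in> nwords r" "transl r c \<in> M" by auto
 have "iv (rho r) \<cdot> (transl r c \<cdot> rho r) \<in> M" using inv cw by blast
 then have "transl r (\<lambda>y. c (y + 1)) \<in> M"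
  using transl_Bij rhoB by (simp add: rho_trans[OF cw(1)] carrier_BijGroup)
 then show "(\<lambda>y. c (y + 1)) \<in> ?U" using D(4)[OF cw(1)] by simp
qed

text \<open>The translations in the group, as continued words. They determine the group up to sign changes and powers of \<open>rho\<close>.\<close>

definition code :: "(int \<Rightarrow> int) set" where
 "code = {c \<in> nwords r. transl r c \<in> K}"

lemma code_negacyclic: "negacyclic_code r code"
 unfolding code_def by (rule subgroup_words[OF K]) (intro K_mult K_inv rho_K)

lemma code_nontrivial: "code \<noteq> {\<lambda>_. 0}"
proof
 assume triv: "code = {\<lambda>_. 0}"
 obtain c where c: "transl r c \<in> K" "transl r c \<noteq> id\<^sub>S" using nontrivial by blast
 have "transl r (extend r c) = transl r c" by (rule transl_eqI) (simp add: extend_eq)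
 then have "extend r c \<in> code" using c extend_nwords[OF r_pos] by (simp add: code_def)
 then have "extend r c = (\<lambda>_. 0)" using triv by auto
 then have "c y mod 3 = 0" if "0 \<le> y" "y < int r" for y using extend_eq[OF that, of c] by simp
 then show False using c(2) transl_zero by blast
qed

lemma code_zero: "c \<in> code \<Longrightarrow> \<exists>y. 0 \<le> y \<and> y < int r \<and> c y = 0"
 using zero[of c] nwordsD(4)[of c r] by (auto simp: code_def)

text \<open>For \<open>r = 1\<close> a nonzero word has no zero. For \<open>r = 2\<close> a nonzero word with a zero is one of \<open>(u, 0)\<close> and
 \<open>(0, u)\<close>, and adding its shift produces a word without zeros.\<close>

lemma a_ge_2: "a \<ge> 2"
proof (rule ccontr)
 assume "\<not> a \<ge> 2"
 then have r12: "r = 1 \<or> r = 2" by (auto simp: r_def less_2_cases_iff not_le)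
 obtain c where c: "c \<in> code" "c \<noteq> (\<lambda>_. 0)"
  using code_nontrivial negacyclic_codeD(2)[OF code_negacyclic] by blast
 then have cw: "c \<in> nwords r" by (simp add: code_def)
 show False
  using r12
 proof
  assume r1: "r = 1"
  then obtain y where "0 \<le> y" "y < 1" "c y = 0" using code_zero[OF c(1)] by auto
  moreover from this have "y = 0" by simp
  ultimately have "c 0 = 0" by simp
  moreover have "y = 0" if "0 \<le> y" "y < int r" for y using that r1 by simp
  ultimately have "c = (\<lambda>_. 0)" by (intro nwords_eqI[OF cw _ r_pos]) (auto simp: nwords_def)
  then show False using c by simp
 next
  assume r2: "r = 2"
  have small: "y = 0 \<or> y = 1" if "0 \<le> y" "y < int r" for y using that r2 by auto
  define d where "d = wadd c (\<lambda>y. c (y + 1))"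
  have d: "d \<in> code" unfolding d_def using negacyclic_codeD(3,4)[OF code_negacyclic] c by blast
  have c2: "c 2 = (- c 0) mod 3" using nwordsD(3)[OF cw, of 0] r2 by simp
  have d01: "d 0 = (c 0 + c 1) mod 3" "d 1 = (c 1 + (- c 0) mod 3) mod 3" by (simp_all add: d_def wadd_def c2)
  have "\<exists>y. 0 \<le> y \<and> y < int r \<and> d y = 0" by (rule code_zero[OF d])
  then have dz: "d 0 = 0 \<or> d 1 = 0" using small by blast
  have "\<exists>y. 0 \<le> y \<and> y < int r \<and> c y = 0" by (rule code_zero[OF c(1)])
  then have cz: "c 0 = 0 \<or> c 1 = 0" using small by blast
  have "c 0 = 0 \<and> c 1 = 0"
   using cz dz d01 nwords_cases[OF cw, of 0] nwords_cases[OF cw, of 1] by auto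
  then have "c = (\<lambda>_. 0)" using small r2 by (intro nwords_eqI[OF cw]) (auto simp: nwords_def)
  then show False using c by simp
 qed
qed

definition k :: nat where "k = r div 4"

lemma r4k: "r = 4 * k" and k_pos: "k > 0" and k_def2: "k = 2 ^ (a - 2)"
proof -
 obtain b where "a = b + 2" using a_ge_2 by (metis add.commute le_Suc_ex)
 then have "r = 4 * 2 ^ b" "a - 2 = b" by (simp_all add: r_def)
 moreover from this have "k = 2 ^ b" unfolding k_def by simp
 ultimately show "r = 4 * k" "k > 0" "k = 2 ^ (a - 2)" by simp_all
qed

theorem code_tetra: "\<exists>s\<in>{1,-1}. code = tetra s k"
proof (rule zero_meeting_code_is_tetra)
 show "4 * k = 2 ^ a" using r4k r_def by simp
 show "negacyclic_code (4 * k) code" using code_negacyclic r4k by simp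
 show "\<exists>y. c y = 0" if "c \<in> code" for c using code_zero[OF that] by blast
qed (rule code_nontrivial)

end

section \<open>Elementary abelian 2-groups and periodic sign patterns\<close>

text \<open>An elementary abelian 2-group is a vector space over the field with two elements; this identifies its dimension
 with the logarithm of its size.\<close>

locale involutive_subgroup = group G for G (structure) +
 fixes L assumes L: "subgroup L G" and finL: "finite L" and sq: "\<And>x. x \<in> L \<Longrightarrow> x \<otimes> x = \<one>"
begin

lemma L_carrier: "x \<in> L \<Longrightarrow> x \<in> carrier G" using subgroup.mem_carrier[OF L] .

lemma L_inv: "x \<in> L \<Longrightarrow> inv x = x" using sq L_carrier by (simp add: inv_equality)

lemma L_comm: "x \<in> L \<Longrightarrow> y \<in> L \<Longrightarrow> x \<otimes> y = y \<otimes> x"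
 using L_inv[of "x \<otimes> y"] L_inv[of x] L_inv[of y] subgroup.m_closed[OF L, of x y]
  inv_mult_group[of x y] L_carrier by metis

lemma L_cancel: "x \<in> L \<Longrightarrow> y \<in> carrier G \<Longrightarrow> x \<otimes> (x \<otimes> y) = y"
 using sq L_carrier by (simp add: m_assoc[symmetric])

lemma gen_L: "X \<subseteq> L \<Longrightarrow> generate G X \<subseteq> L" by (rule generate_subgroup_incl[OF _ L])

text \<open>The elements \<open>x\<close> for which \<open>x\<close> or \<open>b \<otimes> x\<close> is generated by \<open>X\<close> form a subgroup.\<close>

lemma generate_insert:
 assumes X: "X \<subseteq> L" and b: "b \<in> L"
 shows "generate G (insert b X) = generate G X \<union> (\<lambda>x. b \<otimes> x) ` generate G X"
proof -
 let ?S = "generate G X"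
 have S: "subgroup ?S G" by (rule generate_is_subgroup) (use X L_carrier in blast)
 have SL: "x \<in> L" if "x \<in> ?S" for x using gen_L[OF X] that by auto
 define U where "U = {x \<in> L. x \<in> ?S \<or> b \<otimes> x \<in> ?S}"
 have eq: "U = ?S \<union> (\<lambda>x. b \<otimes> x) ` ?S"
 proof
  show "U \<subseteq> ?S \<union> (\<lambda>x. b \<otimes> x) ` ?S" using L_cancel[OF b] L_carrier by (force simp: U_def)
  show "?S \<union> (\<lambda>x. b \<otimes> x) ` ?S \<subseteq> U"
   using SL subgroup.m_closed[OF L b] L_cancel[OF b] L_carrier by (auto simp: U_def)
 qed
 have "subgroup U G"
 proof (rule subgroupI)
  show "U \<subseteq> carrier G" "U \<noteq> {}" using L_carrier subgroup.one_closed[OF S] subgroup.one_closed[OF L] by (auto simp: U_def)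
  show "inv x \<in> U" if "x \<in> U" for x using that L_inv by (simp add: U_def)
  show "x \<otimes> y \<in> U" if "x \<in> U" "y \<in> U" for x y
  proof -
   have xy: "x \<in> L" "y \<in> L" "x \<otimes> y \<in> L" using that subgroup.m_closed[OF L] by (auto simp: U_def)
   note c = L_carrier[OF xy(1)] L_carrier[OF xy(2)] L_carrier[OF b]
   have bx: "b \<otimes> x = x \<otimes> b" by (rule L_comm[OF b xy(1)])
   have "(b \<otimes> x) \<otimes> y = b \<otimes> (x \<otimes> y)" "x \<otimes> (b \<otimes> y) = b \<otimes> (x \<otimes> y)"
    using c bx by (simp_all add: m_assoc[symmetric])
   moreover have "(b \<otimes> x) \<otimes> (b \<otimes> y) = x \<otimes> y" using c L_cancel[OF b c(2)] unfolding bx by (simp add: m_assoc)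
   ultimately have "x \<otimes> y \<in> ?S \<or> b \<otimes> (x \<otimes> y) \<in> ?S"
    using that subgroup.m_closed[OF S, of x y] subgroup.m_closed[OF S, of "b \<otimes> x" y]
     subgroup.m_closed[OF S, of x "b \<otimes> y"] subgroup.m_closed[OF S, of "b \<otimes> x" "b \<otimes> y"] by (auto simp: U_def)
   then show ?thesis using xy(3) by (simp add: U_def)
  qed
 qed
 then have "generate G (insert b X) \<subseteq> U"
  using X b L_cancel[OF b] by (intro generate_subgroup_incl) (auto simp: U_def sq generate.one generate.incl)
 moreover have "?S \<subseteq> generate G (insert b X)" by (rule mono_generate) auto
 moreover from this have "b \<otimes> x \<in> generate G (insert b X)" if "x \<in> ?S" for x
  by (intro generate.eng) (use that in \<open>auto intro: generate.incl\<close>)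
 ultimately show ?thesis unfolding eq by blast
qed

lemma card_generate_insert:
 assumes X: "X \<subseteq> L" and b: "b \<in> L" "b \<notin> generate G X"
 shows "card (generate G (insert b X)) = 2 * card (generate G X)"
proof -
 have gL: "x \<in> L" if "x \<in> generate G X" for x using gen_L[OF X] that by auto
 have fin: "finite (generate G X)" using gen_L[OF X] finL finite_subset by blast
 have disj: "generate G X \<inter> (\<lambda>x. b \<otimes> x) ` generate G X = {}"
 proof (rule ccontr)
  assume "\<not> ?thesis"
  then obtain x where x: "x \<in> generate G X" "b \<otimes> x \<in> generate G X" by auto
  have "b = (b \<otimes> x) \<otimes> x" using sq[OF gL[OF x(1)]] L_carrier gL x(1) b(1) by (simp add: m_assoc)
  then show False using generate.eng[OF x(2,1)] b(2) by simp
 qed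
 have "inj_on (\<lambda>x. b \<otimes> x) (generate G X)"
  using b gL L_carrier by (intro inj_onI) (metis L_cancel)
 then show ?thesis unfolding generate_insert[OF X b(1)]
  using fin disj by (simp add: card_Un_disjoint card_image)
qed

lemma card_generate_independent:
 assumes "finite X" "X \<subseteq> L" "\<forall>b\<in>X. b \<notin> generate G (X - {b})"
 shows "card (generate G X) = 2 ^ card X"
 using assms
proof (induction X rule: finite_induct)
 case empty
 then show ?case by (simp add: generate_empty)
next
 case (insert b X)
 have "b \<notin> generate G X" using insert by auto
 moreover have "\<forall>c\<in>X. c \<notin> generate G (X - {c})"
  using insert mono_generate[of "X - {c}" "insert b X - {c}" for c] by blast
 ultimately show ?case using insert card_generate_insert[of X b] by simp
qed

lemma has_Z2_dim_imp_card: "has_Z2_dim G L i \<Longrightarrow> card L = 2 ^ i"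
 using card_generate_independent unfolding has_Z2_dim_def Z2_basis_def by blast

lemma exists_Z2_dim: "\<exists>i. has_Z2_dim G L i"
proof -
 define P where "P X \<longleftrightarrow> X \<subseteq> L \<and> generate G X = L" for X
 have "P L" using gen_L[of L] generate.incl by (auto simp: P_def)
 then obtain X where PX: "P X" and min: "\<And>Y. P Y \<Longrightarrow> card X \<le> card Y" using ex_has_least_nat[of P L card] by blast
 then have X: "X \<subseteq> L" "generate G X = L" by (auto simp: P_def)
 have fin: "finite X" using finite_subset[OF X(1) finL] .
 have "b \<notin> generate G (X - {b})" if b: "b \<in> X" for b
 proof
  let ?Y = "X - {b}"
  assume "b \<in> generate G ?Y"
  then have "X \<subseteq> generate G ?Y" using generate.incl[of _ ?Y G] by blast
  moreover have "subgroup (generate G ?Y) G" by (rule generate_is_subgroup) (use X L_carrier in blast)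
  ultimately have "L \<subseteq> generate G ?Y" using generate_subgroup_incl X(2) by metis
  then have "generate G ?Y = L" using gen_L[of ?Y] X(1) by blast
  then have "card X \<le> card ?Y" using min[of ?Y] X(1) by (auto simp: P_def)
  then show False using b fin card_gt_0_iff[of X] by (auto simp: card_Diff_singleton)
 qed
 then show ?thesis unfolding has_Z2_dim_def Z2_basis_def using X fin by blast
qed

lemma has_Z2_dim_iff_card: "has_Z2_dim G L i \<longleftrightarrow> card L = 2 ^ i"
proof
 assume c: "card L = 2 ^ i"
 obtain j where j: "has_Z2_dim G L j" using exists_Z2_dim by blast
 then have "i = j" using has_Z2_dim_imp_card c by simp
 then show "has_Z2_dim G L i" using j by simp
qed (rule has_Z2_dim_imp_card)

end

text \<open>Sign patterns of period \<open>k\<close>: the elements of \<open>Lambda (4 * k)\<close>, written multiplicatively with entries \<open>1\<close> and \<open>-1\<close>.\<close>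

definition psigns :: "nat \<Rightarrow> (int \<Rightarrow> int) set" where
 "psigns k = {e. \<forall>y. (e y = 1 \<or> e y = -1) \<and> e (y + int k) = e y}"

definition smult :: "(int \<Rightarrow> int) \<Rightarrow> (int \<Rightarrow> int) \<Rightarrow> int \<Rightarrow> int" where
 "smult e f = (\<lambda>y. e y * f y)"

text \<open>As a linear map over the field with two elements this is one plus the shift, so its \<open>2\<^sup>m\<close>-th power is one plus the
 shift by \<open>2\<^sup>m\<close>. It is nilpotent on patterns whose period is a power of two.\<close>

definition sdiff :: "(int \<Rightarrow> int) \<Rightarrow> int \<Rightarrow> int" where
 "sdiff e = (\<lambda>y. e y * e (y + 1))"

definition sign_module :: "nat \<Rightarrow> (int \<Rightarrow> int) set \<Rightarrow> bool" where
 "sign_module k L \<longleftrightarrow> L \<subseteq> psigns k \<and> (\<lambda>_. 1) \<in> L \<and> (\<forall>e\<in>L. \<forall>f\<in>L. smult e f \<in> L) \<and>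
   (\<forall>e\<in>L. (\<lambda>y. e (y + 1)) \<in> L)"

lemma psigns_cases: "e \<in> psigns k \<Longrightarrow> e y = 1 \<or> e y = -1"
 by (auto simp: psigns_def)

lemma psigns_sq: "e \<in> psigns k \<Longrightarrow> e y * e y = 1"
 using psigns_cases[of e k y] by auto

lemma psigns_period: "e \<in> psigns k \<Longrightarrow> e (y + int k * q) = e y"
 by (rule int_period) (simp add: psigns_def)

lemma card_psigns:
 assumes k: "k > 0"
 shows "card (psigns k) = 2 ^ k" "finite (psigns k)"
proof -
 have "bij_betw (\<lambda>e. restrict e {0..<int k}) (psigns k) ({0..<int k} \<rightarrow>\<^sub>E {1, - 1::int})"
 proof (rule bij_betw_byWitness[of _ "\<lambda>f y. f (y mod int k)"])
  show "\<forall>e\<in>psigns k. (\<lambda>y. restrict e {0..<int k} (y mod int k)) = e"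
  proof (intro ballI ext)
   fix e y assume e: "e \<in> psigns k"
   have "e (y mod int k) = e y" using psigns_period[OF e, of "y mod int k" "y div int k"] by simp
   then show "restrict e {0..<int k} (y mod int k) = e y" using k by simp
  qed
  show "\<forall>f\<in>{0..<int k} \<rightarrow>\<^sub>E {1, - 1::int}. restrict (\<lambda>y. f (y mod int k)) {0..<int k} = f"
  proof (intro ballI ext)
   fix f :: "int \<Rightarrow> int" and y assume f: "f \<in> {0..<int k} \<rightarrow>\<^sub>E {1, - 1::int}"
   then show "restrict (\<lambda>y. f (y mod int k)) {0..<int k} y = f y"
    by (cases "y \<in> {0..<int k}") (auto simp: PiE_def extensional_def)
  qed
  show "(\<lambda>e. restrict e {0..<int k}) ` psigns k \<subseteq> {0..<int k} \<rightarrow>\<^sub>E {1, - 1::int}" by (auto simp: psigns_def)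
  show "(\<lambda>f y. f (y mod int k)) ` ({0..<int k} \<rightarrow>\<^sub>E {1, - 1::int}) \<subseteq> psigns k"
   using k by (auto simp: psigns_def PiE_def Pi_def) (metis pos_mod_bound pos_mod_sign of_nat_0_less_iff)
 qed
 note bij = this
 have fin: "finite ({0..<int k} \<rightarrow>\<^sub>E {1, - 1::int})" by (intro finite_PiE) auto
 show "finite (psigns k)" using bij_betw_finite[OF bij] fin by simp
 have "card ({0..<int k} \<rightarrow>\<^sub>E {1, - 1::int}) = 2 ^ k" by (simp add: card_PiE numeral_2_eq_2)
 then show "card (psigns k) = 2 ^ k" using bij_betw_same_card[OF bij] by simp
qed

lemma sign_module_psigns: "sign_module k (psigns k)"
 unfolding sign_module_def
proof (intro conjI ballI)
 show "(\<lambda>_. 1) \<in> psigns k" by (simp add: psigns_def)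
 fix e assume e: "e \<in> psigns k"
 have per: "e (y + int k) = e y" for y using e by (simp add: psigns_def)
 have "e (y + int k + 1) = e (y + 1)" for y using per[of "y + 1"] by (simp add: algebra_simps)
 then show "(\<lambda>y. e (y + 1)) \<in> psigns k" using psigns_cases[OF e] by (simp add: psigns_def)
 fix f assume f: "f \<in> psigns k"
 have "f (y + int k) = f y" for y using f by (simp add: psigns_def)
 moreover have "e y * f y = 1 \<or> e y * f y = -1" for y using psigns_cases[OF e, of y] psigns_cases[OF f, of y] by auto
 ultimately show "smult e f \<in> psigns k" using per by (simp add: psigns_def smult_def)
qed simp

lemma sdiff_mult: "sdiff (smult e f) = smult (sdiff e) (sdiff f)"
 by (simp add: sdiff_def smult_def fun_eq_iff)

lemma sdiff_pow_mult: "(sdiff ^^ j) (smult e f) = smult ((sdiff ^^ j) e) ((sdiff ^^ j) f)"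
 by (induction j) (simp_all add: sdiff_mult)

lemma sdiff_pow_one: "(sdiff ^^ j) (\<lambda>_. 1) = (\<lambda>_. 1)"
 by (induction j) (simp_all add: sdiff_def)

lemma sdiff_pow_two_power:
 assumes "e \<in> psigns k"
 shows "(sdiff ^^ (2 ^ m)) e = (\<lambda>y. e y * e (y + 2 ^ m))"
proof (induction m)
 case 0
 then show ?case by (simp add: sdiff_def)
next
 case (Suc m)
 have *: "(sdiff ^^ j) (\<lambda>y. e (y + h)) = (\<lambda>y. (sdiff ^^ j) e (y + h))" for j h
  by (induction j) (simp_all add: sdiff_def add.assoc add.commute[of 1])
 have "(sdiff ^^ (2 ^ Suc m)) e = (sdiff ^^ (2 ^ m)) (smult e (\<lambda>y. e (y + 2 ^ m)))"
  by (simp add: mult_2 funpow_add Suc smult_def)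
 also have "\<dots> = smult ((sdiff ^^ (2 ^ m)) e) (\<lambda>y. (sdiff ^^ (2 ^ m)) e (y + 2 ^ m))"
  unfolding sdiff_pow_mult * ..
 also have "\<dots> = (\<lambda>y. e y * (e (y + 2 ^ m) * e (y + 2 ^ m)) * e (y + 2 ^ Suc m))"
  unfolding Suc smult_def by (simp add: mult.assoc add.assoc)
 also have "\<dots> = (\<lambda>y. e y * e (y + 2 ^ Suc m))" by (simp only: psigns_sq[OF assms] mult_1_right)
 finally show ?case .
qed

text \<open>The only candidate for a submodule of dimension \<open>i\<close>.\<close>

definition skernel :: "nat \<Rightarrow> nat \<Rightarrow> (int \<Rightarrow> int) set" where
 "skernel k i = {e \<in> psigns k. (sdiff ^^ i) e = (\<lambda>_. 1)}"

lemma sign_moduleD: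
 assumes "sign_module k L"
 shows "L \<subseteq> psigns k" "(\<lambda>_. 1) \<in> L" "e \<in> L \<Longrightarrow> f \<in> L \<Longrightarrow> smult e f \<in> L" "e \<in> L \<Longrightarrow> (\<lambda>y. e (y + 1)) \<in> L"
  "e \<in> L \<Longrightarrow> (sdiff ^^ j) e \<in> L"
proof -
 show D: "L \<subseteq> psigns k" "(\<lambda>_. 1) \<in> L" "e \<in> L \<Longrightarrow> f \<in> L \<Longrightarrow> smult e f \<in> L" "e \<in> L \<Longrightarrow> (\<lambda>y. e (y + 1)) \<in> L" for e f
  using assms by (auto simp: sign_module_def)
 show "e \<in> L \<Longrightarrow> (sdiff ^^ j) e \<in> L"
  by (induction j) (use D(3,4) in \<open>auto simp: sdiff_def smult_def\<close>)
qed

text \<open>A pattern is determined by its value at \<open>0\<close> and its differences.\<close>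

lemma card_skernel_le:
 assumes k: "k > 0"
 shows "card (skernel k i) \<le> 2 ^ i" "finite (skernel k i)"
proof -
 have fin: "finite (skernel k j)" for j
  by (rule finite_subset[OF _ card_psigns(2)[OF k]]) (auto simp: skernel_def)
 show "card (skernel k i) \<le> 2 ^ i"
 proof (induction i)
  case 0
  have "skernel k 0 = {\<lambda>_. 1}" by (auto simp: skernel_def psigns_def)
  then show ?case by simp
 next
  case (Suc i)
  let ?f = "\<lambda>e. (e 0 :: int, sdiff e)"
  have "inj_on ?f (psigns k)"
  proof (rule inj_onI)
   fix e f assume ef: "e \<in> psigns k" "f \<in> psigns k" "?f e = ?f f"
   then have d: "e y * e (y + 1) = f y * f (y + 1)" for y by (auto simp: sdiff_def dest: fun_cong)
   have "e y = f y" for y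
   proof (induction y rule: int_induct[where k = 0])
    case (step1 i)
    then show ?case using d[of i] psigns_cases[OF ef(1), of i] by auto
   next
    case (step2 i)
    then show ?case using d[of "i - 1"] psigns_cases[OF ef(1), of i] by auto
   qed (use ef in simp)
   then show "e = f" by blast
  qed
  then have "inj_on ?f (skernel k (Suc i))" by (rule inj_on_subset) (auto simp: skernel_def)
  moreover have "?f ` skernel k (Suc i) \<subseteq> {1, -1} \<times> skernel k i"
   using psigns_cases sign_moduleD(5)[OF sign_module_psigns, of _ k 1] by (fastforce simp: skernel_def funpow_swap1)
  ultimately have "card (skernel k (Suc i)) \<le> card ({1, -1::int} \<times> skernel k i)"
   using fin by (intro card_inj_on_le) auto
  then show ?case using Suc by (simp add: card_cartesian_product)
 qed
qed (rule finite_subset[OF _ card_psigns(2)[OF k]], auto simp: skernel_def)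

text \<open>If the difference operator has nilpotency degree exactly \<open>Suc n\<close> on a module, then a suitable
 multiple of one pattern lies in each layer, so that the layers at least double.\<close>

lemma sign_module_layers:
 assumes L: "sign_module k L" and k: "k > 0" and n: "\<not> L \<subseteq> skernel k n" "L \<subseteq> skernel k (Suc n)"
 shows "j \<le> Suc n \<Longrightarrow> 2 ^ j \<le> card (L \<inter> skernel k j)"
proof (induction j)
 case 0
 have "L \<inter> skernel k 0 = {\<lambda>_. 1}" using sign_moduleD(1,2)[OF L] by (auto simp: skernel_def)
 then show ?case by simp
next
 case (Suc j)
 let ?A = "L \<inter> skernel k j"
 note D = sign_moduleD[OF L]
 obtain e where e: "e \<in> L" "(sdiff ^^ n) e \<noteq> (\<lambda>_. 1)" "(sdiff ^^ Suc n) e = (\<lambda>_. 1)"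
  using n D(1) by (auto simp: skernel_def)
 define f where "f = (sdiff ^^ (n - j)) e"
 have f: "f \<in> L" "(sdiff ^^ j) f \<noteq> (\<lambda>_. 1)" "(sdiff ^^ Suc j) f = (\<lambda>_. 1)"
 proof -
  have "(sdiff ^^ j) f = (sdiff ^^ (j + (n - j))) e" unfolding f_def by (simp add: funpow_add)
  then have fj: "(sdiff ^^ j) f = (sdiff ^^ n) e" using Suc.prems by simp
  then show "(sdiff ^^ j) f \<noteq> (\<lambda>_. 1)" "(sdiff ^^ Suc j) f = (\<lambda>_. 1)" using e by simp_all
  show "f \<in> L" unfolding f_def by (rule D(5)[OF e(1)])
 qed
 have ff: "smult f (smult f g) = g" for g
  using psigns_sq f(1) D(1) by (auto simp: smult_def fun_eq_iff mult.assoc[symmetric])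
 have one: "smult (\<lambda>_. 1) g = g" "smult g (\<lambda>_. 1) = g" for g by (auto simp: smult_def)
 have "(sdiff ^^ j) (smult f g) \<noteq> (\<lambda>_. 1)" if "g \<in> ?A" for g
  using that f(2) by (simp add: skernel_def sdiff_pow_mult one)
 then have disj: "?A \<inter> smult f ` ?A = {}" by (auto simp: skernel_def)
 have "(sdiff ^^ Suc j) (smult f g) = (\<lambda>_. 1)" if "g \<in> ?A" for g
  using that f(3) unfolding sdiff_pow_mult by (simp add: skernel_def one) (simp add: sdiff_def)
 then have "?A \<union> smult f ` ?A \<subseteq> L \<inter> skernel k (Suc j)"
  using D(1,3) f(1) by (auto simp: skernel_def sdiff_def)
 then have "card (?A \<union> smult f ` ?A) \<le> card (L \<inter> skernel k (Suc j))"
  using card_skernel_le(2)[OF k] by (intro card_mono) auto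
 moreover have "inj_on (smult f) ?A" by (rule inj_onI) (metis ff)
 then have "card (?A \<union> smult f ` ?A) = 2 * card ?A"
  using disj card_skernel_le(2)[OF k] by (simp add: card_Un_disjoint card_image)
 ultimately show ?case using Suc by simp
qed

lemma psigns_skernel:
 assumes k: "k = 2 ^ m"
 shows "psigns k = skernel k k"
proof -
 have "(sdiff ^^ k) e = (\<lambda>_. 1)" if "e \<in> psigns k" for e
 proof -
  have "e (y + 2 ^ m) = e y" for y using psigns_period[OF that, of y 1] by (simp add: k)
  then show ?thesis using sdiff_pow_two_power[OF that, of m] psigns_sq[OF that] by (simp add: k)
 qed
 then show ?thesis by (auto simp: skernel_def)
qed

text \<open>Let \<open>n\<close> be the nilpotency degree of the difference operator on \<open>L\<close>. Then \<open>L\<close> lies in \<open>skernel k n\<close>, which has at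
 most \<open>2\<^sup>n\<close> elements, while the layers show that \<open>L\<close> has at least \<open>2\<^sup>n\<close>.\<close>

theorem sign_module_unique:
 assumes k: "k = 2 ^ m" and L: "sign_module k L" "card L = 2 ^ i"
 shows "L = skernel k i"
proof -
 have k0: "k > 0" by (simp add: k)
 define n where "n = (LEAST n. L \<subseteq> skernel k n)"
 have Ln: "L \<subseteq> skernel k n"
  unfolding n_def by (rule LeastI[of _ k]) (use psigns_skernel[OF k] sign_moduleD(1)[OF L(1)] in simp)
 have "2 ^ n \<le> card (L \<inter> skernel k n)"
 proof (cases n)
  case 0
  have "(\<lambda>_. 1) \<in> L \<inter> skernel k n" using sign_moduleD(2)[OF L(1)] Ln by blast
  then show ?thesis using 0 card_skernel_le(2)[OF k0, of n] by (simp add: Suc_le_eq card_gt_0_iff) blast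
 next
  case (Suc n')
  have "\<not> L \<subseteq> skernel k n'" using not_less_Least[of n' "\<lambda>n. L \<subseteq> skernel k n"] Suc by (simp add: n_def)
  then show ?thesis using sign_module_layers[OF L(1) k0, of n' n] Ln Suc by simp
 qed
 then have "2 ^ n \<le> card L" using Ln by (simp add: Int_absorb2)
 then have "L = skernel k n" using card_skernel_le[OF k0, of n] Ln by (intro card_seteq) auto
 moreover from this have "i = n" using \<open>2 ^ n \<le> card L\<close> card_skernel_le(1)[OF k0, of n] L(2) by simp
 ultimately show ?thesis by simp
qed

text \<open>On all patterns the nilpotency degree is \<open>k\<close>, because there are \<open>2\<^sup>k\<close> of them; so every layer has full size.\<close>

theorem sign_module_exists:
 assumes k: "k = 2 ^ m" and i: "i \<le> k"
 shows "sign_module k (skernel k i)" and "card (skernel k i) = 2 ^ i"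
proof -
 have k0: "k > 0" by (simp add: k)
 note full = sign_module_psigns[of k]
 have sh: "(sdiff ^^ j) (\<lambda>y. e (y + 1)) = (\<lambda>y. (sdiff ^^ j) e (y + 1))" for j and e :: "int \<Rightarrow> int"
  by (induction j) (simp_all add: sdiff_def add.assoc)
 show "sign_module k (skernel k i)"
  using full by (auto simp: sign_module_def skernel_def sdiff_pow_mult sh sdiff_pow_one) (auto simp: smult_def)
 obtain n where n: "k = Suc n" using k0 by (cases k) auto
 have "\<not> psigns k \<subseteq> skernel k n"
 proof
  assume "psigns k \<subseteq> skernel k n"
  then have "2 ^ k \<le> card (skernel k n)" using card_mono[OF card_skernel_le(2)[OF k0]] card_psigns(1)[OF k0] by metis
  also have "\<dots> \<le> 2 ^ n" by (rule card_skernel_le(1)[OF k0])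
  finally show False using n by simp
 qed
 then have "2 ^ i \<le> card (psigns k \<inter> skernel k i)"
  using sign_module_layers[OF full k0, of n i] psigns_skernel[OF k] n i by simp
 then show "card (skernel k i) = 2 ^ i" using card_skernel_le(1)[OF k0, of i] by (simp add: Int_absorb1 skernel_def le_antisym Collect_conj_eq[symmetric] Int_def)
qed

section \<open>$N$ and $\Lambda$ in coordinates\<close>

lemma tuple_apply: "(x, y) \<in> PXV r \<Longrightarrow> tuple r gs (x, y) = ((gs ! nat y) x, y)"
 by (auto simp: tuple_def wreath_elt_def PXV_iff Zmod_def)

lemma tuple_transl3:
 assumes "length L = r"
 shows "tuple r (map transl3 L) = transl r (\<lambda>y. L ! nat y)"
proof
 fix p :: "int \<times> int"
 obtain x y where p: "p = (x, y)" by (cases p)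
 show "tuple r (map transl3 L) p = transl r (\<lambda>y. L ! nat y) p"
 proof (cases "(x, y) \<in> PXV r")
  case True
  then have "nat y < length L" "x \<in> Zmod 3" using assms by (auto simp: PXV_iff Zmod_def nat_less_iff)
  then show ?thesis using True by (simp add: p tuple_apply transl_apply transl3_def)
 qed (simp add: p tuple_def wreath_elt_def transl_def)
qed

text \<open>The \<open>4 k\<close> positions are cut into the four blocks of the tuples defining \<open>NN\<close> and \<open>Lambda\<close>.\<close>

lemma block_index:
 assumes "0 \<le> y" "y < int (4 * k)" "k > 0"
 obtains m i where "m \<in> {0,1,2,3}" "0 \<le> i" "i < int k" "y = m * int k + i" "y div int k = m" "y mod int k = i"
proof -
 define m where "m = y div int k"
 define i where "i = y mod int k"
 have y: "y = m * int k + i" by (simp add: m_def i_def)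
 have i: "0 \<le> i" "i < int k" using assms by (auto simp: i_def)
 have "m * int k < 4 * int k" using y i assms by linarith
 then have "m < 4" using assms by simp
 moreover have "0 \<le> m" using assms by (simp add: m_def pos_imp_zdiv_nonneg_iff)
 ultimately have "m = 0 \<or> m = 1 \<or> m = 2 \<or> m = 3" by linarith
 then have "m \<in> {0,1,2,3}" by blast
 then show ?thesis using i y by (rule that[of m i]) (simp_all only: m_def i_def)
qed

lemma four_block_nth:
 assumes len: "length as = k" "length bs = k" "length cs = k" "length ds = k"
  and m: "m \<in> {0,1,2,3}" and i: "0 \<le> i" "i < int k"
 shows "(as @ bs @ cs @ ds) ! nat (m * int k + i) =
  (if m = 0 then as else if m = 1 then bs else if m = 2 then cs else ds) ! nat i"
proof -
 obtain j where j: "i = int j" "j < k" using i by (metis nonneg_int_cases of_nat_less_iff)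
 have e: "nat (int k + int j) = k + j" "nat (2 * int k + int j) = 2 * k + j" "nat (3 * int k + int j) = 3 * k + j"
  by linarith+
 consider "m = 0" | "m = 1" | "m = 2" | "m = 3" using m by auto
 then show ?thesis
  unfolding j(1) by cases (use j(2) in \<open>simp_all add: e nth_append len\<close>)
qed

lemma four_blocks_word:
 assumes k: "k > 0" and len: "length xs = k" "length ys = k"
 shows "transl (4 * k) (\<lambda>y. (map2 (+) xs ys @ xs @ ys @ map2 (-) xs ys) ! nat y) =
  transl (4 * k) (tetra_word k (\<lambda>i. xs ! nat i) (\<lambda>i. ys ! nat i))"
proof (rule transl_eqI)
 fix y assume y: "0 \<le> y" "y < int (4 * k)"
 then obtain m i where m: "m \<in> {0,1,2,3}" and i: "0 \<le> i" "i < int k" and ym: "y = m * int k + i"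
  "y div int k = m" "y mod int k = i" using block_index k by blast
 have ik: "nat i < k" using i by linarith
 have F: "(map2 (+) xs ys @ xs @ ys @ map2 (-) xs ys) ! nat y =
   (if m = 0 then map2 (+) xs ys else if m = 1 then xs else if m = 2 then ys else map2 (-) xs ys) ! nat i"
  unfolding ym(1) by (rule four_block_nth) (use len m i in auto)
 consider "m = 0" | "m = 1" | "m = 2" | "m = 3" using m by auto
 then show "(map2 (+) xs ys @ xs @ ys @ map2 (-) xs ys) ! nat y mod 3 =
   tetra_word k (\<lambda>i. xs ! nat i) (\<lambda>i. ys ! nat i) y mod 3"
  unfolding F tetra_word_def Let_def ym(2,3) by cases (use ik len in simp_all)
qed

lemma NN_eq:
 assumes k: "k > 0"
 shows "NN (4 * k) = transl (4 * k) ` tetra 1 k"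
proof
 show "NN (4 * k) \<subseteq> transl (4 * k) ` tetra 1 k"
 proof
  fix g assume "g \<in> NN (4 * k)"
  then obtain xs ys where "length xs = k" "length ys = k"
   and g: "g = tuple (4 * k) (map transl3 (map2 (+) xs ys @ xs @ ys @ map2 (-) xs ys))"
   by (auto simp: NN_def)
  then have "g = transl (4 * k) (tetra_word k (\<lambda>i. xs ! nat i) (\<lambda>i. ys ! nat i))"
   using four_blocks_word[OF k, of xs ys] tuple_transl3[of "map2 (+) xs ys @ xs @ ys @ map2 (-) xs ys" "4 * k"]
   by simp
  then show "g \<in> transl (4 * k) ` tetra 1 k" using tetra_word_in_tetra[OF k] by blast
 qed
 show "transl (4 * k) ` tetra 1 k \<subseteq> NN (4 * k)"
 proof
  fix g assume "g \<in> transl (4 * k) ` tetra 1 k"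
  then obtain c where c: "c \<in> tetra 1 k" "g = transl (4 * k) c" by auto
  then have cw: "c \<in> nwords (4 * k)" by (simp add: tetra_def)
  define xs where "xs = map (\<lambda>i. c (int i + int k)) [0..<k]"
  define ys where "ys = map (\<lambda>i. c (int i + 2 * int k)) [0..<k]"
  have len: "length xs = k" "length ys = k" by (auto simp: xs_def ys_def)
  have sets: "set xs \<subseteq> Zmod 3" "set ys \<subseteq> Zmod 3"
   using nwordsD(1,2)[OF cw] by (auto simp: xs_def ys_def Zmod_def)
  have "c y = tetra_word k (\<lambda>i. xs ! nat i) (\<lambda>i. ys ! nat i) y" for y
  proof -
   have i: "0 \<le> y mod int k" "y mod int k < int k" using k by auto
   then have n: "nat (y mod int k) < k" by linarith
   have xy: "xs ! nat (y mod int k) = c (y mod int k + int k)" "ys ! nat (y mod int k) = c (y mod int k + 2 * int k)"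
    using n i by (simp_all add: xs_def ys_def)
   show ?thesis using fun_cong[OF tetra_word_eq[OF c(1) k], of y]
    by (simp only: tetra_word_def Let_def xy)
  qed
  then have "c = tetra_word k (\<lambda>i. xs ! nat i) (\<lambda>i. ys ! nat i)" by blast
  then have "g = tuple (4 * k) (map transl3 (map2 (+) xs ys @ xs @ ys @ map2 (-) xs ys))"
   using c(2) four_blocks_word[OF k len] len tuple_transl3[of "map2 (+) xs ys @ xs @ ys @ map2 (-) xs ys" "4 * k"]
   by simp
  then show "g \<in> NN (4 * k)" using len sets unfolding NN_def by (intro CollectI exI[of _ xs] exI[of _ ys]) simp
 qed
qed

lemma psigns_signs: "e \<in> psigns k \<Longrightarrow> e \<in> signs r"
 by (auto simp: psigns_def signs_def)

lemma psigns_mod: "e \<in> psigns k \<Longrightarrow> e (y mod int k) = e y"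
 using psigns_period[of e k "y mod int k" "y div int k"] by simp

lemma Lambda_eq:
 assumes k: "k > 0"
 shows "Lambda (4 * k) = sgnp (4 * k) ` psigns k"
proof -
 let ?one = "\<one>\<^bsub>BijGroup (Zmod 3)\<^esub>"
 have act: "tuple (4 * k) (zs @ zs @ zs @ zs) = sgnp (4 * k) e"
  if len: "length zs = k" and e: "e \<in> psigns k"
   and val: "\<And>i. i < k \<Longrightarrow> (e (int i) = 1 \<and> zs ! i = ?one) \<or> (e (int i) = -1 \<and> zs ! i = neg3)" for zs e
 proof
  fix p :: "int \<times> int"
  obtain x y where p: "p = (x, y)" by (cases p)
  show "tuple (4 * k) (zs @ zs @ zs @ zs) p = sgnp (4 * k) e p"
  proof (cases "(x, y) \<in> PXV (4 * k)")
   case True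
   then have y: "0 \<le> y" "y < int (4 * k)" "0 \<le> x" "x < 3" by (auto simp: PXV_iff)
   then obtain m i where m: "m \<in> {0,1,2,3}" and i: "0 \<le> i" "i < int k" and ym: "y = m * int k + i"
    "y div int k = m" "y mod int k = i" using block_index[OF y(1,2) k] by blast
   have "nat i < k" "int (nat i) = i" using i by auto
   moreover have "e i = e y" using psigns_mod[OF e, of y] ym by simp
   moreover have "(zs @ zs @ zs @ zs) ! nat y = zs ! nat i" unfolding ym(1) by (subst four_block_nth[OF len len len len m i]) auto
   ultimately show ?thesis using True val[of "nat i"] y
    by (auto simp: p tuple_apply sgnp_apply neg3_def BijGroup_def Zmod_def)
  qed (simp add: p tuple_def wreath_elt_def sgnp_def)
 qed
 show ?thesis
 proof
  show "Lambda (4 * k) \<subseteq> sgnp (4 * k) ` psigns k"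
  proof
   fix g assume "g \<in> Lambda (4 * k)"
   then obtain zs where zs: "length zs = k" "set zs \<subseteq> {?one, neg3}" "g = tuple (4 * k) (zs @ zs @ zs @ zs)"
    by (auto simp: Lambda_def neg3_group)
   define e where "e y = (if zs ! nat (y mod int k) = ?one then 1 else -1 :: int)" for y
   have "e \<in> psigns k" by (simp add: psigns_def e_def)
   moreover have "(e (int i) = 1 \<and> zs ! i = ?one) \<or> (e (int i) = -1 \<and> zs ! i = neg3)" if "i < k" for i
   proof -
    have "zs ! i \<in> {?one, neg3}" using zs(1,2) that nth_mem by blast
    then show ?thesis using that by (auto simp: e_def)
   qed
   ultimately show "g \<in> sgnp (4 * k) ` psigns k" using act[of zs e] zs by blast
  qed
  show "sgnp (4 * k) ` psigns k \<subseteq> Lambda (4 * k)"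
  proof
   fix g assume "g \<in> sgnp (4 * k) ` psigns k"
   then obtain e where e: "e \<in> psigns k" "g = sgnp (4 * k) e" by auto
   define zs where "zs = map (\<lambda>i. if e (int i) = 1 then ?one else neg3) [0..<k]"
   have "g = tuple (4 * k) (zs @ zs @ zs @ zs)"
    unfolding e(2) by (rule act[symmetric]) (use e psigns_cases[OF e(1)] in \<open>auto simp: zs_def\<close>)
   moreover have "set zs \<subseteq> {?one, neg3}" "length zs = k" by (auto simp: zs_def)
   ultimately show "g \<in> Lambda (4 * k)" unfolding Lambda_def neg3_group by (intro CollectI exI[of _ zs]) simp
  qed
 qed
qed

lemma sgnp_mult:
 assumes "e \<in> signs r" "f \<in> signs r"
 shows "sgnp r e \<otimes>\<^bsub>SymV r\<^esub> sgnp r f = sgnp r (smult e f)" "smult e f \<in> signs r"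
proof -
 show s: "smult e f \<in> signs r" using assms by (auto simp: signs_def smult_def) fastforce+
 interpret group "SymV r" by (rule group_BijGroup)
 show "sgnp r e \<otimes>\<^bsub>SymV r\<^esub> sgnp r f = sgnp r (smult e f)"
 proof (rule SymV_eqI)
  show "sgnp r e \<otimes>\<^bsub>SymV r\<^esub> sgnp r f \<in> Bij (PXV r)"
   using m_closed[of "sgnp r e" "sgnp r f"] sgnp_Bij assms by (simp add: carrier_BijGroup)
  fix x y assume p: "(x, y) \<in> PXV r"
  have "((f y * x) mod 3, y) \<in> PXV r" using p by (simp add: PXV_iff)
  then show "(sgnp r e \<otimes>\<^bsub>SymV r\<^esub> sgnp r f) (x, y) = sgnp r (smult e f) (x, y)"
   using p by (simp add: BijGroup_mult_apply[OF sgnp_Bij sgnp_Bij] assms sgnp_apply smult_def mod_mult_right_eq mult.assoc)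
 qed (rule sgnp_Bij[OF s])
qed

lemma sgnp_one: "(\<And>y. 0 \<le> y \<Longrightarrow> y < int r \<Longrightarrow> e y = 1) \<Longrightarrow> sgnp r e = \<one>\<^bsub>SymV r\<^esub>"
proof -
 assume e: "\<And>y. 0 \<le> y \<Longrightarrow> y < int r \<Longrightarrow> e y = 1"
 interpret group "SymV r" by (rule group_BijGroup)
 have es: "e \<in> signs r" using e by (auto simp: signs_def)
 show ?thesis
 proof (rule SymV_eqI[OF sgnp_Bij[OF es]])
  show "\<one>\<^bsub>SymV r\<^esub> \<in> Bij (PXV r)" using one_closed by (simp add: carrier_BijGroup)
  fix x y assume p: "(x, y) \<in> PXV r"
  show "sgnp r e (x, y) = \<one>\<^bsub>SymV r\<^esub> (x, y)" using p e by (auto simp: sgnp_apply BijGroup_one_apply PXV_iff)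
 qed
qed

lemma sgnp_inj:
 assumes "e \<in> signs r" "f \<in> signs r" "sgnp r e = sgnp r f" "0 \<le> y" "y < int r"
 shows "e y = f y"
proof -
 have p: "(1, y) \<in> PXV r" using assms by (simp add: PXV_iff)
 have "(e y = 1 \<or> e y = -1)" "(f y = 1 \<or> f y = -1)" using assms by (auto simp: signs_def)
 then show ?thesis using fun_cong[OF assms(3), of "(1, y)"] p by (auto simp: sgnp_apply)
qed

context
 fixes k :: nat
 assumes k: "k > 0"
begin

abbreviation "R \<equiv> 4 * k"
abbreviation "S \<equiv> SymV R"
abbreviation S_prod (infixl "\<cdot>" 70) where "g \<cdot> h \<equiv> g \<otimes>\<^bsub>S\<^esub> h"
abbreviation "iv g \<equiv> inv\<^bsub>S\<^esub> g"

lemma sgnp_sigma: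
 assumes e: "e \<in> psigns k"
 shows "sgnp R e \<cdot> sigma R = sigma R \<cdot> sgnp R (\<lambda>y. e (y + 1))"
proof -
 interpret group S by (rule group_BijGroup)
 have e1: "(\<lambda>y. e (y + 1)) \<in> psigns k" using sign_module_psigns[of k] e by (auto simp: sign_module_def)
 note B = sgnp_Bij[OF psigns_signs[OF e], of R] sgnp_Bij[OF psigns_signs[OF e1], of R] sigma_Bij[of R]
 have B3: "sigma R \<in> Bij (PXV R)" using B k by simp
 show ?thesis
 proof (rule SymV_eqI)
  show "sgnp R e \<cdot> sigma R \<in> Bij (PXV R)" "sigma R \<cdot> sgnp R (\<lambda>y. e (y + 1)) \<in> Bij (PXV R)"
   using m_closed B(1,2) B3 by (simp_all add: carrier_BijGroup)
  fix x y assume p: "(x, y) \<in> PXV R"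
  have 1: "(x, (y + 1) mod int R) \<in> PXV R" "((e (y + 1) * x) mod 3, y) \<in> PXV R" using p k by (auto simp: PXV_iff)
  have "(y + 1) mod int R mod int k = (y + 1) mod int k" by (simp add: mod_mod_cancel)
  then have "e ((y + 1) mod int R) = e (y + 1)" using psigns_mod[OF e] by metis
  then show "(sgnp R e \<cdot> sigma R) (x, y) = (sigma R \<cdot> sgnp R (\<lambda>y. e (y + 1))) (x, y)"
   using p 1 by (simp add: BijGroup_mult_apply[OF B(1) B3] BijGroup_mult_apply[OF B3 B(2)] sgnp_apply sigma_apply)
 qed
qed

text \<open>For a periodic pattern the inverse shift is a power of the shift.\<close>

lemma sign_module_shift_back:
 assumes E: "sign_module k E" "e \<in> E"
 shows "(\<lambda>y. e (y - 1)) \<in> E"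
proof -
 have "(\<lambda>y. e (y + int j)) \<in> E" for j
 proof (induction j)
  case (Suc j)
  then have "(\<lambda>y. (\<lambda>y. e (y + int j)) (y + 1)) \<in> E" using E(1) by (auto simp: sign_module_def)
  then show ?case by (simp add: algebra_simps)
 qed (simp add: E)
 then have "(\<lambda>y. e (y + int (k - 1))) \<in> E" .
 moreover have "e (y + int (k - 1)) = e (y - 1)" for y
 proof -
  have "e \<in> psigns k" using E by (auto simp: sign_module_def)
  then have "e ((y - 1) + int k * 1) = e (y - 1)" by (rule psigns_period)
  moreover have "y + int (k - 1) = (y - 1) + int k * 1" using k by (simp add: of_nat_diff)
  ultimately show ?thesis by metis
 qed
 ultimately show ?thesis by simp
qed

text \<open>Conjugation by \<open>sigma\<close> shifts a sign pattern, so the submodules of \<open>Lambda\<close> are the shift-invariant groups of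
 patterns. This is one direction; \<open>Lambda_submodule_sign_module\<close> is the other.\<close>

lemma sign_module_Lambda_submodule:
 assumes E: "sign_module k E"
 shows "Lambda_submodule R (sgnp R ` E)"
proof -
 interpret S: group S by (rule group_BijGroup)
 have Ep: "e \<in> psigns k" if "e \<in> E" for e using E that by (auto simp: sign_module_def)
 have Es: "e \<in> signs R" if "e \<in> E" for e using psigns_signs Ep that by blast
 have sB: "sgnp R e \<in> carrier S" if "e \<in> E" for e using sgnp_Bij[OF Es[OF that]] by (simp add: carrier_BijGroup)
 have mult: "sgnp R e \<cdot> sgnp R f \<in> sgnp R ` E" if "e \<in> E" "f \<in> E" for e f
  using sgnp_mult(1)[OF Es Es, OF that] E that by (auto simp: sign_module_def)
 have "subgroup (sgnp R ` E) S"
 proof (rule S.finite_closed_subgroup[OF finite_SymV])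
  have "sgnp R (\<lambda>_. 1) = \<one>\<^bsub>S\<^esub>" by (rule sgnp_one) simp
  then show "\<one>\<^bsub>S\<^esub> \<in> sgnp R ` E" using E unfolding sign_module_def by (metis imageI)
 qed (use sB mult in auto)
 moreover have "sgnp R ` E \<subseteq> Lambda R" unfolding Lambda_eq[OF k] using Ep by auto
 moreover have "conj_by S s (sgnp R ` E) \<subseteq> sgnp R ` E" if s: "s \<in> generate S {sigma R}" for s
 proof -
  have sig: "sigma R \<in> carrier S" using sigma_Bij[of R] k by (simp add: carrier_BijGroup)
  then obtain n :: nat where n: "s = sigma R [^]\<^bsub>S\<^esub> n"
   using s S.generate_pow_on_finite_carrier[OF finite_SymV sig] by auto
  have "\<exists>f\<in>E. sigma R [^]\<^bsub>S\<^esub> n \<cdot> sgnp R e = sgnp R f \<cdot> sigma R [^]\<^bsub>S\<^esub> n" if "e \<in> E" for e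
   using that
  proof (induction n arbitrary: e)
   case 0
   then show ?case using sB by auto
  next
   case (Suc n)
   have e1: "(\<lambda>y. e (y - 1)) \<in> E" by (rule sign_module_shift_back[OF E Suc.prems])
   then obtain f where f: "f \<in> E" "sigma R [^]\<^bsub>S\<^esub> n \<cdot> sgnp R (\<lambda>y. e (y - 1)) = sgnp R f \<cdot> sigma R [^]\<^bsub>S\<^esub> n"
    using Suc.IH by blast
   have "sigma R \<cdot> sgnp R e = sgnp R (\<lambda>y. e (y - 1)) \<cdot> sigma R" using sgnp_sigma[OF Ep[OF e1]] by simp
   then have "sigma R [^]\<^bsub>S\<^esub> Suc n \<cdot> sgnp R e = sgnp R f \<cdot> sigma R [^]\<^bsub>S\<^esub> Suc n"
    using f(2) sig sB[OF f(1)] sB[OF e1] sB[OF Suc.prems] by (simp add: S.m_assoc) (simp add: S.m_assoc[symmetric])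
   then show ?case using f(1) by blast
  qed
  then have "s \<cdot> sgnp R e \<cdot> iv s \<in> sgnp R ` E" if "e \<in> E" for e
   unfolding n using that sig sB by (metis S.inv_solve_right' S.m_closed S.nat_pow_closed imageI)
  then show ?thesis by (auto simp: conj_by_def)
 qed
 ultimately show ?thesis by (simp add: Lambda_submodule_def)
qed

lemma Lambda_submodule_sign_module:
 assumes L: "Lambda_submodule R L"
 shows "\<exists>E. sign_module k E \<and> L = sgnp R ` E"
proof -
 interpret S: group S by (rule group_BijGroup)
 define E where "E = {e \<in> psigns k. sgnp R e \<in> L}"
 have LD: "subgroup L S" "L \<subseteq> sgnp R ` psigns k" using L by (auto simp: Lambda_submodule_def Lambda_eq[OF k])
 have full: "sign_module k (psigns k)" by (rule sign_module_psigns)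
 have "sign_module k E"
  unfolding sign_module_def
 proof (intro conjI ballI)
  show "E \<subseteq> psigns k" by (auto simp: E_def)
  have "sgnp R (\<lambda>_. 1) = \<one>\<^bsub>S\<^esub>" by (rule sgnp_one) simp
  then show "(\<lambda>_. 1) \<in> E" using subgroup.one_closed[OF LD(1)] full by (simp add: E_def sign_module_def)
 next
  fix e f assume ef: "e \<in> E" "f \<in> E"
  then have "sgnp R (smult e f) \<in> L"
   using sgnp_mult(1)[OF psigns_signs psigns_signs, of e k f k R] subgroup.m_closed[OF LD(1), of "sgnp R e" "sgnp R f"] by (simp add: E_def)
  then show "smult e f \<in> E" using full ef by (simp add: E_def sign_module_def)
 next
  fix e assume e: "e \<in> E"
  have sig: "sigma R \<in> carrier S" using sigma_Bij[of R] k by (simp add: carrier_BijGroup)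
  have e1: "(\<lambda>y. e (y + 1)) \<in> psigns k" using full e by (simp add: E_def sign_module_def)
  have "iv (sigma R) \<in> generate S {sigma R}" by (rule generate.inv) simp
  then have "conj_by S (iv (sigma R)) L \<subseteq> L" using L by (auto simp: Lambda_submodule_def)
  then have "iv (sigma R) \<cdot> sgnp R e \<cdot> iv (iv (sigma R)) \<in> L"
   using e by (auto simp: E_def conj_by_def)
  moreover have "sgnp R e \<in> carrier S" "sgnp R (\<lambda>y. e (y + 1)) \<in> carrier S"
   using sgnp_Bij[OF psigns_signs] e e1 by (auto simp: carrier_BijGroup E_def)
  ultimately have "sgnp R (\<lambda>y. e (y + 1)) \<in> L"
   using sgnp_sigma[of e] e sig by (simp add: E_def S.m_assoc)
  then show "(\<lambda>y. e (y + 1)) \<in> E" using e1 by (simp add: E_def)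
 qed
 moreover have "L = sgnp R ` E" using LD(2) by (auto simp: E_def)
 ultimately show ?thesis by blast
qed

lemma card_sgnp_image:
 assumes E: "E \<subseteq> psigns k"
 shows "card (sgnp R ` E) = card E"
proof (rule card_image, rule inj_onI)
 fix e f assume ef: "e \<in> E" "f \<in> E" "sgnp R e = sgnp R f"
 then have p: "e \<in> psigns k" "f \<in> psigns k" using E by auto
 have "e y = f y" for y
 proof -
  have "0 \<le> y mod int k" "y mod int k < int k" using k by auto
  then have "e (y mod int k) = f (y mod int k)"
   using sgnp_inj[OF psigns_signs[OF p(1)] psigns_signs[OF p(2)] ef(3), of "y mod int k"] by simp
  then show ?thesis using psigns_mod p by metis
 qed
 then show "e = f" by blast
qed

lemma Z2_dim_sgnp_image:
 assumes E: "sign_module k E"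
 shows "has_Z2_dim S (sgnp R ` E) i \<longleftrightarrow> card E = 2 ^ i"
  and "\<exists>i. has_Z2_dim S (sgnp R ` E) i"
proof -
 have Ep: "E \<subseteq> psigns k" using E by (auto simp: sign_module_def)
 have sq: "x \<cdot> x = \<one>\<^bsub>S\<^esub>" if x: "x \<in> sgnp R ` E" for x
 proof -
  obtain e where e: "e \<in> psigns k" "x = sgnp R e" using Ep x by auto
  have "sgnp R (smult e e) = \<one>\<^bsub>S\<^esub>"
   by (rule sgnp_one) (simp add: smult_def psigns_sq[OF e(1)])
  then show ?thesis using sgnp_mult(1)[OF psigns_signs psigns_signs, OF e(1) e(1)] e(2) by simp
 qed
 have sub: "subgroup (sgnp R ` E) S"
  using sign_module_Lambda_submodule[OF E] by (simp add: Lambda_submodule_def)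
 have fin: "finite (sgnp R ` E)" using Ep card_psigns(2)[OF k] finite_subset by blast
 interpret involutive_subgroup S "sgnp R ` E"
  by (rule involutive_subgroup.intro[OF group_BijGroup involutive_subgroup_axioms.intro[OF sub fin sq]])
 show "has_Z2_dim S (sgnp R ` E) i \<longleftrightarrow> card E = 2 ^ i"
  using has_Z2_dim_iff_card card_sgnp_image[OF Ep] by simp
 show "\<exists>i. has_Z2_dim S (sgnp R ` E) i" by (rule exists_Z2_dim)
qed

end

hide_const (open) R S S_prod iv

theorem Lambda_i_sign_module:
 assumes k: "k = 2 ^ m" and E: "sign_module k E" "card E = 2 ^ i"
 shows "Lambda_i (4 * k) i = sgnp (4 * k) ` E"
 unfolding Lambda_i_def
proof (rule the_equality)
 have k0: "k > 0" by (simp add: k)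
 show "Lambda_submodule (4 * k) (sgnp (4 * k) ` E) \<and> has_Z2_dim (SymV (4 * k)) (sgnp (4 * k) ` E) i"
  using sign_module_Lambda_submodule[OF k0 E(1)] Z2_dim_sgnp_image(1)[OF k0 E(1)] E(2) by simp
 fix L assume L: "Lambda_submodule (4 * k) L \<and> has_Z2_dim (SymV (4 * k)) L i"
 then obtain E' where E': "sign_module k E'" "L = sgnp (4 * k) ` E'" using Lambda_submodule_sign_module[OF k0] by blast
 then have "card E' = 2 ^ i" using L Z2_dim_sgnp_image(1)[OF k0 E'(1)] by simp
 then have "E' = E" using sign_module_unique[OF k E'(1)] sign_module_unique[OF k E] by simp
 then show "L = sgnp (4 * k) ` E" using E' by simp
qed

section \<open>Translations and sign changes in a group containing $\rho$\<close>

context rho_group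
begin

lemma rho_pow_K: "rho r \<up> (n::nat) \<in> K"
 by (induction n) (simp_all add: K_one K_mult rho_K)

lemmas rho_pow_Bij = rho_pow(1)[OF r_pos] and rho_pow_apply = rho_pow(2)[OF r_pos]

lemma const_sign: "(\<lambda>_. -1) \<in> signs r" by (simp add: signs_def)

text \<open>One full turn with \<open>rho\<close> changes the sign on every block.\<close>

lemma minus_one_K: "sgnp r (\<lambda>_. -1) \<in> K"
proof -
 have "rho r \<up> r = sgnp r (\<lambda>_. -1)"
 proof (rule SymV_eqI[OF rho_pow_Bij sgnp_Bij[OF const_sign]])
  fix x y assume p: "(x, y) \<in> PXV r"
  have "(y + int r) div int r = 1" "(y + int r) mod int r = y" using p by (auto simp: PXV_iff)
  then show "(rho r \<up> r) (x, y) = sgnp r (\<lambda>_. -1) (x, y)"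
   using p rho_pow_apply[of x y r] by (simp add: sgnp_apply)
 qed
 then show ?thesis using rho_pow_K by metis
qed

definition block_preserving :: "(int \<times> int \<Rightarrow> int \<times> int) \<Rightarrow> bool" where
 "block_preserving g \<longleftrightarrow> (\<forall>p\<in>PXV r. snd (g p) = snd p)"

lemma sgnp_trans:
 assumes e: "e \<in> signs r"
 shows "sgnp r e \<cdot> transl r c = transl r (\<lambda>y. e y * c y) \<cdot> sgnp r e"
proof (rule SymV_eqI)
 fix x y assume p: "(x, y) \<in> PXV r"
 have "((x + c y) mod 3, y) \<in> PXV r" "((e y * x) mod 3, y) \<in> PXV r" using p by (auto simp: PXV_iff)
 moreover have "(e y * ((x + c y) mod 3)) mod 3 = ((e y * x) mod 3 + e y * c y) mod 3"
  by (simp only: mod_mult_right_eq mod_add_left_eq distrib_left)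
 ultimately show "(sgnp r e \<cdot> transl r c) (x, y) = (transl r (\<lambda>y. e y * c y) \<cdot> sgnp r e) (x, y)"
  using p by (simp add: mult_apply transl_Bij sgnp_Bij[OF e] sgnp_apply transl_apply)
qed (auto intro: mult_Bij transl_Bij sgnp_Bij[OF e])

lemma transl_K_iff_double: "transl r (\<lambda>y. 2 * c y) \<in> K \<Longrightarrow> transl r c \<in> K"
proof -
 assume h: "transl r (\<lambda>y. 2 * c y) \<in> K"
 have "transl r (\<lambda>y. 2 * c y) \<cdot> transl r (\<lambda>y. 2 * c y) = transl r c"
  unfolding transl_mult
 proof (rule transl_eqI)
  fix y
  have "(2 * c y + 2 * c y) = c y + 3 * c y" by simp
  then show "(2 * c y + 2 * c y) mod 3 = c y mod 3" by (metis mod_mult_self2)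
 qed
 then show ?thesis using K_mult[OF h h] by simp
qed

text \<open>An element acting on the blocks separately is a translation times a sign change; comparing it
 with its conjugate under the sign change of all blocks exhibits the translation in the group.\<close>

lemma block_preserving_decomposition:
 assumes b: "b \<in> K" "block_preserving b"
 obtains e c where "e \<in> signs r" "sgnp r e \<in> K" "transl r c \<in> K" "b = transl r c \<cdot> sgnp r e"
proof -
 have bB: "b \<in> Bij (PXV r)" by (rule KB[OF b(1)])
 define e where "e = sign_part b"
 define c where "c y = fst (b (0, y))" for y
 have es: "e \<in> signs r" by (auto simp: e_def signs_def sign_part_def)
 have b_apply: "b (x, y) = ((e y * x + c y) mod 3, y)" if "(x, y) \<in> PXV r" for x y
  unfolding e_def c_def by (rule block_permutation[OF bB _ that]) (use b(2) in \<open>simp add: block_preserving_def\<close>)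
 have b_eq: "b = transl r c \<cdot> sgnp r e"
  by (rule Bij_eqI[OF bB mult_Bij[OF transl_Bij sgnp_Bij[OF es]]]) (auto simp: b_apply transl_sgnp_apply[OF es])
 let ?z = "sgnp r (\<lambda>_. -1)"
 note zB = sgnp_Bij[OF const_sign]
 note cc = transl_Bij[of r, folded carrier_BijGroup] zB[folded carrier_BijGroup] sgnp_Bij[OF es, folded carrier_BijGroup]
 have "?z \<cdot> b = transl r (\<lambda>y. - c y) \<cdot> (?z \<cdot> sgnp r e)"
  unfolding b_eq using cc sgnp_trans[OF const_sign, of c] by (simp add: S.m_assoc[symmetric])
 then have "transl r (\<lambda>y. 2 * c y) \<cdot> (?z \<cdot> b) = transl r c \<cdot> (?z \<cdot> sgnp r e)"
  using cc by (simp add: S.m_assoc[symmetric] transl_mult)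
 also have "?z \<cdot> sgnp r e = sgnp r e \<cdot> ?z" using sgnp_mult(1) const_sign es by (simp add: smult_def mult.commute)
 finally have "b \<cdot> ?z = transl r (\<lambda>y. 2 * c y) \<cdot> (?z \<cdot> b)" unfolding b_eq using cc by (simp add: S.m_assoc)
 then have "transl r (\<lambda>y. 2 * c y) = (b \<cdot> ?z) \<cdot> iv (?z \<cdot> b)"
  using S.inv_solve_right[of "transl r (\<lambda>y. 2 * c y)" "b \<cdot> ?z" "?z \<cdot> b"] mult_Bij zB bB transl_Bij
  by (simp add: carrier_BijGroup)
 moreover have "\<dots> \<in> K" by (intro K_mult K_inv b(1) minus_one_K)
 ultimately have "transl r (\<lambda>y. 2 * c y) \<in> K" by (simp only:)
 then have cK: "transl r c \<in> K" by (rule transl_K_iff_double)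
 have "sgnp r e = iv (transl r c) \<cdot> b"
  unfolding b_eq using transl_Bij sgnp_Bij[OF es] by (simp add: carrier_BijGroup)
 then have "sgnp r e \<in> K" using K_mult[OF K_inv[OF cK] b(1)] by simp
 then show ?thesis using that[OF es _ cK b_eq] by blast
qed

lemma rotation:
 assumes "g \<in> K"
 obtains n :: nat where "\<And>p. p \<in> PXV r \<Longrightarrow> snd (g p) = (snd p + int n) mod int r"
proof -
 obtain j where j: "\<And>x y. (x, y) \<in> PXV r \<Longrightarrow> snd (g (x, y)) = (y + j) mod int r" using rotates[OF assms] by blast
 have "(y + j) mod int r = (y + int (nat (j mod int r))) mod int r" for y
  using r_pos by (simp add: mod_add_right_eq)
 then show ?thesis using that[of "nat (j mod int r)"] j by (metis prod.collapse)
qed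

lemma rotation_inv:
 assumes g: "g \<in> Bij (PXV r)" and rot: "\<And>p. p \<in> PXV r \<Longrightarrow> snd (g p) = (snd p + n) mod int r" and p: "p \<in> PXV r"
 shows "snd ((iv g) p) = (snd p - n) mod int r"
proof -
 let ?q = "(iv g) p"
 have q: "?q \<in> PXV r" "g ?q = p" using BijGroup_inv_apply[OF g p] by auto
 have "snd p = (snd ?q + n) mod int r" using rot[OF q(1)] q(2) by simp
 then have "(snd p - n) mod int r = (snd ?q + n - n) mod int r" by (simp add: mod_diff_left_eq)
 moreover have "0 \<le> snd ?q" "snd ?q < int r" using q(1) by (cases ?q; simp add: PXV_iff)+
 ultimately show ?thesis by simp
qed

lemma rho_pow_rotation: "p \<in> PXV r \<Longrightarrow> snd ((rho r \<up> (n::nat)) p) = (snd p + int n) mod int r"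
 using rho_pow_apply[of "fst p" "snd p" n] by simp

lemma range_snd: "p \<in> PXV r \<Longrightarrow> 0 \<le> snd p \<and> snd p < int r"
 by (cases p) (simp add: PXV_iff)

lemma derotate:
 assumes g: "g \<in> K"
 obtains n :: nat where "block_preserving (iv (rho r \<up> n) \<cdot> g)"
  "block_preserving (g \<cdot> iv (rho r \<up> n))"
proof -
 obtain n :: nat where n: "\<And>p. p \<in> PXV r \<Longrightarrow> snd (g p) = (snd p + int n) mod int r" using rotation[OF g] by blast
 let ?h = "rho r \<up> n"
 note gB = KB[OF g] and hB = rho_pow_Bij[of n] and hiB = inv_Bij[OF rho_pow_Bij[of n]]
 have inv: "snd ((iv ?h) p) = (snd p - int n) mod int r" if "p \<in> PXV r" for p
  by (rule rotation_inv[OF hB rho_pow_rotation that])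
 have "snd ((iv ?h \<cdot> g) p) = snd p" if p: "p \<in> PXV r" for p
  using p range_snd[OF p] inv[OF Bij_apply_closed[OF gB p]] n[OF p]
  by (simp add: mult_apply[OF hiB gB] mod_diff_left_eq)
 moreover have "snd ((g \<cdot> iv ?h) p) = snd p" if p: "p \<in> PXV r" for p
  using p range_snd[OF p] n[OF Bij_apply_closed[OF hiB p]] inv[OF p]
  by (simp add: mult_apply[OF gB hiB] mod_add_left_eq)
 ultimately show ?thesis using that[of n] by (simp add: block_preserving_def)
qed

text \<open>A description of the translations that is invariant under conjugation: they preserve the blocks and have order
 dividing three.\<close>

lemma translations_eq:
 "{g \<in> K. block_preserving g \<and> (\<forall>p\<in>PXV r. g (g (g p)) = p)} = transl r ` code" (is "?T = _")
proof
 show "?T \<subseteq> transl r ` code"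
 proof
  fix b assume b: "b \<in> ?T"
  then have bK: "b \<in> K" by simp
  define c where "c y = fst (b (0, y))" for y
  have "b = transl r c" unfolding c_def
   by (rule order_three_translation[OF KB[OF bK]]) (use b in \<open>auto simp: block_preserving_def\<close>)
  also have "\<dots> = transl r (extend r c)" by (rule transl_eqI) (simp add: extend_eq)
  finally have "b = transl r (extend r c)" .
  moreover from this have "extend r c \<in> code" using bK extend_nwords[OF r_pos] by (simp add: code_def)
  ultimately show "b \<in> transl r ` code" by blast
 qed
 show "transl r ` code \<subseteq> ?T"
 proof
  fix g assume "g \<in> transl r ` code"
  then obtain c where c: "c \<in> code" "g = transl r c" by auto
  have "block_preserving (transl r c)" by (auto simp: block_preserving_def transl_def)
  then show "g \<in> ?T" using c transl_cube by (auto simp: code_def)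
 qed
qed

lemma translations_subgroup: "subgroup (transl r ` code) S"
proof (rule S.finite_closed_subgroup[OF finite_SymV])
 note D = negacyclic_codeD[OF code_negacyclic]
 show "transl r ` code \<subseteq> carrier S" using transl_Bij by (auto simp: carrier_BijGroup)
 have "transl r (\<lambda>_. 0) = id\<^sub>S" by (simp add: transl_zero)
 then show "id\<^sub>S \<in> transl r ` code" using D(2) by (metis imageI)
 show "g \<cdot> h \<in> transl r ` code" if "g \<in> transl r ` code" "h \<in> transl r ` code" for g h
  using that D(3) transl_wadd by auto
qed

lemma translations_normal: "transl r ` code \<lhd> S\<lparr>carrier := K\<rparr>"
proof -
 interpret KG: group "S\<lparr>carrier := K\<rparr>" by (rule S.subgroup_imp_group[OF K])
 have sub: "transl r ` code \<subseteq> K" by (auto simp: code_def)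
 have sg: "subgroup (transl r ` code) (S\<lparr>carrier := K\<rparr>)"
  using S.subgroup_incl[OF translations_subgroup K sub] .
 show ?thesis
 proof (rule KG.normal_invI[OF sg])
  fix g h assume "g \<in> carrier (S\<lparr>carrier := K\<rparr>)" and h: "h \<in> transl r ` code"
  then have g: "g \<in> K" by simp
  then have inv: "inv\<^bsub>S\<lparr>carrier := K\<rparr>\<^esub> g = iv g" by (rule S.m_inv_consistent[OF K])
  have hT: "h \<in> K" "block_preserving h" "\<And>p. p \<in> PXV r \<Longrightarrow> h (h (h p)) = p"
   using h translations_eq by auto
  note gB = KB[OF g] and hB = KB[OF hT(1)] and giB = inv_Bij[OF KB[OF g]]
  obtain n :: nat where n: "\<And>p. p \<in> PXV r \<Longrightarrow> snd (g p) = (snd p + int n) mod int r" using rotation[OF g] by blast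
  let ?c = "g \<cdot> h \<cdot> iv g"
  have app: "?c p = g (h ((iv g) p))" if p: "p \<in> PXV r" for p
   using mult_apply[OF mult_Bij[OF gB hB] giB p] mult_apply[OF gB hB Bij_apply_closed[OF giB p]] by simp
  have "?c \<in> K" using K_mult K_inv g hT(1) by blast
  moreover have "block_preserving ?c"
   unfolding block_preserving_def
  proof
   fix p assume p: "p \<in> PXV r"
   define q where "q = (iv g) p"
   have q: "q \<in> PXV r" "g q = p" using BijGroup_inv_apply[OF gB p] by (auto simp: q_def)
   have "snd (g (h q)) = (snd q + int n) mod int r"
    using n[OF Bij_apply_closed[OF hB q(1)]] hT(2) q(1) by (simp add: block_preserving_def)
   also have "\<dots> = snd p" using n[OF q(1)] q(2) by simp
   finally show "snd (?c p) = snd p" unfolding app[OF p] q_def .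
  qed
  moreover have "?c (?c (?c p)) = p" if p: "p \<in> PXV r" for p
  proof -
   define q where "q = (iv g) p"
   have q: "q \<in> PXV r" "g q = p" using BijGroup_inv_apply[OF gB p] by (auto simp: q_def)
   have step: "?c (g u) = g (h u)" if "u \<in> PXV r" for u
    using app[OF Bij_apply_closed[OF gB that]] BijGroup_inv_apply(1)[OF gB that] by simp
   have "?c (?c (?c (g q))) = g (h (h (h q)))"
    using step q(1) Bij_apply_closed[OF hB] by simp
   then show ?thesis using hT(3)[OF q(1)] q(2) by simp
  qed
  ultimately have "?c \<in> transl r ` code" unfolding translations_eq[symmetric] by simp
  then show "g \<otimes>\<^bsub>S\<lparr>carrier := K\<rparr>\<^esub> h \<otimes>\<^bsub>S\<lparr>carrier := K\<rparr>\<^esub> inv\<^bsub>S\<lparr>carrier := K\<rparr>\<^esub> g \<in> transl r ` code"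
   using inv by simp
 qed
qed

end

section \<open>The semidirect decomposition\<close>

context rho_group
begin

lemma transl_extend: "transl r (extend r c) = transl r c"
 by (rule transl_eqI) (simp add: extend_eq)

lemma extend_code: "transl r c \<in> K \<Longrightarrow> extend r c \<in> code"
 by (simp add: code_def transl_extend extend_nwords[OF r_pos])

lemma conj_sign_code:
 assumes e: "e \<in> signs r" "sgnp r e \<in> K" and c: "c \<in> code"
 shows "extend r (\<lambda>y. e y * c y) \<in> code"
proof (rule extend_code)
 have "transl r (\<lambda>y. e y * c y) = (sgnp r e \<cdot> transl r c) \<cdot> iv (sgnp r e)"
  unfolding sgnp_trans[OF e(1)] using transl_Bij sgnp_Bij[OF e(1)] by (simp add: carrier_BijGroup[symmetric] S.m_assoc)
 moreover have "\<dots> \<in> K" using c by (intro K_mult K_inv e(2)) (simp add: code_def)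
 ultimately show "transl r (\<lambda>y. e y * c y) \<in> K" by (simp only:)
qed

lemma sign_eqI:
 fixes u v :: int
 assumes "u = 1 \<or> u = -1" "v = 1 \<or> v = -1" "(u - v) mod 3 = 0"
 shows "u = v"
 using assms by auto

lemma mod3_diff: "(u mod 3 - v mod 3 - w mod 3) mod 3 = (u - v - w) mod (3::int)"
 by (intro mod_diff_cong) simp_all

text \<open>Conjugation by the sign change maps the code to itself. Comparing the relations for a word
 \<open>(X + Y, X, Y, X - Y)\<close> and for its image, with \<open>(X, Y)\<close> equal to \<open>(1, 0)\<close> and to \<open>(0, 1)\<close>, shows that the signs in
 the four blocks agree.\<close>

lemma signs_periodic:
 assumes T: "code = tetra 1 k" and e: "e \<in> signs r" "sgnp r e \<in> K" and y: "0 \<le> y" "y < int r"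
 shows "e y = e (y mod int k)"
proof -
 have sh: "(i + n * int k) div int k = n" "(i + n * int k) mod int k = i" if "0 \<le> i" "i < int k" for i n
  using that by simp_all
 have rel: "(e i * (X + Y) - e (i + int k) * X - e (i + 2 * int k) * Y) mod 3 = 0"
  "(e (i + int k) * X - e (i + 2 * int k) * Y - e (i + 3 * int k) * (X - Y)) mod 3 = 0"
  if i: "0 \<le> i" "i < int k" for i X Y
 proof -
  define c where "c = tetra_word k (\<lambda>_. X) (\<lambda>_. Y)"
  define d where "d = extend r (\<lambda>y. e y * c y)"
  have "c \<in> code" using tetra_word_in_tetra[OF k_pos] T by (simp add: c_def)
  then have "d \<in> tetra 1 k" using conj_sign_code[OF e] T d_def by simp
  then have D: "(d y - d (y + int k) - d (y + 2 * int k)) mod 3 = 0" for y by (simp add: tetra_def)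
  have dv: "d y = (e y * c y) mod 3" if "0 \<le> y" "y < int r" for y
   unfolding d_def by (rule extend_eq[OF that])
  have c0: "c i = (X + Y) mod 3" using sh[OF i, of 0] i by (simp add: c_def tetra_word_def)
  have c1: "c (i + int k) = X mod 3" using sh[OF i, of 1] by (simp add: c_def tetra_word_def)
  have c2: "c (i + 2 * int k) = Y mod 3" using sh[OF i, of 2] by (simp add: c_def tetra_word_def)
  have c3: "c (i + 3 * int k) = (X - Y) mod 3" using sh[OF i, of 3] by (simp add: c_def tetra_word_def)
  have b: "i < int r" "i + int k < int r" "i + 2 * int k < int r" "i + 3 * int k < int r" using i r4k by auto
  have d0: "d i = (e i * (X + Y)) mod 3" using dv[OF i(1) b(1)] c0 by (simp add: mod_mult_right_eq)
  have d1: "d (i + int k) = (e (i + int k) * X) mod 3" using dv[OF _ b(2)] i c1 by (simp add: mod_mult_right_eq)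
  have d2: "d (i + 2 * int k) = (e (i + 2 * int k) * Y) mod 3" using dv[OF _ b(3)] i c2 by (simp add: mod_mult_right_eq)
  have d3: "d (i + 3 * int k) = (e (i + 3 * int k) * (X - Y)) mod 3" using dv[OF _ b(4)] i c3 by (simp add: mod_mult_right_eq)
  show "(e i * (X + Y) - e (i + int k) * X - e (i + 2 * int k) * Y) mod 3 = 0"
   using D[of i] unfolding d0 d1 d2 mod3_diff .
  have p: "i + int k + int k = i + 2 * int k" "i + int k + 2 * int k = i + 3 * int k" by simp_all
  show "(e (i + int k) * X - e (i + 2 * int k) * Y - e (i + 3 * int k) * (X - Y)) mod 3 = 0"
   using D[of "i + int k"] unfolding p d1 d2 d3 mod3_diff .
 qed
 obtain m i where m: "m \<in> {0,1,2,3}" and i: "0 \<le> i" "i < int k" and ym: "y = m * int k + i" "y mod int k = i"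
  using block_index[of y k] y r4k k_pos by auto
 have b: "i < int r" "i + int k < int r" "i + 2 * int k < int r" "i + 3 * int k < int r" using i r4k by auto
 have ev: "e i = 1 \<or> e i = -1" "e (i + int k) = 1 \<or> e (i + int k) = -1"
  "e (i + 2 * int k) = 1 \<or> e (i + 2 * int k) = -1" "e (i + 3 * int k) = 1 \<or> e (i + 3 * int k) = -1"
  using e(1) i b by (auto simp: signs_def)
 have "e i = e (i + int k)" by (rule sign_eqI[OF ev(1,2)]) (use rel(1)[OF i, of 1 0] in simp)
 moreover have "e (i + int k) = e (i + 3 * int k)" by (rule sign_eqI[OF ev(2,4)]) (use rel(2)[OF i, of 1 0] in simp)
 moreover have "e i = e (i + 2 * int k)" by (rule sign_eqI[OF ev(1,3)]) (use rel(1)[OF i, of 0 1] in simp)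
 ultimately show ?thesis unfolding ym(2) using m ym(1) by (auto simp: add.commute)
qed

definition E :: "(int \<Rightarrow> int) set" where
 "E = {e \<in> psigns k. sgnp r e \<in> K}"

lemma signs_E:
 assumes T: "code = tetra 1 k" and e: "e \<in> signs r" "sgnp r e \<in> K"
 shows "sgnp r e \<in> sgnp r ` E"
proof -
 define f where "f y = e (y mod int k)" for y
 have "f y = 1 \<or> f y = -1" for y
 proof -
  have "0 \<le> y mod int k" "y mod int k < int k" using k_pos by auto
  moreover from this have "y mod int k < int r" using r4k by linarith
  ultimately show ?thesis using e(1) unfolding f_def signs_def by blast
 qed
 then have f: "f \<in> psigns k" by (simp add: psigns_def f_def)
 have "sgnp r e = sgnp r f"
 proof (rule SymV_eqI[OF sgnp_Bij[OF e(1)] sgnp_Bij[OF psigns_signs[OF f]]])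
  fix x y assume p: "(x, y) \<in> PXV r"
  show "sgnp r e (x, y) = sgnp r f (x, y)"
   using p signs_periodic[OF T e, of y] by (simp add: sgnp_apply f_def PXV_iff)
 qed
 then show ?thesis using e f by (auto simp: E_def)
qed

lemma sgnp_rho:
 assumes e: "e \<in> psigns k"
 shows "sgnp r e \<cdot> rho r = rho r \<cdot> sgnp r (\<lambda>y. e (y + 1))"
proof -
 let ?e = "\<lambda>y. e (y + 1)" and ?a = "\<lambda>y. if y = int r - 1 then -1 else 1 :: int"
 have "?e \<in> psigns k" using sign_module_psigns[of k] e by (auto simp: sign_module_def)
 then have s: "e \<in> signs r" "?e \<in> signs r" "?a \<in> signs r" using psigns_signs e by (auto simp: signs_def)
 have c: "sgnp r e \<in> carrier S" "sgnp r ?e \<in> carrier S" "alpha r \<in> carrier S" "sigma r \<in> carrier S"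
  using sgnp_Bij[OF s(1)] sgnp_Bij[OF s(2)] sgnp_Bij[OF s(3)] sigma_Bij[OF r_pos] by (simp_all add: carrier_BijGroup alpha_eq)
 have "sgnp r ?e \<cdot> alpha r = alpha r \<cdot> sgnp r ?e"
  unfolding alpha_eq using s by (simp add: sgnp_mult smult_def mult.commute)
 moreover have "sgnp r e \<cdot> sigma r = sigma r \<cdot> sgnp r ?e" using sgnp_sigma[OF k_pos e] unfolding r4k[symmetric] .
 ultimately show ?thesis unfolding rho_def using c by (metis S.m_assoc)
qed

lemma E_sign_module: "sign_module k E"
 unfolding sign_module_def
proof (intro conjI ballI)
 have full: "sign_module k (psigns k)" by (rule sign_module_psigns)
 show "E \<subseteq> psigns k" by (auto simp: E_def)
 have "sgnp r (\<lambda>_. 1) = id\<^sub>S" by (rule sgnp_one) simp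
 then show "(\<lambda>_. 1) \<in> E" using K_one full by (simp add: E_def sign_module_def)
 show "smult e f \<in> E" if "e \<in> E" "f \<in> E" for e f
  using that sgnp_mult(1)[OF psigns_signs psigns_signs, of e k f k r] K_mult[of "sgnp r e" "sgnp r f"] full
  by (simp add: E_def sign_module_def)
 fix e assume "e \<in> E"
 then have e: "e \<in> psigns k" "sgnp r e \<in> K" by (auto simp: E_def)
 have e1: "(\<lambda>y. e (y + 1)) \<in> psigns k" using full e by (simp add: sign_module_def)
 have "sgnp r (\<lambda>y. e (y + 1)) = iv (rho r) \<cdot> (sgnp r e \<cdot> rho r)"
  unfolding sgnp_rho[OF e(1)] using rhoB sgnp_Bij[OF psigns_signs[OF e1]] by (simp add: carrier_BijGroup)
 moreover have "\<dots> \<in> K" by (intro K_mult K_inv rho_K e(2))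
 ultimately show "(\<lambda>y. e (y + 1)) \<in> E" using e1 by (simp add: E_def)
qed

text \<open>The dimension is positive because the constant pattern \<open>-1\<close> comes from the \<open>r\<close>-th power of \<open>rho\<close>.\<close>

lemma card_E: "\<exists>i\<in>{1..2 ^ (a - 2)}. card E = 2 ^ i"
proof -
 have E: "E \<subseteq> psigns k" "finite E" using card_psigns(2)[OF k_pos] finite_subset by (auto simp: E_def)
 obtain i where i: "card E = 2 ^ i" using Z2_dim_sgnp_image[OF k_pos E_sign_module] by blast
 have "(\<lambda>_. -1) \<in> E" using minus_one_K by (simp add: E_def psigns_def)
 moreover have "(\<lambda>_. 1) \<in> E" using E_sign_module by (simp add: sign_module_def)
 moreover have "(\<lambda>_. -1::int) \<noteq> (\<lambda>_::int. 1)" by (auto dest: fun_cong)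
 ultimately have "card E \<noteq> 1" by (auto simp: card_1_singleton_iff)
 then have "i \<ge> 1" using i by (cases i) auto
 moreover have "(2::nat) ^ i \<le> 2 ^ k" using card_mono[OF card_psigns(2)[OF k_pos] E(1)] i card_psigns(1)[OF k_pos] by simp
 then have "i \<le> k" by simp
 ultimately show ?thesis using i k_def2 by auto
qed

text \<open>The complement of the translations is the stabiliser of the set of points with first coordinate
 \<open>0\<close>.\<close>

definition H :: "(int \<times> int \<Rightarrow> int \<times> int) set" where
 "H = {g \<in> K. \<forall>y. 0 \<le> y \<and> y < int r \<longrightarrow> fst (g (0, y)) = 0}"

lemma H_subgroup: "subgroup H S"
proof (rule S.finite_closed_subgroup[OF finite_SymV])
 show "H \<subseteq> carrier S" using KB by (auto simp: H_def carrier_BijGroup)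
 show "id\<^sub>S \<in> H" using K_one by (auto simp: H_def BijGroup_one_apply PXV_iff)
 fix g h assume gh: "g \<in> H" "h \<in> H"
 have "fst ((g \<cdot> h) (0, y)) = 0" if y: "0 \<le> y" "y < int r" for y
 proof -
  have p: "(0, y) \<in> PXV r" using y by (simp add: PXV_iff)
  have B: "g \<in> Bij (PXV r)" "h \<in> Bij (PXV r)" using gh KB by (auto simp: H_def)
  obtain y' where y': "h (0, y) = (0, y')" using gh(2) y by (cases "h (0, y)") (auto simp: H_def)
  have "0 \<le> y'" "y' < int r" using Bij_apply_closed[OF B(2) p] y' by (auto simp: PXV_iff)
  then show ?thesis using gh(1) y' mult_apply[OF B p] by (simp add: H_def)
 qed
 then show "g \<cdot> h \<in> H" using gh K_mult by (simp add: H_def)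
qed

lemma rho_H: "rho r \<in> H"
 using rho_K by (auto simp: H_def rho_apply PXV_iff)

lemma generate_rho: "generate S {rho r} \<subseteq> H"
 by (rule S.generate_subgroup_incl[OF _ H_subgroup]) (simp add: rho_H)

lemma rho_pow_generate: "rho r \<up> (n::nat) \<in> generate S {rho r}"
 by (induction n) (auto intro: generate.intros)

lemma sgnp_H: "sgnp r e \<in> K \<Longrightarrow> sgnp r e \<in> H"
 by (auto simp: H_def sgnp_apply PXV_iff)

lemma H_eq:
 assumes T: "code = tetra 1 k"
 shows "generate S {rho r} <#>\<^bsub>S\<^esub> (sgnp r ` E) = H"
proof
 show "generate S {rho r} <#>\<^bsub>S\<^esub> (sgnp r ` E) \<subseteq> H"
  using generate_rho sgnp_H subgroup.m_closed[OF H_subgroup] by (auto simp: set_mult_def E_def)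
 show "H \<subseteq> generate S {rho r} <#>\<^bsub>S\<^esub> (sgnp r ` E)"
 proof
  fix g assume g: "g \<in> H"
  then have gK: "g \<in> K" by (simp add: H_def)
  obtain n :: nat where n: "block_preserving (iv (rho r \<up> n) \<cdot> g)" by (rule derotate[OF gK])
  define b where "b = iv (rho r \<up> n) \<cdot> g"
  have "rho r \<up> n \<in> H" using rho_pow_generate generate_rho by blast
  then have bH: "b \<in> H" unfolding b_def using subgroup.m_closed[OF H_subgroup] subgroup.m_inv_closed[OF H_subgroup] g by blast
  then have bK: "b \<in> K" "block_preserving b" using n by (auto simp: b_def H_def)
  from block_preserving_decomposition[OF bK] obtain e c where e: "e \<in> signs r" "sgnp r e \<in> K" and c: "transl r c \<in> K"
   and beq: "b = transl r c \<cdot> sgnp r e" by blast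
  have "c y mod 3 = 0" if y: "0 \<le> y" "y < int r" for y
  proof -
   have p: "(0, y) \<in> PXV r" using y by (simp add: PXV_iff)
   have "b (0, y) = (c y mod 3, y)"
    unfolding beq using transl_sgnp_apply[OF e(1) p] by simp
   moreover have "fst (b (0, y)) = 0" using bH y by (simp add: H_def)
   ultimately show ?thesis by simp
  qed
  then have "transl r c = id\<^sub>S" by (simp add: transl_zero)
  then have "b = sgnp r e" using beq sgnp_Bij[OF e(1)] by (simp add: carrier_BijGroup)
  then have "b \<in> sgnp r ` E" using signs_E[OF T e] by simp
  moreover have "g = rho r \<up> n \<cdot> b"
   unfolding b_def using rho_pow_Bij KB[OF gK] by (simp add: carrier_BijGroup S.m_assoc[symmetric])
  ultimately show "g \<in> generate S {rho r} <#>\<^bsub>S\<^esub> (sgnp r ` E)"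
   using rho_pow_generate[of n] by (auto simp: set_mult_def)
 qed
qed

lemma K_eq: "K = (transl r ` code) <#>\<^bsub>S\<^esub> H"
proof
 show "(transl r ` code) <#>\<^bsub>S\<^esub> H \<subseteq> K" using K_mult by (auto simp: set_mult_def code_def H_def)
 show "K \<subseteq> (transl r ` code) <#>\<^bsub>S\<^esub> H"
 proof
  fix g assume g: "g \<in> K"
  obtain n :: nat where n: "block_preserving (g \<cdot> iv (rho r \<up> n))" by (rule derotate[OF g])
  have gK: "g \<cdot> iv (rho r \<up> n) \<in> K" by (intro K_mult K_inv g rho_pow_K)
  from block_preserving_decomposition[OF gK n] obtain e c where e: "e \<in> signs r" "sgnp r e \<in> K" and c: "transl r c \<in> K"
   and beq: "g \<cdot> iv (rho r \<up> n) = transl r c \<cdot> sgnp r e" by blast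
  have cc: "g \<in> carrier S" "rho r \<up> n \<in> carrier S" "transl r c \<in> carrier S" "sgnp r e \<in> carrier S"
   using KB[OF g] rho_pow_Bij transl_Bij sgnp_Bij[OF e(1)] by (auto simp: carrier_BijGroup)
  have "g = (g \<cdot> iv (rho r \<up> n)) \<cdot> (rho r \<up> n)" using cc by (simp add: S.m_assoc)
  also have "\<dots> = transl r (extend r c) \<cdot> (sgnp r e \<cdot> (rho r \<up> n))"
   unfolding beq transl_extend using cc by (simp add: S.m_assoc)
  finally have g_eq: "g = transl r (extend r c) \<cdot> (sgnp r e \<cdot> (rho r \<up> n))" .
  have "sgnp r e \<cdot> (rho r \<up> n) \<in> H"
   using sgnp_H[OF e(2)] rho_pow_generate generate_rho subgroup.m_closed[OF H_subgroup] by blast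
  moreover have "transl r (extend r c) \<in> transl r ` code" using extend_code[OF c] by blast
  ultimately show "g \<in> (transl r ` code) <#>\<^bsub>S\<^esub> H" unfolding set_mult_def using g_eq by blast
 qed
qed

theorem semidirect_decomposition:
 assumes T: "code = tetra 1 k"
 shows "\<exists>i\<in>{1..2 ^ (a - 2)}. internal_semidirect S K (NN r) (Lambda_i_rho r i)"
proof -
 obtain i where i: "i \<in> {1..2 ^ (a - 2)}" "card E = 2 ^ i" using card_E by blast
 have N: "NN r = transl r ` code" using NN_eq[OF k_pos] T r4k by simp
 have "Lambda_i r i = sgnp r ` E" using Lambda_i_sign_module[OF k_def2 E_sign_module i(2)] r4k by simp
 then have L: "Lambda_i_rho r i = H" using H_eq[OF T] by (simp add: Lambda_i_rho_def)
 have "NN r \<inter> H \<subseteq> {id\<^sub>S}"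
 proof
  fix g assume "g \<in> NN r \<inter> H"
  then obtain c where c: "g = transl r c" "g \<in> H" unfolding N by blast
  have "c y mod 3 = 0" if y: "0 \<le> y" "y < int r" for y
  proof -
   have "(0, y) \<in> PXV r" using y by (simp add: PXV_iff)
   moreover have "fst (g (0, y)) = 0" using c(2) y by (simp add: H_def)
   ultimately show ?thesis using c(1) by (simp add: transl_apply)
  qed
  then show "g \<in> {id\<^sub>S}" using c(1) transl_zero by simp
 qed
 then have "NN r \<inter> H = {id\<^sub>S}"
  using subgroup.one_closed[OF H_subgroup] subgroup.one_closed[OF translations_subgroup] N by auto
 moreover have "subgroup H (S\<lparr>carrier := K\<rparr>)"
  by (rule S.subgroup_incl[OF H_subgroup K]) (auto simp: H_def)
 ultimately have "internal_semidirect S K (NN r) (Lambda_i_rho r i)"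
  using K translations_normal K_eq unfolding internal_semidirect_def L N[symmetric] by blast
 then show ?thesis using i(1) by blast
qed

text \<open>The words of \<open>M\<close> form a negacyclic code, and \<open>code\<close> has no proper nonzero subcode.\<close>

lemma invariant_translations:
 assumes M: "subgroup M S" "M \<subseteq> transl r ` code" "M \<noteq> {id\<^sub>S}"
  and inv: "\<And>m. m \<in> M \<Longrightarrow> iv (rho r) \<cdot> (m \<cdot> rho r) \<in> M"
 shows "M = transl r ` code"
proof -
 define U where "U = {c \<in> nwords r. transl r c \<in> M}"
 have one: "transl r (\<lambda>_. 0) = id\<^sub>S" by (simp add: transl_zero)
 have "negacyclic_code (4 * k) U" unfolding U_def r4k[symmetric] by (rule subgroup_words[OF M(1) inv])
 moreover have "U \<noteq> {\<lambda>_. 0}"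
 proof
  assume U0: "U = {\<lambda>_. 0}"
  have "m = id\<^sub>S" if m: "m \<in> M" for m
  proof -
   obtain c where c: "c \<in> code" "m = transl r c" using M(2) m by blast
   then have "c \<in> U" using m by (simp add: U_def code_def)
   then show ?thesis using U0 c one by simp
  qed
  then show False using M(3) subgroup.one_closed[OF M(1)] by blast
 qed
 moreover obtain s where s: "s \<in> {1, -1}" "code = tetra s k" using code_tetra by blast
 moreover have "U \<subseteq> code"
 proof
  fix c assume c: "c \<in> U"
  then have "transl r c \<in> transl r ` code" using M(2) by (auto simp: U_def)
  then show "c \<in> code" using c by (auto simp: U_def code_def)
 qed
 moreover have "4 * k = 2 ^ a" unfolding r_def[symmetric] by (rule r4k[symmetric])
 ultimately have "U = code" using code_in_tetra_eq[of k a s U] by auto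
 then show ?thesis using M(2) by (auto simp: U_def code_def)
qed

lemma word_without_adjacent_zeros: "\<exists>c\<in>code. \<forall>y. \<not> (c y = 0 \<and> c (y + 1) = 0)"
 using code_tetra tetra_word_without_adjacent_zeros[OF k_pos] by auto

end

section \<open>Reversing the cycle of blocks\<close>

lemma conj_by_subgroup:
 assumes "group S" "subgroup K S" "w \<in> carrier S"
 shows "subgroup (conj_by S w K) S"
 unfolding conj_by_def using group.conj_group_hom[OF assms(1,3)] by (rule group_hom.subgroup_img_is_subgroup[OF _ assms(2)])

text \<open>Reversing the order of the blocks inverts \<open>rho\<close> and exchanges the two possible codes.\<close>

definition beta :: "nat \<Rightarrow> int \<times> int \<Rightarrow> int \<times> int" where
 "beta r = restrict (\<lambda>(x, y). (x, int r - 1 - y)) (PXV r)"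

lemma beta_apply: "(x, y) \<in> PXV r \<Longrightarrow> beta r (x, y) = (x, int r - 1 - y)"
 by (simp add: beta_def)

lemma beta_Bij: "beta r \<in> Bij (PXV r)"
proof (rule Bij_finiteI[OF finite_PXV])
 show "inj_on (beta r) (PXV r)" by (rule inj_onI) (auto simp: beta_def)
qed (auto simp: beta_def PXV_iff)

lemma W_identity_tuple:
 assumes "h \<in> Dih r"
 shows "restrict (\<lambda>(x, y). (x, h y)) (PXV r) \<in> W r"
proof -
 let ?gs = "replicate r \<one>\<^bsub>BijGroup (Zmod 3)\<^esub>"
 have "\<one>\<^bsub>BijGroup (Zmod 3)\<^esub> \<in> Bij (Zmod 3)"
  using monoid.one_closed[OF group.is_monoid[OF group_BijGroup, of "Zmod 3"]] by (simp add: carrier_BijGroup)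
 moreover have "restrict (\<lambda>(x, y). (x, h y)) (PXV r) = wreath_elt r ?gs h"
  unfolding wreath_elt_def by (rule restrict_ext) (auto simp: PXV_def Zmod_def BijGroup_one_apply)
 ultimately show ?thesis using assms unfolding W_def by force
qed

lemma one_W: "r > 0 \<Longrightarrow> \<one>\<^bsub>SymV r\<^esub> \<in> W r"
proof -
 assume r: "r > 0"
 define h where "h = (\<lambda>y\<in>Zmod r. (1 * y + 0) mod int r)"
 have "h \<in> Dih r" unfolding Dih_def mem_Collect_eq h_def
  by (rule exI[of _ 1], rule exI[of _ 0]) (use r in \<open>simp add: Zmod_def\<close>)
 moreover have "\<one>\<^bsub>SymV r\<^esub> = restrict (\<lambda>(x, y). (x, h y)) (PXV r)"
  unfolding h_def BijGroup_def by (auto simp: PXV_def Zmod_def fun_eq_iff)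
 ultimately show ?thesis using W_identity_tuple by simp
qed

lemma beta_W: "r > 0 \<Longrightarrow> beta r \<in> W r"
proof -
 assume r: "r > 0"
 define h where "h = (\<lambda>y\<in>Zmod r. (-1 * y + (int r - 1)) mod int r)"
 have "h \<in> Dih r" unfolding Dih_def mem_Collect_eq h_def
  by (rule exI[of _ "-1"], rule exI[of _ "int r - 1"]) (use r in \<open>simp add: Zmod_def\<close>)
 moreover have "beta r = restrict (\<lambda>(x, y). (x, h y)) (PXV r)"
  unfolding h_def beta_def by (rule restrict_ext) (auto simp: PXV_def Zmod_def)
 ultimately show ?thesis using W_identity_tuple by simp
qed

context rho_group
begin

lemma beta_beta: "beta r \<cdot> beta r = id\<^sub>S"
proof (rule SymV_eqI[OF mult_Bij[OF beta_Bij beta_Bij] one_Bij])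
 fix x y assume p: "(x, y) \<in> PXV r"
 have "(x, int r - 1 - y) \<in> PXV r" using p by (auto simp: PXV_iff)
 then show "(beta r \<cdot> beta r) (x, y) = id\<^sub>S (x, y)"
  using p by (simp add: mult_apply[OF beta_Bij beta_Bij] BijGroup_one_apply beta_apply)
qed

lemma inv_beta: "iv (beta r) = beta r"
 using S.inv_equality[OF beta_beta] beta_Bij by (simp add: carrier_BijGroup)

lemma rho_beta: "rho r \<cdot> (beta r \<cdot> rho r) = beta r"
proof (rule SymV_eqI[OF _ beta_Bij])
 fix x y assume p: "(x, y) \<in> PXV r"
 have xy: "0 \<le> x" "x < 3" "0 \<le> y" "y < int r" "(x, y) \<in> PXV r" using p by (auto simp: PXV_iff)
 define q where "q = rho r (x, y)"
 have q: "q = (if y = int r - 1 then (- x) mod 3 else x, (y + 1) mod int r)" unfolding q_def by (rule rho_apply(1)[OF xy(5)])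
 have e: "(rho r \<cdot> (beta r \<cdot> rho r)) (x, y) = rho r (beta r q)"
  using mult_apply[OF rhoB mult_Bij[OF beta_Bij rhoB] p] mult_apply[OF beta_Bij rhoB p] by (simp add: q_def)
 show "(rho r \<cdot> (beta r \<cdot> rho r)) (x, y) = beta r (x, y)"
 proof (cases "y = int r - 1")
  case True
  then have q': "q = ((- x) mod 3, 0)" using q by simp
  have "((- x) mod 3, 0) \<in> PXV r" "((- x) mod 3, int r - 1) \<in> PXV r" using r_pos by (auto simp: PXV_iff)
  then have "rho r (beta r q) = (x, 0)" unfolding q' using xy by (simp add: beta_apply rho_apply(1) mod_minus_eq)
  then show ?thesis unfolding e using True xy(5) by (simp add: beta_apply)
 next
  case False
  then have q': "q = (x, y + 1)" using q xy by simp
  have P: "(x, y + 1) \<in> PXV r" "(x, int r - 1 - (y + 1)) \<in> PXV r" using False xy by (auto simp: PXV_iff)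
  have "rho r (beta r q) = rho r (x, int r - 1 - (y + 1))" unfolding q' beta_apply[OF P(1)] ..
  also have "\<dots> = (x, int r - 1 - y)" unfolding rho_apply(1)[OF P(2)] using xy by simp
  finally show ?thesis unfolding e using xy(5) by (simp add: beta_apply)
 qed
qed (intro mult_Bij rhoB beta_Bij)

lemma beta_rho: "beta r \<cdot> iv (rho r) \<cdot> beta r = rho r"
proof -
 have c: "beta r \<in> carrier S" "rho r \<in> carrier S" using beta_Bij rhoB by (auto simp: carrier_BijGroup)
 have "iv (rho r) \<cdot> beta r = beta r \<cdot> rho r"
  by (subst rho_beta[symmetric]) (use c in \<open>simp add: S.m_assoc[symmetric]\<close>)
 then have "beta r \<cdot> iv (rho r) \<cdot> beta r = (beta r \<cdot> beta r) \<cdot> rho r"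
  using c by (simp add: S.m_assoc)
 then show ?thesis using c beta_beta by simp
qed

lemma beta_trans: "beta r \<cdot> transl r c \<cdot> beta r = transl r (\<lambda>y. c (int r - 1 - y))"
proof (rule SymV_eqI)
 fix x y assume p: "(x, y) \<in> PXV r"
 have "(x, int r - 1 - y) \<in> PXV r" "((x + c (int r - 1 - y)) mod 3, int r - 1 - y) \<in> PXV r" using p by (auto simp: PXV_iff)
 then show "(beta r \<cdot> transl r c \<cdot> beta r) (x, y) = transl r (\<lambda>y. c (int r - 1 - y)) (x, y)"
  using p by (simp add: mult_apply mult_Bij beta_Bij transl_Bij beta_apply transl_apply)
qed (intro mult_Bij beta_Bij transl_Bij)+

lemma conj_beta: "conj_by S (beta r) K = (\<lambda>g. beta r \<cdot> g \<cdot> beta r) ` K"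
 unfolding conj_by_def inv_beta ..

lemma conj_beta_trans_iff: "transl r c \<in> conj_by S (beta r) K \<longleftrightarrow> transl r (\<lambda>y. c (int r - 1 - y)) \<in> K"
proof
 have bc: "beta r \<in> carrier S" using beta_Bij by (simp add: carrier_BijGroup)
 assume "transl r c \<in> conj_by S (beta r) K"
 then obtain g where g: "g \<in> K" "transl r c = beta r \<cdot> g \<cdot> beta r" unfolding conj_beta by blast
 have gc: "g \<in> carrier S" using KB[OF g(1)] by (simp add: carrier_BijGroup)
 have "beta r \<cdot> transl r c \<cdot> beta r = (beta r \<cdot> beta r) \<cdot> g \<cdot> (beta r \<cdot> beta r)"
  unfolding g(2) using bc gc by (simp only: S.m_assoc S.m_closed)
 then show "transl r (\<lambda>y. c (int r - 1 - y)) \<in> K" using g(1) gc beta_trans[of c] by (simp add: beta_beta)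
next
 assume "transl r (\<lambda>y. c (int r - 1 - y)) \<in> K"
 then have "beta r \<cdot> transl r (\<lambda>y. c (int r - 1 - y)) \<cdot> beta r \<in> conj_by S (beta r) K" unfolding conj_beta by blast
 then show "transl r c \<in> conj_by S (beta r) K" unfolding beta_trans by simp
qed

lemma reversed: "rho_group r a (conj_by S (beta r) K)"
proof (rule rho_group.intro)
 have bc: "beta r \<in> carrier S" using beta_Bij by (simp add: carrier_BijGroup)
 show "r = 2 ^ a" by (rule r_def)
 show "subgroup (conj_by S (beta r) K) S" by (rule conj_by_subgroup[OF group_BijGroup K bc])
 show "rho r \<in> conj_by S (beta r) K"
  unfolding conj_beta using K_inv[OF rho_K] by (intro image_eqI[where x = "iv (rho r)"]) (simp_all add: beta_rho)
 show "\<exists>j. \<forall>x y. (x, y) \<in> PXV r \<longrightarrow> snd (g (x, y)) = (y + j) mod int r" if g: "g \<in> conj_by S (beta r) K" for g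
 proof -
  obtain h where h: "h \<in> K" "g = beta r \<cdot> h \<cdot> beta r" using g unfolding conj_beta by blast
  obtain j where j: "\<And>x y. (x, y) \<in> PXV r \<Longrightarrow> snd (h (x, y)) = (y + j) mod int r" using rotates[OF h(1)] by blast
  have "snd (g (x, y)) = (y + - j) mod int r" if p: "(x, y) \<in> PXV r" for x y
  proof -
   have q: "(x, int r - 1 - y) \<in> PXV r" using p by (auto simp: PXV_iff)
   have hq: "h (x, int r - 1 - y) \<in> PXV r" by (rule Bij_apply_closed[OF KB[OF h(1)] q])
   have gp: "g (x, y) = beta r (h (x, int r - 1 - y))"
    unfolding h(2) mult_apply[OF mult_Bij[OF beta_Bij KB[OF h(1)]] beta_Bij p] beta_apply[OF p]
    by (rule mult_apply[OF beta_Bij KB[OF h(1)] q])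
   obtain u v where uv: "h (x, int r - 1 - y) = (u, v)" by (cases "h (x, int r - 1 - y)")
   have v: "v = (int r - 1 - y + j) mod int r" using j[OF q] uv by simp
   have b: "0 \<le> int r - 1 - v" "int r - 1 - v < int r" using hq uv by (auto simp: PXV_iff)
   have "snd (g (x, y)) = int r - 1 - v" unfolding gp uv using hq uv by (simp add: beta_apply)
   also have "\<dots> = (int r - 1 - v) mod int r" using b by simp
   also have "\<dots> = (int r - 1 - (int r - 1 - y + j)) mod int r" unfolding v by (simp only: mod_diff_right_eq)
   finally show ?thesis by simp
  qed
  then show ?thesis by blast
 qed
 show "\<exists>y. 0 \<le> y \<and> y < int r \<and> c y mod 3 = 0" if c: "transl r c \<in> conj_by S (beta r) K" for c
 proof -
  have "\<exists>y. 0 \<le> y \<and> y < int r \<and> c (int r - 1 - y) mod 3 = 0"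
   by (rule zero) (rule c[unfolded conj_beta_trans_iff])
  then obtain y where y: "0 \<le> y" "y < int r" "c (int r - 1 - y) mod 3 = 0" by (elim exE conjE)
  show ?thesis
  proof (intro exI conjI)
   show "0 \<le> int r - 1 - y" "int r - 1 - y < int r" using y by simp_all
  qed (rule y(3))
 qed
 obtain c where c: "transl r c \<in> K" "transl r c \<noteq> id\<^sub>S" using nontrivial by blast
 obtain y where y: "0 \<le> y" "y < int r" "c y mod 3 \<noteq> 0" using c(2) transl_zero by blast
 have "transl r (\<lambda>y. c (int r - 1 - y)) \<noteq> id\<^sub>S"
  unfolding transl_zero using y by (auto intro!: exI[of _ "int r - 1 - y"])
 moreover have "transl r (\<lambda>y. c (int r - 1 - y)) \<in> conj_by S (beta r) K" unfolding conj_beta_trans_iff using c(1) by simp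
 ultimately show "\<exists>c. transl r c \<in> conj_by S (beta r) K \<and> transl r c \<noteq> id\<^sub>S" by blast
qed

text \<open>The two factors of \<open>x\<^sup>4 + 1\<close> are coprime: their difference is \<open>2 x\<close>, and the shift is invertible.\<close>

lemma tetra_disjoint:
 assumes "c \<in> tetra 1 k" "c \<in> tetra (-1) k"
 shows "c = (\<lambda>_. 0)"
proof
 fix y
 have c: "c \<in> nwords (4 * k)" using assms(1) by (simp add: tetra_def)
 have "(c z - c (z + int k) - c (z + 2 * int k)) mod 3 = 0" "(c z + c (z + int k) - c (z + 2 * int k)) mod 3 = 0" for z
  using assms by (simp_all add: tetra_def)
 from this[of "y - int k"] have "(c (y - int k) - c y - c (y + int k)) mod 3 = 0"
  "(c (y - int k) + c y - c (y + int k)) mod 3 = 0" by (simp_all add: algebra_simps)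
 then show "c y = 0" using nwords_cases[OF c, of y] by presburger
qed

lemma reversed_code:
 assumes "code = tetra (-1) k"
 shows "rho_group.code r (conj_by S (beta r) K) = tetra 1 k"
proof -
 interpret R: rho_group r a "conj_by S (beta r) K" by (rule reversed)
 obtain c where c: "c \<in> code" "c \<noteq> (\<lambda>_. 0)" using code_nontrivial negacyclic_codeD(2)[OF code_negacyclic] by blast
 have cw: "c \<in> nwords r" "transl r c \<in> K" using c by (auto simp: code_def)
 define d where "d y = c (-1 - y)" for y
 have d1: "d \<in> tetra 1 k" using tetra_reverse[of c "-1" k] c(1) assms by (simp add: d_def[abs_def])
 have "transl r (\<lambda>y. d (int r - 1 - y)) = iv (transl r c)"
 proof (rule S.inv_equality[symmetric])
  have "c (y - int r) mod 3 = (- c y) mod 3" for y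
   using nwordsD(3)[OF cw(1), of "y - int r"] by (simp add: mod_minus_eq)
  then have "(c (y - int r) + c y) mod 3 = ((- c y) mod 3 + c y) mod 3" for y by (metis mod_add_left_eq)
  moreover have "d (int r - 1 - y) = c (y - int r)" for y by (simp add: d_def)
  ultimately have "(d (int r - 1 - y) + c y) mod 3 = 0" for y by (simp add: mod_add_left_eq)
  then show "transl r (\<lambda>y. d (int r - 1 - y)) \<otimes>\<^bsub>S\<^esub> transl r c = id\<^sub>S" unfolding transl_mult transl_zero by blast
 qed (use transl_Bij in \<open>auto simp: carrier_BijGroup\<close>)
 then have "transl r d \<in> conj_by S (beta r) K" unfolding conj_beta_trans_iff using K_inv[OF cw(2)] by simp
 then have dR: "d \<in> R.code" using d1 r4k by (simp add: R.code_def tetra_def)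
 have "d \<noteq> (\<lambda>_. 0)"
 proof
  assume "d = (\<lambda>_. 0)"
  then have "c (-1 - (-1 - y)) = 0" for y unfolding d_def by (rule fun_cong)
  then show False using c(2) by auto
 qed
 moreover have "R.code = tetra 1 k \<or> R.code = tetra (-1) k" using R.code_tetra by (auto simp: R.k_def k_def)
 ultimately show ?thesis using dR d1 tetra_disjoint by blast
qed

text \<open>The conjugating element of \<open>W\<close> is the identity or \<open>beta\<close>, depending on the code.\<close>

theorem conjugate_semidirect_decomposition:
 "\<exists>w\<in>W r. \<exists>i\<in>{1..2 ^ (a - 2)}. internal_semidirect S (conj_by S w K) (NN r) (Lambda_i_rho r i)"
proof -
 consider "code = tetra 1 k" | "code = tetra (-1) k" using code_tetra by blast
 then show ?thesis
 proof cases
  case 1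
  have "conj_by S id\<^sub>S K = K" using KB by (force simp: conj_by_def carrier_BijGroup[symmetric])
  then show ?thesis using semidirect_decomposition[OF 1] one_W[OF r_pos] by (intro bexI[of _ "id\<^sub>S"]) simp_all
 next
  case 2
  interpret R: rho_group r a "conj_by S (beta r) K" by (rule reversed)
  have "R.code = tetra 1 R.k" using reversed_code[OF 2] by (simp add: R.k_def k_def)
  then show ?thesis using R.semidirect_decomposition beta_W[OF r_pos] by blast
 qed
qed

end

section \<open>Semiregular permutations\<close>

lemma funpow_Bij_closed: "g \<in> Bij V \<Longrightarrow> v \<in> V \<Longrightarrow> (g ^^ n) v \<in> V"
 by (induction n) (auto intro: Bij_apply_closed)

lemma BijGroup_pow_apply:
 assumes g: "g \<in> Bij V" and v: "v \<in> V"
 shows "(g [^]\<^bsub>BijGroup V\<^esub> (n::nat)) v = (g ^^ n) v"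
 using v
proof (induction n arbitrary: v)
 case 0
 then show ?case by (simp add: BijGroup_one_apply)
next
 case (Suc n)
 interpret group "BijGroup V" by (rule group_BijGroup)
 have "g [^]\<^bsub>BijGroup V\<^esub> n \<in> Bij V" using nat_pow_closed[of g n] g by (simp add: carrier_BijGroup)
 then show ?case using Suc BijGroup_mult_apply[of "g [^]\<^bsub>BijGroup V\<^esub> n" V g v] g Bij_apply_closed[OF g]
  by (simp add: funpow_swap1)
qed

text \<open>Cycle lengths enter the arguments only through the exponents at which a power of the permutation fixes a point.\<close>

lemma card_orbit_period:
 assumes V: "finite V" and g: "g \<in> Bij V" and v: "v \<in> V"
 shows "(g ^^ n) v = v \<longleftrightarrow> card (orbit g v) dvd n" "card (orbit g v) > 0"
proof -
 interpret group "BijGroup V" by (rule group_BijGroup)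
 have fin: "finite (carrier (BijGroup V))" using finite_Bij[OF V] by (simp add: carrier_BijGroup)
 have gc: "g \<in> carrier (BijGroup V)" using g by (simp add: carrier_BijGroup)
 have "(g ^^ ord g) v = v"
  using BijGroup_pow_apply[OF g v, of "ord g"] pow_ord_eq_1[OF gc] BijGroup_one_apply[OF v] by simp
 moreover have "ord g > 0" using ord_ge_1[OF fin gc] by simp
 ultimately show "(g ^^ n) v = v \<longleftrightarrow> card (orbit g v) dvd n" "card (orbit g v) > 0"
  using funpow_fixes_iff_card_orbit_dvd by metis+
qed

lemma semiregular_transfer:
 assumes \<phi>: "bij_betw \<phi> V V'" and g: "semiregular V g" and g': "g' \<in> Bij V'"
  and eq: "\<And>v. v \<in> V \<Longrightarrow> g' (\<phi> v) = \<phi> (g v)"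
 shows "semiregular V' g'"
proof -
 have gB: "g \<in> Bij V" using g by (simp add: semiregular_def)
 have inj: "inj_on \<phi> V" and im: "\<phi> ` V = V'" using \<phi> by (auto simp: bij_betw_def)
 have pow: "(g' ^^ n) (\<phi> v) = \<phi> ((g ^^ n) v)" if "v \<in> V" for n v
  by (induction n) (simp_all add: eq funpow_Bij_closed[OF gB that])
 have card: "card (orbit g' (\<phi> v)) = card (orbit g v)" if v: "v \<in> V" for v
 proof -
  have "orbit g' (\<phi> v) = \<phi> ` orbit g v" by (auto simp: orbit_altdef pow[OF v])
  moreover have "orbit g v \<subseteq> V" using funpow_Bij_closed[OF gB v] by (auto simp: orbit_altdef)
  ultimately show ?thesis using inj_on_subset[OF inj] by (simp add: card_image)
 qed
 have "card (orbit g' x) = card (orbit g' y)" if xy: "x \<in> V'" "y \<in> V'" for x y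
 proof -
  obtain u v where uv: "u \<in> V" "v \<in> V" "x = \<phi> u" "y = \<phi> v" using xy unfolding im[symmetric] by blast
  then have "card (orbit g u) = card (orbit g v)" using g unfolding semiregular_def by blast
  then show ?thesis unfolding uv(3,4) card[OF uv(1)] card[OF uv(2)] .
 qed
 then show ?thesis using g' unfolding semiregular_def by blast
qed

lemma semiregular_fixed_point:
 assumes V: "finite V" and g: "semiregular V g" and p: "p \<in> V" "(g ^^ n) p = p" and q: "q \<in> V"
 shows "(g ^^ n) q = q"
proof -
 have gB: "g \<in> Bij V" using g by (simp add: semiregular_def)
 have "card (orbit g q) = card (orbit g p)" using g p q unfolding semiregular_def by blast
 then show ?thesis using card_orbit_period(1)[OF V gB] p q by metis
qed

lemma prime_order_semiregular:
 assumes V: "finite V" and g: "g \<in> Bij V" "g \<noteq> \<one>\<^bsub>BijGroup V\<^esub>" and p: "prime (p::nat)" "g [^]\<^bsub>BijGroup V\<^esub> p = \<one>\<^bsub>BijGroup V\<^esub>"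
  and nofix: "\<And>v. v \<in> V \<Longrightarrow> g v \<noteq> v"
 shows "semiregular V g"
proof -
 have "card (orbit g v) = p" if v: "v \<in> V" for v
 proof -
  have "(g ^^ p) v = v" using BijGroup_pow_apply[OF g(1) v, of p] p(2) BijGroup_one_apply[OF v] by simp
  then have "card (orbit g v) dvd p" using card_orbit_period[OF V g(1) v] by simp
  moreover have "card (orbit g v) \<noteq> 1" using card_orbit_period(1)[OF V g(1) v, of 1] nofix[OF v] by simp
  ultimately show ?thesis using p(1) by (auto simp: prime_nat_iff)
 qed
 then show ?thesis using g(1) by (simp add: semiregular_def)
qed

text \<open>In the shape \<open>(X + Y, X, Y, X - Y)\<close>, if \<open>X\<close> and \<open>Y\<close> do not vanish at some position, then they are equal or
 opposite there, and their sum or their difference vanishes.\<close>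

lemma tetra_zero:
 assumes d: "d \<in> tetra 1 k"
 shows "\<exists>m\<in>{0, 1, 2, 3}. d (m * int k) = 0"
proof (rule ccontr)
 assume n: "\<not> ?thesis"
 have D: "(d y - d (y + int k) - d (y + 2 * int k)) mod 3 = 0" and dw: "d \<in> nwords (4 * k)" for y
  using d by (auto simp: tetra_def)
 have "d (0 * int k) \<noteq> 0" "d (1 * int k) \<noteq> 0" "d (2 * int k) \<noteq> 0" "d (3 * int k) \<noteq> 0" using n by blast+
 then have c: "d 0 = 1 \<or> d 0 = 2" "d (int k) = 1 \<or> d (int k) = 2" "d (2 * int k) = 1 \<or> d (2 * int k) = 2"
  "d (3 * int k) = 1 \<or> d (3 * int k) = 2" using nwords_cases[OF dw] by auto
 have "(d 0 - d (int k) - d (2 * int k)) mod 3 = 0" "(d (int k) - d (2 * int k) - d (3 * int k)) mod 3 = 0"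
  using D[of 0] D[of "int k"] by simp_all
 then show False using c by (elim disjE) simp_all
qed

context rho_group
begin

lemma K_pow: "g \<in> K \<Longrightarrow> g \<up> (n::nat) \<in> K"
 by (induction n) (simp_all add: K_one K_mult)

text \<open>On a block where the sign is \<open>-1\<close> every affine map has a fixed point. If the sign on block \<open>0\<close> is \<open>1\<close>, it is \<open>1\<close> on
 the blocks \<open>0, k, 2 k, 3 k\<close> by periodicity, and the word of the translation vanishes on one of them.\<close>

lemma block_preserving_fixes:
 assumes T: "code = tetra 1 k" and b: "b \<in> K" "block_preserving b"
 shows "\<exists>p\<in>PXV r. b p = p"
proof -
 from block_preserving_decomposition[OF b] obtain e c where e: "e \<in> signs r" "sgnp r e \<in> K" and c: "transl r c \<in> K"
  and beq: "b = transl r c \<cdot> sgnp r e" by blast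
 have b_apply: "b (x, y) = ((e y * x + c y) mod 3, y)" if p: "(x, y) \<in> PXV r" for x y
  unfolding beq by (rule transl_sgnp_apply[OF e(1) p])
 consider "e 0 = -1" | "e 0 = 1" using e(1) r_pos by (auto simp: signs_def)
 then show ?thesis
 proof cases
  case 1
  have P: "((2 * c 0) mod 3, 0) \<in> PXV r" using r_pos by (simp add: PXV_iff)
  have "(- ((2 * c 0) mod 3) + c 0) mod 3 = (- (2 * c 0) + c 0) mod 3" by (intro mod_add_cong) (simp_all add: mod_minus_eq)
  also have "- (2 * c 0) + c 0 = 2 * c 0 + 3 * (- c 0)" by simp
  also have "\<dots> mod 3 = (2 * c 0) mod 3" by (rule mod_mult_self2)
  finally have "b ((2 * c 0) mod 3, 0) = ((2 * c 0) mod 3, 0)" using b_apply[OF P] 1 by simp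
  then show ?thesis using P by blast
 next
  case 2
  define d where "d = extend r c"
  have "d \<in> tetra 1 k" using extend_code[OF c] T by (simp add: d_def)
  then obtain m where m: "m \<in> {0, 1, 2, 3}" "d (m * int k) = 0" using tetra_zero by blast
  have y: "0 \<le> m * int k" "m * int k < int r" using m(1) r4k k_pos by auto
  have "c (m * int k) mod 3 = 0" using m(2) extend_eq[OF y, of c] by (simp add: d_def)
  moreover have "e (m * int k) = 1" using signs_periodic[OF T e y] 2 by simp
  moreover have P: "(0, m * int k) \<in> PXV r" using y by (simp add: PXV_iff)
  ultimately have "b (0, m * int k) = (0, m * int k)" using b_apply[OF P] by simp
  then show ?thesis using P by blast
 qed
qed

text \<open>Such an element is \<open>b\<close> times the power \<open>r / 2\<close> of \<open>rho\<close>, with \<open>b\<close> acting on each block separately and having the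
 same sign on opposite blocks. Its square is one full turn, which contributes the sign \<open>-1\<close>, so on a block it
 is \<open>x \<mapsto> u - x\<close> for some \<open>u\<close>.\<close>

lemma half_turn_square:
 assumes T: "code = tetra 1 k" and h: "h \<in> K" and rot: "\<And>p. p \<in> PXV r \<Longrightarrow> snd (h p) = (snd p + 2 * int k) mod int r"
 shows "\<exists>p\<in>PXV r. h (h p) \<noteq> p"
proof (rule ccontr)
 assume "\<not> ?thesis"
 then have hh: "h (h p) = p" if "p \<in> PXV r" for p using that by blast
 let ?n = "2 * k"
 define b where "b = h \<cdot> iv (rho r \<up> ?n)"
 note hB = KB[OF h] and rB = rho_pow_Bij[of ?n] and riB = inv_Bij[OF rho_pow_Bij[of ?n]]
 have bK: "b \<in> K" unfolding b_def by (intro K_mult K_inv h rho_pow_K)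
 have bb: "block_preserving b"
  unfolding block_preserving_def
 proof
  fix p assume p: "p \<in> PXV r"
  have "snd ((iv (rho r \<up> ?n)) p) = (snd p - int ?n) mod int r"
   by (rule rotation_inv[OF rB rho_pow_rotation p])
  then show "snd (b p) = snd p"
   unfolding b_def mult_apply[OF hB riB p] rot[OF Bij_apply_closed[OF riB p]]
   using range_snd[OF p] by (simp add: mod_add_left_eq)
 qed
 from block_preserving_decomposition[OF bK bb] obtain e c where e: "e \<in> signs r" "sgnp r e \<in> K" and c: "transl r c \<in> K"
  and beq: "b = transl r c \<cdot> sgnp r e" by blast
 have b_apply: "b (x, y) = ((e y * x + c y) mod 3, y)" if p: "(x, y) \<in> PXV r" for x y
  unfolding beq by (rule transl_sgnp_apply[OF e(1) p])
 have h_eq: "h p = b ((rho r \<up> ?n) p)" if p: "p \<in> PXV r" for p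
 proof -
  have "h = b \<cdot> (rho r \<up> ?n)" unfolding b_def using hB rB by (simp add: carrier_BijGroup[symmetric] S.m_assoc)
  then show ?thesis using mult_apply[OF KB[OF bK] rB p] by simp
 qed
 have kk: "2 * int k < int r" "int r = 4 * int k" using r4k k_pos by auto
 have y2: "0 \<le> 2 * int k" using k_pos by simp
 have div1: "(2 * int k) div int r = 0" "(2 * int k) mod int r = 2 * int k" using kk k_pos by simp_all
 have div2: "(2 * int k + 2 * int k) div int r = 1" "(2 * int k + 2 * int k) mod int r = 0" using kk k_pos by simp_all
 have e2: "e (2 * int k) = e 0" using signs_periodic[OF T e y2 kk(1)] by simp
 have h0: "h (x, 0) = ((e 0 * x + c (2 * int k)) mod 3, 2 * int k)" if x: "0 \<le> x" "x < 3" for x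
 proof -
  have p: "(x, 0) \<in> PXV r" "(x, 2 * int k) \<in> PXV r" using x kk r_pos by (auto simp: PXV_iff)
  have "(rho r \<up> ?n) (x, 0) = (x, 2 * int k)" using rho_pow_apply[OF p(1), of ?n] div1 by simp
  then show ?thesis using h_eq[OF p(1)] b_apply[OF p(2)] e2 by simp
 qed
 have h2: "h (x, 2 * int k) = ((e 0 * ((- x) mod 3) + c 0) mod 3, 0)" if x: "0 \<le> x" "x < 3" for x
 proof -
  have p: "(x, 2 * int k) \<in> PXV r" "((- x) mod 3, 0) \<in> PXV r" using x kk r_pos by (auto simp: PXV_iff)
  have "(rho r \<up> ?n) (x, 2 * int k) = ((- x) mod 3, 0)" using rho_pow_apply[OF p(1), of ?n] div2 by simp
  then show ?thesis using h_eq[OF p(1)] b_apply[OF p(2)] by simp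
 qed
 have eq: "(e 0 * ((- ((e 0 * x + c (2 * int k)) mod 3)) mod 3) + c 0) mod 3 = x" if x: "0 \<le> x" "x < 3" for x
 proof -
  have "(x, 0) \<in> PXV r" using x r_pos by (simp add: PXV_iff)
  from hh[OF this] show ?thesis unfolding h0[OF x] by (subst (asm) h2) simp_all
 qed
 have "(e 0 * ((- ((e 0 * x + c (2 * int k)) mod 3)) mod 3) + c 0) mod 3 = (e 0 * (- (e 0 * x + c (2 * int k))) + c 0) mod 3" for x
  by (intro mod_add_cong mod_mult_cong) (simp_all add: mod_minus_eq)
 moreover have "e 0 = 1 \<or> e 0 = -1" using e(1) r_pos by (auto simp: signs_def)
 ultimately have lin: "(c 0 - e 0 * c (2 * int k) - x) mod 3 = x" if "0 \<le> x" "x < 3" for x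
  using eq[OF that] by (auto simp: algebra_simps)
 define u where "u = c 0 - e 0 * c (2 * int k)"
 have "u mod 3 = 0" "(u - 1) mod 3 = 1" using lin[of 0] lin[of 1] by (simp_all add: u_def)
 then show False by presburger
qed

text \<open>A power of a semiregular element that preserves the blocks fixes a point, hence is trivial. If the element moves the
 blocks, some power of it rotates by half a turn; the square of that power preserves the blocks but is not trivial.\<close>

theorem no_semiregular:
 assumes T: "code = tetra 1 k" and g: "g \<in> K" "semiregular (PXV r) g"
 shows "g = id\<^sub>S"
proof -
 note gB = KB[OF g(1)]
 obtain n :: nat where n: "\<And>p. p \<in> PXV r \<Longrightarrow> snd (g p) = (snd p + int n) mod int r" using rotation[OF g(1)] by blast
 have pow: "snd ((g ^^ t) p) = (snd p + int t * int n) mod int r" if p: "p \<in> PXV r" for p t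
 proof (induction t)
  case 0
  then show ?case using range_snd[OF p] by simp
 next
  case (Suc t)
  have "snd ((g ^^ Suc t) p) = ((snd p + int t * int n) mod int r + int n) mod int r"
   using n[OF funpow_Bij_closed[OF gB p, of t]] Suc by simp
  also have "\<dots> = (snd p + int (Suc t) * int n) mod int r" by (subst mod_add_left_eq) (simp add: algebra_simps)
  finally show ?case .
 qed
 have powK: "g \<up> (t::nat) \<in> K" for t by (rule K_pow[OF g(1)])
 have trivial: "(g ^^ t) p = p" if t: "int r dvd int t * int n" and p: "p \<in> PXV r" for t p
 proof -
  have "block_preserving (g \<up> t)"
   unfolding block_preserving_def
  proof
   fix q assume q: "q \<in> PXV r"
   have "(snd q + int t * int n) mod int r = snd q mod int r" using t by (auto elim!: dvdE)
   then show "snd ((g \<up> t) q) = snd q"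
    using pow[OF q, of t] range_snd[OF q] BijGroup_pow_apply[OF gB q] by simp
  qed
  then obtain q where q: "q \<in> PXV r" "(g \<up> t) q = q" using block_preserving_fixes[OF T powK] by blast
  then have "(g ^^ t) q = q" using BijGroup_pow_apply[OF gB q(1)] by simp
  then show ?thesis using semiregular_fixed_point[OF finite_PXV g(2) q(1) _ p] by blast
 qed
 show ?thesis
 proof (cases "r dvd n")
  case True
  then have "int r dvd int 1 * int n" by simp
  then have "g p = p" if "p \<in> PXV r" for p using trivial[of 1 p] that by simp
  then show ?thesis by (intro Bij_eqI[OF gB one_Bij]) (simp add: BijGroup_one_apply)
 next
  case False
  define b where "b = multiplicity 2 n"
  have n0: "n \<noteq> 0" using False by (metis dvd_0_right)
  have "n \<noteq> 0" "\<not> is_unit (2::nat)" using n0 by simp_all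
  from multiplicity_decompose'[OF this] obtain m where m: "n = 2 ^ b * m" "odd m" unfolding b_def by blast
  have "b < a"
  proof (rule ccontr)
   assume "\<not> b < a"
   then have "(2::nat) ^ a dvd 2 ^ b" by (simp add: le_imp_power_dvd)
   then show False using False m(1) r_def by simp
  qed
  then obtain s where s: "a = b + 1 + s" using less_iff_Suc_add by auto
  define t where "t = (2::nat) ^ s"
  obtain q where q: "m = 2 * q + 1" using m(2) by (elim oddE)
  have r2: "2 * (2 * k) = r" using r4k by linarith
  \<comment> \<open>The power \<open>t\<close> makes the total rotation an odd multiple of half a turn.\<close>
  have tn: "t * n = 2 * k + r * q"
  proof -
   have "2 * (t * n) = r * m" unfolding t_def m(1) r_def s by (simp add: power_add)
   also have "\<dots> = 2 * (2 * k + r * q)" unfolding q using r2 by (simp add: algebra_simps)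
   finally show ?thesis by simp
  qed
  have tn': "int t * int n = 2 * int k + int r * int q" using tn by (metis of_nat_add of_nat_mult of_nat_numeral)
  have rot: "snd ((g \<up> t) p) = (snd p + 2 * int k) mod int r" if p: "p \<in> PXV r" for p
   unfolding BijGroup_pow_apply[OF gB p] pow[OF p] tn' by (simp add: add.assoc[symmetric])
  then obtain p where p: "p \<in> PXV r" "(g \<up> t) ((g \<up> t) p) \<noteq> p" using half_turn_square[OF T powK] by blast
  have "(g \<up> t) ((g \<up> t) p) = (g ^^ (t + t)) p"
   using BijGroup_pow_apply[OF gB] p(1) funpow_Bij_closed[OF gB] by (simp add: funpow_add)
  moreover have "int r dvd int (t + t) * int n"
  proof -
   have "int (t + t) * int n = 2 * (int t * int n)" by simp
   also have "\<dots> = int r * (1 + 2 * int q)" unfolding tn' using r4k by (simp add: algebra_simps)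
   finally show ?thesis by simp
  qed
  ultimately show ?thesis using trivial p by metis
 qed
qed

end

section \<open>The groups of the theorem contain no semiregular element\<close>

text \<open>Every element of the group is a product of a translation from the code, a power of \<open>rho\<close> and a sign change. The last
 two preserve the points with first coordinate \<open>0\<close>, so the translation can be read off from the images of these points.\<close>

theorem semidirect_rho_group:
 assumes a: "a \<ge> 2" and i: "i \<le> 2 ^ (a - 2)"
  and K: "internal_semidirect (SymV (2 ^ a)) K (NN (2 ^ a)) (Lambda_i_rho (2 ^ a) i)"
 shows "rho_group (2 ^ a) a K" "rho_group.code (2 ^ a) K = tetra 1 (2 ^ (a - 2))"
proof -
 define k :: nat where "k = 2 ^ (a - 2)"
 define r :: nat where "r = 2 ^ a"
 have k0: "k > 0" by (simp add: k_def)
 have "a = 2 + (a - 2)" using a by simp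
 then have "r = 2 ^ 2 * 2 ^ (a - 2)" unfolding r_def by (metis power_add)
 then have r4k: "r = 4 * k" by (simp add: k_def)
 have r0: "r > 0" using r4k k0 by simp
 let ?S = "SymV r"
 interpret S: group ?S by (rule group_BijGroup)
 define L where "L = skernel k i"
 have L: "sign_module k L" "card L = 2 ^ i" using sign_module_exists[OF k_def, of i] i by (simp_all add: L_def k_def)
 have Li: "Lambda_i r i = sgnp r ` L" using Lambda_i_sign_module[OF k_def L] r4k by simp
 have N: "NN r = transl r ` tetra 1 k" using NN_eq[OF k0] r4k by simp
 have pP: "(0, 0) \<in> PXV r" using r0 by (simp add: PXV_iff)
 have rB: "rho r \<in> Bij (PXV r)" by (rule rho_apply(2)[OF pP])
 have gen: "generate ?S {rho r} = {rho r [^]\<^bsub>?S\<^esub> n | n. n \<in> (UNIV :: nat set)}"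
  by (rule S.generate_pow_on_finite_carrier[OF finite_SymV]) (simp add: rB carrier_BijGroup)
 have K': "subgroup K ?S" "K = NN r <#>\<^bsub>?S\<^esub> (generate ?S {rho r} <#>\<^bsub>?S\<^esub> sgnp r ` L)"
  using K unfolding internal_semidirect_def r_def[symmetric] Lambda_i_rho_def Li by auto
 have shape: "\<exists>c\<in>tetra 1 k. \<exists>n::nat. \<forall>x y. (x, y) \<in> PXV r \<longrightarrow> snd (g (x, y)) = (y + int n) mod int r \<and>
   (x = 0 \<longrightarrow> fst (g (x, y)) = c ((y + int n) mod int r) mod 3)" if g: "g \<in> K" for g
 proof -
  obtain c n e where c: "c \<in> tetra 1 k" and e: "e \<in> L"
   and g_eq: "g = transl r c \<otimes>\<^bsub>?S\<^esub> (rho r [^]\<^bsub>?S\<^esub> (n::nat) \<otimes>\<^bsub>?S\<^esub> sgnp r e)"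
   using g unfolding K'(2) N gen set_mult_def by blast
  let ?h = "rho r [^]\<^bsub>?S\<^esub> n"
  have es: "e \<in> signs r" using psigns_signs e L(1) by (auto simp: sign_module_def)
  note hB = rho_pow(1)[OF r0, of n] and sB = sgnp_Bij[OF es]
  have hsB: "?h \<otimes>\<^bsub>?S\<^esub> sgnp r e \<in> Bij (PXV r)" using S.m_closed[of ?h "sgnp r e"] hB sB by (simp add: carrier_BijGroup)
  have "snd (g (x, y)) = (y + int n) mod int r \<and> (x = 0 \<longrightarrow> fst (g (x, y)) = c ((y + int n) mod int r) mod 3)"
   if p: "(x, y) \<in> PXV r" for x y
  proof -
   have q: "((e y * x) mod 3, y) \<in> PXV r" using p by (auto simp: PXV_iff)
   define u where "u = fst (?h ((e y * x) mod 3, y))"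
   have uv: "?h ((e y * x) mod 3, y) = (u, (y + int n) mod int r)" "x = 0 \<Longrightarrow> u = 0"
    using rho_pow(2)[OF r0 q, of n] by (simp_all add: u_def)
   have "(u, (y + int n) mod int r) \<in> PXV r" using Bij_apply_closed[OF hB q] uv(1) by simp
   moreover have "g (x, y) = transl r c (u, (y + int n) mod int r)"
    unfolding g_eq BijGroup_mult_apply[OF transl_Bij hsB p] BijGroup_mult_apply[OF hB sB p] sgnp_apply[OF p] uv(1) ..
   ultimately show ?thesis using transl_apply uv(2) by auto
  qed
  then show ?thesis using c by blast
 qed
 have transl_code: "extend r c \<in> tetra 1 k" if g: "transl r c \<in> K" for c
 proof -
  obtain d n where d: "d \<in> tetra 1 k" and n: "\<And>x y. (x, y) \<in> PXV r \<Longrightarrow> snd (transl r c (x, y)) = (y + int n) mod int r"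
   "\<And>y. (0, y) \<in> PXV r \<Longrightarrow> fst (transl r c (0, y)) = d ((y + int n) mod int r) mod 3" using shape[OF g] by metis
  have cd: "c y mod 3 = d y mod 3" if y: "0 \<le> y" "y < int r" for y
  proof -
   have p: "(0, y) \<in> PXV r" using y by (simp add: PXV_iff)
   show ?thesis using n(1)[OF p] n(2)[OF p] transl_apply[OF p, of c] by simp
  qed
  have dw: "d \<in> nwords r" using d r4k by (simp add: tetra_def)
  have "extend r c = d"
   by (rule nwords_eqI[OF extend_nwords[OF r0] dw r0]) (simp add: extend_eq cd nwordsD(4)[OF dw])
  then show ?thesis using d by simp
 qed
 have "NN r \<lhd> ?S\<lparr>carrier := K\<rparr>" "subgroup (generate ?S {rho r} <#>\<^bsub>?S\<^esub> sgnp r ` L) (?S\<lparr>carrier := K\<rparr>)"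
  using K unfolding internal_semidirect_def r_def[symmetric] Lambda_i_rho_def Li by auto
 then have NK: "NN r \<subseteq> K" and LK: "generate ?S {rho r} <#>\<^bsub>?S\<^esub> sgnp r ` L \<subseteq> K"
  using normal_imp_subgroup subgroup.subset by fastforce+
 have rg: "rho_group r a K"
 proof (rule rho_group.intro)
  show "r = 2 ^ a" by (rule r_def)
  show "subgroup K ?S" by (rule K'(1))
  have "rho r = rho r \<otimes>\<^bsub>?S\<^esub> \<one>\<^bsub>?S\<^esub>" using rB by (simp add: carrier_BijGroup)
  moreover have "sgnp r (\<lambda>_. 1) = \<one>\<^bsub>?S\<^esub>" by (rule sgnp_one) simp
  then have "\<one>\<^bsub>?S\<^esub> \<in> sgnp r ` L" using L(1) unfolding sign_module_def by (metis imageI)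
  moreover have "rho r \<in> generate ?S {rho r}" by (rule generate.incl) simp
  ultimately show "rho r \<in> K" using LK unfolding set_mult_def by blast
  show "\<exists>j. \<forall>x y. (x, y) \<in> PXV r \<longrightarrow> snd (g (x, y)) = (y + j) mod int r" if "g \<in> K" for g
   using shape[OF that] by blast
  show "\<exists>y. 0 \<le> y \<and> y < int r \<and> c y mod 3 = 0" if c: "transl r c \<in> K" for c
  proof -
   define d where "d = extend r c"
   have d: "d \<in> tetra 1 k" using transl_code[OF c] by (simp add: d_def)
   have "\<exists>m\<in>{0,1,2,3}. d (m * int k) = 0" by (rule tetra_zero[OF d])
   then obtain m where m: "m \<in> {0, 1, 2, 3}" "d (m * int k) = 0" by blast
   have y: "0 \<le> m * int k" "m * int k < int r" using m(1) r4k k0 by auto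
   then show ?thesis using m(2) extend_eq[OF y, of c] by (intro exI[of _ "m * int k"]) (simp add: d_def)
  qed
  obtain c where c: "c \<in> tetra 1 k" "\<And>y. \<not> (c y = 0 \<and> c (y + 1) = 0)" using tetra_word_without_adjacent_zeros[OF k0, of 1] by auto
  have cw: "c \<in> nwords r" using c(1) r4k by (simp add: tetra_def)
  have "transl r c \<noteq> \<one>\<^bsub>?S\<^esub>"
  proof
   assume one: "transl r c = \<one>\<^bsub>?S\<^esub>"
   have z: "c y = 0" if y: "0 \<le> y" "y < int r" for y
   proof -
    have p: "(0, y) \<in> PXV r" using y by (simp add: PXV_iff)
    then have "(c y mod 3, y) = (0, y)" using transl_apply[OF p, of c] BijGroup_one_apply[OF p] one by simp
    then show ?thesis using nwordsD(4)[OF cw, of y] by simp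
   qed
   have "1 < int r" using r4k k0 by linarith
   then show False using z[of 0] z[of 1] c(2)[of 0] by simp
  qed
  moreover have "transl r c \<in> K" using c(1) NK N by blast
  ultimately show "\<exists>c. transl r c \<in> K \<and> transl r c \<noteq> \<one>\<^bsub>?S\<^esub>" by blast
 qed
 then interpret R: rho_group r a K .
 have "R.code = tetra 1 k"
 proof
  show "tetra 1 k \<subseteq> R.code" using NK N r4k unfolding R.code_def by (auto simp: tetra_def)
  show "R.code \<subseteq> tetra 1 k"
  proof
   fix c assume "c \<in> R.code"
   then have c: "c \<in> nwords r" "transl r c \<in> K" by (auto simp: R.code_def)
   have "extend r c = c" by (rule nwords_eqI[OF extend_nwords[OF r0] c(1) r0]) (simp add: extend_eq nwordsD(4)[OF c(1)])
   then show "c \<in> tetra 1 k" using transl_code[OF c(2)] by simp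
  qed
 qed
 then show "rho_group (2 ^ a) a K" "rho_group.code (2 ^ a) K = tetra 1 (2 ^ (a - 2))"
  using rg by (simp_all add: r_def k_def)
qed

lemma conj_by_apply:
 assumes w: "w \<in> Bij V" and g: "g \<in> Bij V" and v: "v \<in> V"
 shows "(w \<otimes>\<^bsub>BijGroup V\<^esub> g \<otimes>\<^bsub>BijGroup V\<^esub> inv\<^bsub>BijGroup V\<^esub> w) (w v) = w (g v)"
  and "w \<otimes>\<^bsub>BijGroup V\<^esub> g \<otimes>\<^bsub>BijGroup V\<^esub> inv\<^bsub>BijGroup V\<^esub> w \<in> Bij V"
proof -
 interpret group "BijGroup V" by (rule group_BijGroup)
 have B: "w \<otimes>\<^bsub>BijGroup V\<^esub> g \<in> Bij V" "inv\<^bsub>BijGroup V\<^esub> w \<in> Bij V"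
  using m_closed[of w g] inv_closed[of w] w g by (simp_all add: carrier_BijGroup)
 show "w \<otimes>\<^bsub>BijGroup V\<^esub> g \<otimes>\<^bsub>BijGroup V\<^esub> inv\<^bsub>BijGroup V\<^esub> w \<in> Bij V"
  using m_closed[of "w \<otimes>\<^bsub>BijGroup V\<^esub> g" "inv\<^bsub>BijGroup V\<^esub> w"] B by (simp add: carrier_BijGroup)
 show "(w \<otimes>\<^bsub>BijGroup V\<^esub> g \<otimes>\<^bsub>BijGroup V\<^esub> inv\<^bsub>BijGroup V\<^esub> w) (w v) = w (g v)"
  unfolding BijGroup_mult_apply[OF B Bij_apply_closed[OF w v]] BijGroup_inv_apply(1)[OF w v]
  by (rule BijGroup_mult_apply[OF w g v])
qed

lemma transport_apply:
 assumes f: "bij_betw f V V'" and g: "g \<in> Bij V" and v: "v \<in> V"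
 shows "transport V V' f g (f v) = f (g v)"
 using bij_betw_inv_into_left[OF f v] bij_betwE[OF f] v by (simp add: transport_def)

lemma transport_Bij:
 assumes f: "bij_betw f V V'" and g: "g \<in> Bij V"
 shows "transport V V' f g \<in> Bij V'"
proof -
 have "bij_betw (f \<circ> (g \<circ> inv_into V f)) V' V'"
  using f g bij_betw_inv_into[OF f] by (intro bij_betw_trans) (auto simp: Bij_def)
 then have "bij_betw (transport V V' f g) V' V'"
  by (rule bij_betw_cong[THEN iffD1, rotated]) (simp add: transport_def)
 then show ?thesis by (simp add: Bij_def transport_def)
qed

lemma transport_mult:
 assumes f: "bij_betw f V V'" and g: "g \<in> Bij V" and h: "h \<in> Bij V"
 shows "transport V V' f (g \<otimes>\<^bsub>BijGroup V\<^esub> h) = transport V V' f g \<otimes>\<^bsub>BijGroup V'\<^esub> transport V V' f h"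
proof (rule Bij_eqI)
 interpret V: group "BijGroup V" by (rule group_BijGroup)
 interpret V': group "BijGroup V'" by (rule group_BijGroup)
 note tB = transport_Bij[OF f g] transport_Bij[OF f h]
 have gh: "g \<otimes>\<^bsub>BijGroup V\<^esub> h \<in> Bij V" using V.m_closed[of g h] g h by (simp add: carrier_BijGroup)
 show "transport V V' f (g \<otimes>\<^bsub>BijGroup V\<^esub> h) \<in> Bij V'" by (rule transport_Bij[OF f gh])
 show "transport V V' f g \<otimes>\<^bsub>BijGroup V'\<^esub> transport V V' f h \<in> Bij V'"
  using V'.m_closed tB by (simp add: carrier_BijGroup)
 fix p assume "p \<in> V'"
 then obtain v where v: "v \<in> V" "p = f v" using f by (auto simp: bij_betw_def)
 have p: "f v \<in> V'" using bij_betwE[OF f] v(1) by blast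
 show "transport V V' f (g \<otimes>\<^bsub>BijGroup V\<^esub> h) p = (transport V V' f g \<otimes>\<^bsub>BijGroup V'\<^esub> transport V V' f h) p"
  unfolding v(2) transport_apply[OF f gh v(1)] BijGroup_mult_apply[OF tB p] transport_apply[OF f h v(1)]
   transport_apply[OF f g Bij_apply_closed[OF h v(1)]] BijGroup_mult_apply[OF g h v(1)] ..
qed

lemma W_Bij: "w \<in> W r \<Longrightarrow> w \<in> Bij (PXV r)"
proof -
 assume "w \<in> W r"
 then obtain gs h where w: "w = wreath_elt r gs h" and gs: "length gs = r" "set gs \<subseteq> Bij (Zmod 3)" and h: "h \<in> Dih r"
  by (auto simp: W_def)
 obtain s c where sc: "h = (\<lambda>y\<in>Zmod r. (s * y + c) mod int r)" "s = 1 \<or> s = -1" using h by (auto simp: Dih_def)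
 have app: "w (x, y) = ((gs ! nat y) x, (s * y + c) mod int r)" if "(x, y) \<in> PXV r" for x y
  using that by (simp add: w wreath_elt_def sc PXV_def)
 have gB: "gs ! nat y \<in> Bij (Zmod 3)" if "0 \<le> y" "y < int r" for y
 proof -
  have "nat y < length gs" using that gs(1) by linarith
  then show ?thesis using gs(2) nth_mem by blast
 qed
 show ?thesis
 proof (rule Bij_finiteI[OF finite_PXV])
  show "w \<in> extensional (PXV r)" by (simp add: w wreath_elt_def)
  show "w p \<in> PXV r" if p: "p \<in> PXV r" for p
  proof -
   obtain x y where xy: "p = (x, y)" by (cases p)
   have "x \<in> Zmod 3" "0 \<le> y" "y < int r" using p by (auto simp: xy PXV_iff Zmod_def)
   then have "(gs ! nat y) x \<in> Zmod 3" using Bij_apply_closed[OF gB] by blast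
   then show ?thesis using p \<open>0 \<le> y\<close> \<open>y < int r\<close> by (auto simp: xy app PXV_iff Zmod_def)
  qed
  show "inj_on w (PXV r)"
  proof (rule inj_onI)
   fix p q assume pq: "p \<in> PXV r" "q \<in> PXV r" "w p = w q"
   obtain x y x' y' where xy: "p = (x, y)" "q = (x', y')" by (cases p, cases q)
   have b: "0 \<le> y" "y < int r" "0 \<le> y'" "y' < int r" "x \<in> Zmod 3" "x' \<in> Zmod 3" using pq by (auto simp: xy PXV_iff Zmod_def)
   have m: "(s * y + c) mod int r = (s * y' + c) mod int r" and fx: "(gs ! nat y) x = (gs ! nat y') x'"
    using pq by (auto simp: xy app)
   have "(s * y + c - c) mod int r = (s * y' + c - c) mod int r" using m by (rule mod_diff_cong) simp
   then have "(s * y) mod int r = (s * y') mod int r" by simp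
   then have "(s * (s * y)) mod int r = (s * (s * y')) mod int r" by (rule mod_mult_cong[OF refl])
   moreover have "s * (s * z) = z" for z using sc(2) by auto
   ultimately have "y = y'" using b by simp
   then show "p = q" using Bij_inj[OF gB[OF b(1,2)] b(5,6)] fx by (simp add: xy)
  qed
 qed
qed

theorem described_group_no_semiregular:
 assumes a: "a \<ge> 2" and f: "dg_iso \<Gamma> (PX3 (2 ^ a)) f" and w: "w \<in> W (2 ^ a)" and i: "i \<in> {1..2 ^ (a - 2)}"
  and K: "internal_semidirect (SymV (2 ^ a)) (conj_by (SymV (2 ^ a)) w (transport (pverts \<Gamma>) (PXV (2 ^ a)) f ` G))
       (NN (2 ^ a)) (Lambda_i_rho (2 ^ a) i)"
  and g: "g \<in> G" "semiregular (pverts \<Gamma>) g"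
 shows "g = \<one>\<^bsub>BijGroup (pverts \<Gamma>)\<^esub>"
proof -
 define r :: nat where "r = 2 ^ a"
 let ?V = "pverts \<Gamma>"
 define t where "t = transport ?V (PXV r) f g"
 define g' where "g' = w \<otimes>\<^bsub>SymV r\<^esub> t \<otimes>\<^bsub>SymV r\<^esub> inv\<^bsub>SymV r\<^esub> w"
 let ?K = "conj_by (SymV r) w (transport ?V (PXV r) f ` G)"
 have fb: "bij_betw f ?V (PXV r)" using f by (simp add: dg_iso_def PX3_def r_def)
 have gB: "g \<in> Bij ?V" using g by (simp add: semiregular_def)
 have wB: "w \<in> Bij (PXV r)" using W_Bij w by (simp add: r_def)
 have tB: "t \<in> Bij (PXV r)" unfolding t_def by (rule transport_Bij[OF fb gB])
 interpret R: rho_group r a ?K using semidirect_rho_group(1)[OF a _ K] i by (simp add: r_def)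
 have k: "R.k = 2 ^ (a - 2)" by (rule R.k_def2)
 have code: "R.code = tetra 1 R.k" using semidirect_rho_group(2)[OF a _ K] i unfolding k by (simp add: r_def)
 have g'B: "g' \<in> Bij (PXV r)" unfolding g'_def by (rule conj_by_apply(2)[OF wB tB, of "(0, 0)"]) (use R.r_pos in \<open>simp add: PXV_iff\<close>)
 have fV: "f v \<in> PXV r" if "v \<in> ?V" for v using fb that by (auto dest: bij_betwE)
 have eq: "g' ((w \<circ> f) v) = (w \<circ> f) (g v)" if v: "v \<in> ?V" for v
  using conj_by_apply(1)[OF wB tB fV[OF v]] transport_apply[OF fb gB v] by (simp add: g'_def t_def)
 have wf: "bij_betw (w \<circ> f) ?V (PXV r)" using fb wB by (intro bij_betw_trans[of f ?V "PXV r" w]) (auto simp: Bij_def)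
 have "semiregular (PXV r) g'" by (rule semiregular_transfer[OF wf g(2) g'B eq])
 moreover have "g' \<in> ?K" using g(1) unfolding g'_def t_def conj_by_def by blast
 ultimately have one: "g' = \<one>\<^bsub>SymV r\<^esub>" using R.no_semiregular[OF code] by blast
 have "g v = v" if v: "v \<in> ?V" for v
 proof -
  have "(w \<circ> f) (g v) = (w \<circ> f) v" using eq[OF v] bij_betwE[OF wf] v BijGroup_one_apply one by metis
  then show ?thesis using bij_betw_imp_inj_on[OF wf] v Bij_apply_closed[OF gB v] by (meson inj_onD)
 qed
 then show ?thesis
  by (intro Bij_eqI[OF gB]) (auto simp: BijGroup_one_apply BijGroup_def id_Bij)
qed

section \<open>Permutation groups with a cyclic system of blocks of size three\<close>

lemma pow_funpow:
 assumes g: "g \<in> Bij V" and v: "v \<in> V"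
 shows "((g [^]\<^bsub>BijGroup V\<^esub> (n::nat)) ^^ p) v = (g ^^ (n * p)) v"
proof (induction p)
 case (Suc p)
 have "((g [^]\<^bsub>BijGroup V\<^esub> n) ^^ Suc p) v = (g ^^ n) ((g ^^ (n * p)) v)"
  using Suc BijGroup_pow_apply[OF g funpow_Bij_closed[OF g v]] by simp
 then show ?case by (simp add: funpow_add)
qed simp

lemma funpow_commute_apply: "(g ^^ m) ((g ^^ n) x) = (g ^^ n) ((g ^^ m) x)"
 by (metis add.commute comp_apply funpow_add)

lemma funpow_Bij_inj: "g \<in> Bij V \<Longrightarrow> x \<in> V \<Longrightarrow> y \<in> V \<Longrightarrow> (g ^^ n) x = (g ^^ n) y \<Longrightarrow> x = y"
proof (induction n)
 case (Suc n)
 then have "g ((g ^^ n) x) = g ((g ^^ n) y)" by simp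
 then show ?case using Suc.IH Suc.prems Bij_inj[OF Suc.prems(1) funpow_Bij_closed[OF Suc.prems(1,2)] funpow_Bij_closed[OF Suc.prems(1,3)]] by blast
qed simp

lemma period_le:
 assumes V: "finite V" and g: "g \<in> Bij V" and x: "x \<in> V" and B: "finite B" "\<And>n. (g ^^ n) x \<in> B"
 shows "card (orbit g x) \<le> card B"
 by (rule card_mono[OF B(1)]) (use B(2) in \<open>auto simp: orbit_altdef\<close>)

lemma dvd_prime_3: "(n::nat) dvd 3 \<Longrightarrow> n = 1 \<or> n = 3"
 using prime_nat_iff[of 3] by auto

text \<open>An abstract set with the block structure of \<open>\<int>\<^sub>3 \<times> \<int>\<^sub>r\<close>. The last two conditions are what is kept of the absence of
 semiregular elements and of the elementary abelian normal 3-subgroup.\<close>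

locale cyclic_blocks =
 fixes X :: "'b set" and P :: "('b \<Rightarrow> 'b) set" and blk :: "'b \<Rightarrow> int" and r :: nat
 assumes fin: "finite X"
  and P: "subgroup P (BijGroup X)"
  and transitive: "transitive_on X P"
  and r_ge: "r \<ge> 2"
  and blk_range: "\<And>x. x \<in> X \<Longrightarrow> 0 \<le> blk x \<and> blk x < int r"
  and shift: "\<And>g. g \<in> P \<Longrightarrow> \<exists>j. \<forall>x\<in>X. blk (g x) = (blk x + j) mod int r"
  and size: "\<And>y. 0 \<le> y \<Longrightarrow> y < int r \<Longrightarrow> card {x\<in>X. blk x = y} = 3"
  and fixes_point: "\<And>g p. g \<in> P \<Longrightarrow> prime (p::nat) \<Longrightarrow> (\<And>x. x \<in> X \<Longrightarrow> (g ^^ p) x = x) \<Longrightarrow> \<exists>x\<in>X. g x = x"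
  and order_three: "\<exists>c\<in>P. (\<forall>x\<in>X. (c ^^ 3) x = x \<and> blk (c x) = blk x) \<and> (\<exists>x\<in>X. c x \<noteq> x)"
begin

lemma PB: "g \<in> P \<Longrightarrow> g \<in> Bij X"
 using subgroup.subset[OF P] by (auto simp: carrier_BijGroup)

lemma P_pow: "g \<in> P \<Longrightarrow> g [^]\<^bsub>BijGroup X\<^esub> (n::nat) \<in> P"
 by (induction n) (simp_all add: subgroup.one_closed[OF P] subgroup.m_closed[OF P])

lemma finB: "finite {x\<in>X. Q x}" using fin by simp

lemma exists_rotation: "\<exists>\<tau>\<in>P. \<forall>x\<in>X. blk (\<tau> x) = (blk x + 1) mod int r"
proof -
 have r0: "0 < int r" "1 < int r" using r_ge by auto
 have "\<exists>x. x \<in> {x\<in>X. blk x = y}" if "y = 0 \<or> y = 1" for y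
  using size[of y] that r0 by (metis card.empty ex_in_conv zero_neq_numeral order_refl zero_le_one)
 then obtain x0 x1 where x: "x0 \<in> X" "blk x0 = 0" "x1 \<in> X" "blk x1 = 1" by blast
 then obtain g where g: "g \<in> P" "g x0 = x1" using transitive by (auto simp: transitive_on_def)
 obtain j where j: "\<And>x. x \<in> X \<Longrightarrow> blk (g x) = (blk x + j) mod int r" using shift[OF g(1)] by blast
 have "j mod int r = 1" using j[OF x(1)] g x by simp
 then have "blk (g x) = (blk x + 1) mod int r" if "x \<in> X" for x using j[OF that] by (metis mod_add_right_eq)
 then show ?thesis using g(1) by blast
qed

definition \<tau> :: "'b \<Rightarrow> 'b" where
 "\<tau> = (SOME t. t \<in> P \<and> (\<forall>x\<in>X. blk (t x) = (blk x + 1) mod int r))"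

lemma \<tau>: "\<tau> \<in> P" "\<And>x. x \<in> X \<Longrightarrow> blk (\<tau> x) = (blk x + 1) mod int r"
proof -
 have "\<exists>t. t \<in> P \<and> (\<forall>x\<in>X. blk (t x) = (blk x + 1) mod int r)" using exists_rotation by blast
 then have "\<tau> \<in> P \<and> (\<forall>x\<in>X. blk (\<tau> x) = (blk x + 1) mod int r)" unfolding \<tau>_def by (rule someI_ex)
 then show "\<tau> \<in> P" "\<And>x. x \<in> X \<Longrightarrow> blk (\<tau> x) = (blk x + 1) mod int r" by auto
qed

lemma \<tau>B: "\<tau> \<in> Bij X" by (rule PB[OF \<tau>(1)])

lemma \<tau>_closed: "x \<in> X \<Longrightarrow> (\<tau> ^^ n) x \<in> X" by (rule funpow_Bij_closed[OF \<tau>B])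

lemma blk_\<tau>: "x \<in> X \<Longrightarrow> blk ((\<tau> ^^ n) x) = (blk x + int n) mod int r"
proof (induction n)
 case 0
 then show ?case using blk_range[of x] by simp
next
 case (Suc n)
 have "blk ((\<tau> ^^ Suc n) x) = ((blk x + int n) mod int r + 1) mod int r" using Suc \<tau>(2)[OF \<tau>_closed] by simp
 also have "\<dots> = (blk x + int (Suc n)) mod int r" by (subst mod_add_left_eq) (simp add: algebra_simps)
 finally show ?case .
qed

lemma rotate_to:
 assumes x: "x \<in> X" and y: "0 \<le> y" "y < int r"
 obtains n where "blk ((\<tau> ^^ n) x) = y"
proof -
 have "0 \<le> y - blk x + int r" using y blk_range[OF x] by simp
 then have "blk ((\<tau> ^^ nat (y - blk x + int r)) x) = (y + int r) mod int r" unfolding blk_\<tau>[OF x] by simp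
 then show ?thesis using that[of "nat (y - blk x + int r)"] y by simp
qed

text \<open>Powers of \<open>\<tau>\<close> commute with \<open>\<tau>\<close>, which carries the given block to every other one.\<close>

lemma trivial_on_block:
 assumes "0 \<le> y" "y < int r" and triv: "\<And>x. x \<in> X \<Longrightarrow> blk x = y \<Longrightarrow> (\<tau> ^^ n) x = x" and x: "x \<in> X"
 shows "(\<tau> ^^ n) x = x"
proof -
 obtain m where m: "blk ((\<tau> ^^ m) x) = y" using rotate_to[OF x assms(1,2)] .
 have "(\<tau> ^^ m) ((\<tau> ^^ n) x) = (\<tau> ^^ m) x" using triv[OF \<tau>_closed[OF x] m] funpow_commute_apply by metis
 then show ?thesis using funpow_Bij_inj[OF \<tau>B \<tau>_closed[OF x] x] by blast
qed

lemma \<tau>_pow_fixes: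
 assumes p: "prime (p::nat)" and triv: "\<And>x. x \<in> X \<Longrightarrow> (\<tau> ^^ (n * p)) x = x"
 shows "\<exists>x\<in>X. (\<tau> ^^ n) x = x"
proof -
 have "\<exists>x\<in>X. (\<tau> [^]\<^bsub>BijGroup X\<^esub> n) x = x"
  by (rule fixes_point[OF P_pow[OF \<tau>(1)] p]) (use pow_funpow[OF \<tau>B] triv in simp)
 then show ?thesis using BijGroup_pow_apply[OF \<tau>B] by auto
qed

lemma blk_multiple: "x \<in> X \<Longrightarrow> r dvd n \<Longrightarrow> blk ((\<tau> ^^ n) x) = blk x"
 unfolding blk_\<tau> using blk_range[of x] by (auto elim!: dvdE)

lemma \<tau>_fixes_dvd:
 assumes x: "x \<in> X" "(\<tau> ^^ n) x = x"
 shows "r dvd n"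
proof -
 have "blk x = (blk x + int n) mod int r" using blk_\<tau>[OF x(1), of n] x(2) by simp
 then have "(blk x + int n - blk x) mod int r = (blk x - blk x) mod int r" by (metis mod_diff_left_eq)
 then show ?thesis by (metis add_diff_cancel_left' diff_self mod_0 mod_0_imp_dvd of_nat_dvd_iff)
qed

text \<open>On a block of three points the \<open>r\<close>-th power of \<open>\<tau>\<close> has cycles of length at most three, so its sixth power is
 trivial. Hence \<open>\<tau> ^^ (2 * r)\<close> has order dividing three and fixes a point; on the two other points of its block it has no
 room for a cycle of length three.\<close>

lemma \<tau>_2r:
 assumes x: "x \<in> X"
 shows "(\<tau> ^^ (2 * r)) x = x"
proof -
 let ?b = "\<tau> [^]\<^bsub>BijGroup X\<^esub> r" and ?u = "\<tau> [^]\<^bsub>BijGroup X\<^esub> (2 * r)"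
 have bB: "?b \<in> Bij X" "?u \<in> Bij X" using PB P_pow \<tau>(1) by auto
 have six: "(\<tau> ^^ (2 * r * 3)) x = x" if x: "x \<in> X" for x
 proof -
  have "card (orbit ?b x) \<le> card {z\<in>X. blk z = blk x}"
   by (rule period_le[OF fin bB(1) x finB]) (simp add: pow_funpow[OF \<tau>B x] \<tau>_closed[OF x] blk_multiple[OF x])
  then have "card (orbit ?b x) \<le> 3" using size blk_range[OF x] by simp
  moreover have "card (orbit ?b x) > 0" by (rule card_orbit_period(2)[OF fin bB(1) x])
  ultimately have "card (orbit ?b x) \<in> {1, 2, 3}" by auto
  then have "card (orbit ?b x) dvd 6" by auto
  then have "(?b ^^ 6) x = x" using card_orbit_period(1)[OF fin bB(1) x] by blast
  then show ?thesis unfolding pow_funpow[OF \<tau>B x] by (simp add: mult.commute mult.assoc)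
 qed
 obtain x0 where x0: "x0 \<in> X" "(\<tau> ^^ (2 * r)) x0 = x0" using \<tau>_pow_fixes[of 3 "2 * r"] six by auto
 show ?thesis
 proof (rule trivial_on_block[OF _ _ _ x])
  show "0 \<le> blk x0" "blk x0 < int r" using blk_range[OF x0(1)] by auto
  fix z assume z: "z \<in> X" "blk z = blk x0"
  show "(\<tau> ^^ (2 * r)) z = z"
  proof (cases "z = x0")
   case False
   let ?B = "{w\<in>X. blk w = blk x0} - {x0}"
   have "(?u ^^ n) z \<in> ?B" for n
   proof -
    have "(\<tau> ^^ (2 * r * n)) x0 = x0"
    proof (induction n)
     case (Suc n)
     have "2 * r * Suc n = 2 * r + 2 * r * n" by simp
     then show ?case using Suc x0(2) by (simp only: funpow_add comp_apply)
    qed simp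
    then have "(\<tau> ^^ (2 * r * n)) z \<noteq> x0" using funpow_Bij_inj[OF \<tau>B z(1) x0(1)] False by metis
    then show ?thesis using pow_funpow[OF \<tau>B z(1)] \<tau>_closed[OF z(1)] blk_multiple[OF z(1)] z(2) by simp
   qed
   then have "card (orbit ?u z) \<le> card ?B" by (intro period_le[OF fin bB(2) z(1)]) (use fin in auto)
   also have "card ?B = 2" using size blk_range[OF x0(1)] x0(1) finB by (subst card_Diff_singleton) auto
   finally have le: "card (orbit ?u z) \<le> 2" .
   have "(?u ^^ 3) z = z" unfolding pow_funpow[OF \<tau>B z(1)] by (rule six[OF z(1)])
   then have "card (orbit ?u z) dvd 3" using card_orbit_period(1)[OF fin bB(2) z(1)] by blast
   then have "card (orbit ?u z) \<in> {1, 3}" using dvd_prime_3 by blast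
   then have "card (orbit ?u z) = 1" using le by auto
   then have "(?u ^^ 1) z = z" using card_orbit_period(1)[OF fin bB(2) z(1), of 1] by simp
   then show ?thesis using BijGroup_pow_apply[OF \<tau>B z(1)] by simp
  qed (use x0 in simp)
 qed
qed

text \<open>For an odd prime \<open>p\<close> with \<open>r = p m\<close>, the power \<open>\<tau> ^^ (2 * m)\<close> has order dividing \<open>p\<close> and would have to fix a point, but it
 rotates the blocks nontrivially.\<close>

lemma r_power_of_two: "\<exists>a. r = 2 ^ a"
proof (rule only_prime_factor_imp_power)
 show "r > 0" using r_ge by simp
 fix p assume p: "prime p" "p dvd r"
 then obtain m where m: "r = p * m" by (auto elim: dvdE)
 show "p = 2"
 proof (rule ccontr)
  assume "p \<noteq> 2"
  then have p2: "p > 2" using prime_ge_2_nat[OF p(1)] by simp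
  have e: "2 * m * p = 2 * r" using m by simp
  obtain x where x: "x \<in> X" "(\<tau> ^^ (2 * m)) x = x"
   using \<tau>_pow_fixes[OF p(1), of "2 * m"] \<tau>_2r unfolding e by blast
  then have "p * m dvd 2 * m" using \<tau>_fixes_dvd m by blast
  moreover have "m > 0" using m r_ge by (cases m) auto
  ultimately have "p dvd 2" by simp
  then show False using p2 by (auto dest: dvd_imp_le)
 qed
qed

lemma \<tau>_r_nontrivial: "\<exists>x\<in>X. (\<tau> ^^ r) x \<noteq> x"
proof (rule ccontr)
 assume "\<not> ?thesis"
 then have triv: "(\<tau> ^^ r) x = x" if "x \<in> X" for x using that by blast
 obtain a where a: "r = 2 ^ a" using r_power_of_two by blast
 obtain b where "a = Suc b" using a r_ge by (cases a) auto
 then have h: "r = 2 ^ b * 2" using a by simp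
 obtain x where x: "x \<in> X" "(\<tau> ^^ (2 ^ b)) x = x" using \<tau>_pow_fixes[of 2 "2 ^ b"] triv h by auto
 then have "r dvd 2 ^ b" by (rule \<tau>_fixes_dvd)
 then show False using h by (auto dest: dvd_imp_le)
qed

text \<open>A nontrivial involution of three points fixes one of them and exchanges the others; these become \<open>0\<close>, \<open>1\<close> and \<open>2\<close>.\<close>

lemma base_points:
 obtains p0 p1 p2 where "p0 \<in> X" "p1 \<in> X" "p2 \<in> X" "p0 \<noteq> p1" "p0 \<noteq> p2" "p1 \<noteq> p2" "{x\<in>X. blk x = 0} = {p0, p1, p2}"
  "(\<tau> ^^ r) p0 = p0" "(\<tau> ^^ r) p1 = p2" "(\<tau> ^^ r) p2 = p1"
proof -
 have r0: "0 \<le> (0::int)" "0 < int r" using r_ge by auto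
 have rr: "(\<tau> ^^ (r * 2)) x = x" if "x \<in> X" for x using \<tau>_2r[OF that] by (simp add: mult.commute)
 have sq: "(\<tau> ^^ r) ((\<tau> ^^ r) x) = x" if "x \<in> X" for x
  using \<tau>_2r[OF that] by (simp only: mult_2 funpow_add comp_apply)
 obtain q where q: "q \<in> X" "(\<tau> ^^ r) q = q" using \<tau>_pow_fixes[of 2 r] rr by auto
 obtain n where n: "blk ((\<tau> ^^ n) q) = 0" using rotate_to[OF q(1) r0] .
 define p0 where "p0 = (\<tau> ^^ n) q"
 have p0: "p0 \<in> X" "blk p0 = 0" "(\<tau> ^^ r) p0 = p0"
  using n q \<tau>_closed[OF q(1)] funpow_commute_apply[of r \<tau> n q] by (simp_all add: p0_def)
 obtain p1 where p1: "p1 \<in> X" "blk p1 = 0" "(\<tau> ^^ r) p1 \<noteq> p1"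
  using trivial_on_block[OF r0, of r] \<tau>_r_nontrivial by blast
 define p2 where "p2 = (\<tau> ^^ r) p1"
 have p2: "p2 \<in> X" "blk p2 = 0" "(\<tau> ^^ r) p2 = p1"
  using \<tau>_closed[OF p1(1)] blk_multiple[OF p1(1), of r] p1 sq[OF p1(1)] by (simp_all add: p2_def)
 have d: "p0 \<noteq> p1" "p0 \<noteq> p2" "p1 \<noteq> p2" using p0(3) p1(3) p2(3) by (auto simp: p2_def)
 have "{p0, p1, p2} = {x\<in>X. blk x = 0}"
  by (rule card_subset_eq[OF finB]) (use p0 p1 p2 d size[OF r0] in auto)
 then show ?thesis using that[OF p0(1) p1(1) p2(1) d _ p0(3) p2_def[symmetric] p2(3)] by (simp only:)
qed

text \<open>The rotation \<open>\<tau>\<close> carries the coordinates of the first block around the cycle. After one turn it acts as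
 \<open>x \<mapsto> -x\<close>, so in these coordinates it is \<open>rho\<close>.\<close>

theorem coordinates:
 "\<exists>a f. r = 2 ^ a \<and> bij_betw f X (PXV r) \<and> (\<forall>x\<in>X. snd (f x) = blk x) \<and>
  rho_group r a (transport X (PXV r) f ` P)"
proof -
 obtain a where a: "r = 2 ^ a" using r_power_of_two by blast
 have r0: "0 \<le> (0::int)" "0 < int r" using r_ge by auto
 obtain p0 p1 p2 where p: "p0 \<in> X" "p1 \<in> X" "p2 \<in> X" "p0 \<noteq> p1" "p0 \<noteq> p2" "p1 \<noteq> p2" "{x\<in>X. blk x = 0} = {p0, p1, p2}"
  "(\<tau> ^^ r) p0 = p0" "(\<tau> ^^ r) p1 = p2" "(\<tau> ^^ r) p2 = p1" by (rule base_points)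
 define pt where "pt x = (if x = (0::int) then p0 else if x = 1 then p1 else p2)" for x
 have pt: "pt x \<in> X" "blk (pt x) = 0" for x using p by (auto simp: pt_def)
 have pt_inj: "x = x'" if "0 \<le> x" "x < 3" "0 \<le> x'" "x' < 3" "pt x = pt x'" for x x'
  using that p three_cases[of x] three_cases[of x'] by (auto simp: pt_def split: if_splits)
 have pt_neg: "(\<tau> ^^ r) (pt x) = pt ((- x) mod 3)" if "0 \<le> x" "x < 3" for x
  using three_cases[OF that] p by (auto simp: pt_def)
 define h where "h = (\<lambda>(x, y). (\<tau> ^^ nat y) (pt x))"
 have hX: "h q \<in> X" for q by (cases q) (simp add: h_def \<tau>_closed pt)
 have blk_h: "blk (h q) = snd q" if "q \<in> PXV r" for q
  using that blk_\<tau>[OF pt(1)] pt(2) by (cases q) (auto simp: h_def PXV_iff)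
 have hb: "bij_betw h (PXV r) X"
  unfolding bij_betw_def
 proof
  show "inj_on h (PXV r)"
  proof (rule inj_onI)
   fix q q' assume q: "q \<in> PXV r" "q' \<in> PXV r" "h q = h q'"
   obtain x y x' y' where xy: "q = (x, y)" "q' = (x', y')" by (cases q, cases q')
   have "y = y'" using blk_h[OF q(1)] blk_h[OF q(2)] q(3) by (simp add: xy)
   moreover from this have "pt x = pt x'" using q(3) funpow_Bij_inj[OF \<tau>B pt(1) pt(1)] by (simp add: xy h_def)
   then have "x = x'" using pt_inj q by (simp add: xy PXV_iff)
   ultimately show "q = q'" by (simp add: xy)
  qed
  show "h ` PXV r = X"
  proof
   show "X \<subseteq> h ` PXV r"
   proof
    fix x assume x: "x \<in> X"
    define y where "y = nat (blk x)"
    have y: "blk x = int y" "y < r" using blk_range[OF x] by (auto simp: y_def)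
    define w where "w = (\<tau> ^^ (2 * r - y)) x"
    have "int (2 * r - y) = int r * 2 - int y" using y by auto
    then have "blk w = (int r * 2) mod int r" unfolding w_def blk_\<tau>[OF x] y(1) by simp
    then have "w \<in> {p0, p1, p2}" using p(7) \<tau>_closed[OF x] by (auto simp: w_def)
    then have "w = pt 0 \<or> w = pt 1 \<or> w = pt 2" by (auto simp: pt_def)
    then have "\<exists>u\<in>{0, 1, 2}. w = pt u" by blast
    then obtain u where w: "u \<in> {0, 1, 2}" "w = pt u" by blast
    then have u: "0 \<le> u" "u < 3" "w = pt u" by auto
    have "(\<tau> ^^ y) w = (\<tau> ^^ (y + (2 * r - y))) x" unfolding w_def by (simp add: funpow_add)
    also have "\<dots> = x" using \<tau>_2r[OF x] y by simp
    finally have "h (u, int y) = x" using u by (simp add: h_def)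
    then show "x \<in> h ` PXV r" using u y by (intro image_eqI[of _ _ "(u, int y)"]) (auto simp: PXV_iff)
   qed
  qed (use hX in auto)
 qed
 define f where "f = inv_into (PXV r) h"
 have fb: "bij_betw f X (PXV r)" unfolding f_def by (rule bij_betw_inv_into[OF hb])
 have fh: "f (h q) = q" if "q \<in> PXV r" for q unfolding f_def by (rule bij_betw_inv_into_left[OF hb that])
 have hf: "h (f x) = x" if "x \<in> X" for x unfolding f_def by (rule bij_betw_inv_into_right[OF hb that])
 have fX: "f x \<in> PXV r" if "x \<in> X" for x using bij_betwE[OF fb] that by blast
 have snd_f: "snd (f x) = blk x" if "x \<in> X" for x using blk_h[OF fX[OF that]] hf[OF that] by simp
 let ?T = "transport X (PXV r) f"
 have T_apply: "?T g q = f (g (h q))" if "g \<in> P" "q \<in> PXV r" for g q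
  using transport_apply[OF fb PB[OF that(1)] hX[of q]] fh[OF that(2)] by simp
 have T_Bij: "?T g \<in> Bij (PXV r)" if "g \<in> P" for g by (rule transport_Bij[OF fb PB[OF that]])
 have T_pow: "(?T g ^^ n) q = f ((g ^^ n) (h q))" if g: "g \<in> P" and q: "q \<in> PXV r" for g q n
 proof (induction n)
  case (Suc n)
  have gX: "(g ^^ n) (h q) \<in> X" by (rule funpow_Bij_closed[OF PB[OF g] hX])
  show ?case using Suc T_apply[OF g fX[OF gX]] hf[OF gX] by simp
 qed (simp add: fh[OF q])
 have rB: "rho r \<in> Bij (PXV r)" using rho_apply(2)[of 0 0 r] r0 by (simp add: PXV_iff)
 have "?T \<tau> = rho r"
 proof (rule Bij_eqI[OF T_Bij[OF \<tau>(1)] rB])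
  fix q assume q: "q \<in> PXV r"
  obtain x y where xy: "q = (x, y)" by (cases q)
  have b: "0 \<le> x" "x < 3" "0 \<le> y" "y < int r" "(x, y) \<in> PXV r" using q by (auto simp: xy PXV_iff)
  have th: "\<tau> (h q) = (\<tau> ^^ Suc (nat y)) (pt x)" by (simp add: h_def xy)
  show "?T \<tau> q = rho r q"
  proof (cases "y = int r - 1")
   case True
   then have "Suc (nat y) = r" using r0 by linarith
   then have "\<tau> (h q) = h ((- x) mod 3, 0)" using th pt_neg[OF b(1,2)] by (simp add: h_def)
   moreover have "((- x) mod 3, 0) \<in> PXV r" using r0 by (simp add: PXV_iff)
   ultimately show ?thesis using T_apply[OF \<tau>(1) q] fh True b by (simp add: xy rho_apply(1))
  next
   case False
   then have P': "(x, y + 1) \<in> PXV r" using b by (auto simp: PXV_iff)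
   have "nat (y + 1) = Suc (nat y)" using b by linarith
   then have "\<tau> (h q) = h (x, y + 1)" using th by (simp add: h_def)
   then show ?thesis using T_apply[OF \<tau>(1) q] fh[OF P'] False b P' by (simp add: xy rho_apply(1) PXV_iff)
  qed
 qed
 have "rho_group r a (?T ` P)"
 proof (rule rho_group.intro)
  show "r = 2 ^ a" by (rule a)
  show "rho r \<in> ?T ` P" using \<open>?T \<tau> = rho r\<close> \<tau>(1) by (metis imageI)
  have mult: "?T (g \<otimes>\<^bsub>BijGroup X\<^esub> h) = ?T g \<otimes>\<^bsub>SymV r\<^esub> ?T h" if "g \<in> P" "h \<in> P" for g h
   by (rule transport_mult[OF fb PB[OF that(1)] PB[OF that(2)]])
  show "subgroup (?T ` P) (SymV r)"
   by (rule hom_image_subgroup(1)[where F = ?T, OF group_BijGroup group_BijGroup P _ mult]) (simp_all add: T_Bij carrier_BijGroup)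
  show "\<exists>j. \<forall>x y. (x, y) \<in> PXV r \<longrightarrow> snd (q (x, y)) = (y + j) mod int r" if q: "q \<in> ?T ` P" for q
  proof -
   obtain g where g: "g \<in> P" "q = ?T g" using q by blast
   obtain j where j: "\<And>x. x \<in> X \<Longrightarrow> blk (g x) = (blk x + j) mod int r" using shift[OF g(1)] by blast
   have "snd (q (x, y)) = (y + j) mod int r" if xy: "(x, y) \<in> PXV r" for x y
    unfolding g(2) T_apply[OF g(1) xy] snd_f[OF Bij_apply_closed[OF PB[OF g(1)] hX]] j[OF hX] blk_h[OF xy] by simp
   then show ?thesis by blast
  qed
  show "\<exists>y. 0 \<le> y \<and> y < int r \<and> c y mod 3 = 0" if c: "transl r c \<in> ?T ` P" for c
  proof -
   obtain g where g: "g \<in> P" "transl r c = ?T g" using c by blast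
   have g_eq: "g x = h (transl r c (f x))" if x: "x \<in> X" for x
    using T_apply[OF g(1) fX[OF x]] hf[OF x] hf[OF Bij_apply_closed[OF PB[OF g(1)] x]] g(2) by simp
   have "(transl r c ^^ 3) q = q" if q: "q \<in> PXV r" for q
    using q transl_cube[of "fst q" "snd q" r c] by (simp add: numeral_3_eq_3)
   then have "(g ^^ 3) x = x" if x: "x \<in> X" for x
    using T_pow[OF g(1) fX[OF x], of 3] hf[OF x] hf[OF funpow_Bij_closed[OF PB[OF g(1)] x]] fX[OF x] g(2) by metis
   then obtain x where x: "x \<in> X" "g x = x" using fixes_point[OF g(1), of 3] by auto
   obtain u y where uy: "f x = (u, y)" by (cases "f x")
   have uyP: "(u, y) \<in> PXV r" using fX[OF x(1)] uy by simp
   have "transl r c (u, y) = (u, y)" using T_apply[OF g(1) uyP] g(2) hf[OF x(1)] x(2) uy by simp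
   then have "(u + c y) mod 3 = u mod 3" using transl_apply[OF uyP] uyP by (simp add: PXV_iff)
   then have "(u + c y - u) mod 3 = (u - u) mod 3" by (metis mod_diff_left_eq)
   then show ?thesis using uyP by (intro exI[of _ y]) (simp add: PXV_iff)
  qed
  obtain c where c: "c \<in> P" "\<And>x. x \<in> X \<Longrightarrow> (c ^^ 3) x = x" "\<And>x. x \<in> X \<Longrightarrow> blk (c x) = blk x" "\<exists>x\<in>X. c x \<noteq> x"
   using order_three by blast
  define t where "t = ?T c"
  have tB: "t \<in> Bij (PXV r)" unfolding t_def by (rule T_Bij[OF c(1)])
  have "t (t (t q)) = q" if "q \<in> PXV r" for q
   using T_pow[OF c(1) that, of 3] c(2)[OF hX, of q] fh[OF that] by (simp add: t_def numeral_3_eq_3)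
  moreover have "snd (t q) = snd q" if "q \<in> PXV r" for q
   unfolding t_def T_apply[OF c(1) that] snd_f[OF Bij_apply_closed[OF PB[OF c(1)] hX]] c(3)[OF hX] blk_h[OF that] ..
  ultimately have "t = transl r (\<lambda>y. fst (t (0, y)))" by (rule order_three_translation[OF tB])
  moreover have "t \<noteq> \<one>\<^bsub>SymV r\<^esub>"
  proof
   assume "t = \<one>\<^bsub>SymV r\<^esub>"
   moreover obtain x where x: "x \<in> X" "c x \<noteq> x" using c(4) by blast
   ultimately have "f (c x) = f x" using T_apply[OF c(1) fX[OF x(1)]] hf[OF x(1)] BijGroup_one_apply[OF fX[OF x(1)]] by (simp add: t_def)
   then show False using x bij_betw_imp_inj_on[OF fb] Bij_apply_closed[OF PB[OF c(1)] x(1)] by (meson inj_onD)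
  qed
  moreover have "t \<in> ?T ` P" using c(1) by (simp add: t_def)
  ultimately show "\<exists>c. transl r c \<in> ?T ` P \<and> transl r c \<noteq> \<one>\<^bsub>SymV r\<^esub>" by metis
 qed
 then show ?thesis using a fb snd_f by blast
qed

end

section \<open>Vertex-transitive groups without semiregular elements\<close>

lemma two_three_number:
 assumes "(n::nat) > 0" and pf: "\<And>p. prime p \<Longrightarrow> p dvd n \<Longrightarrow> p = 2 \<or> p = 3"
 shows "\<exists>a b. n = 2 ^ a * 3 ^ b"
proof -
 have "n \<noteq> 0" "\<not> is_unit (2::nat)" using assms(1) by simp_all
 from multiplicity_decompose'[OF this] obtain m where m: "n = 2 ^ multiplicity 2 n * m" "\<not> 2 dvd m" by blast
 have "\<exists>b. m = 3 ^ b"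
 proof (rule only_prime_factor_imp_power)
  show "m > 0" using m assms(1) by (cases m) auto
  fix p assume p: "prime p" "p dvd m"
  then have "p dvd n" using m(1) by (metis dvd_mult)
  then show "p = 3" using pf[OF p(1)] m(2) p(2) by blast
 qed
 then show ?thesis using m(1) by blast
qed

text \<open>The digraph is given by its sets of vertices and arcs, its connectedness by the reachability relation of the underlying
 graph, and the automorphisms as permutations preserving \<open>E\<close>.\<close>

locale elusive_digraph =
 fixes V :: "'a set" and E :: "('a \<times> 'a) set" and G :: "('a \<Rightarrow> 'a) set" and d :: nat
 assumes finV: "finite V" and E_sub: "E \<subseteq> V \<times> V" and two: "card V \<ge> 2"
  and conn: "\<And>u v. u \<in> V \<Longrightarrow> v \<in> V \<Longrightarrow> (u, v) \<in> (E \<union> E\<inverse>)\<^sup>*"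
  and outdeg: "\<And>v. v \<in> V \<Longrightarrow> card (E `` {v}) = d" and d3: "d \<le> 3"
  and G: "subgroup G (BijGroup V)"
  and aut: "\<And>g u v. g \<in> G \<Longrightarrow> u \<in> V \<Longrightarrow> v \<in> V \<Longrightarrow> (g u, g v) \<in> E \<longleftrightarrow> (u, v) \<in> E"
  and transG: "transitive_on V G"
  and elusive: "\<And>g. g \<in> G \<Longrightarrow> semiregular V g \<Longrightarrow> g = \<one>\<^bsub>BijGroup V\<^esub>"
begin

abbreviation "SV \<equiv> BijGroup V"

abbreviation SV_mult (infixl "\<star>" 70) where "g \<star> h \<equiv> g \<otimes>\<^bsub>SV\<^esub> h"
abbreviation SV_pow (infixr "\<Up>" 75) where "g \<Up> (n::nat) \<equiv> g [^]\<^bsub>SV\<^esub> n"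
abbreviation iv where "iv g \<equiv> inv\<^bsub>SV\<^esub> g"
abbreviation id\<^sub>V where "id\<^sub>V \<equiv> \<one>\<^bsub>SV\<^esub>"

sublocale SV: group SV by (rule group_BijGroup)

lemma V_nonempty: "V \<noteq> {}" using two by auto
lemma GB: "g \<in> G \<Longrightarrow> g \<in> Bij V" using subgroup.subset[OF G] by (auto simp: carrier_BijGroup)
lemma GC: "g \<in> G \<Longrightarrow> g \<in> carrier SV" using subgroup.subset[OF G] by auto
lemma GV: "g \<in> G \<Longrightarrow> v \<in> V \<Longrightarrow> g v \<in> V" by (rule Bij_apply_closed[OF GB])
lemma G_mult: "g \<in> G \<Longrightarrow> h \<in> G \<Longrightarrow> g \<star> h \<in> G" by (rule subgroup.m_closed[OF G])
lemma G_inv: "g \<in> G \<Longrightarrow> iv g \<in> G" by (rule subgroup.m_inv_closed[OF G])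
lemma G_one: "id\<^sub>V \<in> G" by (rule subgroup.one_closed[OF G])
lemma G_pow: "g \<in> G \<Longrightarrow> g \<Up> (n::nat) \<in> G" by (induction n) (simp_all add: G_one G_mult)
lemma mult_app: "g \<in> G \<Longrightarrow> h \<in> G \<Longrightarrow> v \<in> V \<Longrightarrow> (g \<star> h) v = g (h v)"
 by (rule BijGroup_mult_apply[OF GB GB])
lemma inv_app: "g \<in> G \<Longrightarrow> v \<in> V \<Longrightarrow> (iv g) (g v) = v" "g \<in> G \<Longrightarrow> v \<in> V \<Longrightarrow> g ((iv g) v) = v"
 using BijGroup_inv_apply[OF GB] by auto
lemma G_inj: "g \<in> G \<Longrightarrow> u \<in> V \<Longrightarrow> v \<in> V \<Longrightarrow> g u = g v \<longleftrightarrow> u = v" using Bij_inj[OF GB] by blast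
lemma G_eqI: "g \<in> G \<Longrightarrow> h \<in> G \<Longrightarrow> (\<And>v. v \<in> V \<Longrightarrow> g v = h v) \<Longrightarrow> g = h" by (rule Bij_eqI[OF GB GB])
lemma G_eq_oneI: "g \<in> G \<Longrightarrow> (\<And>v. v \<in> V \<Longrightarrow> g v = v) \<Longrightarrow> g = id\<^sub>V"
 by (rule G_eqI[OF _ G_one]) (simp_all add: BijGroup_one_apply)
lemma conj_app: "g \<in> G \<Longrightarrow> m \<in> G \<Longrightarrow> v \<in> V \<Longrightarrow> (g \<star> m \<star> iv g) (g v) = g (m v)"
 by (rule conj_by_apply(1)[OF GB GB])
lemma pow_app: "g \<in> G \<Longrightarrow> v \<in> V \<Longrightarrow> (g \<Up> (n::nat)) v = (g ^^ n) v"
 by (rule BijGroup_pow_apply[OF GB])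
lemma funpow_V: "g \<in> G \<Longrightarrow> v \<in> V \<Longrightarrow> (g ^^ n) v \<in> V" by (rule funpow_Bij_closed[OF GB])
lemma pow_one_iff: "g \<in> G \<Longrightarrow> g \<Up> (n::nat) = id\<^sub>V \<longleftrightarrow> (\<forall>v\<in>V. (g ^^ n) v = v)"
 using pow_app[of g _ n] G_eq_oneI[OF G_pow] BijGroup_one_apply by metis
lemma finC: "finite (carrier SV)" using finite_Bij[OF finV] by (simp add: carrier_BijGroup)
lemma finG: "finite G" using finC subgroup.subset[OF G] finite_subset by blast
lemma E_V: "(u, v) \<in> E \<Longrightarrow> u \<in> V" "(u, v) \<in> E \<Longrightarrow> v \<in> V" using E_sub by auto
lemma finN: "finite (E `` {v})" using E_sub finV by (auto intro: finite_subset[of _ V])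
lemma transitivity: "u \<in> V \<Longrightarrow> v \<in> V \<Longrightarrow> \<exists>g\<in>G. g u = v" using transG by (simp add: transitive_on_def)

lemma autD: "g \<in> G \<Longrightarrow> (u, v) \<in> E \<Longrightarrow> (g u, g v) \<in> E" using aut E_V by blast

lemma aut_rtrancl: "(u, v) \<in> E\<^sup>* \<Longrightarrow> g \<in> G \<Longrightarrow> (g u, g v) \<in> E\<^sup>*"
 by (induction rule: rtrancl_induct) (auto intro: rtrancl_into_rtrancl autD)

lemma reach_V: "(u, v) \<in> E\<^sup>* \<Longrightarrow> u \<in> V \<Longrightarrow> v \<in> V"
 by (induction rule: rtrancl_induct) (auto dest: E_V)

text \<open>All vertices reach equally many vertices, so that reachability is symmetric.\<close>

lemma reach:
 assumes "u \<in> V" "v \<in> V"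
 shows "(u, v) \<in> E\<^sup>*"
proof -
 define R where "R v = E\<^sup>* `` {v}" for v
 have RV: "R v \<subseteq> V" if "v \<in> V" for v using reach_V that by (auto simp: R_def)
 have fR: "finite (R v)" if "v \<in> V" for v using RV[OF that] finV finite_subset by blast
 have le: "card (R u) \<le> card (R v)" if uv: "u \<in> V" "v \<in> V" for u v
 proof -
  obtain g where g: "g \<in> G" "g u = v" using transitivity[OF uv] by blast
  have "g ` R u \<subseteq> R v" using aut_rtrancl[OF _ g(1)] g(2) by (auto simp: R_def)
  moreover have "inj_on g (R u)" by (rule inj_onI) (use G_inj[OF g(1)] RV[OF uv(1)] in blast)
  ultimately show ?thesis using card_inj_on_le fR[OF uv(2)] by blast
 qed
 have sym: "(v, u) \<in> E\<^sup>*" if uv: "(u, v) \<in> E" for u v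
 proof -
  have V: "u \<in> V" "v \<in> V" using E_V uv by auto
  have "R v \<subseteq> R u" using uv by (auto simp: R_def intro: converse_rtrancl_into_rtrancl)
  then have "R v = R u" using card_subset_eq[OF fR[OF V(1)]] le V by (metis le_antisym)
  then show ?thesis by (auto simp: R_def)
 qed
 from conn[OF assms] show ?thesis
 proof (induction rule: rtrancl_induct)
  case (step y z)
  then show ?case using sym by (auto intro: rtrancl_into_rtrancl rtrancl_trans)
 qed simp
qed

lemma closed_all:
 assumes "u \<in> F" "u \<in> V" and cl: "\<And>v w. v \<in> F \<Longrightarrow> v \<in> V \<Longrightarrow> (v, w) \<in> E \<Longrightarrow> w \<in> F" and "x \<in> V"
 shows "x \<in> F"
proof -
 have "x \<in> F \<and> x \<in> V" using reach[OF assms(2,4)]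
  by (induction rule: rtrancl_induct) (use assms(1,2) cl E_V in auto)
 then show ?thesis by simp
qed

lemma moves_out_neighbour:
 assumes g: "g \<in> G" "g \<noteq> id\<^sub>V" and v: "v \<in> V" "g v = v"
 shows "\<exists>v w. v \<in> V \<and> g v = v \<and> (v, w) \<in> E \<and> g w \<noteq> w"
proof (rule ccontr)
 assume n: "\<not> ?thesis"
 have "x \<in> {x. g x = x}" if "x \<in> V" for x
  by (rule closed_all[OF _ v(1) _ that]) (use v(2) n in auto)
 then show False using G_eq_oneI g by blast
qed

lemma prime_fix:
 assumes g: "g \<in> G" and p: "prime (p::nat)" and gp: "\<And>v. v \<in> V \<Longrightarrow> (g ^^ p) v = v"
 shows "\<exists>v\<in>V. g v = v"
proof (rule ccontr)
 assume n: "\<not> ?thesis"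
 have ne: "g \<noteq> id\<^sub>V" using n V_nonempty BijGroup_one_apply by fastforce
 have "semiregular V g"
  by (rule prime_order_semiregular[OF finV GB[OF g] ne p]) (use n gp pow_one_iff[OF g] in auto)
 then show False using elusive g ne by blast
qed

lemma orbit_in_neighbours:
 assumes g: "g \<in> G" "g v = v" and w: "(v, w) \<in> E"
 shows "(v, (g ^^ n) w) \<in> E"
 by (induction n) (use w autD[OF g(1), of v] g(2) in auto)

text \<open>The element fixes a vertex, and by connectedness some fixed vertex has an out-neighbour that is moved. Its cycle of
 length \<open>p\<close> consists of out-neighbours.\<close>

lemma prime_le_three:
 assumes g: "g \<in> G" "g \<noteq> id\<^sub>V" and p: "prime (p::nat)" and gp: "\<And>v. v \<in> V \<Longrightarrow> (g ^^ p) v = v"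
 shows "p = 2 \<or> p = 3"
proof (rule ccontr)
 assume n: "\<not> ?thesis"
 obtain u where u: "u \<in> V" "g u = u" using prime_fix[OF g(1) p gp] by blast
 obtain v w where v: "v \<in> V" "g v = v" "(v, w) \<in> E" "g w \<noteq> w" using moves_out_neighbour[OF g u] by blast
 have wV: "w \<in> V" using E_V v by blast
 have "card (orbit g w) \<le> card (E `` {v})"
  by (rule period_le[OF finV GB[OF g(1)] wV finN]) (use orbit_in_neighbours[OF g(1) v(2,3)] in auto)
 then have le: "card (orbit g w) \<le> 3" using outdeg[OF v(1)] d3 by simp
 have "card (orbit g w) dvd p" using card_orbit_period(1)[OF finV GB[OF g(1)] wV] gp[OF wV] by blast
 then have "card (orbit g w) = 1 \<or> card (orbit g w) = p" using p by (auto simp: prime_nat_iff)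
 moreover have "card (orbit g w) \<noteq> 1" using card_orbit_period(1)[OF finV GB[OF g(1)] wV, of 1] v(4) by simp
 ultimately have "p \<le> 3" using le by simp
 then show False using n prime_ge_2_nat[OF p] by auto
qed

abbreviation "GG \<equiv> SV\<lparr>carrier := G\<rparr>"

sublocale GG: group GG by (rule SV.subgroup_imp_group[OF G])

lemma GG_pow: "x [^]\<^bsub>GG\<^esub> (n::nat) = x \<Up> n" by (rule SV.nat_pow_consistent[symmetric])

lemma cauchy_G:
 assumes p: "prime (p::nat)" "p dvd card G"
 obtains x where "x \<in> G" "x \<noteq> id\<^sub>V" "\<And>v. v \<in> V \<Longrightarrow> (x ^^ p) v = v"
proof -
 have "finite (carrier GG)" using finG by simp
 moreover have "p dvd order GG" using p by (simp add: Coset.order_def)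
 ultimately obtain x where x: "x \<in> carrier GG" "x \<noteq> \<one>\<^bsub>GG\<^esub>" "x [^]\<^bsub>GG\<^esub> p = \<one>\<^bsub>GG\<^esub>"
  using GG.cauchy_prime_order[OF _ p(1)] by blast
 then have xG: "x \<in> G" "x \<noteq> id\<^sub>V" "x \<Up> p = id\<^sub>V" by (auto simp: GG_pow)
 then show ?thesis using that[of x] pow_one_iff[OF xG(1)] by blast
qed

lemma card_G: "\<exists>a b. card G = 2 ^ a * 3 ^ b"
proof (rule two_three_number)
 show "card G > 0" using finG G_one card_gt_0_iff by blast
 fix p assume p: "prime p" "p dvd card G"
 then obtain x where "x \<in> G" "x \<noteq> id\<^sub>V" "\<And>v. v \<in> V \<Longrightarrow> (x ^^ p) v = v" using cauchy_G by blast
 then show "p = 2 \<or> p = 3" using prime_le_three p(1) by blast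
qed

lemma prime_power:
 assumes x: "x \<in> G" "x \<noteq> id\<^sub>V"
 obtains n p :: nat where "prime p" "x \<Up> n \<noteq> id\<^sub>V" "\<And>v. v \<in> V \<Longrightarrow> ((x \<Up> n) ^^ p) v = v"
proof -
 obtain n p :: nat where np: "prime p" "x \<Up> n \<noteq> id\<^sub>V" "(x \<Up> n) \<Up> p = id\<^sub>V"
  using SV.nontrivial_power_of_prime_order[OF finC GC[OF x(1)] x(2)] by blast
 then show ?thesis using that pow_one_iff[OF G_pow[OF x(1)]] by blast
qed

text \<open>A power of prime order fixes a vertex and commutes with a transitive group.\<close>

lemma central_trivial:
 assumes z: "z \<in> G" and c: "\<And>g. g \<in> G \<Longrightarrow> g \<star> z = z \<star> g"
 shows "z = id\<^sub>V"
proof (rule ccontr)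
 assume "z \<noteq> id\<^sub>V"
 then obtain n p :: nat where np: "prime p" "z \<Up> n \<noteq> id\<^sub>V"
  "\<And>v. v \<in> V \<Longrightarrow> ((z \<Up> n) ^^ p) v = v" using prime_power[OF z] by metis
 obtain v where v: "v \<in> V" "(z \<Up> n) v = v" using prime_fix[OF G_pow[OF z] np(1,3)] by blast
 have cz: "g (z u) = z (g u)" if "g \<in> G" "u \<in> V" for g u
  using c[OF that(1)] mult_app[OF that(1) z that(2)] mult_app[OF z that] by simp
 have cn: "g ((z ^^ n) u) = (z ^^ n) (g u)" if "g \<in> G" "u \<in> V" for g u
  by (induction n) (simp_all add: cz that funpow_V[OF z])
 have "(z \<Up> n) u = u" if u: "u \<in> V" for u
 proof -
  obtain g where g: "g \<in> G" "g v = u" using transitivity[OF v(1) u] by blast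
  have "(z ^^ n) u = g ((z ^^ n) v)" using cn[OF g(1) v(1)] g(2) by simp
  then show ?thesis using v g(2) pow_app[OF z] u by simp
 qed
 then show False using np(2) G_eq_oneI[OF G_pow[OF z]] by blast
qed

text \<open>The normal subgroups of \<open>G\<close>, expressed in the symmetric group.\<close>

definition invariant :: "('a \<Rightarrow> 'a) set \<Rightarrow> bool" where
 "invariant M \<longleftrightarrow> subgroup M SV \<and> M \<subseteq> G \<and> (\<forall>g\<in>G. \<forall>m\<in>M. g \<star> m \<star> iv g \<in> M)"

lemma invariantD:
 assumes "invariant M"
 shows "subgroup M SV" "m \<in> M \<Longrightarrow> m \<in> G" "g \<in> G \<Longrightarrow> m \<in> M \<Longrightarrow> g \<star> m \<star> iv g \<in> M"
  "id\<^sub>V \<in> M" "m \<in> M \<Longrightarrow> m' \<in> M \<Longrightarrow> m \<star> m' \<in> M" "m \<in> M \<Longrightarrow> iv m \<in> M" "m \<in> M \<Longrightarrow> m \<Up> (n::nat) \<in> M"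
proof -
 show s: "subgroup M SV" using assms by (simp add: invariant_def)
 show "id\<^sub>V \<in> M" "m \<in> M \<Longrightarrow> m' \<in> M \<Longrightarrow> m \<star> m' \<in> M" "m \<in> M \<Longrightarrow> iv m \<in> M" for m'
  using subgroup.one_closed[OF s] subgroup.m_closed[OF s] subgroup.m_inv_closed[OF s] by auto
 show "m \<in> M \<Longrightarrow> m \<Up> (n::nat) \<in> M"
  by (induction n) (simp_all add: subgroup.one_closed[OF s] subgroup.m_closed[OF s])
qed (use assms in \<open>auto simp: invariant_def\<close>)

text \<open>A nontrivial normal subgroup contains an element fixing some vertex but not all its
 out-neighbours; by transitivity this happens at every vertex.\<close>

lemma normal_moves:
 assumes M: "invariant M" "M \<noteq> {id\<^sub>V}" and v: "v \<in> V"
 shows "\<exists>m\<in>M. m v = v \<and> (\<exists>w. (v, w) \<in> E \<and> m w \<noteq> w)"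
proof -
 note D = invariantD[OF M(1)]
 obtain x where x: "x \<in> M" "x \<noteq> id\<^sub>V" using M(2) D(4) by blast
 obtain n p :: nat where np: "prime p" "x \<Up> n \<noteq> id\<^sub>V"
  "\<And>v. v \<in> V \<Longrightarrow> ((x \<Up> n) ^^ p) v = v" using prime_power[OF D(2)[OF x(1)] x(2)] by metis
 define y where "y = x \<Up> n"
 have y: "y \<in> M" "y \<in> G" "y \<noteq> id\<^sub>V" using D(7)[OF x(1)] D(2) np(2) by (auto simp: y_def)
 obtain u0 where "u0 \<in> V" "y u0 = u0" using prime_fix[OF y(2) np(1)] np(3) by (auto simp: y_def)
 then obtain u w where u: "u \<in> V" "y u = u" "(u, w) \<in> E" "y w \<noteq> w" using moves_out_neighbour[OF y(2,3)] by blast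
 have wV: "w \<in> V" using E_V u by blast
 obtain g where g: "g \<in> G" "g u = v" using transitivity[OF u(1) v] by blast
 let ?m = "g \<star> y \<star> iv g"
 have "?m v = v" using conj_app[OF g(1) y(2) u(1)] g(2) u(2) by simp
 moreover have "?m (g w) \<noteq> g w" using conj_app[OF g(1) y(2) wV] u(4) G_inj[OF g(1) GV[OF y(2) wV] wV] by simp
 moreover have "(v, g w) \<in> E" using autD[OF g(1) u(3)] g(2) by simp
 ultimately show ?thesis using D(3)[OF g(1) y(1)] by blast
qed

lemma normal_invariant: "N \<lhd> GG \<Longrightarrow> invariant N"
proof -
 assume N: "N \<lhd> GG"
 note sub = normal_imp_subgroup[OF N]
 have "g \<star> m \<star> iv g \<in> N" if "g \<in> G" "m \<in> N" for g m
  using normal.inv_op_closed2[OF N, of g m] that SV.m_inv_consistent[OF G that(1)] by simp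
 then show ?thesis using SV.incl_subgroup[OF G sub] subgroup.subset[OF sub] by (simp add: invariant_def)
qed

text \<open>The elements of order dividing \<open>p\<close> of an abelian normal subgroup form a characteristic subgroup.\<close>

lemma elementary_abelian_normal:
 obtains p :: nat and A where "p = 2 \<or> p = 3" "invariant A" "A \<noteq> {id\<^sub>V}"
  "\<And>x y. x \<in> A \<Longrightarrow> y \<in> A \<Longrightarrow> x \<star> y = y \<star> x" "\<And>x v. x \<in> A \<Longrightarrow> v \<in> V \<Longrightarrow> (x ^^ p) v = v"
proof -
 obtain a b where ab: "card G = 2 ^ a * 3 ^ b" using card_G by blast
 have nt: "carrier GG \<noteq> {\<one>\<^bsub>GG\<^esub>}"
 proof
  assume "carrier GG = {\<one>\<^bsub>GG\<^esub>}"
  then have "G = {id\<^sub>V}" by simp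
  then have "u = v" if "u \<in> V" "v \<in> V" for u v using transitivity[OF that] BijGroup_one_apply[OF that(1)] by auto
  then show False using two finV by (metis card_le_Suc0_iff_eq not_less_eq_eq numeral_2_eq_2)
 qed
 have ord: "order GG = 2 ^ a * 3 ^ b" using ab by (simp add: Coset.order_def)
 obtain A0 where A0: "A0 \<lhd> GG" "A0 \<noteq> {\<one>\<^bsub>GG\<^esub>}" "\<And>x y. x \<in> A0 \<Longrightarrow> y \<in> A0 \<Longrightarrow> x \<otimes>\<^bsub>GG\<^esub> y = y \<otimes>\<^bsub>GG\<^esub> x"
  using GG.two_p_group_abelian_normal_subgroup[OF _ _ ord nt] by auto
 have comm: "x \<star> y = y \<star> x" if "x \<in> A0" "y \<in> A0" for x y using A0(3)[OF that] by simp
 have inv: "invariant A0" by (rule normal_invariant[OF A0(1)])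
 note D = invariantD[OF inv]
 obtain x where x: "x \<in> A0" "x \<noteq> id\<^sub>V" using A0(2) D(4) by auto
 obtain n p :: nat where np: "prime p" "x \<Up> n \<noteq> id\<^sub>V"
  "\<And>v. v \<in> V \<Longrightarrow> ((x \<Up> n) ^^ p) v = v" using prime_power[OF D(2)[OF x(1)] x(2)] by metis
 have p23: "p = 2 \<or> p = 3" by (rule prime_le_three[OF G_pow[OF D(2)[OF x(1)]] np(2,1,3)])
 define A where "A = {y \<in> A0. y \<Up> p = id\<^sub>V}"
 have AG: "y \<in> G" "y \<in> A0" "y \<Up> p = id\<^sub>V" if "y \<in> A" for y using that D(2) by (auto simp: A_def)
 have invA: "invariant A"
  unfolding invariant_def
 proof (intro conjI ballI)
  show "A \<subseteq> G" using AG by blast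
  show "subgroup A SV"
  proof (rule SV.subgroupI)
   show "A \<subseteq> carrier SV" using AG GC by blast
   show "A \<noteq> {}" using D(4) by (auto simp: A_def)
   show "iv y \<in> A" if "y \<in> A" for y using AG[OF that] D(6) GC by (simp add: A_def SV.nat_pow_inv)
   show "y \<star> z \<in> A" if y: "y \<in> A" "z \<in> A" for y z
    using AG[OF y(1)] AG[OF y(2)] D(5) GC comm by (simp add: A_def SV.pow_mult_distrib)
  qed
  fix g m assume g: "g \<in> G" "m \<in> A"
  let ?c = "g \<star> m \<star> iv g"
  have cA: "?c \<in> A0" using D(3) g AG by blast
  interpret c: group_hom SV SV "\<lambda>x. g \<star> x \<star> iv g" by (rule SV.conj_group_hom[OF GC[OF g(1)]])
  have "?c \<Up> p = id\<^sub>V" using c.hom_nat_pow[OF GC[OF AG(1)[OF g(2)]], of p] AG(3)[OF g(2)] GC[OF g(1)] by simp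
  then show "?c \<in> A" using cA by (simp add: A_def)
 qed
 have "x \<Up> n \<in> A" using D(7)[OF x(1)] np(3) pow_one_iff[OF D(2)[OF D(7)[OF x(1)]]] by (auto simp: A_def)
 then have "A \<noteq> {id\<^sub>V}" using np(2) by blast
 moreover have "(y ^^ p) v = v" if "y \<in> A" "v \<in> V" for y v using AG[OF that(1)] pow_one_iff that(2) by blast
 ultimately show ?thesis using that[OF p23 invA] comm AG(2) by blast
qed

text \<open>Suppose that \<open>x\<close> has order three. It rotates the three out-neighbours of some vertex, on which some element of \<open>A\<close>
 acts as a transposition. The conjugate of the transposition by \<open>x\<close> is a different transposition, and
 the two do not commute. So \<open>G\<close> is a 2-group, and its centre contradicts \<open>central_trivial\<close>.\<close>

lemma no_elementary_two:
 assumes A: "invariant A" "A \<noteq> {id\<^sub>V}" and comm: "\<And>x y. x \<in> A \<Longrightarrow> y \<in> A \<Longrightarrow> x \<star> y = y \<star> x"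
  and sq: "\<And>x v. x \<in> A \<Longrightarrow> v \<in> V \<Longrightarrow> (x ^^ 2) v = v"
 shows False
proof -
 note D = invariantD[OF A(1)]
 have no3: False if x: "x \<in> G" "x \<noteq> id\<^sub>V" and x3: "\<And>v. v \<in> V \<Longrightarrow> (x ^^ 3) v = v" for x
 proof -
  obtain v0 where v0: "v0 \<in> V" "x v0 = v0" using prime_fix[OF x(1), of 3] x3 by auto
  obtain v w where v: "v \<in> V" "x v = v" "(v, w) \<in> E" "x w \<noteq> w" using moves_out_neighbour[OF x v0] by blast
  have wV: "w \<in> V" using E_V v by blast
  \<comment> \<open>The out-neighbours of \<open>v\<close> are \<open>w\<close>, \<open>x w\<close> and \<open>x (x w)\<close>.\<close>
  have cyc: "x (x (x w)) = w" using x3[OF wV] by (simp add: numeral_3_eq_3)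
  have sub: "{w, x w, x (x w)} \<subseteq> E `` {v}"
   using orbit_in_neighbours[OF x(1) v(2,3), of 1] orbit_in_neighbours[OF x(1) v(2,3), of 2] v(3)
   by (auto simp: numeral_2_eq_2)
  have xV: "x w \<in> V" "x (x w) \<in> V" using GV[OF x(1)] wV by auto
  have dist: "w \<noteq> x w" "w \<noteq> x (x w)" "x w \<noteq> x (x w)"
   using v(4) cyc G_inj[OF x(1) wV xV(1)] by auto
  have cN: "card (E `` {v}) \<le> 3" using outdeg[OF v(1)] d3 by simp
  have N: "E `` {v} = {w, x w, x (x w)}" using card_seteq[OF finN sub] cN dist by simp
  then have N3: "card (E `` {v}) = 3" using dist by simp
  have NV: "u \<in> V" if "u \<in> E `` {v}" for u using that E_V by blast
  have xN: "x u \<in> E `` {v}" "x u \<noteq> u" if "u \<in> E `` {v}" for u using that cyc dist unfolding N by auto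
  have xsurj: "\<exists>u\<in>E `` {v}. x u = y" if "y \<in> E `` {v}" for y using that cyc unfolding N by auto
  obtain m u1 where m: "m \<in> A" "m v = v" "(v, u1) \<in> E" "m u1 \<noteq> u1" using normal_moves[OF A v(1)] by blast
  have mG: "m \<in> G" using D(2) m by blast
  have mN: "m u \<in> E `` {v}" if "u \<in> E `` {v}" for u using orbit_in_neighbours[OF mG m(2), of u 1] that by auto
  have mm: "m (m u) = u" if "u \<in> V" for u using sq[OF m(1) that] by (simp add: numeral_2_eq_2)
  have u1: "u1 \<in> E `` {v}" "m u1 \<in> E `` {v}" "u1 \<in> V" using m mN NV by auto
  have "card (E `` {v} - {u1, m u1}) = 1" using N3 u1 m(4) finN by (subst card_Diff_subset) auto
  then obtain u0 where u0: "E `` {v} - {u1, m u1} = {u0}" by (auto simp: card_1_singleton_iff)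
  have u0N: "u0 \<in> E `` {v}" "u0 \<noteq> u1" "u0 \<noteq> m u1" using u0 by auto
  have N': "u = u0 \<or> u = u1 \<or> u = m u1" if "u \<in> E `` {v}" for u using u0 that by auto
  have "m u0 \<noteq> u1" using mm[OF NV[OF u0N(1)]] u0N(3) by auto
  moreover have "m u0 \<noteq> m u1" using G_inj[OF mG NV[OF u0N(1)] u1(3)] u0N(2) by simp
  ultimately have m0: "m u0 = u0" using N'[OF mN[OF u0N(1)]] by blast
  have m_only: "u = u0" if "u \<in> E `` {v}" "m u = u" for u using N'[OF that(1)] that(2) m(4) mm[OF u1(3)] by auto
  \<comment> \<open>The transposition \<open>m\<close> fixes only \<open>u0\<close>, and its conjugate \<open>m'\<close> fixes only \<open>x u0\<close>.\<close>
  define m' where "m' = x \<star> m \<star> iv x"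
  have m'A: "m' \<in> A" unfolding m'_def by (rule D(3)[OF x(1) m(1)])
  have m'G: "m' \<in> G" using D(2) m'A by blast
  have m'x: "m' (x u) = x (m u)" if "u \<in> V" for u unfolding m'_def by (rule conj_app[OF x(1) mG that])
  define y where "y = x u0"
  have y: "y \<in> E `` {v}" "y \<noteq> u0" "m' y = y" "y \<in> V" using xN[OF u0N(1)] m'x[OF NV[OF u0N(1)]] m0 NV by (auto simp: y_def)
  have "m' (m y) = m (m' y)" using comm[OF m'A m(1)] mult_app[OF m'G mG y(4)] mult_app[OF mG m'G y(4)] by simp
  then have my: "m' (m y) = m y" using y(3) by simp
  obtain u where u: "u \<in> E `` {v}" "x u = m y" using xsurj[OF mN[OF y(1)]] by blast
  have "x (m u) = x u" using m'x[OF NV[OF u(1)]] my u(2) by simp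
  then have "m u = u" using G_inj[OF x(1) GV[OF mG NV[OF u(1)]] NV[OF u(1)]] by simp
  then have "u = u0" by (rule m_only[OF u(1)])
  then have "m y = y" using u(2) by (simp add: y_def)
  then show False using m_only[OF y(1)] y(2) by blast
 qed
 obtain a b where ab: "card G = 2 ^ a * 3 ^ b" using card_G by blast
 have "b = 0"
 proof (rule ccontr)
  assume "b \<noteq> 0"
  then have "3 dvd card G" using ab by (simp add: dvd_power)
  then obtain x where "x \<in> G" "x \<noteq> id\<^sub>V" "\<And>v. v \<in> V \<Longrightarrow> (x ^^ 3) v = v" using cauchy_G[of 3] by auto
  then show False using no3 by blast
 qed
 then have ord: "order GG = 2 ^ a" using ab by (simp add: Coset.order_def)
 obtain x where "x \<in> A" "x \<noteq> id\<^sub>V" using A(2) D(4) by blast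
 then have "carrier GG \<noteq> {\<one>\<^bsub>GG\<^esub>}" using D(2) by auto
 then obtain z where "z \<in> carrier GG" "z \<noteq> \<one>\<^bsub>GG\<^esub>" "\<And>g. g \<in> carrier GG \<Longrightarrow> g \<otimes>\<^bsub>GG\<^esub> z = z \<otimes>\<^bsub>GG\<^esub> g"
  using GG.p_group_center_nontrivial[OF two_is_prime_nat ord] by blast
 then show False using central_trivial[of z] by simp
qed

theorem elementary_abelian_three:
 obtains A where "invariant A" "A \<noteq> {id\<^sub>V}" "\<And>x y. x \<in> A \<Longrightarrow> y \<in> A \<Longrightarrow> x \<star> y = y \<star> x"
  "\<And>x v. x \<in> A \<Longrightarrow> v \<in> V \<Longrightarrow> (x ^^ 3) v = v"
proof -
 show ?thesis
 proof (rule elementary_abelian_normal)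
  fix p :: nat and A
  assume A: "invariant A" "A \<noteq> {id\<^sub>V}" "\<And>x y. x \<in> A \<Longrightarrow> y \<in> A \<Longrightarrow> x \<star> y = y \<star> x"
   and p: "p = 2 \<or> p = 3" and Ap: "\<And>x v. x \<in> A \<Longrightarrow> v \<in> V \<Longrightarrow> (x ^^ p) v = v"
  have "p \<noteq> 2" using no_elementary_two[OF A] Ap by blast
  then show thesis using that[OF A] p Ap by blast
 qed
qed

end

section \<open>The elementary abelian normal 3-subgroup\<close>

text \<open>A map on a finite set that moves everything along one cycle is a shift modulo the cycle length.\<close>

lemma cyclic_labelling:
 fixes s :: "'x \<Rightarrow> 'x"
 assumes zQ: "z \<in> Q" and cl: "\<And>x. x \<in> Q \<Longrightarrow> s x \<in> Q" and all: "\<And>x. x \<in> Q \<Longrightarrow> \<exists>n. (s ^^ n) z = x"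
  and bk: "n > 0" "(s ^^ n) z = z"
 obtains r :: nat and lab :: "'x \<Rightarrow> int" where "r > 0" "\<And>x. x \<in> Q \<Longrightarrow> 0 \<le> lab x \<and> lab x < int r" "inj_on lab Q"
  "lab ` Q = {0..<int r}" "\<And>x. x \<in> Q \<Longrightarrow> lab (s x) = (lab x + 1) mod int r"
proof -
 have oo: "z \<in> orbit s z" using bk by (auto simp: orbit_altdef intro!: exI[of _ n])
 define r where "r = funpow_dist1 s z z"
 let ?h = "\<lambda>n. (s ^^ n) z"
 have hr: "?h r = z" unfolding r_def by (rule funpow_dist1_prop[OF oo])
 have r0: "r > 0" by (simp add: r_def)
 have hQ: "?h n \<in> Q" for n by (induction n) (simp_all add: zQ cl)
 have inj: "inj_on ?h {0..<r}" unfolding r_def by (rule inj_on_funpow_dist1[OF oo])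
 have surj: "\<exists>n<r. ?h n = x" if x: "x \<in> Q" for x
 proof -
  obtain n where "?h n = x" using all[OF x] by blast
  then have "?h (n mod r) = x" using funpow_mod_eq[OF hr, of n] by simp
  then show ?thesis using r0 by (intro exI[of _ "n mod r"]) simp
 qed
 define lab where "lab x = int (THE n. n < r \<and> ?h n = x)" for x
 have lab_h: "lab (?h n) = int n" if "n < r" for n
  unfolding lab_def by (rule arg_cong[where f = int], rule the_equality) (use that inj in \<open>auto dest: inj_onD\<close>)
 have labQ: "0 \<le> lab x \<and> lab x < int r" if "x \<in> Q" for x using surj[OF that] lab_h by auto
 have step: "lab (s x) = (lab x + 1) mod int r" if x: "x \<in> Q" for x
 proof -
  obtain n where n: "n < r" "?h n = x" using surj[OF x] by blast
  show ?thesis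
  proof (cases "Suc n = r")
   case True
   then have "s x = ?h 0" using n hr by auto
   then have "lab (s x) = 0" using lab_h[of 0] r0 by simp
   moreover have "int n + 1 = int r" using True by linarith
   ultimately show ?thesis using lab_h[OF n(1)] n(2) by simp
  next
   case False
   then have "lab (s x) = int (Suc n)" using lab_h[of "Suc n"] n by simp
   then show ?thesis using lab_h[OF n(1)] n False by auto
  qed
 qed
 have i: "inj_on lab Q"
 proof (rule inj_onI)
  fix x y assume xy: "x \<in> Q" "y \<in> Q" "lab x = lab y"
  obtain n m where "n < r" "?h n = x" "m < r" "?h m = y" using surj[OF xy(1)] surj[OF xy(2)] by blast
  then show "x = y" using lab_h[of n] lab_h[of m] xy(3) by auto
 qed
 have im: "lab ` Q = {0..<int r}"
 proof
  show "{0..<int r} \<subseteq> lab ` Q"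
  proof
   fix y assume "y \<in> {0..<int r}"
   then have "nat y < r" "y = int (nat y)" by auto
   then show "y \<in> lab ` Q" using lab_h[of "nat y"] hQ by (metis imageI)
  qed
 qed (use labQ in auto)
 show ?thesis by (rule that[OF r0 labQ i im step])
qed

locale elusive_digraph_three = elusive_digraph +
 fixes A :: "('a \<Rightarrow> 'a) set"
 assumes A: "invariant A" and A_nontrivial: "A \<noteq> {id\<^sub>V}"
  and A_comm: "\<And>x y. x \<in> A \<Longrightarrow> y \<in> A \<Longrightarrow> x \<star> y = y \<star> x"
  and A_cube: "\<And>x v. x \<in> A \<Longrightarrow> v \<in> V \<Longrightarrow> (x ^^ 3) v = v"
begin

lemmas AD = invariantD[OF A]

lemma AG: "x \<in> A \<Longrightarrow> x \<in> G" by (rule AD(2))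

lemma A_cube': "x \<in> A \<Longrightarrow> v \<in> V \<Longrightarrow> x (x (x v)) = v"
 using A_cube by (simp add: numeral_3_eq_3)

lemma A_comm_app: "x \<in> A \<Longrightarrow> y \<in> A \<Longrightarrow> v \<in> V \<Longrightarrow> x (y v) = y (x v)"
 using A_comm[of x y] mult_app[OF AG AG] by metis

text \<open>A cycle of length three on the out-neighbours leaves no room for others.\<close>

lemma three_cycle:
 assumes k: "k \<in> A" "k v = v" and w: "(v, w) \<in> E" "k w \<noteq> w"
 shows "E `` {v} = {w, k w, k (k w)}" "k w \<noteq> k (k w)" "w \<noteq> k (k w)" "card (E `` {v}) = 3"
proof -
 note kG = AG[OF k(1)]
 have V: "v \<in> V" "w \<in> V" using E_V w by auto
 have kV: "k w \<in> V" "k (k w) \<in> V" using GV[OF kG] V by auto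
 have sub: "{w, k w, k (k w)} \<subseteq> E `` {v}"
  using orbit_in_neighbours[OF kG k(2) w(1), of 1] orbit_in_neighbours[OF kG k(2) w(1), of 2] w(1) by (auto simp: numeral_2_eq_2)
 show dist: "k w \<noteq> k (k w)" "w \<noteq> k (k w)" using w(2) A_cube'[OF k(1) V(2)] G_inj[OF kG] V kV by auto
 have c: "card (E `` {v}) \<le> 3" using outdeg[OF V(1)] d3 by simp
 show N: "E `` {v} = {w, k w, k (k w)}" using card_seteq[OF finN sub] c dist w(2) by simp
 show "card (E `` {v}) = 3" unfolding N using dist w(2) by simp
qed

lemma stab_mover:
 assumes v: "v \<in> V"
 shows "\<exists>k\<in>A. k v = v \<and> (\<forall>w. (v, w) \<in> E \<longrightarrow> k w \<noteq> w)"
proof -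
 obtain k w where k: "k \<in> A" "k v = v" "(v, w) \<in> E" "k w \<noteq> w" using normal_moves[OF A A_nontrivial v] by blast
 note N = three_cycle[OF k]
 have wV: "w \<in> V" using E_V k(3) by blast
 have "k w' \<noteq> w'" if w': "(v, w') \<in> E" for w'
 proof -
  consider "w' = w" | "w' = k w" | "w' = k (k w)" using w' N(1) by blast
  then show ?thesis using N(2,3) k(4) A_cube'[OF k(1) wV] by cases simp_all
 qed
 then show ?thesis using k by blast
qed

lemma card_N: "v \<in> V \<Longrightarrow> card (E `` {v}) = 3"
proof -
 assume v: "v \<in> V"
 obtain k w where "k \<in> A" "k v = v" "(v, w) \<in> E" "k w \<noteq> w" using normal_moves[OF A A_nontrivial v] by blast
 then show ?thesis by (rule three_cycle(4))
qed

lemma stab_transitive: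
 assumes w: "(v, w) \<in> E" "(v, w') \<in> E"
 obtains k where "k \<in> A" "k v = v" "k w = w'"
proof -
 have v: "v \<in> V" using E_V w by blast
 obtain k where k: "k \<in> A" "k v = v" "\<And>w. (v, w) \<in> E \<Longrightarrow> k w \<noteq> w" using stab_mover[OF v] by blast
 have "w' \<in> {w, k w, k (k w)}" using three_cycle(1)[OF k(1,2) w(1) k(3)[OF w(1)]] w(2) by blast
 then consider "w' = w" | "w' = k w" | "w' = k (k w)" by blast
 then show ?thesis
 proof cases
  case 1
  then show ?thesis using that[OF AD(4)] v E_V w by (simp add: BijGroup_one_apply)
 next
  case 2
  then show ?thesis using that[OF k(1,2)] by simp
 next
  case 3
  then show ?thesis using that[OF AD(5)[OF k(1) k(1)]] mult_app[OF AG[OF k(1)] AG[OF k(1)]] k(2) v E_V w by simp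
 qed
qed

definition rc :: "'a \<Rightarrow> nat \<Rightarrow> 'a set" where
 "rc v j = {w. \<exists>i\<le>j. (v, w) \<in> E ^^ i}"

definition gens :: "'a \<Rightarrow> nat \<Rightarrow> ('a \<Rightarrow> 'a) set" where
 "gens v j = {m \<in> A. \<exists>w\<in>rc v j. m w = w}"

text \<open>The groups grow from the stabiliser of \<open>v\<close> in \<open>A\<close>, for \<open>j = 0\<close>, to \<open>M\<close>, for large \<open>j\<close>.\<close>

definition T :: "'a \<Rightarrow> nat \<Rightarrow> ('a \<Rightarrow> 'a) set" where
 "T v j = generate SV (gens v j)"

definition M :: "('a \<Rightarrow> 'a) set" where
 "M = generate SV {m \<in> A. \<exists>w\<in>V. m w = w}"

lemma relpow_V: "(v, w) \<in> E ^^ i \<Longrightarrow> v \<in> V \<Longrightarrow> w \<in> V"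
 by (induction i arbitrary: w) (auto dest: E_V)

lemma rc_V: "v \<in> V \<Longrightarrow> rc v j \<subseteq> V" using relpow_V by (auto simp: rc_def)

lemma gens_A: "gens v j \<subseteq> A" by (auto simp: gens_def)

lemma generate_A: "X \<subseteq> A \<Longrightarrow> generate SV X \<subseteq> A"
 by (rule SV.generate_subgroup_incl[OF _ AD(1)])

lemma A_carrier: "A \<subseteq> carrier SV" using AG GC by blast

lemma T_A: "T v j \<subseteq> A" unfolding T_def by (rule generate_A[OF gens_A])

lemma M_A: "M \<subseteq> A" unfolding M_def by (rule generate_A) auto

lemma T_subgroup: "subgroup (T v j) SV"
 unfolding T_def by (rule SV.generate_is_subgroup) (use gens_A A_carrier in blast)

lemma M_subgroup: "subgroup M SV"
 unfolding M_def by (rule SV.generate_is_subgroup) (use A_carrier in blast)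

lemma T_M: "v \<in> V \<Longrightarrow> T v j \<subseteq> M"
 unfolding T_def M_def by (rule SV.mono_generate) (use rc_V in \<open>auto simp: gens_def\<close>)

lemma gens_T: "gens v j \<subseteq> T v j" unfolding T_def by (auto intro: generate.incl)

lemma stab_M: "m \<in> A \<Longrightarrow> w \<in> V \<Longrightarrow> m w = w \<Longrightarrow> m \<in> M"
 unfolding M_def by (rule generate.incl) auto

lemma rc_self: "v \<in> rc v j" by (auto simp: rc_def intro: exI[of _ 0])

lemma stab_T: "m \<in> A \<Longrightarrow> m v = v \<Longrightarrow> m \<in> T v j"
 using gens_T[of v j] rc_self[of v j] unfolding gens_def by blast

lemma relpow_aut: "(v, w) \<in> E ^^ i \<Longrightarrow> g \<in> G \<Longrightarrow> (g v, g w) \<in> E ^^ i"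
 by (induction i arbitrary: w) (auto intro: autD)

lemma conj_generate:
 assumes g: "g \<in> G" and X: "X \<subseteq> G" and Y: "subgroup Y SV" "\<And>x. x \<in> X \<Longrightarrow> g \<star> x \<star> iv g \<in> Y"
  and m: "m \<in> generate SV X"
 shows "g \<star> m \<star> iv g \<in> Y"
proof -
 interpret c: group_hom SV SV "\<lambda>x. g \<star> x \<star> iv g" by (rule SV.conj_group_hom[OF GC[OF g]])
 have "X \<subseteq> carrier SV" using X GC by blast
 then have "g \<star> m \<star> iv g \<in> generate SV ((\<lambda>x. g \<star> x \<star> iv g) ` X)" using c.generate_img m by blast
 also have "\<dots> \<subseteq> Y" by (rule SV.generate_subgroup_incl[OF _ Y(1)]) (use Y(2) in blast)
 finally show ?thesis .
qed

lemma T_conj: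
 assumes g: "g \<in> G" and v: "v \<in> V" and m: "m \<in> T v j"
 shows "g \<star> m \<star> iv g \<in> T (g v) j"
proof (rule conj_generate[OF g _ T_subgroup _ m[unfolded T_def]])
 show "gens v j \<subseteq> G" using gens_A AG by blast
 fix x assume x: "x \<in> gens v j"
 then obtain w where w: "x \<in> A" "w \<in> rc v j" "x w = w" by (auto simp: gens_def)
 have wV: "w \<in> V" using rc_V[OF v] w(2) by blast
 have "(g \<star> x \<star> iv g) (g w) = g w" using conj_app[OF g AG[OF w(1)] wV] w(3) by simp
 moreover have "g w \<in> rc (g v) j" using w(2) relpow_aut g by (auto simp: rc_def)
 ultimately have "g \<star> x \<star> iv g \<in> gens (g v) j" using AD(3)[OF g w(1)] by (auto simp: gens_def)
 then show "g \<star> x \<star> iv g \<in> T (g v) j" using gens_T by blast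
qed

lemma M_invariant: "invariant M"
 unfolding invariant_def
proof (intro conjI ballI)
 show "subgroup M SV" by (rule M_subgroup)
 show "M \<subseteq> G" using M_A AG by blast
 fix g m assume g: "g \<in> G" and m: "m \<in> M"
 show "g \<star> m \<star> iv g \<in> M"
 proof (rule conj_generate[OF g _ M_subgroup _ m[unfolded M_def]])
  show "{m \<in> A. \<exists>w\<in>V. m w = w} \<subseteq> G" using AG by blast
  fix x assume "x \<in> {m \<in> A. \<exists>w\<in>V. m w = w}"
  then obtain w where w: "x \<in> A" "w \<in> V" "x w = w" by auto
  have "(g \<star> x \<star> iv g) (g w) = g w" using conj_app[OF g AG[OF w(1)] w(2)] w(3) by simp
  then show "g \<star> x \<star> iv g \<in> M" using stab_M[OF AD(3)[OF g w(1)] GV[OF g w(2)]] by blast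
 qed
qed

lemmas MD = invariantD[OF M_invariant]

lemma M_nontrivial: "M \<noteq> {id\<^sub>V}"
proof
 assume M1: "M = {id\<^sub>V}"
 obtain v where v: "v \<in> V" using V_nonempty by blast
 obtain m w where m: "m \<in> A" "m v = v" "(v, w) \<in> E" "m w \<noteq> w" using normal_moves[OF A A_nontrivial v] by blast
 then have "m = id\<^sub>V" using stab_M[OF m(1) v m(2)] M1 by simp
 then show False using m(4) E_V(2)[OF m(3)] by (simp add: BijGroup_one_apply)
qed

lemma conj_comm: "a \<in> A \<Longrightarrow> m \<in> A \<Longrightarrow> a \<star> m \<star> iv a = m"
 using A_comm[of a m] A_carrier by (auto simp: SV.m_assoc subsetD)

text \<open>\<open>A\<close> is abelian, so conjugation by its elements changes nothing.\<close>

lemma T_shift: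
 assumes a: "a \<in> A" and v: "v \<in> V"
 shows "T (a v) j = T v j"
proof
 have le: "T v j \<subseteq> T (a v) j" if a: "a \<in> A" and v: "v \<in> V" for a v
 proof
  fix m assume m: "m \<in> T v j"
  then have "m \<in> A" using T_A by blast
  then show "m \<in> T (a v) j" using T_conj[OF AG[OF a] v m] conj_comm[OF a] by simp
 qed
 show "T v j \<subseteq> T (a v) j" by (rule le[OF a v])
 have "T (a v) j \<subseteq> T ((iv a) (a v)) j" by (rule le[OF AD(6)[OF a] GV[OF AG[OF a] v]])
 then show "T (a v) j \<subseteq> T v j" using inv_app(1)[OF AG[OF a] v] by simp
qed

lemma T_top: "v \<in> V \<Longrightarrow> \<exists>n. T v n = M"
proof -
 assume v: "v \<in> V"
 have "\<forall>w\<in>V. \<exists>i. (v, w) \<in> E ^^ i" using reach[OF v] by (simp add: rtrancl_power)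
 then obtain f where f: "\<And>w. w \<in> V \<Longrightarrow> (v, w) \<in> E ^^ f w" by metis
 have "V \<subseteq> rc v (Max (f ` V))"
 proof
  fix w assume w: "w \<in> V"
  then have "f w \<le> Max (f ` V)" using finV by simp
  then show "w \<in> rc v (Max (f ` V))" using f[OF w] by (auto simp: rc_def)
 qed
 then have "M \<subseteq> T v (Max (f ` V))" unfolding M_def T_def by (intro SV.mono_generate) (auto simp: gens_def)
 then show ?thesis using T_M[OF v] by blast
qed

lemma T_eq_M:
 assumes "u \<in> V" "v \<in> V" "T u n = M"
 shows "T v n = M"
proof
 show "T v n \<subseteq> M" by (rule T_M[OF assms(2)])
 obtain g where g: "g \<in> G" "g u = v" using transitivity assms by blast
 show "M \<subseteq> T v n"
 proof
  fix m assume m: "m \<in> M"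
  have gc: "g \<in> carrier SV" "m \<in> carrier SV" using GC[OF g(1)] GC[OF MD(2)[OF m]] by auto
  have "iv g \<star> m \<star> iv (iv g) \<in> M" by (rule MD(3)[OF G_inv[OF g(1)] m])
  then have "iv g \<star> m \<star> g \<in> T u n" using gc assms(3) by simp
  from T_conj[OF g(1) assms(1) this] show "m \<in> T v n" using gc g(2) by (simp add: SV.m_assoc SV.inv_solve_left)
 qed
qed

lemma fix_all:
 assumes "v \<in> V" "\<And>m. m \<in> M \<Longrightarrow> m v = v"
 shows False
proof -
 have "m = id\<^sub>V" if m: "m \<in> M" for m
 proof (rule G_eq_oneI[OF MD(2)[OF m]])
  fix u assume u: "u \<in> V"
  obtain g where g: "g \<in> G" "g v = u" using transitivity[OF assms(1) u] by blast
  let ?c = "iv g \<star> m \<star> iv (iv g)"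
  have "?c ((iv g) u) = (iv g) (m u)" by (rule conj_app[OF G_inv[OF g(1)] MD(2)[OF m] u])
  moreover have "(iv g) u = v" using inv_app(1)[OF g(1) assms(1)] g(2) by simp
  moreover have "?c v = v" by (rule assms(2)[OF MD(3)[OF G_inv[OF g(1)] m]])
  ultimately have "(iv g) (m u) = (iv g) u" by simp
  then show "m u = u" using G_inj[OF G_inv[OF g(1)] GV[OF MD(2)[OF m] u] u] by simp
 qed
 then show False using M_nontrivial MD(4) by blast
qed

lemma T_zero_fixes: "v \<in> V \<Longrightarrow> m \<in> T v 0 \<Longrightarrow> m v = v"
proof -
 assume v: "v \<in> V" and m: "m \<in> T v 0"
 have "m \<in> A \<and> m v = v" using m unfolding T_def
 proof (induction rule: generate.induct)
  case one
  then show ?case using AD(4) v by (simp add: BijGroup_one_apply)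
 next
  case (incl h)
  then show ?case by (auto simp: gens_def rc_def)
 next
  case (inv h)
  then have "h \<in> A" "h v = v" by (auto simp: gens_def rc_def)
  then show ?case using AD(6) inv_app(1)[OF AG v, of h] by simp
 next
  case (eng h1 h2)
  then show ?case using AD(5) mult_app[OF AG AG v, of h1 h2] by simp
 qed
 then show ?thesis by simp
qed

text \<open>The largest radius at which the groups \<open>T v j\<close> are proper subgroups of \<open>M\<close>, the same for all \<open>v\<close> by transitivity. The
 subtraction does not truncate, since \<open>T v 0\<close> fixes \<open>v\<close> and \<open>M\<close> fixes no vertex.\<close>

definition jj :: nat where
 "jj = (LEAST n. \<exists>v\<in>V. T v n = M) - 1"

lemma jj:
 assumes v: "v \<in> V"
 shows "T v jj \<noteq> M" "T v (Suc jj) = M"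
proof -
 define J where "J = (LEAST n. \<exists>v\<in>V. T v n = M)"
 have ex: "\<exists>n. \<exists>v\<in>V. T v n = M" using T_top v by blast
 obtain u where u: "u \<in> V" "T u J = M" unfolding J_def using LeastI_ex[OF ex] by blast
 have "J \<noteq> 0"
 proof
  assume "J = 0"
  then show False using fix_all[OF u(1)] T_zero_fixes[OF u(1)] u(2) by auto
 qed
 then have sj: "Suc jj = J" by (simp add: jj_def J_def)
 then show "T v (Suc jj) = M" using T_eq_M[OF u(1) v u(2)] by simp
 have "jj < J" using sj by simp
 then show "T v jj \<noteq> M" using not_less_Least[of jj "\<lambda>n. \<exists>v\<in>V. T v n = M"] v unfolding J_def by blast
qed

text \<open>An element fixing \<open>v\<close> and moving an out-neighbour \<open>w\<close> generates \<open>M\<close> modulo \<open>T w jj\<close>, because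
 the vertices near \<open>v\<close> are \<open>v\<close> itself and those near the out-neighbours, and \<open>T\<close> takes the same value
 at all out-neighbours.\<close>

lemma M_cosets:
 assumes k: "k \<in> A" "k v = v" and w: "(v, w) \<in> E" "k w \<noteq> w"
 shows "x \<in> M \<Longrightarrow> \<exists>(n::nat) t. t \<in> T w jj \<and> x = k \<Up> n \<star> t" and "k \<notin> T w jj"
proof -
 note kG = AG[OF k(1)]
 have V: "v \<in> V" "w \<in> V" using E_V w by auto
 have kc: "k \<in> carrier SV" by (rule GC[OF kG])
 have TC: "t \<in> carrier SV" "t \<in> A" if "t \<in> T w jj" for t using that T_A A_carrier by auto
 note Tsub = T_subgroup[of w jj]
 let ?P = "\<lambda>x. \<exists>(n::nat) t. t \<in> T w jj \<and> x = k \<Up> n \<star> t"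
 have P_T: "?P t" if t: "t \<in> T w jj" for t
  using that TC[OF t] by (intro exI[of _ 0] exI[of _ t]) simp
 have gen: "?P h" if h: "h \<in> gens v (Suc jj)" for h
 proof -
  obtain u i where u: "h \<in> A" "i \<le> Suc jj" "(v, u) \<in> E ^^ i" "h u = u" using h by (auto simp: gens_def rc_def)
  show ?thesis
  proof (cases i)
   case 0
   then have hv: "h v = v" using u by simp
   have "(v, h w) \<in> E" using autD[OF AG[OF u(1)] w(1)] hv by simp
   then have "h w \<in> {w, k w, k (k w)}" using three_cycle(1)[OF k w] by blast
   moreover have "w = (k ^^ 0) w" "k w = (k ^^ 1) w" "k (k w) = (k ^^ 2) w" by (simp_all add: numeral_2_eq_2)
   ultimately obtain n where n: "h w = (k ^^ n) w" by (metis insertE singletonD)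
   define t where "t = iv (k \<Up> n) \<star> h"
   have knA: "k \<Up> n \<in> A" by (rule AD(7)[OF k(1)])
   have tA: "t \<in> A" unfolding t_def by (intro AD(5) AD(6) knA u(1))
   have "t w = (iv (k \<Up> n)) ((k \<Up> n) w)"
    unfolding t_def mult_app[OF AG[OF AD(6)[OF knA]] AG[OF u(1)] V(2)] n pow_app[OF kG V(2)] ..
   also have "\<dots> = w" by (rule inv_app(1)[OF AG[OF knA] V(2)])
   finally have "t \<in> T w jj" by (rule stab_T[OF tA])
   moreover have "h = k \<Up> n \<star> t"
    unfolding t_def using GC[OF AG[OF knA]] GC[OF AG[OF u(1)]] by (simp add: SV.m_assoc[symmetric])
   ultimately show ?thesis by blast
  next
   case (Suc i')
   then obtain w' where w': "(v, w') \<in> E" "(w', u) \<in> E ^^ i'" using u(3) by (metis relpow_Suc_D2)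
   obtain a where a: "a \<in> A" "a v = v" "a w = w'" by (rule stab_transitive[OF w(1) w'(1)])
   have "u \<in> rc w' jj" using w'(2) u(2) Suc by (auto simp: rc_def)
   then have "h \<in> gens w' jj" using u by (auto simp: gens_def)
   then have "h \<in> T w' jj" using gens_T by blast
   then have "h \<in> T w jj" using T_shift[OF a(1) V(2), of jj] a(3) by simp
   then show ?thesis by (rule P_T)
  qed
 qed
 have all: "?P x" if x: "x \<in> M" for x
  using x unfolding jj(2)[OF V(1), symmetric] T_def[of v]
 proof (induction rule: generate.induct)
  case one
  then show ?case by (rule P_T[OF subgroup.one_closed[OF Tsub]])
 next
  case (incl h)
  then show ?case by (rule gen)
 next
  case (inv h)
  then obtain u where u: "h \<in> A" "u \<in> rc v (Suc jj)" "h u = u" by (auto simp: gens_def)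
  have "(iv h) u = u" using inv_app(1)[OF AG[OF u(1)], of u] u(3) rc_V[OF V(1)] u(2) by auto
  then have "iv h \<in> gens v (Suc jj)" using AD(6)[OF u(1)] u(2) by (auto simp: gens_def)
  then show ?case by (rule gen)
 next
  case (eng h1 h2)
  then obtain n1 t1 n2 t2 where h: "t1 \<in> T w jj" "h1 = k \<Up> (n1::nat) \<star> t1" "t2 \<in> T w jj" "h2 = k \<Up> (n2::nat) \<star> t2" by blast
  have c: "t1 \<star> k \<Up> n2 = k \<Up> n2 \<star> t1" by (rule A_comm[OF TC(2)[OF h(1)] AD(7)[OF k(1)]])
  have "h1 \<star> h2 = k \<Up> n1 \<star> (t1 \<star> k \<Up> n2) \<star> t2"
   unfolding h using kc TC[OF h(1)] TC[OF h(3)] by (simp add: SV.m_assoc)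
  also have "\<dots> = k \<Up> (n1 + n2) \<star> (t1 \<star> t2)"
   unfolding c using kc TC[OF h(1)] TC[OF h(3)] by (simp add: SV.m_assoc SV.nat_pow_mult[symmetric])
  finally show ?case using subgroup.m_closed[OF Tsub h(1,3)] by blast
 qed
 then show "x \<in> M \<Longrightarrow> ?P x" .
 show "k \<notin> T w jj"
 proof
  assume kT: "k \<in> T w jj"
  have kn: "k \<Up> (n::nat) \<in> T w jj" for n
   by (induction n) (simp_all add: subgroup.one_closed[OF Tsub] subgroup.m_closed[OF Tsub] kT)
  have "M \<subseteq> T w jj"
  proof
   fix x assume "x \<in> M"
   then obtain n t where "t \<in> T w jj" "x = k \<Up> (n::nat) \<star> t" using all by blast
   then show "x \<in> T w jj" using subgroup.m_closed[OF Tsub kn] by simp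
  qed
  then show False using jj(1)[OF V(2)] T_M[OF V(2)] by blast
 qed
qed

end

section \<open>Cells\<close>

context elusive_digraph_three
begin

text \<open>The cells refine the orbits of \<open>M\<close>. They turn out to be single vertices, but only after the action on the cells has been
 determined.\<close>

definition cell :: "'a \<Rightarrow> 'a set" where "cell v = (\<lambda>t. t v) ` T v jj"

definition orb :: "'a \<Rightarrow> 'a set" where "orb v = (\<lambda>m. m v) ` M"

lemma subgroup_orbit_shift:
 assumes X: "subgroup X SV" "X \<subseteq> G" and t: "t \<in> X" and v: "v \<in> V"
 shows "(\<lambda>s. s (t v)) ` X = (\<lambda>s. s v) ` X"
proof
 have XG: "s \<in> G" if "s \<in> X" for s using X(2) that by blast
 have le: "(\<lambda>s. s (t v)) ` X \<subseteq> (\<lambda>s. s v) ` X" if t: "t \<in> X" and v: "v \<in> V" for t v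
 proof
  fix y assume "y \<in> (\<lambda>s. s (t v)) ` X"
  then obtain s where s: "s \<in> X" "y = s (t v)" by blast
  then have "y = (s \<star> t) v" using mult_app[OF XG XG v, OF s(1) t] by simp
  then show "y \<in> (\<lambda>s. s v) ` X" using subgroup.m_closed[OF X(1) s(1) t] by blast
 qed
 show "(\<lambda>s. s (t v)) ` X \<subseteq> (\<lambda>s. s v) ` X" by (rule le[OF t v])
 show "(\<lambda>s. s v) ` X \<subseteq> (\<lambda>s. s (t v)) ` X"
  using le[OF subgroup.m_inv_closed[OF X(1) t] GV[OF XG[OF t] v]] inv_app(1)[OF XG[OF t] v] by simp
qed

lemma T_G: "T v j \<subseteq> G" using T_A AG by blast

lemma M_G: "M \<subseteq> G" using M_A AG by blast

lemma cell_V: "v \<in> V \<Longrightarrow> cell v \<subseteq> V" unfolding cell_def using GV subsetD[OF T_G] by blast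

lemma cell_self: "v \<in> V \<Longrightarrow> v \<in> cell v"
 unfolding cell_def using subgroup.one_closed[OF T_subgroup[of v jj]] BijGroup_one_apply[of v V] by (metis image_eqI)

lemma orb_self: "v \<in> V \<Longrightarrow> v \<in> orb v"
 unfolding orb_def using MD(4) BijGroup_one_apply[of v V] by (metis image_eqI)

lemma cell_eq: "v \<in> V \<Longrightarrow> u \<in> cell v \<Longrightarrow> cell u = cell v"
proof -
 assume v: "v \<in> V" and "u \<in> cell v"
 then obtain t where t: "t \<in> T v jj" "u = t v" by (auto simp: cell_def)
 have "T u jj = T v jj" unfolding t(2) by (rule T_shift[OF _ v]) (use t(1) T_A in blast)
 then show ?thesis unfolding cell_def using subgroup_orbit_shift[OF T_subgroup T_G t(1) v] t(2) by simp
qed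

lemma same_cell_T:
 assumes w: "w \<in> V" and k: "k \<in> A" "k w \<in> cell w"
 shows "k \<in> T w jj"
proof -
 obtain t where t: "t \<in> T w jj" "k w = t w" using k(2) by (auto simp: cell_def)
 have tA: "t \<in> A" using t(1) T_A by blast
 have "(iv t \<star> k) w = w"
  using mult_app[OF AG[OF AD(6)[OF tA]] AG[OF k(1)] w] t(2) inv_app(1)[OF AG[OF tA] w] by simp
 then have "iv t \<star> k \<in> T w jj" by (rule stab_T[OF AD(5)[OF AD(6)[OF tA] k(1)]])
 then have "t \<star> (iv t \<star> k) \<in> T w jj" by (rule subgroup.m_closed[OF T_subgroup t(1)])
 then show ?thesis using GC[OF AG[OF tA]] GC[OF AG[OF k(1)]] by (simp add: SV.m_assoc[symmetric])
qed

lemma orb_eq: "v \<in> V \<Longrightarrow> u \<in> orb v \<Longrightarrow> orb u = orb v"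
proof -
 assume v: "v \<in> V" and "u \<in> orb v"
 then obtain m where m: "m \<in> M" "u = m v" by (auto simp: orb_def)
 show ?thesis unfolding orb_def m(2) by (rule subgroup_orbit_shift[OF M_subgroup M_G m(1) v])
qed

lemma orb_iff: "u \<in> V \<Longrightarrow> v \<in> V \<Longrightarrow> orb u = orb v \<longleftrightarrow> u \<in> orb v"
 using orb_eq orb_self by blast

lemma cell_orb: "v \<in> V \<Longrightarrow> cell v \<subseteq> orb v"
 using T_M by (auto simp: cell_def orb_def)

lemma cell_image:
 assumes g: "g \<in> G" and v: "v \<in> V"
 shows "g ` cell v = cell (g v)"
proof
 have le: "g ` cell v \<subseteq> cell (g v)" if g: "g \<in> G" and v: "v \<in> V" for g v
 proof
  fix y assume "y \<in> g ` cell v"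
  then obtain t where t: "t \<in> T v jj" "y = g (t v)" by (auto simp: cell_def)
  have "t \<in> G" using t(1) T_G by blast
  then show "y \<in> cell (g v)" unfolding cell_def t(2) using conj_app[OF g _ v, of t] T_conj[OF g v t(1)] by (metis image_eqI)
 qed
 show "g ` cell v \<subseteq> cell (g v)" by (rule le[OF g v])
 show "cell (g v) \<subseteq> g ` cell v"
 proof
  fix y assume y: "y \<in> cell (g v)"
  have gv: "g v \<in> V" by (rule GV[OF g v])
  have yV: "y \<in> V" using cell_V[OF gv] y by blast
  have "(iv g) y \<in> cell v" using le[OF G_inv[OF g] gv] y inv_app(1)[OF g v] by auto
  then show "y \<in> g ` cell v" using inv_app(2)[OF g yV] by (metis image_eqI)
 qed
qed

lemma orb_out_neighbours:
 assumes "(v, w) \<in> E" "(v, w') \<in> E"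
 shows "orb w = orb w'"
proof -
 obtain k where k: "k \<in> A" "k v = v" "k w = w'" by (rule stab_transitive[OF assms])
 have V: "v \<in> V" "w \<in> V" using assms E_V by auto
 have "k \<in> M" using stab_M[OF k(1) V(1) k(2)] .
 then have "w' \<in> orb w" using k(3) by (auto simp: orb_def)
 then show ?thesis using orb_eq[OF V(2)] by simp
qed

lemma orb_step:
 assumes v: "v \<in> V" "v' \<in> V" "orb v = orb v'" and w: "(v, w) \<in> E" "(v', w') \<in> E"
 shows "orb w = orb w'"
proof -
 obtain m where m: "m \<in> M" "v' = m v" using v(3) orb_iff[OF v(2,1)] by (auto simp: orb_def)
 have wV: "w \<in> V" using E_V w by blast
 have "(v', m w) \<in> E" using autD[OF MD(2)[OF m(1)] w(1)] m(2) by simp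
 then have "orb (m w) = orb w'" using orb_out_neighbours w(2) by blast
 moreover have "m w \<in> orb w" using m(1) by (auto simp: orb_def)
 ultimately show ?thesis using orb_eq[OF wV] by simp
qed

lemma out_neighbour: "v \<in> V \<Longrightarrow> \<exists>w. (v, w) \<in> E"
 using card_N[of v] by (metis Image_singleton_iff card.empty ex_in_conv zero_neq_numeral)

lemma in_neighbour: "w \<in> V \<Longrightarrow> \<exists>v. (v, w) \<in> E"
proof -
 assume w: "w \<in> V"
 obtain x where x: "(w, x) \<in> E" using out_neighbour[OF w] by blast
 have "(x, w) \<in> E\<^sup>*" using reach E_V x w by blast
 then show ?thesis using x by (cases rule: rtranclE) auto
qed

text \<open>The out-neighbours of a vertex lie in one orbit of the normal subgroup \<open>M\<close>, so the arcs induce a map on the orbits of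
 \<open>M\<close>. By strong connectedness it consists of a single cycle.\<close>

lemma labelling:
 obtains r :: nat and blk :: "'a \<Rightarrow> int" where "r > 0" "\<And>v. v \<in> V \<Longrightarrow> 0 \<le> blk v \<and> blk v < int r"
  "\<And>u v. u \<in> V \<Longrightarrow> v \<in> V \<Longrightarrow> blk u = blk v \<longleftrightarrow> orb u = orb v" "\<And>v w. (v, w) \<in> E \<Longrightarrow> blk w = (blk v + 1) mod int r"
  "\<And>y. 0 \<le> y \<Longrightarrow> y < int r \<Longrightarrow> \<exists>v\<in>V. blk v = y"
proof -
 define s where "s Q = orb (SOME w. \<exists>v\<in>V. orb v = Q \<and> (v, w) \<in> E)" for Q
 have s: "s (orb v) = orb w" if vw: "(v, w) \<in> E" for v w
 proof -
  have V: "v \<in> V" using E_V vw by blast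
  have ex: "\<exists>w. \<exists>v'\<in>V. orb v' = orb v \<and> (v', w) \<in> E" using V vw by blast
  obtain v' where "v' \<in> V" "orb v' = orb v" "(v', SOME w. \<exists>v'\<in>V. orb v' = orb v \<and> (v', w) \<in> E) \<in> E" using someI_ex[OF ex] by blast
  then show ?thesis unfolding s_def using orb_step[OF _ V _ _ vw] by blast
 qed
 have iter: "(s ^^ n) (orb v) = orb w" if "(v, w) \<in> E ^^ n" for n v w
  using that by (induction n arbitrary: w) (auto simp: s)
 obtain v0 where v0: "v0 \<in> V" using V_nonempty by blast
 have path: "\<exists>n. (s ^^ n) (orb v0) = orb v" if "v \<in> V" for v
  using reach[OF v0 that] iter by (metis rtrancl_power)
 obtain w where w: "(v0, w) \<in> E" using out_neighbour[OF v0] by blast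
 obtain i where "(w, v0) \<in> E ^^ i" using reach[OF _ v0, of w] E_V(2)[OF w] by (auto simp: rtrancl_power)
 then have "(s ^^ i) (orb w) = orb v0" by (rule iter)
 then have bk: "(s ^^ Suc i) (orb v0) = orb v0" using s[OF w] by (simp add: funpow_swap1)
 have sQ: "s x \<in> orb ` V" if x: "x \<in> orb ` V" for x
 proof -
  obtain v where v: "v \<in> V" "x = orb v" using x by blast
  obtain w where "(v, w) \<in> E" using out_neighbour[OF v(1)] by blast
  then show ?thesis using s E_V(2) v(2) by blast
 qed
 obtain r :: nat and lab :: "'a set \<Rightarrow> int" where L: "r > 0" "\<And>x. x \<in> orb ` V \<Longrightarrow> 0 \<le> lab x \<and> lab x < int r" "inj_on lab (orb ` V)"
  "lab ` (orb ` V) = {0..<int r}" "\<And>x. x \<in> orb ` V \<Longrightarrow> lab (s x) = (lab x + 1) mod int r"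
 proof (rule cyclic_labelling[of "orb v0" "orb ` V" s "Suc i"])
  show "\<exists>n. (s ^^ n) (orb v0) = x" if "x \<in> orb ` V" for x using path that by blast
 qed (use v0 sQ bk in auto)
 show ?thesis
 proof (rule that[of r "\<lambda>v. lab (orb v)"])
  show "lab (orb u) = lab (orb v) \<longleftrightarrow> orb u = orb v" if "u \<in> V" "v \<in> V" for u v
   using inj_on_eq_iff[OF L(3)] that by simp
  show "lab (orb w) = (lab (orb v) + 1) mod int r" if "(v, w) \<in> E" for v w
   using L(5)[of "orb v"] s[OF that] E_V(1)[OF that] by simp
  show "\<exists>v\<in>V. lab (orb v) = y" if y: "0 \<le> y" "y < int r" for y
  proof -
   have "y \<in> lab ` (orb ` V)" unfolding L(4) using y by simp
   then show ?thesis by blast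
  qed
 qed (use L(1,2) in auto)
qed

end

locale elusive_digraph_labelled = elusive_digraph_three +
 fixes r :: nat and blk :: "'a \<Rightarrow> int"
 assumes r_pos: "r > 0" and blk_range: "\<And>v. v \<in> V \<Longrightarrow> 0 \<le> blk v \<and> blk v < int r"
  and blk_orb: "\<And>u v. u \<in> V \<Longrightarrow> v \<in> V \<Longrightarrow> blk u = blk v \<longleftrightarrow> orb u = orb v"
  and blk_edge: "\<And>v w. (v, w) \<in> E \<Longrightarrow> blk w = (blk v + 1) mod int r"
  and blk_surj: "\<And>y. 0 \<le> y \<Longrightarrow> y < int r \<Longrightarrow> \<exists>v\<in>V. blk v = y"
begin

text \<open>\<open>M\<close> is not transitive, as an abelian transitive group has trivial stabilisers.\<close>

lemma r_ge_2: "r \<ge> 2"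
proof (rule ccontr)
 assume "\<not> r \<ge> 2"
 then have r1: "int r = 1" using r_pos by simp
 obtain v where v: "v \<in> V" using V_nonempty by blast
 obtain k w where k: "k \<in> A" "k v = v" "(v, w) \<in> E" "k w \<noteq> w" using normal_moves[OF A A_nontrivial v] by blast
 have wV: "w \<in> V" using E_V k(3) by blast
 have "blk w = blk v" using blk_range[OF v] blk_range[OF wV] r1 by simp
 then have "w \<in> orb v" using blk_orb[OF wV v] orb_iff[OF wV v] by simp
 then obtain m where m: "m \<in> M" "w = m v" by (auto simp: orb_def)
 have "k w = m (k v)" unfolding m(2) by (rule A_comm_app[OF k(1) _ v]) (use m(1) M_A in blast)
 then show False using k(2,4) m(2) by simp
qed

lemma blk_shift:
 assumes g: "g \<in> G"
 shows "\<exists>c. \<forall>v\<in>V. blk (g v) = (blk v + c) mod int r"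
proof -
 obtain v0 where v0: "v0 \<in> V" using V_nonempty by blast
 define c where "c = blk (g v0) - blk v0"
 have "v \<in> V \<and> blk (g v) = (blk v + c) mod int r" if "(v0, v) \<in> E\<^sup>*" for v
  using that
 proof (induction rule: rtrancl_induct)
  case base
  show ?case using v0 blk_range[OF GV[OF g v0]] by (simp add: c_def)
 next
  case (step v w)
  have "blk (g w) = ((blk v + c) mod int r + 1) mod int r" using blk_edge[OF autD[OF g step(2)]] step.IH by simp
  also have "\<dots> = (blk v + 1 + c) mod int r" by (subst mod_add_left_eq) (simp add: algebra_simps)
  also have "\<dots> = ((blk v + 1) mod int r + c) mod int r" by (rule mod_add_left_eq[symmetric])
  finally show ?case using blk_edge[OF step(2)] E_V(2)[OF step(2)] by simp
 qed
 then show ?thesis using reach[OF v0] by blast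
qed

definition \<Omega> :: "'a set set" where "\<Omega> = cell ` V"

definition act :: "('a \<Rightarrow> 'a) \<Rightarrow> 'a set \<Rightarrow> 'a set" where "act g = (\<lambda>C\<in>\<Omega>. g ` C)"

definition blkc :: "'a set \<Rightarrow> int" where "blkc C = blk (SOME v. v \<in> C)"

lemma finO: "finite \<Omega>" using finV by (simp add: \<Omega>_def)

lemma cell_O: "v \<in> V \<Longrightarrow> cell v \<in> \<Omega>" by (simp add: \<Omega>_def)

lemma blkc_cell: "v \<in> V \<Longrightarrow> blkc (cell v) = blk v"
proof -
 assume v: "v \<in> V"
 define u where "u = (SOME u. u \<in> cell v)"
 have u: "u \<in> cell v" unfolding u_def using cell_self[OF v] by (rule someI)
 have uV: "u \<in> V" using u cell_V[OF v] by blast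
 have "u \<in> orb v" using u cell_orb[OF v] by blast
 then have "blk u = blk v" using blk_orb[OF uV v] orb_eq[OF v] by simp
 then show ?thesis by (simp add: blkc_def u_def)
qed

lemma act_cell: "g \<in> G \<Longrightarrow> v \<in> V \<Longrightarrow> act g (cell v) = cell (g v)"
 using cell_O cell_image by (simp add: act_def)

lemma act_Bij:
 assumes g: "g \<in> G"
 shows "act g \<in> Bij \<Omega>"
proof (rule Bij_finiteI[OF finO])
 show "act g \<in> extensional \<Omega>" by (simp add: act_def)
 show "act g C \<in> \<Omega>" if "C \<in> \<Omega>" for C
  using that act_cell[OF g] GV[OF g] cell_O by (auto simp: \<Omega>_def)
 have "inj_on g V" by (rule inj_onI) (use G_inj[OF g] in blast)
 then show "inj_on (act g) \<Omega>"
  by (intro inj_onI) (use cell_V in \<open>auto simp: act_def \<Omega>_def inj_on_image_eq_iff\<close>)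
qed

lemma act_mult:
 assumes g: "g \<in> G" and h: "h \<in> G"
 shows "act (g \<star> h) = act g \<otimes>\<^bsub>BijGroup \<Omega>\<^esub> act h"
proof (rule Bij_eqI[OF act_Bij[OF G_mult[OF g h]]])
 interpret B: group "BijGroup \<Omega>" by (rule group_BijGroup)
 show "act g \<otimes>\<^bsub>BijGroup \<Omega>\<^esub> act h \<in> Bij \<Omega>" using B.m_closed act_Bij g h by (simp add: carrier_BijGroup)
 fix C assume "C \<in> \<Omega>"
 then obtain v where v: "v \<in> V" "C = cell v" by (auto simp: \<Omega>_def)
 show "act (g \<star> h) C = (act g \<otimes>\<^bsub>BijGroup \<Omega>\<^esub> act h) C"
  unfolding v(2) act_cell[OF G_mult[OF g h] v(1)] BijGroup_mult_apply[OF act_Bij[OF g] act_Bij[OF h] cell_O[OF v(1)]]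
   act_cell[OF h v(1)] act_cell[OF g GV[OF h v(1)]] mult_app[OF g h v(1)] ..
qed

lemma act_pow:
 assumes g: "g \<in> G" and v: "v \<in> V"
 shows "(act g ^^ n) (cell v) = cell ((g ^^ n) v)"
 by (induction n) (simp_all add: act_cell[OF g] funpow_V[OF g v])

text \<open>The kernel is a normal subgroup, so if it were nontrivial it would move an out-neighbour \<open>w\<close> of some fixed vertex \<open>v\<close>
 within its cell. Some element of \<open>A\<close> fixing \<open>v\<close> agrees with it on \<open>w\<close> and hence lies in \<open>T w jj\<close>, against \<open>M_cosets\<close>.\<close>

lemma act_faithful:
 assumes g: "g \<in> G" and triv: "\<And>v. v \<in> V \<Longrightarrow> cell (g v) = cell v"
 shows "g = id\<^sub>V"
proof (rule ccontr)
 assume ne: "g \<noteq> id\<^sub>V"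
 interpret B: group "BijGroup \<Omega>" by (rule group_BijGroup)
 interpret h: group_hom GG "BijGroup \<Omega>" act
  by unfold_locales (use act_mult act_Bij in \<open>auto simp: hom_def carrier_BijGroup\<close>)
 let ?Kr = "kernel GG (BijGroup \<Omega>) act"
 have inv: "invariant ?Kr" by (rule normal_invariant[OF h.normal_kernel])
 have "act g = \<one>\<^bsub>BijGroup \<Omega>\<^esub>"
  by (rule Bij_eqI[OF act_Bij[OF g]]) (use triv act_cell[OF g] B.one_closed in \<open>auto simp: \<Omega>_def BijGroup_one_apply carrier_BijGroup\<close>)
 then have nt: "?Kr \<noteq> {id\<^sub>V}" using g ne by (auto simp: kernel_def)
 obtain v where v: "v \<in> V" using V_nonempty by blast
 obtain e w where e: "e \<in> ?Kr" "e v = v" "(v, w) \<in> E" "e w \<noteq> w" using normal_moves[OF inv nt v] by blast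
 have eG: "e \<in> G" and wV: "w \<in> V" using e E_V by (auto simp: kernel_def)
 have ew: "(v, e w) \<in> E" using autD[OF eG e(3)] e(2) by simp
 obtain k where k: "k \<in> A" "k v = v" "k w = e w" by (rule stab_transitive[OF e(3) ew])
 have "cell (e w) = cell w" using act_cell[OF eG wV] e(1) cell_O[OF wV] by (simp add: kernel_def BijGroup_one_apply)
 then have "e w \<in> cell w" using cell_self[OF GV[OF eG wV]] by simp
 then have "k \<in> T w jj" using same_cell_T[OF wV k(1)] k(3) by simp
 then show False using M_cosets(2)[OF k(1,2) e(3)] k(3) e(4) by simp
qed

text \<open>Let \<open>k\<close> rotate the out-neighbours of a vertex. Modulo \<open>T w jj\<close> the group \<open>M\<close> is generated by \<open>k\<close>, which does not
 lie in \<open>T w jj\<close>; so the cells in the orbit of \<open>w\<close> are those of \<open>w\<close>, \<open>k w\<close> and \<open>k (k w)\<close>.\<close>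

lemma card_block:
 assumes w: "w \<in> V"
 shows "card {C\<in>\<Omega>. blkc C = blk w} = 3"
proof -
 obtain v where v: "(v, w) \<in> E" using in_neighbour[OF w] by blast
 have vV: "v \<in> V" using E_V v by blast
 obtain k where k: "k \<in> A" "k v = v" "\<And>w. (v, w) \<in> E \<Longrightarrow> k w \<noteq> w" using stab_mover[OF vV] by blast
 note kG = AG[OF k(1)]
 have kw: "k w \<noteq> w" by (rule k(3)[OF v])
 note cos = M_cosets[OF k(1,2) v kw]
 have kM: "k \<in> M" by (rule stab_M[OF k(1) vV k(2)])
 have kV: "k w \<in> V" "k (k w) \<in> V" using GV[OF kG] w by auto
 have kkk: "k (k (k w)) = w" by (rule A_cube'[OF k(1) w])
 have eq: "{C\<in>\<Omega>. blkc C = blk w} = {cell w, cell (k w), cell (k (k w))}"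
 proof
  show "{cell w, cell (k w), cell (k (k w))} \<subseteq> {C\<in>\<Omega>. blkc C = blk w}"
  proof -
   have "k w \<in> orb w" using kM by (auto simp: orb_def)
   then have o1: "orb (k w) = orb w" by (rule orb_eq[OF w])
   have "k (k w) \<in> orb (k w)" using kM by (auto simp: orb_def)
   then have o2: "orb (k (k w)) = orb w" using orb_eq[OF kV(1)] o1 by simp
   show ?thesis using cell_O w kV blkc_cell blk_orb[OF kV(1) w] blk_orb[OF kV(2) w] o1 o2 by auto
  qed
  show "{C\<in>\<Omega>. blkc C = blk w} \<subseteq> {cell w, cell (k w), cell (k (k w))}"
  proof
   fix C assume C: "C \<in> {C\<in>\<Omega>. blkc C = blk w}"
   then obtain u where u: "u \<in> V" "C = cell u" by (auto simp: \<Omega>_def)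
   then have "orb u = orb w" using C blkc_cell[OF u(1)] blk_orb[OF u(1) w] by simp
   then obtain x where x: "x \<in> M" "u = x w" using orb_iff[OF u(1) w] by (auto simp: orb_def)
   obtain n t where t: "t \<in> T w jj" "x = k \<Up> (n::nat) \<star> t" using cos(1)[OF x(1)] by blast
   have tG: "t \<in> G" using t(1) T_G by blast
   have tV: "t w \<in> V" by (rule GV[OF tG w])
   have "cell (t w) = cell w" by (rule cell_eq[OF w]) (use t(1) in \<open>auto simp: cell_def\<close>)
   then have "C = cell ((k ^^ n) w)"
    unfolding u(2) x(2) t(2) mult_app[OF G_pow[OF kG] tG w] cell_image[OF G_pow[OF kG] tV, symmetric]
    using cell_image[OF G_pow[OF kG] w, of n] pow_app[OF kG w] by simp
   moreover have "(k ^^ n) w \<in> {w, k w, k (k w)}" by (induction n) (auto simp: kkk)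
   ultimately show "C \<in> {cell w, cell (k w), cell (k (k w))}" by auto
  qed
 qed
 have d: "cell (k u) \<noteq> cell u" if u: "u \<in> V" "T u jj = T w jj" for u
 proof
  assume "cell (k u) = cell u"
  then have "k u \<in> cell u" using cell_self[OF GV[OF kG u(1)]] by simp
  then show False using same_cell_T[OF u(1) k(1)] cos(2) u(2) by simp
 qed
 have "T (k w) jj = T w jj" "T (k (k w)) jj = T w jj" using T_shift[OF k(1)] w kV(1) by simp_all
 then show ?thesis unfolding eq using d[OF w] d[OF kV(1)] d[OF kV(2)] kkk by auto
qed

definition P :: "('a set \<Rightarrow> 'a set) set" where "P = act ` G"

lemma P_subgroup: "subgroup P (BijGroup \<Omega>)"
 unfolding P_def using act_Bij by (intro hom_image_subgroup(1)[where F = act, OF SV.is_group group_BijGroup G _ act_mult])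
  (simp_all add: carrier_BijGroup)

text \<open>An element whose \<open>q\<close>-th power is trivial on the cells has trivial \<open>q\<close>-th power by faithfulness, so it fixes a vertex and
 the cell of this vertex.\<close>

sublocale cb: cyclic_blocks \<Omega> P blkc r
proof (rule cyclic_blocks.intro)
 show "finite \<Omega>" by (rule finO)
 show "subgroup P (BijGroup \<Omega>)" by (rule P_subgroup)
 show "r \<ge> 2" by (rule r_ge_2)
 show "transitive_on \<Omega> P"
  unfolding transitive_on_def
 proof (intro ballI)
  fix C D assume "C \<in> \<Omega>" "D \<in> \<Omega>"
  then obtain u v where uv: "u \<in> V" "v \<in> V" "C = cell u" "D = cell v" by (auto simp: \<Omega>_def)
  then obtain g where g: "g \<in> G" "g u = v" using transitivity by blast
  then have "act g C = D" using act_cell uv by simp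
  then show "\<exists>p\<in>P. p C = D" using g(1) by (auto simp: P_def)
 qed
 show "0 \<le> blkc C \<and> blkc C < int r" if "C \<in> \<Omega>" for C
  using that blkc_cell blk_range by (auto simp: \<Omega>_def)
 show "\<exists>j. \<forall>C\<in>\<Omega>. blkc (p C) = (blkc C + j) mod int r" if p: "p \<in> P" for p
 proof -
  obtain g where g: "g \<in> G" "p = act g" using p by (auto simp: P_def)
  obtain c where c: "\<And>v. v \<in> V \<Longrightarrow> blk (g v) = (blk v + c) mod int r" using blk_shift[OF g(1)] by blast
  have "blkc (p C) = (blkc C + c) mod int r" if "C \<in> \<Omega>" for C
   using that c act_cell[OF g(1)] blkc_cell GV[OF g(1)] by (auto simp: \<Omega>_def g(2))
  then show ?thesis by blast
 qed
 show "card {C\<in>\<Omega>. blkc C = y} = 3" if y: "0 \<le> y" "y < int r" for y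
  using blk_surj[OF y] card_block by blast
 show "\<exists>C\<in>\<Omega>. p C = C" if p: "p \<in> P" and q: "prime (q::nat)" and pq: "\<And>C. C \<in> \<Omega> \<Longrightarrow> (p ^^ q) C = C" for p q
 proof -
  obtain g where g: "g \<in> G" "p = act g" using p by (auto simp: P_def)
  have "g \<Up> q = id\<^sub>V"
  proof (rule act_faithful[OF G_pow[OF g(1)]])
   show "cell ((g \<Up> q) v) = cell v" if v: "v \<in> V" for v
    using pq[OF cell_O[OF v]] act_pow[OF g(1) v] pow_app[OF g(1) v] by (simp add: g(2))
  qed
  then obtain v where v: "v \<in> V" "g v = v" using prime_fix[OF g(1) q] pow_one_iff[OF g(1)] by blast
  then show ?thesis using cell_O act_cell[OF g(1)] g(2) by (intro bexI[of _ "cell v"]) auto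
 qed
 show "\<exists>c\<in>P. (\<forall>C\<in>\<Omega>. (c ^^ 3) C = C \<and> blkc (c C) = blkc C) \<and> (\<exists>C\<in>\<Omega>. c C \<noteq> C)"
 proof -
  obtain m where m: "m \<in> M" "m \<noteq> id\<^sub>V" using M_nontrivial MD(4) by blast
  note mG = MD(2)[OF m(1)]
  have mA: "m \<in> A" using m(1) M_A by blast
  have "(act m ^^ 3) (cell v) = cell v \<and> blkc (act m (cell v)) = blkc (cell v)" if v: "v \<in> V" for v
  proof -
   have "m v \<in> orb v" using m(1) by (auto simp: orb_def)
   then have "blk (m v) = blk v" using blk_orb[OF GV[OF mG v] v] orb_eq[OF v] by simp
   then show ?thesis using act_pow[OF mG v] A_cube[OF mA v] act_cell[OF mG v] blkc_cell[OF v] blkc_cell[OF GV[OF mG v]] by simp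
  qed
  moreover have "\<exists>v\<in>V. cell (m v) \<noteq> cell v" using act_faithful[OF mG] m(2) by blast
  then have "\<exists>C\<in>\<Omega>. act m C \<noteq> C" using cell_O act_cell[OF mG] by metis
  moreover have "act m \<in> P" using mG by (simp add: P_def)
  ultimately show ?thesis by (intro bexI[of _ "act m"]) (auto simp: \<Omega>_def)
 qed
qed

lemma T_fixes_cells:
 assumes x: "x \<in> V" and m: "m \<in> T x jj" and v: "v \<in> V" "blk v = blk x"
 shows "act m (cell v) = cell v"
proof -
 have "v \<in> orb x" using v(2) blk_orb[OF v(1) x] orb_iff[OF v(1) x] by simp
 then obtain a where a: "a \<in> M" "v = a x" by (auto simp: orb_def)
 have "T v jj = T x jj" unfolding a(2) by (rule T_shift[OF _ x]) (use a(1) M_A in blast)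
 then have "m v \<in> cell v" using m by (auto simp: cell_def)
 moreover have "m \<in> G" using m T_G by blast
 ultimately show ?thesis using act_cell[OF _ v(1)] cell_eq[OF v(1)] by simp
qed

text \<open>For positive \<open>jj\<close>, an element of \<open>M\<close> with a fixed vertex would act trivially on two
 consecutive blocks of cells. But the elements of \<open>M\<close> realise all words of the code, one of which
 has no two adjacent zeros.\<close>

lemma jj_zero: "jj = 0"
proof (rule ccontr)
 assume j: "jj \<noteq> 0"
 obtain a f where f: "r = 2 ^ a" "bij_betw f \<Omega> (PXV r)" "\<And>C. C \<in> \<Omega> \<Longrightarrow> snd (f C) = blkc C"
  "rho_group r a (transport \<Omega> (PXV r) f ` P)" using cb.coordinates by blast
 interpret R: rho_group r a "transport \<Omega> (PXV r) f ` P" by (rule f(4))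
 \<comment> \<open>The action of \<open>G\<close> on the cells, in coordinates.\<close>
 define F where "F g = transport \<Omega> (PXV r) f (act g)" for g
 have K: "transport \<Omega> (PXV r) f ` P = F ` G" by (auto simp: P_def F_def)
 have F_Bij: "F g \<in> Bij (PXV r)" if "g \<in> G" for g unfolding F_def by (rule transport_Bij[OF f(2) act_Bij[OF that]])
 have F_cell: "F g (f (cell v)) = f (cell (g v))" if "g \<in> G" "v \<in> V" for g v
  unfolding F_def transport_apply[OF f(2) act_Bij[OF that(1)] cell_O[OF that(2)]] act_cell[OF that] ..
 have F_mult: "F (g \<star> h) = F g \<otimes>\<^bsub>SymV r\<^esub> F h" if "g \<in> G" "h \<in> G" for g h
  unfolding F_def act_mult[OF that] by (rule transport_mult[OF f(2) act_Bij[OF that(1)] act_Bij[OF that(2)]])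
 have F_one: "F id\<^sub>V = \<one>\<^bsub>SymV r\<^esub>"
  by (rule hom_image_subgroup(2)[where F = F, OF SV.is_group group_BijGroup G _ F_mult]) (simp_all add: F_Bij carrier_BijGroup)
 have FM: "subgroup (F ` M) (SymV r)"
  by (rule hom_image_subgroup(1)[where F = F, OF SV.is_group group_BijGroup M_subgroup]) (use F_Bij F_mult MD(2) in \<open>auto simp: carrier_BijGroup\<close>)
 have point: "\<exists>v\<in>V. q = f (cell v)" if "q \<in> PXV r" for q
  using f(2) that by (auto simp: bij_betw_def \<Omega>_def)
 have sub: "F ` M \<subseteq> transl r ` R.code"
 proof
  fix q assume "q \<in> F ` M"
  then obtain m where m: "m \<in> M" "q = F m" by blast
  note mG = MD(2)[OF m(1)]
  have mA: "m \<in> A" using m(1) M_A by blast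
  have "snd (q p) = snd p \<and> q (q (q p)) = p" if p: "p \<in> PXV r" for p
  proof -
   obtain v where v: "v \<in> V" "p = f (cell v)" using point[OF p] by blast
   have mv: "m v \<in> V" "m (m v) \<in> V" using GV[OF mG] v(1) by auto
   have "m v \<in> orb v" using m(1) by (auto simp: orb_def)
   then have "blk (m v) = blk v" using blk_orb[OF mv(1) v(1)] orb_eq[OF v(1)] by simp
   then show ?thesis unfolding m(2) v(2)
    using F_cell[OF mG] v(1) mv f(3)[OF cell_O] blkc_cell A_cube'[OF mA v(1)] by simp
  qed
  moreover have "q \<in> transport \<Omega> (PXV r) f ` P" unfolding K m(2) using mG by blast
  ultimately show "q \<in> transl r ` R.code" unfolding R.translations_eq[symmetric] R.block_preserving_def by blast
 qed
 have nt: "F ` M \<noteq> {\<one>\<^bsub>SymV r\<^esub>}"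
 proof
  assume F1: "F ` M = {\<one>\<^bsub>SymV r\<^esub>}"
  have "m = id\<^sub>V" if m: "m \<in> M" for m
  proof (rule act_faithful[OF MD(2)[OF m]])
   fix v assume v: "v \<in> V"
   have "F m = \<one>\<^bsub>SymV r\<^esub>" using F1 m by blast
   moreover have "f (cell v) \<in> PXV r" using bij_betwE[OF f(2)] cell_O[OF v] by blast
   ultimately have "f (cell (m v)) = f (cell v)" using F_cell[OF MD(2)[OF m] v] BijGroup_one_apply by metis
   then show "cell (m v) = cell v" using bij_betw_imp_inj_on[OF f(2)] cell_O v GV[OF MD(2)[OF m] v] by (meson inj_onD)
  qed
  then show False using M_nontrivial MD(4) by blast
 qed
 have "F ` M = transl r ` R.code"
 proof (rule R.invariant_translations[OF FM sub nt])
  fix q assume "q \<in> F ` M"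
  then obtain m where m: "m \<in> M" "q = F m" by blast
  obtain g where g: "g \<in> G" "rho r = F g" using R.rho_K unfolding K by blast
  have gi: "iv g \<in> G" by (rule G_inv[OF g(1)])
  have "F (iv g) \<otimes>\<^bsub>SymV r\<^esub> F g = \<one>\<^bsub>SymV r\<^esub>"
   using F_mult[OF gi g(1)] F_one GC[OF g(1)] by simp
  then have i: "inv\<^bsub>SymV r\<^esub> (F g) = F (iv g)"
   using R.S.inv_equality F_Bij[OF g(1)] F_Bij[OF gi] by (simp add: carrier_BijGroup)
  have "iv g \<star> m \<star> iv (iv g) \<in> M" by (rule MD(3)[OF gi m(1)])
  then have "iv g \<star> (m \<star> g) \<in> M" using GC[OF g(1)] GC[OF MD(2)[OF m(1)]] by (simp add: SV.m_assoc)
  moreover have "F (iv g \<star> (m \<star> g)) = inv\<^bsub>SymV r\<^esub> (rho r) \<otimes>\<^bsub>SymV r\<^esub> (q \<otimes>\<^bsub>SymV r\<^esub> rho r)"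
   unfolding m(2) g(2) i using F_mult[OF gi G_mult[OF MD(2)[OF m(1)] g(1)]] F_mult[OF MD(2)[OF m(1)] g(1)] by simp
  ultimately show "inv\<^bsub>SymV r\<^esub> (rho r) \<otimes>\<^bsub>SymV r\<^esub> (q \<otimes>\<^bsub>SymV r\<^esub> rho r) \<in> F ` M" by (metis imageI)
 qed
 moreover obtain c where c: "c \<in> R.code" "\<And>y. \<not> (c y = 0 \<and> c (y + 1) = 0)" using R.word_without_adjacent_zeros by blast
 ultimately have "transl r c \<in> F ` M" by blast
 then obtain m where m: "m \<in> M" "F m = transl r c" by auto
 have cw: "c \<in> nwords r" using c(1) by (simp add: R.code_def)
 note mG = MD(2)[OF m(1)]
 have mA: "m \<in> A" using m(1) M_A by blast
 obtain u where u: "u \<in> V" "m u = u" using prime_fix[OF mG, of 3] A_cube[OF mA] by auto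
 obtain x where x: "(x, u) \<in> E" using in_neighbour[OF u(1)] by blast
 have xV: "x \<in> V" using E_V x by blast
 \<comment> \<open>Such an \<open>m\<close> fixes every cell in the block of \<open>v\<close>.\<close>
 have zero: "c (blk v) = 0" if v: "v \<in> V" and mT: "m \<in> T v jj" for v
 proof -
  have y: "0 \<le> blk v" "blk v < int r" using blk_range[OF v] by auto
  then have q: "(0, blk v) \<in> PXV r" by (simp add: PXV_iff)
  obtain v' where v': "v' \<in> V" "(0, blk v) = f (cell v')" using point[OF q] by blast
  have "blk v' = blk v" using f(3)[OF cell_O[OF v'(1)]] blkc_cell[OF v'(1)] v'(2)[symmetric] by simp
  then have "cell (m v') = cell v'" using T_fixes_cells[OF v mT v'(1)] act_cell[OF mG v'(1)] by simp
  then have "transl r c (0, blk v) = (0, blk v)" using F_cell[OF mG v'(1)] m(2) v'(2) by simp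
  then have "c (blk v) mod 3 = 0" using transl_apply[OF q, of c] by simp
  then show ?thesis using nwordsD(4)[OF cw] by simp
 qed
 \<comment> \<open>Both the fixed vertex \<open>u\<close> and its in-neighbour \<open>x\<close> qualify, and their blocks are adjacent.\<close>
 have "u \<in> rc x jj" using x j by (auto simp: rc_def intro!: exI[of _ 1])
 then have "m \<in> gens x jj" using mA u(2) by (auto simp: gens_def)
 then have zx: "c (blk x) = 0" using zero[OF xV] gens_T by blast
 have zu: "c (blk u) = 0" by (rule zero[OF u(1) stab_T[OF mA u(2)]])
 have "c (blk x + 1) = 0"
 proof (cases "blk x + 1 = int r")
  case True
  then have "c 0 = 0" using zu blk_edge[OF x] by simp
  then show ?thesis using nwordsD(3)[OF cw, of 0] True by simp
 next
  case False
  then have "blk u = blk x + 1" using blk_edge[OF x] blk_range[OF xV] by simp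
  then show ?thesis using zu by simp
 qed
 then show False using c(2) zx by blast
qed

lemma cell_singleton: "v \<in> V \<Longrightarrow> cell v = {v}"
 using T_zero_fixes[of v] cell_self[of v] unfolding cell_def jj_zero by auto

text \<open>The three out-neighbours of a vertex are all vertices of the next block, which has three cells.\<close>

lemma edge_iff:
 assumes u: "u \<in> V" and w: "w \<in> V"
 shows "(u, w) \<in> E \<longleftrightarrow> blk w = (blk u + 1) mod int r"
proof
 assume bw: "blk w = (blk u + 1) mod int r"
 have "{C\<in>\<Omega>. blkc C = blk w} = (\<lambda>v. {v}) ` {v\<in>V. blk v = blk w}"
  using cell_singleton blkc_cell by (auto simp: \<Omega>_def)
 then have "card {v\<in>V. blk v = blk w} = 3" using card_block[OF w] by (simp add: card_image)
 moreover have "E `` {u} \<subseteq> {v\<in>V. blk v = blk w}" using blk_edge bw E_V by auto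
 ultimately have "E `` {u} = {v\<in>V. blk v = blk w}" using card_subset_eq[of "{v\<in>V. blk v = blk w}"] finV card_N[OF u] by simp
 then show "(u, w) \<in> E" using w by blast
qed (rule blk_edge)

theorem vertex_coordinates:
 "\<exists>a f. r = 2 ^ a \<and> bij_betw f V (PXV r) \<and> (\<forall>v\<in>V. snd (f v) = blk v) \<and> rho_group r a (transport V (PXV r) f ` G)"
proof -
 obtain a f where f: "r = 2 ^ a" "bij_betw f \<Omega> (PXV r)" "\<And>C. C \<in> \<Omega> \<Longrightarrow> snd (f C) = blkc C"
  "rho_group r a (transport \<Omega> (PXV r) f ` P)" using cb.coordinates by blast
 have "bij_betw cell V \<Omega>"
  unfolding bij_betw_def \<Omega>_def by (auto simp: inj_on_def cell_singleton)
 then have fc: "bij_betw (f \<circ> cell) V (PXV r)" by (rule bij_betw_trans[OF _ f(2)])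
 have eq: "transport V (PXV r) (f \<circ> cell) g = transport \<Omega> (PXV r) f (act g)" if g: "g \<in> G" for g
 proof (rule Bij_eqI[OF transport_Bij[OF fc GB[OF g]] transport_Bij[OF f(2) act_Bij[OF g]]])
  fix p assume "p \<in> PXV r"
  then obtain v where v: "v \<in> V" "p = (f \<circ> cell) v" using fc by (auto simp: bij_betw_def)
  have "transport \<Omega> (PXV r) f (act g) p = f (cell (g v))"
   using transport_apply[OF f(2) act_Bij[OF g] cell_O[OF v(1)]] act_cell[OF g v(1)] v(2) by simp
  then show "transport V (PXV r) (f \<circ> cell) g p = transport \<Omega> (PXV r) f (act g) p"
   using transport_apply[OF fc GB[OF g] v(1)] v(2) by simp
 qed
 have "transport V (PXV r) (f \<circ> cell) ` G = transport \<Omega> (PXV r) f ` P"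
  unfolding P_def image_image by (rule image_cong) (auto simp: eq)
 then have "rho_group r a (transport V (PXV r) (f \<circ> cell) ` G)" using f(4) by simp
 moreover have "\<forall>v\<in>V. snd ((f \<circ> cell) v) = blk v" using f(3) cell_O blkc_cell by simp
 ultimately show ?thesis using f(1) fc by blast
qed

end

section \<open>The theorem\<close>

lemma automorphisms_subgroup:
 assumes fin: "finite (pverts \<Gamma>)"
 shows "subgroup {g \<in> Bij (pverts \<Gamma>). dg_iso \<Gamma> \<Gamma> g} (BijGroup (pverts \<Gamma>))"
proof -
 let ?V = "pverts \<Gamma>" and ?A = "{g \<in> Bij (pverts \<Gamma>). dg_iso \<Gamma> \<Gamma> g}"
 interpret B: group "BijGroup ?V" by (rule group_BijGroup)
 have iso: "dg_iso \<Gamma> \<Gamma> g \<longleftrightarrow> (\<forall>u\<in>?V. \<forall>v\<in>?V. (u, v) \<in> parcs \<Gamma> \<longleftrightarrow> (g u, g v) \<in> parcs \<Gamma>)" if "g \<in> Bij ?V" for g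
  using that by (auto simp: dg_iso_def Bij_def)
 show ?thesis
 proof (rule B.finite_closed_subgroup)
  show "finite (carrier (BijGroup ?V))" using finite_Bij[OF fin] by (simp add: carrier_BijGroup)
  show "?A \<subseteq> carrier (BijGroup ?V)" by (auto simp: carrier_BijGroup)
  have "\<one>\<^bsub>BijGroup ?V\<^esub> \<in> Bij ?V" using B.one_closed by (simp add: carrier_BijGroup)
  then show "\<one>\<^bsub>BijGroup ?V\<^esub> \<in> ?A" by (simp add: iso BijGroup_one_apply)
  fix g h assume gh: "g \<in> ?A" "h \<in> ?A"
  then have B: "g \<in> Bij ?V" "h \<in> Bij ?V" "g \<otimes>\<^bsub>BijGroup ?V\<^esub> h \<in> Bij ?V" using B.m_closed by (auto simp: carrier_BijGroup)
  show "g \<otimes>\<^bsub>BijGroup ?V\<^esub> h \<in> ?A"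
   using gh iso[OF B(1)] iso[OF B(2)] iso[OF B(3)] B BijGroup_mult_apply[OF B(1,2)] Bij_apply_closed[OF B(2)] by simp
 qed
qed

lemma (in pair_digraph) elusive_digraphI:
 assumes conn: "connected (with_proj G)" and d: "d \<le> 3" "has_out_valency G d"
  and two: "card (pverts G) \<ge> 2" and H: "subgroup H (aut_group G)" and tr: "transitive_on (pverts G) H"
  and elusive: "\<nexists>g. g \<in> H \<and> g \<noteq> \<one>\<^bsub>aut_group G\<^esub> \<and> semiregular (pverts G) g"
 shows "elusive_digraph (pverts G) (parcs G) H d"
proof (rule elusive_digraph.intro)
 show "finite (pverts G)" by (rule pair_finite_verts)
 show "parcs G \<subseteq> pverts G \<times> pverts G" using in_arcsD1 in_arcsD2 by auto
 show "card (pverts G) \<ge> 2" "d \<le> 3" "transitive_on (pverts G) H" by fact+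
 show "(u, v) \<in> (parcs G \<union> (parcs G)\<inverse>)\<^sup>*" if "u \<in> pverts G" "v \<in> pverts G" for u v
 proof -
  have "(u, v) \<in> rtrancl_on (pverts G) ((parcs G)\<^sup>s)" using conn that unfolding connected_conv by simp
  then have "(u, v) \<in> ((parcs G)\<^sup>s)\<^sup>*" by (induction rule: rtrancl_on.induct) (auto intro: rtrancl_into_rtrancl)
  moreover have "(parcs G)\<^sup>s = parcs G \<union> (parcs G)\<inverse>" by (auto simp: symcl_def)
  ultimately show ?thesis by (simp only:)
 qed
 show "card (parcs G `` {v}) = d" if v: "v \<in> pverts G" for v
 proof -
  have "out_arcs (with_proj G) v = Pair v ` (parcs G `` {v})" by (auto simp: out_arcs_def)
  then have "out_degree (with_proj G) v = card (parcs G `` {v})" by (simp add: out_degree_def card_image inj_on_def)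
  then show ?thesis using d(2) v by (simp add: has_out_valency_def)
 qed
 interpret B: group "BijGroup (pverts G)" by (rule group_BijGroup)
 have HA: "g \<in> Bij (pverts G)" "dg_iso G G g" if "g \<in> H" for g
  using subgroup.subset[OF H] that by (auto simp: aut_group_def)
 show "subgroup H (BijGroup (pverts G))"
  using B.incl_subgroup[OF automorphisms_subgroup[OF pair_finite_verts]] H by (simp add: aut_group_def)
 show "(g u, g v) \<in> parcs G \<longleftrightarrow> (u, v) \<in> parcs G" if "g \<in> H" "u \<in> pverts G" "v \<in> pverts G" for g u v
  using HA(2)[OF that(1)] that by (simp add: dg_iso_def)
 show "g = \<one>\<^bsub>BijGroup (pverts G)\<^esub>" if "g \<in> H" "semiregular (pverts G) g" for g
  using elusive that by (auto simp: aut_group_def)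
qed

theorem (in elusive_digraph) normal_form:
 "\<exists>a f. bij_betw f V (PXV (2 ^ a)) \<and> rho_group (2 ^ a) a (transport V (PXV (2 ^ a)) f ` G) \<and>
   (\<forall>u\<in>V. \<forall>v\<in>V. (u, v) \<in> E \<longleftrightarrow> [snd (f v) - snd (f u) = 1] (mod 2 ^ a))"
proof (rule elementary_abelian_three)
 fix A assume "invariant A" "A \<noteq> {id\<^sub>V}" "\<And>x y. x \<in> A \<Longrightarrow> y \<in> A \<Longrightarrow> x \<star> y = y \<star> x"
  "\<And>x v. x \<in> A \<Longrightarrow> v \<in> V \<Longrightarrow> (x ^^ 3) v = v"
 then interpret T: elusive_digraph_three V E G d A
  by (intro elusive_digraph_three.intro elusive_digraph_axioms elusive_digraph_three_axioms.intro)
 show ?thesis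
 proof (rule T.labelling)
  fix r :: nat and blk :: "'a \<Rightarrow> int"
  assume "r > 0" "\<And>v. v \<in> V \<Longrightarrow> 0 \<le> blk v \<and> blk v < int r"
   "\<And>u v. u \<in> V \<Longrightarrow> v \<in> V \<Longrightarrow> blk u = blk v \<longleftrightarrow> T.orb u = T.orb v" "\<And>v w. (v, w) \<in> E \<Longrightarrow> blk w = (blk v + 1) mod int r"
   "\<And>y. 0 \<le> y \<Longrightarrow> y < int r \<Longrightarrow> \<exists>v\<in>V. blk v = y"
  then interpret L: elusive_digraph_labelled V E G d A r blk
   by (intro elusive_digraph_labelled.intro T.elusive_digraph_three_axioms elusive_digraph_labelled_axioms.intro)
  obtain a f where f: "r = 2 ^ a" "bij_betw f V (PXV r)" "\<forall>v\<in>V. snd (f v) = blk v"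
   "rho_group r a (transport V (PXV r) f ` G)" using L.vertex_coordinates by blast
  have "(u, v) \<in> E \<longleftrightarrow> [snd (f v) - snd (f u) = 1] (mod int r)" if uv: "u \<in> V" "v \<in> V" for u v
  proof -
   have "[blk v - blk u = 1] (mod int r) \<longleftrightarrow> [blk v = blk u + 1] (mod int r)"
    by (metis cong_add_lcancel cong_add_rcancel add.commute diff_add_cancel)
   also have "\<dots> \<longleftrightarrow> blk v = (blk u + 1) mod int r" using L.blk_range[OF uv(2)] by (simp add: cong_def)
   finally show ?thesis using L.edge_iff[OF uv] f(3) uv by simp
  qed
  then show ?thesis using f(1,2,4) by (intro exI[of _ a] exI[of _ f]) simp
 qed
qed

theorem theorem1p2:
 fixes \<Gamma> :: "'a pair_pre_digraph" and G :: "('a \<Rightarrow> 'a) set"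
 assumes "pair_digraph \<Gamma>"
  and "connected (with_proj \<Gamma>)"
  and "\<exists>d\<le>3. has_out_valency \<Gamma> d"
  and "card (pverts \<Gamma>) \<ge> 2"
  and "subgroup G (aut_group \<Gamma>)"
  and "transitive_on (pverts \<Gamma>) G"
 shows "(\<nexists>g. g \<in> G \<and> g \<noteq> \<one>\<^bsub>aut_group \<Gamma>\<^esub> \<and> semiregular (pverts \<Gamma>) g) \<longleftrightarrow>
  (\<exists>a::nat. a \<ge> 2 \<and>
   (\<exists>f. dg_iso \<Gamma> (PX3 (2 ^ a)) f \<and>
    (\<exists>w\<in>W (2 ^ a). \<exists>i\<in>{1..2 ^ (a - 2)}.
      internal_semidirect (SymV (2 ^ a))
       (conj_by (SymV (2 ^ a)) w (transport (pverts \<Gamma>) (PXV (2 ^ a)) f ` G))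
       (NN (2 ^ a)) (Lambda_i_rho (2 ^ a) i))))"
  (is "?elusive \<longleftrightarrow> ?form")
proof
 interpret pair_digraph \<Gamma> by (rule assms(1))
 assume el: ?elusive
 obtain d where d: "d \<le> 3" "has_out_valency \<Gamma> d" using assms(3) by blast
 interpret elusive_digraph "pverts \<Gamma>" "parcs \<Gamma>" G d
  by (rule elusive_digraphI[OF assms(2) d assms(4-6) el])
 obtain a f where f: "bij_betw f (pverts \<Gamma>) (PXV (2 ^ a))"
  and K: "rho_group (2 ^ a) a (transport (pverts \<Gamma>) (PXV (2 ^ a)) f ` G)"
  and arcs: "\<forall>u\<in>pverts \<Gamma>. \<forall>v\<in>pverts \<Gamma>. (u, v) \<in> parcs \<Gamma> \<longleftrightarrow> [snd (f v) - snd (f u) = 1] (mod 2 ^ a)"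
  using normal_form by blast
 have "(f u, f v) \<in> parcs (PX3 (2 ^ a)) \<longleftrightarrow> [snd (f v) - snd (f u) = 1] (mod 2 ^ a)"
  if uv: "u \<in> pverts \<Gamma>" "v \<in> pverts \<Gamma>" for u v
  using bij_betwE[OF f] uv by (cases "f u"; cases "f v") (auto simp: PX3_def)
 then have "dg_iso \<Gamma> (PX3 (2 ^ a)) f"
  using f arcs by (auto simp: dg_iso_def PX3_def)
 then show ?form using rho_group.a_ge_2[OF K] rho_group.conjugate_semidirect_decomposition[OF K] by blast
next
 assume ?form
 then obtain a f w i where a: "a \<ge> 2" and f: "dg_iso \<Gamma> (PX3 (2 ^ a)) f" and w: "w \<in> W (2 ^ a)" and i: "i \<in> {1..2 ^ (a - 2)}"
  and K: "internal_semidirect (SymV (2 ^ a)) (conj_by (SymV (2 ^ a)) w (transport (pverts \<Gamma>) (PXV (2 ^ a)) f ` G))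
       (NN (2 ^ a)) (Lambda_i_rho (2 ^ a) i)" by blast
 have "g = \<one>\<^bsub>aut_group \<Gamma>\<^esub>" if "g \<in> G" "semiregular (pverts \<Gamma>) g" for g
  using described_group_no_semiregular[OF a f w i K that] by (simp add: aut_group_def)
 then show ?elusive by blast
qed

end
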